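(* Assume $H$ is twice continuously differentiable in a neighborhood of $\beta^*$. Let $\epsilon_t>0$ satisfy $\epsilon_t=o(1)$ and $\epsilon_t\sqrt t\to\infty$, and let $$\beta^{\mathrm{boot}}_{\mathrm{nu}}=\operatorname*{argmin}_{\beta\in\mathbb R^n_+}\ \frac1t\sum_{\tau=1}^t\big(1+\epsilon_t\sqrt t\,(W_\tau-1)\big)F(\theta^\tau,\beta).$$ Then the conditional distribution of $\epsilon_t^{-1}(\beta^{\mathrm{boot}}_{\mathrm{nu}}-\beta^\gamma)$ consistently estimates $\mathcal J_{\mathrm{LFM}}$.
   Context: Setting. There are $n$ buyers with budgets $b_i>0$, a measurable item space $\Theta$ with integrating measure $d\theta$, nonnegative integrable valuations $v_i:\Theta\to[0,\infty)$ with $\max_i\sup_\theta v_i(\theta)<\infty$, and a bounded supply function $s\ge 0$ with $\int_\Theta s\,d\theta=1$. Write $\mathbb E[g]=\int g\,s\,d\theta$. Let $\theta^1,\theta^2,\dots$ be i.i.d. draws from the density $s$ and $P_tf=\frac1t\sum_{\tau=1}^tf(\theta^\tau)$. For $\beta\in\mathbb R^n_+$ put $$F(\theta,\beta)=\max_{i}\beta_iv_i(\theta)-\sum_{i=1}^nb_i\log\beta_i,\quad H(\beta)=\mathbb E[F(\cdot,\beta)],\quad H_t(\beta)=P_tF(\cdot,\beta)$$ (with $-\log0=+\infty$). In the linear Fisher market (LFM), the limit equilibrium inverse bang-per-buck vector is $\beta^*=\operatorname{argmin}_{\mathbb R^n_+}H$ and the observed (finite) one is $\beta^\gamma=\operatorname{argmin}_{\mathbb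 R^n_+}H_t$. Let $\mathcal H=\nabla^2H(\beta^* )$ (positive definite); $\nabla F(\theta,\beta^* )$ exists for almost every $\theta$. Define $$\mathcal J_{\mathrm{LFM}}=\mathcal N\big(0,\ \mathcal H^{-1}\,\mathbb E[\nabla F(\cdot,\beta^* )\nabla F(\cdot,\beta^* )^{\top}]\,\mathcal H^{-1}\big).$$ The weights $W=(W_1,\dots,W_t)$ are multinomial with $t$ trials and probabilities $(1/t,\dots,1/t)$, independent of the data. Consistency: for random vectors $X_t\in\mathbb R^n$ that are functions of $(\theta^\tau)_{\tau\le t}$ and $W$, the conditional distribution of $X_t$ consistently estimates a law $L$ if $$\sup_{f\in\mathrm{BL}_1}\big|\mathbb E[f(X_t)\mid\theta^1,\dots,\theta^t]-\mathbb E_{X\sim L}[f(X)]\big|\to0\text{ in probability},$$ where $\mathrm{BL}_1$ is the set of $f:\mathbb R^n\to\mathbb R$ with $\sup|f|\le1$ and $|f(x)-f(y)|\le\|x-y\|_2$. *)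

theory Defs
  imports "HOL-Probability.Probability"
begin

definition gradient :: "(real ^ 'n \<Rightarrow> real) \<Rightarrow> real ^ 'n \<Rightarrow> real ^ 'n" where
  "gradient f x = (THE D. GDERIV f x :> D)"

definition hessian :: "(real ^ 'n \<Rightarrow> real) \<Rightarrow> real ^ 'n \<Rightarrow> real ^ 'n ^ 'n" where
  "hessian f x = jacobian (gradient f) (at x)"

definition C2_near :: "(real ^ 'n \<Rightarrow> real) \<Rightarrow> real ^ 'n \<Rightarrow> bool" where
  "C2_near f x \<longleftrightarrow> (\<exists>U. open U \<and> x \<in> U \<and>
     (\<forall>y\<in>U. f differentiable (at y)) \<and>
     (\<forall>y\<in>U. gradient f differentiable (at y)) \<and>
     continuous_on U (hessian f))"

text \<open>
  Every objective below has the form \<open>U \<beta> - (\<Sum>i. b i * log (\<beta> i))\<close> with \<open>U\<close> finite and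
  \<open>b i > 0\<close>, where \<open>- log 0 = + \<infinity>\<close> (for the bootstrap objective this uses that the weights
  sum to \<open>t\<close>). HOL has \<open>ln 0 = 0\<close>, so the value \<open>\<infinity>\<close> on the boundary of the orthant is
  put in explicitly.
\<close>

definition ext_obj :: "(real ^ 'n \<Rightarrow> real) \<Rightarrow> real ^ 'n \<Rightarrow> ereal" where
  "ext_obj J \<beta> = (if \<forall>i. 0 < \<beta> $ i then ereal (J \<beta>) else \<infinity>)"

definition argmin_orthant :: "(real ^ 'n \<Rightarrow> real) \<Rightarrow> (real ^ 'n) set" where
  "argmin_orthant J = {\<beta>. is_arg_min (ext_obj J) (\<lambda>\<beta>. \<forall>i. 0 \<le> \<beta> $ i) \<beta>}"

definition supply_expectation :: "'a measure \<Rightarrow> ('a \<Rightarrow> real) \<Rightarrow> ('a \<Rightarrow> real) \<Rightarrow> real" where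
  "supply_expectation N s g = (\<integral>\<theta>. g \<theta> * s \<theta> \<partial>N)"

definition F_LFM :: "real ^ 'n \<Rightarrow> ('n::finite \<Rightarrow> 'a \<Rightarrow> real) \<Rightarrow> 'a \<Rightarrow> real ^ 'n \<Rightarrow> real" where
  "F_LFM b v \<theta> \<beta> = (MAX i. \<beta> $ i * v i \<theta>) - (\<Sum>i\<in>UNIV. b $ i * ln (\<beta> $ i))"

definition H_pop ::
  "'a measure \<Rightarrow> ('a \<Rightarrow> real) \<Rightarrow> real ^ 'n \<Rightarrow> ('n::finite \<Rightarrow> 'a \<Rightarrow> real) \<Rightarrow> real ^ 'n \<Rightarrow> real" where
  "H_pop N s b v \<beta> = supply_expectation N s (\<lambda>\<theta>. F_LFM b v \<theta> \<beta>)"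

definition H_obs ::
  "real ^ 'n \<Rightarrow> ('n::finite \<Rightarrow> 'a \<Rightarrow> real) \<Rightarrow> nat \<Rightarrow> (nat \<Rightarrow> 'a) \<Rightarrow> real ^ 'n \<Rightarrow> real" where
  "H_obs b v t x \<beta> = (\<Sum>\<tau>=1..t. F_LFM b v (x \<tau>) \<beta>) / real t"

definition H_boot ::
  "real ^ 'n \<Rightarrow> ('n::finite \<Rightarrow> 'a \<Rightarrow> real) \<Rightarrow> real \<Rightarrow> nat \<Rightarrow> (nat \<Rightarrow> 'a) \<Rightarrow> (nat \<Rightarrow> nat) \<Rightarrow> real ^ 'n \<Rightarrow> real"
where
  "H_boot b v e t x w \<beta> =
     (\<Sum>\<tau>=1..t. (1 + e * sqrt (real t) * (real (w \<tau>) - 1)) * F_LFM b v (x \<tau>) \<beta>) / real t"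

definition std_mv_normal :: "(real ^ 'n) measure" where
  "std_mv_normal = density lborel (\<lambda>z. ennreal (\<Prod>i\<in>UNIV. std_normal_density (z $ i)))"

text \<open>
  The law of \<open>m + A Z\<close> with \<open>Z\<close> standard normal and \<open>A A\<^sup>T = S\<close>, which also covers singular \<open>S\<close>.
  It does not depend on the choice of \<open>A\<close>, and such an \<open>A\<close> exists for every positive
  semidefinite \<open>S\<close>.
\<close>

definition mv_normal :: "real ^ 'n \<Rightarrow> real ^ 'n ^ 'n \<Rightarrow> (real ^ 'n) measure" where
  "mv_normal m S =
     distr std_mv_normal borel (\<lambda>z. m + (SOME A :: real ^ 'n ^ 'n. A ** transpose A = S) *v z)"

definition J_LFM ::
  "'a measure \<Rightarrow> ('a \<Rightarrow> real) \<Rightarrow> real ^ 'n \<Rightarrow> ('n::finite \<Rightarrow> 'a \<Rightarrow> real) \<Rightarrow> real ^ 'n \<Rightarrow> (real ^ 'n) measure"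
where
  "J_LFM N s b v \<beta> =
     (let H = hessian (H_pop N s b v) \<beta>;
          g = (\<lambda>\<theta>. gradient (F_LFM b v \<theta>) \<beta>);
          G = (\<chi> i j. supply_expectation N s (\<lambda>\<theta>. g \<theta> $ i * g \<theta> $ j))
      in mv_normal 0 (matrix_inv H ** G ** matrix_inv H))"

text \<open>Category counts of \<open>k\<close> independent trials with category law \<open>p\<close>.\<close>

definition multinomial_pmf :: "nat \<Rightarrow> 'c pmf \<Rightarrow> ('c \<Rightarrow> nat) pmf" where
  "multinomial_pmf k p =
     map_pmf (\<lambda>I c. card {j. j < k \<and> I j = c}) (Pi_pmf {..<k} undefined (\<lambda>_. p))"

definition data_vec :: "nat \<Rightarrow> (nat \<Rightarrow> 'w \<Rightarrow> 'a) \<Rightarrow> 'w \<Rightarrow> nat \<Rightarrow> 'a" where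
  "data_vec t X \<omega> = (\<lambda>\<tau>\<in>{1..t}. X \<tau> \<omega>)"

definition data_algebra ::
  "'w measure \<Rightarrow> 'a measure \<Rightarrow> nat \<Rightarrow> (nat \<Rightarrow> 'w \<Rightarrow> 'a) \<Rightarrow> 'w measure" where
  "data_algebra M N t X = vimage_algebra (space M) (data_vec t X) (PiM {1..t} (\<lambda>_. N))"

definition data_weight_algebra ::
  "'w measure \<Rightarrow> 'a measure \<Rightarrow> nat \<Rightarrow> (nat \<Rightarrow> 'w \<Rightarrow> 'a) \<Rightarrow> ('w \<Rightarrow> nat \<Rightarrow> nat) \<Rightarrow> 'w measure" where
  "data_weight_algebra M N t X W = vimage_algebra (space M) (\<lambda>\<omega>. (data_vec t X \<omega>, W \<omega>))
     (PiM {1..t} (\<lambda>_. N) \<Otimes>\<^sub>M count_space UNIV)"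

definition is_cond_distr ::
  "'w measure \<Rightarrow> 'w measure \<Rightarrow> ('w \<Rightarrow> real ^ 'n) \<Rightarrow> ('w \<Rightarrow> (real ^ 'n) measure) \<Rightarrow> bool" where
  "is_cond_distr M G X K \<longleftrightarrow>
     K \<in> measurable G (prob_algebra borel) \<and>
     (\<forall>A\<in>sets borel. AE \<omega> in M.
        measure (K \<omega>) A = real_cond_exp M G (\<lambda>\<omega>. indicator A (X \<omega>)) \<omega>)"

definition BL1 :: "(real ^ 'n \<Rightarrow> real) set" where
  "BL1 = {f. (\<forall>x. \<bar>f x\<bar> \<le> 1) \<and> (\<forall>x y. \<bar>f x - f y\<bar> \<le> norm (x - y))}"

definition BL_dist :: "(real ^ 'n) measure \<Rightarrow> (real ^ 'n) measure \<Rightarrow> real" where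
  "BL_dist P Q = (SUP f\<in>BL1. \<bar>(\<integral>x. f x \<partial>P) - (\<integral>x. f x \<partial>Q)\<bar>)"

text \<open>
  Convergence to \<open>0\<close> in probability of nonnegative \<open>Z t\<close>, through measurable envelopes: for
  measurable \<open>Z t\<close> this is the usual notion, and it is not weakened by the convention that
  \<open>measure\<close> is \<open>0\<close> on non-measurable sets.
\<close>

definition vanishes_in_prob :: "'w measure \<Rightarrow> (nat \<Rightarrow> 'w \<Rightarrow> real) \<Rightarrow> bool" where
  "vanishes_in_prob M Z \<longleftrightarrow> (\<forall>\<delta>>0. \<exists>A.
     (\<forall>t. A t \<in> sets M \<and> {\<omega> \<in> space M. \<delta> < Z t \<omega>} \<subseteq> A t) \<and>
     (\<lambda>t. measure M (A t)) \<longlonglongrightarrow> 0)"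

text \<open>
  The supremum over \<open>BL1\<close> is uncountable, so the conditional expectations in it have to come from
  one regular conditional distribution. It exists because \<open>real ^ 'n\<close> is Polish, and it is
  almost surely unique; the definition therefore speaks about every version.
\<close>

definition consistently_estimates ::
  "'w measure \<Rightarrow> (nat \<Rightarrow> 'w measure) \<Rightarrow> (nat \<Rightarrow> 'w \<Rightarrow> real ^ 'n) \<Rightarrow> (real ^ 'n) measure \<Rightarrow> bool" where
  "consistently_estimates M G X L \<longleftrightarrow>
     (\<forall>K. (\<forall>t\<ge>1. is_cond_distr M (G t) (X t) (K t)) \<longrightarrow>
        vanishes_in_prob M (\<lambda>t \<omega>. BL_dist (K t \<omega>) L))"

end

theory Submission
  imports Defs "HOL-Real_Asymp.Real_Asymp"
begin

text \<open>
  The population objective is \<open>H \<beta> = E[max_i \<beta>_i v_i] - \<Sum>i. b_i ln \<beta>_i\<close>, a convex function minus a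
  concave one. The logarithms make it strongly convex near its minimizer \<open>\<beta>*\<close>, and convexity turns the
  resulting quadratic growth into linear growth far away (locale \<open>penalized_convex\<close>). Since the weights
  add up to \<open>t\<close>, the logarithmic term is the same in all three objectives. The observed and the
  bootstrap objective are therefore both of the form \<open>H \<beta> + \<epsilon> \<Xi>(f \<beta>)\<close>, where \<open>f \<beta> \<theta>\<close> is the maximal bid
  and \<open>\<Xi>\<close> is a random linear functional: it is \<open>1/(\<epsilon> sqrt t)\<close> times the empirical process of the sample,
  plus, for the bootstrap, the resampling process (\<open>H_obs_eq\<close>, \<open>H_boot_eq\<close>).

  As soon as \<open>\<epsilon> sqrt t > 1\<close>, the factors \<open>1 + \<epsilon> sqrt t (W - 1)\<close> with \<open>W = 0\<close> are negative, so the bootstrap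
  objective need not be convex and its minimizer cannot be located by a convexity argument. Instead,
  \<open>\<Xi>\<close> is controlled uniformly in \<open>\<beta>\<close>. Bounded centred summands have normalized sums with
  moments of every order bounded independently of \<open>t\<close>. With moments of order \<open>2n\<close> on
  \<open>n\<close>-dimensional space, a dyadic chaining argument (\<open>dyadic_chaining\<close>) bounds the supremum of the
  increments of \<open>\<beta> \<mapsto> \<Xi>(f \<beta>)\<close> over balls of every radius. With high probability a
  peeling argument then places the minimizers within distance \<open>O(\<epsilon>)\<close> of \<open>\<beta>*\<close> (\<open>argmin_localization\<close>). Because \<open>H\<close> is twice differentiable at \<open>\<beta>*\<close>, the
  maximal bid is almost surely differentiable there (\<open>AE_no_tie\<close>), so that on the scale \<open>\<epsilon>\<close> the process
  is linear with slope \<open>\<zeta> = \<Xi>(\<nabla>f)\<close>, up to a uniformly negligible error (\<open>Xi_lin_rem_small\<close>). Minimizing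
  the quadratic approximation gives \<open>(\<beta> - \<beta>*)/\<epsilon> = - A\<^sup>-\<^sup>1 \<zeta> + o(1)\<close> in probability for both
  estimators, \<open>A\<close> being the Hessian of \<open>H\<close> at \<open>\<beta>*\<close> (\<open>argmin_expansion\<close>).

  In the difference of the two expansions the sampling part of \<open>\<zeta>\<close> cancels. What remains is, for given
  data, a normalized sum of \<open>t\<close> independent draws from the empirical law of \<open>- A\<^sup>-\<^sup>1 \<nabla>f\<close>, centred at its mean
  (\<open>boot_vec_influence\<close>, \<open>boot_sum_counts\<close>). Its conditional characteristic function is close to
  the one of the normal law whose variances are the empirical ones, and those converge. Smoothing with a
  small Gaussian turns this into convergence uniform over \<open>BL1\<close> (\<open>BL_dist_char_fn\<close>,
  \<open>conditional_bootstrap_clt\<close>). Finally, every regular conditional distribution of the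
  estimation error agrees almost surely with the kernel that freezes the data and integrates out
  the weights, and the \<open>o(1)\<close> of the expansions costs this kernel only a term with vanishing
  expectation (\<open>cond_distr_BL_dist_le\<close>).
\<close>

section \<open>Characteristic functions and Gaussian smoothing\<close>

lemma inj_axis_one: "inj (\<lambda>i. axis i (1::real) :: real ^ 'n)"
  by (auto simp: inj_on_def axis_eq_axis)

lemma prod_Basis_cart:
  "(\<Prod>b\<in>(Basis :: (real ^ 'n) set). g b) = (\<Prod>i\<in>UNIV. g (axis i 1))"
proof -
  have "(Basis :: (real ^ 'n) set) = range (\<lambda>i. axis i 1)"
    by (auto simp: Basis_vec_def)
  then have "(\<Prod>b\<in>(Basis :: (real ^ 'n) set). g b) = prod g (range (\<lambda>i. axis i 1))"
    by simp
  also have "\<dots> = (\<Prod>i\<in>UNIV. g (axis i 1))"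
    by (subst prod.reindex[OF inj_axis_one]) simp
  finally show ?thesis .
qed

lemma component_sum_Basis:
  fixes f :: "real ^ 'n \<Rightarrow> real"
  shows "(\<Sum>b\<in>Basis. f b *\<^sub>R b) $ i = f (axis i 1)"
proof -
  have "(\<Sum>b\<in>Basis. f b *\<^sub>R b) $ i = (\<Sum>b\<in>Basis. f b *\<^sub>R b) \<bullet> axis i 1"
    by (simp add: inner_axis)
  also have "\<dots> = f (axis i 1)"
    by (subst inner_sum_left_Basis) (auto simp: Basis_vec_def)
  finally show ?thesis .
qed

text \<open>
  Lebesgue measure is a product over \<open>Basis\<close>, whose elements are the axis vectors; reindexing
  brings the product formulas to coordinates.
\<close>

lemma
  fixes f :: "'n::finite \<Rightarrow> real \<Rightarrow> 'b::{real_normed_field,banach,second_countable_topology}"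
  assumes int: "\<And>i. integrable lborel (f i)"
  shows integrable_prod_lborel_cart: "integrable lborel (\<lambda>x::real^'n. \<Prod>i\<in>UNIV. f i (x $ i))"
    and integral_prod_lborel_cart:
      "(\<integral>x. (\<Prod>i\<in>UNIV. f i (x $ i)) \<partial>(lborel :: (real^'n) measure)) = (\<Prod>i\<in>UNIV. \<integral>x. f i x \<partial>lborel)"
proof -
  interpret product_sigma_finite "\<lambda>_::real^'n. lborel :: real measure" ..
  define g where "g b = f (SOME i. axis i 1 = b)" for b :: "real^'n"
  have g: "g (axis i 1) = f i" for i
    unfolding g_def by (rule arg_cong[of _ _ f]) (auto simp: axis_eq_axis)
  have gi: "integrable lborel (g b)" for b
    unfolding g_def by (rule int)
  have fm [measurable]: "f i \<in> borel_measurable borel" for i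
    using int[of i] by (auto simp: integrable_iff_bounded)
  have *: "(\<lambda>x::real^'n. \<Prod>i\<in>UNIV. f i (x $ i)) \<in> borel_measurable borel"
    by measurable
  have eq: "(\<Prod>i\<in>UNIV. f i ((\<Sum>b\<in>Basis. z b *\<^sub>R b) $ i)) = (\<Prod>b\<in>Basis. g b (z b))" for z :: "real^'n \<Rightarrow> real"
    unfolding component_sum_Basis by (simp add: prod_Basis_cart g)
  have meas: "(\<lambda>z. \<Sum>b\<in>Basis. z b *\<^sub>R b) \<in> measurable (\<Pi>\<^sub>M b\<in>(Basis::(real^'n) set). lborel) borel"
    by measurable
  show "integrable lborel (\<lambda>x::real^'n. \<Prod>i\<in>UNIV. f i (x $ i))"
    unfolding lborel_eq[where 'a="real^'n"]
    by (subst integrable_distr_eq[OF meas]) (use * in \<open>auto simp: eq simp del: sum_component intro!: product_integrable_prod gi\<close>)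
  show "(\<integral>x. (\<Prod>i\<in>UNIV. f i (x $ i)) \<partial>(lborel :: (real^'n) measure)) = (\<Prod>i\<in>UNIV. \<integral>x. f i x \<partial>lborel)"
    unfolding lborel_eq[where 'a="real^'n"]
    by (subst integral_distr[OF meas]) (use * prod_Basis_cart[where g="\<lambda>b. integral\<^sup>L lborel (g b)"] in
       \<open>auto simp: eq g product_integral_prod gi simp del: sum_component\<close>)
qed

abbreviation gauss_density :: "real ^ 'n \<Rightarrow> real" where
  "gauss_density z \<equiv> \<Prod>i\<in>UNIV. std_normal_density (z $ i)"

lemma gauss_density_eq:
  fixes z :: "real ^ 'n"
  shows "gauss_density z = (1 / sqrt (2 * pi)) ^ CARD('n) * exp (- (norm z)\<^sup>2 / 2)"
proof -
  have "gauss_density z = (\<Prod>i\<in>(UNIV::'n set). 1 / sqrt (2 * pi) * exp (- (z $ i)\<^sup>2 / 2))"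
    by (simp add: std_normal_density_def)
  also have "\<dots> = (1 / sqrt (2 * pi)) ^ CARD('n) * exp (\<Sum>i\<in>(UNIV::'n set). - (z $ i)\<^sup>2 / 2)"
    by (simp only: prod.distrib prod_constant exp_sum finite_UNIV finite)
  also have "(\<Sum>i\<in>(UNIV::'n set). - (z $ i)\<^sup>2 / 2) = - (norm z)\<^sup>2 / 2"
    by (simp add: norm_vec_def L2_set_def sum_nonneg sum_negf sum_divide_distrib)
  finally show ?thesis .
qed

lemma prob_space_std_mv_normal: "prob_space (std_mv_normal :: (real ^ 'n) measure)"
proof
  have "emeasure std_mv_normal (space (std_mv_normal :: (real^'n) measure)) =
      (\<integral>\<^sup>+z. ennreal (gauss_density z) \<partial>(lborel :: (real^'n) measure))"
    by (simp add: std_mv_normal_def emeasure_density)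
  also have "\<dots> = ennreal (\<integral>z. gauss_density z \<partial>(lborel :: (real^'n) measure))"
    by (intro nn_integral_eq_integral integrable_prod_lborel_cart AE_I2 prod_nonneg) auto
  also have "\<dots> = 1"
    by (subst integral_prod_lborel_cart) auto
  finally show "emeasure std_mv_normal (space (std_mv_normal :: (real^'n) measure)) = 1" .
qed

lemma sets_std_mv_normal [measurable_cong, simp]: "sets std_mv_normal = sets borel"
  and space_std_mv_normal [simp]: "space std_mv_normal = UNIV"
  by (simp_all add: std_mv_normal_def)

lemma measure_std_mv_normal_UNIV: "measure (std_mv_normal :: (real ^ 'n) measure) UNIV = 1"
  using prob_space.prob_space[OF prob_space_std_mv_normal] by simp

lemma cis_inner_prod: "cis (u \<bullet> z) = (\<Prod>i\<in>UNIV. cis (u $ i * z $ i))" for u z :: "real ^ 'n"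
proof -
  have "cis (sum f A) = (\<Prod>i\<in>A. cis (f i))" if "finite A" for f :: "'n \<Rightarrow> real" and A
    using that by (induction A) (auto simp: cis_mult[symmetric])
  then show ?thesis by (simp add: inner_vec_def)
qed

lemma integral_std_mv_normal:
  fixes f :: "real ^ 'n \<Rightarrow> 'b::{banach, second_countable_topology}"
  assumes [measurable]: "f \<in> borel_measurable borel"
  shows "(\<integral>z. f z \<partial>std_mv_normal) = (\<integral>z. gauss_density z *\<^sub>R f z \<partial>lborel)"
  unfolding std_mv_normal_def
  by (intro integral_density) (auto intro!: AE_I2 prod_nonneg)

text \<open>
  The function \<open>cis (u \<bullet> z)\<close> splits over the coordinates, which reduces the claim to the
  one-dimensional characteristic function.
\<close>

lemma char_std_mv_normal:
  fixes u :: "real ^ 'n"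
  shows "(\<integral>z. cis (u \<bullet> z) \<partial>std_mv_normal) = exp (- (norm u)\<^sup>2 / 2)"
proof -
  have 1: "(\<integral>x. std_normal_density x *\<^sub>R cis (a * x) \<partial>lborel) = exp (- a\<^sup>2 / 2)" for a
  proof -
    have "char std_normal_distribution a = (\<integral>x. std_normal_density x *\<^sub>R cis (a * x) \<partial>lborel)"
      unfolding char_def by (subst integral_density) (auto simp: cis_conv_exp)
    then show ?thesis by (simp add: char_std_normal_distribution)
  qed
  have int1: "integrable lborel (\<lambda>x. std_normal_density x *\<^sub>R cis (a * x))" for a
    by (rule Bochner_Integration.integrable_bound[of _ std_normal_density]) (auto simp: cis_conv_exp)
  have "(\<integral>z. cis (u \<bullet> z) \<partial>std_mv_normal) =
      (\<integral>z. (\<Prod>i\<in>UNIV. std_normal_density (z $ i) *\<^sub>R cis (u $ i * z $ i)) \<partial>lborel)"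
    by (subst integral_std_mv_normal)
       (simp_all add: cis_inner_prod scaleR_conv_of_real prod.distrib, simp add: cis_conv_exp)
  also have "\<dots> = (\<Prod>i\<in>UNIV. complex_of_real (exp (- (u $ i)\<^sup>2 / 2)))"
    by (subst integral_prod_lborel_cart[where f="\<lambda>i x. std_normal_density x *\<^sub>R cis (u $ i * x)"])
       (auto simp: int1 1)
  also have "\<dots> = exp (- (norm u)\<^sup>2 / 2)"
    by (simp add: norm_vec_def L2_set_def sum_nonneg sum_negf sum_divide_distrib
        flip: exp_sum of_real_prod exp_of_real)
  finally show ?thesis .
qed

lemma integrable_norm_std_mv_normal: "integrable (std_mv_normal :: (real ^ 'n) measure) norm"
proof -
  have comp: "integrable (std_mv_normal :: (real ^ 'n) measure) (\<lambda>z. z $ j)" for j :: 'n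
  proof -
    define f where "f i x = std_normal_density x * (if i = j then x else 1)" for i :: 'n and x
    have "integrable lborel (f i)" for i
      using integrable_std_normal_moment[of 1] by (cases "i = j") (simp_all add: f_def[abs_def])
    then have "integrable lborel (\<lambda>z::real^'n. \<Prod>i\<in>UNIV. f i (z $ i))"
      by (rule integrable_prod_lborel_cart)
    also have "(\<lambda>z::real^'n. \<Prod>i\<in>UNIV. f i (z $ i)) = (\<lambda>z. gauss_density z * z $ j)"
      by (auto simp: f_def prod.distrib)
    finally show ?thesis
      unfolding std_mv_normal_def
      by (subst integrable_density) (auto intro!: AE_I2 prod_nonneg)
  qed
  show ?thesis
  proof (rule Bochner_Integration.integrable_bound)
    show "integrable std_mv_normal (\<lambda>z::real^'n. \<Sum>i\<in>UNIV. \<bar>z $ i\<bar>)"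
      using comp by auto
    show "AE z in std_mv_normal. norm (norm z) \<le> norm (\<Sum>i\<in>UNIV. \<bar>(z::real^'n) $ i\<bar>)"
      using norm_le_l1_cart by (auto intro!: AE_I2 simp: order_trans[OF _ abs_ge_self])
  qed simp
qed

definition char_fn :: "(real ^ 'n) measure \<Rightarrow> real ^ 'n \<Rightarrow> complex" where
  "char_fn P u = (\<integral>x. cis (u \<bullet> x) \<partial>P)"

lemma measurable_cis [measurable]: "cis \<in> borel_measurable borel"
  by (intro borel_measurable_continuous_onI continuous_intros)

lemma norm_char_fn_le_1:
  assumes "prob_space P"
  shows "norm (char_fn P u) \<le> 1"
proof -
  interpret prob_space P by fact
  show ?thesis unfolding char_fn_def
    by (rule order_trans[OF integral_norm_bound]) (simp add: prob_space)
qed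

lemma char_fn_measurable:
  assumes P: "prob_space P" "sets P = sets borel"
  shows "char_fn P \<in> borel_measurable (borel :: (real^'n) measure)"
proof -
  interpret prob_space P by fact
  note [measurable_cong] = P(2)
  have "(\<lambda>u. \<integral>x. cis (u \<bullet> x) \<partial>P) \<in> borel_measurable borel"
    by (rule borel_measurable_lebesgue_integral) measurable
  then show ?thesis unfolding char_fn_def[abs_def] .
qed

text \<open>
  The density of the convolution of \<open>P\<close> with the normal law \<open>N(0, \<sigma>\<^sup>2 I)\<close>.
\<close>

definition smoothed_density :: "real \<Rightarrow> (real ^ 'n) measure \<Rightarrow> real ^ 'n \<Rightarrow> real" where
  "smoothed_density \<sigma> P y = (\<integral>x. gauss_density ((1/\<sigma>) *\<^sub>R (y - x)) / \<sigma> ^ CARD('n) \<partial>P)"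

lemma gauss_density_measurable [measurable]: "gauss_density \<in> borel_measurable (borel :: (real^'n) measure)"
  by measurable

text \<open>
  Up to a factor the Gaussian density is its own Fourier transform. Smoothing with it therefore
  becomes an integral of characteristic functions.
\<close>

lemma gauss_density_char:
  fixes z :: "real ^ 'n"
  shows "complex_of_real (gauss_density z) = (1 / sqrt (2 * pi)) ^ CARD('n) * (\<integral>w. cis (z \<bullet> w) \<partial>std_mv_normal)"
  by (simp add: char_std_mv_normal gauss_density_eq)

text \<open>
  Fourier inversion for the smoothed law: insert the Fourier representation of the kernel and exchange
  the integrals.
\<close>

lemma smoothed_density_char:
  fixes P :: "(real ^ 'n) measure"
  assumes P: "prob_space P" "sets P = sets borel" and \<sigma>: "\<sigma> > 0"
  shows "complex_of_real (smoothed_density \<sigma> P y) =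
    (1 / (\<sigma> * sqrt (2 * pi))) ^ CARD('n) *
      (\<integral>w. cis ((1/\<sigma>) *\<^sub>R w \<bullet> y) * cnj (char_fn P ((1/\<sigma>) *\<^sub>R w)) \<partial>std_mv_normal)"
proof -
  interpret P: prob_space P by fact
  interpret G: prob_space "std_mv_normal :: (real^'n) measure" by (rule prob_space_std_mv_normal)
  interpret PG: pair_prob_space P "std_mv_normal :: (real^'n) measure" ..
  note [measurable_cong] = P(2)
  let ?c = "(1 / sqrt (2 * pi)) ^ CARD('n) / \<sigma> ^ CARD('n)"
  have "complex_of_real (smoothed_density \<sigma> P y) =
      (\<integral>x. complex_of_real (gauss_density ((1/\<sigma>) *\<^sub>R (y - x))) / \<sigma> ^ CARD('n) \<partial>P)"
    unfolding smoothed_density_def by (subst integral_complex_of_real[symmetric]) (simp only: of_real_divide of_real_power)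
  also have "\<dots> = (\<integral>x. ?c * (\<integral>w. cis (((1/\<sigma>) *\<^sub>R (y - x)) \<bullet> w) \<partial>std_mv_normal) \<partial>P)"
    unfolding gauss_density_char by (simp add: field_simps)
  also have "\<dots> = ?c * (\<integral>x. (\<integral>w. cis (((1/\<sigma>) *\<^sub>R (y - x)) \<bullet> w) \<partial>std_mv_normal) \<partial>P)"
    by (rule integral_mult_right_zero)
  also have "(\<integral>x. (\<integral>w. cis (((1/\<sigma>) *\<^sub>R (y - x)) \<bullet> w) \<partial>std_mv_normal) \<partial>P) =
      (\<integral>w. (\<integral>x. cis (((1/\<sigma>) *\<^sub>R (y - x)) \<bullet> w) \<partial>P) \<partial>std_mv_normal)"
    by (rule PG.Fubini_integral[symmetric]) (rule PG.integrable_const_bound[of _ 1], auto)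
  also have "\<dots> = (\<integral>w. cis ((1/\<sigma>) *\<^sub>R w \<bullet> y) * cnj (char_fn P ((1/\<sigma>) *\<^sub>R w)) \<partial>std_mv_normal)"
  proof (rule Bochner_Integration.integral_cong[OF refl])
    fix w :: "real^'n"
    have "(\<integral>x. cis (((1/\<sigma>) *\<^sub>R (y - x)) \<bullet> w) \<partial>P) = (\<integral>x. cis ((1/\<sigma>) *\<^sub>R w \<bullet> y) * cnj (cis ((1/\<sigma>) *\<^sub>R w \<bullet> x)) \<partial>P)"
      by (simp add: cis_cnj cis_mult inner_diff_left inner_commute algebra_simps)
    also have "\<dots> = cis ((1/\<sigma>) *\<^sub>R w \<bullet> y) * (\<integral>x. cnj (cis ((1/\<sigma>) *\<^sub>R w \<bullet> x)) \<partial>P)"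
      by (rule integral_mult_right_zero)
    also have "(\<integral>x. cnj (cis ((1/\<sigma>) *\<^sub>R w \<bullet> x)) \<partial>P) = cnj (char_fn P ((1/\<sigma>) *\<^sub>R w))"
      unfolding char_fn_def by (rule Bochner_Integration.integral_cnj)
    finally show "(\<integral>x. cis (((1/\<sigma>) *\<^sub>R (y - x)) \<bullet> w) \<partial>P) = cis ((1/\<sigma>) *\<^sub>R w \<bullet> y) * cnj (char_fn P ((1/\<sigma>) *\<^sub>R w))" .
  qed
  finally show ?thesis by (simp add: power_divide power_mult_distrib mult_ac)
qed

text \<open>
  The bound is uniform in \<open>y\<close> because the factor \<open>cis\<close> in the inversion formula has modulus one.
\<close>

lemma smoothed_density_diff_le:
  fixes P Q :: "(real ^ 'n) measure"
  assumes P: "prob_space P" "sets P = sets borel" and Q: "prob_space Q" "sets Q = sets borel" and \<sigma>: "\<sigma> > 0"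
  shows "\<bar>smoothed_density \<sigma> P y - smoothed_density \<sigma> Q y\<bar> \<le>
    (1 / (\<sigma> * sqrt (2 * pi))) ^ CARD('n) *
      (\<integral>w. norm (char_fn P ((1/\<sigma>) *\<^sub>R w) - char_fn Q ((1/\<sigma>) *\<^sub>R w)) \<partial>std_mv_normal)"
proof -
  interpret G: prob_space "std_mv_normal :: (real^'n) measure" by (rule prob_space_std_mv_normal)
  note [measurable] = char_fn_measurable[OF P] char_fn_measurable[OF Q]
  let ?c = "(1 / (\<sigma> * sqrt (2 * pi))) ^ CARD('n)"
  let ?f = "\<lambda>P w. cis ((1/\<sigma>) *\<^sub>R w \<bullet> y) * cnj (char_fn P ((1/\<sigma>) *\<^sub>R w))"
  have [measurable]: "cnj \<in> borel_measurable borel"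
    by (intro borel_measurable_continuous_onI continuous_intros)
  have int: "integrable std_mv_normal (?f P)" "integrable std_mv_normal (?f Q)"
    using norm_char_fn_le_1[OF P(1)] norm_char_fn_le_1[OF Q(1)]
    by (intro G.integrable_const_bound[of _ 1] AE_I2; simp add: norm_mult)+
  have "\<bar>smoothed_density \<sigma> P y - smoothed_density \<sigma> Q y\<bar> =
      norm (complex_of_real (smoothed_density \<sigma> P y) - complex_of_real (smoothed_density \<sigma> Q y))"
    by (simp flip: of_real_diff)
  also have "\<dots> = norm (?c * (\<integral>w. ?f P w - ?f Q w \<partial>std_mv_normal))"
    unfolding smoothed_density_char[OF P \<sigma>] smoothed_density_char[OF Q \<sigma>]
    by (subst Bochner_Integration.integral_diff) (use int in \<open>auto simp: right_diff_distrib\<close>)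
  also have "\<dots> = ?c * norm (\<integral>w. ?f P w - ?f Q w \<partial>std_mv_normal)"
    using \<sigma> by (simp add: norm_mult norm_power norm_divide)
  also have "\<dots> \<le> ?c * (\<integral>w. norm (?f P w - ?f Q w) \<partial>std_mv_normal)"
    using \<sigma> by (intro mult_left_mono integral_norm_bound) auto
  also have "(\<lambda>w. norm (?f P w - ?f Q w)) = (\<lambda>w. norm (char_fn P ((1/\<sigma>) *\<^sub>R w) - char_fn Q ((1/\<sigma>) *\<^sub>R w)))"
    by (auto simp: norm_mult simp flip: right_diff_distrib complex_cnj_diff)
  finally show ?thesis .
qed

lemma std_mv_normal_affine:
  fixes f :: "real ^ 'n \<Rightarrow> real"
  assumes [measurable]: "f \<in> borel_measurable borel" and \<sigma>: "\<sigma> > 0" and bd: "\<And>x. \<bar>f x\<bar> \<le> B"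
  shows "(\<integral>z. f (x + \<sigma> *\<^sub>R z) \<partial>std_mv_normal) =
      (\<integral>y. f y * (gauss_density ((1/\<sigma>) *\<^sub>R (y - x)) / \<sigma> ^ CARD('n)) \<partial>lborel)" (is ?eq)
    and "integrable lborel (\<lambda>y. f y * (gauss_density ((1/\<sigma>) *\<^sub>R (y - x)) / \<sigma> ^ CARD('n)))" (is ?int)
proof -
  interpret G: prob_space "std_mv_normal :: (real^'n) measure" by (rule prob_space_std_mv_normal)
  have lb: "(lborel :: (real^'n) measure) = density (distr lborel borel (\<lambda>z. x + \<sigma> *\<^sub>R z)) (\<lambda>_. ennreal (\<bar>\<sigma>\<bar>^CARD('n)))"
    by (subst lborel_affine[of \<sigma> x]) (use \<sigma> in \<open>auto simp: ennreal_power\<close>)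
  have a: "(\<lambda>z. (\<bar>\<sigma>\<bar> ^ CARD('n)) *\<^sub>R (f (x + \<sigma> *\<^sub>R z) * (gauss_density ((1/\<sigma>) *\<^sub>R ((x + \<sigma> *\<^sub>R z) - x)) / \<sigma> ^ CARD('n)))) =
     (\<lambda>z. gauss_density z *\<^sub>R f (x + \<sigma> *\<^sub>R z))"
    using \<sigma> by auto
  have meas: "(\<lambda>y. f y * (gauss_density ((1/\<sigma>) *\<^sub>R (y - x)) / \<sigma> ^ CARD('n))) \<in> borel_measurable borel"
    by measurable
  have "integrable std_mv_normal (\<lambda>z. f (x + \<sigma> *\<^sub>R z))"
    using bd by (intro G.integrable_const_bound[of _ B]) auto
  then have i: "integrable lborel (\<lambda>z. gauss_density z *\<^sub>R f (x + \<sigma> *\<^sub>R z))"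
    unfolding std_mv_normal_def by (subst (asm) integrable_density) (auto intro!: prod_nonneg)
  let ?h = "\<lambda>y. f y * (gauss_density ((1/\<sigma>) *\<^sub>R (y - x)) / \<sigma> ^ CARD('n))"
  have "(\<integral>y. ?h y \<partial>lborel) = (\<integral>z. (\<bar>\<sigma>\<bar> ^ CARD('n)) *\<^sub>R ?h (x + \<sigma> *\<^sub>R z) \<partial>lborel)"
    by (subst lb, subst integral_density) (use meas in \<open>auto simp: integral_distr simp del: times_divide_eq_right\<close>)
  also have "\<dots> = (\<integral>z. f (x + \<sigma> *\<^sub>R z) \<partial>std_mv_normal)"
    unfolding a by (rule integral_std_mv_normal[symmetric]) simp
  finally show ?eq ..
  have "integrable (distr lborel borel (\<lambda>z. x + \<sigma> *\<^sub>R z)) (\<lambda>y. (\<bar>\<sigma>\<bar> ^ CARD('n)) *\<^sub>R ?h y)"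
    by (subst integrable_distr_eq) (use meas i in \<open>simp_all only: a, simp_all\<close>)
  then show ?int
    by (subst lb, subst integrable_density) (use meas in auto)
qed

text \<open>
  The left-hand side is close to \<open>\<integral>f \<partial>P\<close> when \<open>\<sigma>\<close> is small, and the right-hand side can be compared between
  two laws through their densities.
\<close>

lemma gauss_smoothing:
  fixes P :: "(real ^ 'n) measure" and f :: "real ^ 'n \<Rightarrow> real"
  assumes P: "prob_space P" "sets P = sets borel" and \<sigma>: "\<sigma> > 0"
    and [measurable]: "f \<in> borel_measurable borel" and bd: "\<And>x. \<bar>f x\<bar> \<le> B"
  shows "(\<integral>x. (\<integral>z. f (x + \<sigma> *\<^sub>R z) \<partial>std_mv_normal) \<partial>P) = (\<integral>y. f y * smoothed_density \<sigma> P y \<partial>lborel)" (is ?eq)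
    and "integrable lborel (\<lambda>y. f y * smoothed_density \<sigma> P y)" (is ?int)
proof -
  interpret P: prob_space P by fact
  interpret PL: pair_sigma_finite P "lborel :: (real^'n) measure" ..
  note [measurable_cong] = P(2)
  let ?k = "\<lambda>x y. gauss_density ((1/\<sigma>) *\<^sub>R (y - x)) / \<sigma> ^ CARD('n)"
  have k0: "0 \<le> ?k x y" for x y :: "real^'n"
    using \<sigma> by (auto intro!: divide_nonneg_nonneg prod_nonneg)
  have B: "0 \<le> B" using bd[of 0] by linarith
  have k1: "(\<integral>y. ?k x y \<partial>lborel) = 1" for x :: "real^'n"
    using std_mv_normal_affine(1)[of "\<lambda>_. 1" \<sigma> 1 x] \<sigma>
      measure_std_mv_normal_UNIV[where 'n='n] zero_less_power[OF \<sigma>, of "CARD('n)"]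
    by (simp del: times_divide_eq_right zero_less_power)
  have int2: "integrable (P \<Otimes>\<^sub>M lborel) (\<lambda>(x, y). f y * ?k x y)"
  proof (rule PL.Fubini_integrable)
    have le: "(\<integral>y. norm (f y * ?k x y) \<partial>lborel) \<le> B" for x
    proof -
      have "(\<integral>y. norm (f y * ?k x y) \<partial>lborel) \<le> (\<integral>y. B * ?k x y \<partial>lborel)"
      proof (rule integral_mono)
        fix y
        show "norm (f y * ?k x y) \<le> B * ?k x y"
          unfolding real_norm_def abs_mult abs_of_nonneg[OF k0] by (intro mult_right_mono bd k0)
      next
        show "integrable lborel (\<lambda>y. norm (f y * ?k x y))"
          by (rule integrable_norm, rule std_mv_normal_affine(2)) (use \<sigma> bd in auto)
        show "integrable lborel (\<lambda>y. B * ?k x y)"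
          by (rule std_mv_normal_affine(2)[where B=B]) (use \<sigma> B in auto)
      qed
      then show ?thesis by (simp only: integral_mult_right_zero k1 mult_1_right)
    qed
    have "(\<lambda>x. LINT y|lborel. norm (case (x, y) of (x, y) \<Rightarrow> f y * ?k x y)) \<in> borel_measurable P"
      by measurable
    then show "integrable P (\<lambda>x. LINT y|lborel. norm (case (x, y) of (x, y) \<Rightarrow> f y * ?k x y))"
      by (rule P.integrable_const_bound[of _ B, rotated])
        (use le in \<open>simp del: times_divide_eq_right add: integral_nonneg_AE\<close>)
  next
    show "(\<lambda>(x, y). f y * ?k x y) \<in> borel_measurable (P \<Otimes>\<^sub>M lborel)" by measurable
  qed (use std_mv_normal_affine(2)[of f \<sigma> B] \<sigma> bd in auto)
  have sm: "(\<integral>x. f y * ?k x y \<partial>P) = f y * smoothed_density \<sigma> P y" for y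
    unfolding smoothed_density_def by (rule integral_mult_right_zero)
  have fm: "f \<in> borel_measurable borel" by measurable
  show ?eq
    using PL.Fubini_integral[OF int2] unfolding prod.case sm std_mv_normal_affine(1)[OF fm \<sigma> bd] by (rule sym)
  show ?int
    using PL.integrable_snd[OF int2] unfolding prod.case sm .
qed

lemma smoothed_density_nonneg: "\<sigma> > 0 \<Longrightarrow> 0 \<le> smoothed_density \<sigma> P y"
  unfolding smoothed_density_def by (intro Bochner_Integration.integral_nonneg) (auto intro!: divide_nonneg_nonneg prod_nonneg)

lemma
  fixes P :: "(real ^ 'n) measure"
  assumes P: "prob_space P" "sets P = sets borel" and \<sigma>: "\<sigma> > 0"
  shows integrable_smoothed_density: "integrable lborel (smoothed_density \<sigma> P)"
    and integral_smoothed_density: "(\<integral>y. smoothed_density \<sigma> P y \<partial>lborel) = 1"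
  using gauss_smoothing[OF assms, of "\<lambda>_. 1" 1] measure_std_mv_normal_UNIV[where 'n='n]
    prob_space.prob_space[OF P(1)] by auto

lemma BL1_measurable: "f \<in> BL1 \<Longrightarrow> f \<in> borel_measurable borel"
proof (intro borel_measurable_continuous_onI)
  assume "f \<in> BL1"
  then have "1-lipschitz_on UNIV f"
    by (auto simp: BL1_def lipschitz_on_def dist_norm)
  then show "continuous_on UNIV f"
    by (rule lipschitz_on_continuous_on)
qed

text \<open>
  Moving the argument by \<open>\<sigma> z\<close> changes a function in \<open>BL1\<close> by at most \<open>\<sigma> norm z\<close>.
\<close>

lemma BL1_smoothing_error:
  fixes P :: "(real ^ 'n) measure" and f :: "real ^ 'n \<Rightarrow> real"
  assumes P: "prob_space P" "sets P = sets borel" and \<sigma>: "\<sigma> > 0" and f: "f \<in> BL1"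
  shows "\<bar>(\<integral>x. f x \<partial>P) - (\<integral>y. f y * smoothed_density \<sigma> P y \<partial>lborel)\<bar> \<le> \<sigma> * (\<integral>z. norm z \<partial>(std_mv_normal :: (real^'n) measure))"
proof -
  interpret P: prob_space P by fact
  interpret G: prob_space "std_mv_normal :: (real^'n) measure" by (rule prob_space_std_mv_normal)
  note [measurable_cong] = P(2)
  note [measurable] = BL1_measurable[OF f]
  have fb: "\<bar>f x\<bar> \<le> 1" for x using f by (auto simp: BL1_def)
  have fl: "\<bar>f x - f y\<bar> \<le> norm (x - y)" for x y using f by (auto simp: BL1_def)
  have i1: "integrable std_mv_normal (\<lambda>z. f (x + \<sigma> *\<^sub>R z))" for x
    using fb by (intro G.integrable_const_bound[of _ 1]) auto
  have i2: "integrable P f"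
    using fb by (intro P.integrable_const_bound[of _ 1]) auto
  have i3: "integrable P (\<lambda>x. \<integral>z. f (x + \<sigma> *\<^sub>R z) \<partial>std_mv_normal)"
  proof (intro P.integrable_const_bound[of _ 1])
    have "norm (\<integral>z. f (x + \<sigma> *\<^sub>R z) \<partial>std_mv_normal) \<le> 1" for x
      by (rule order_trans[OF integral_norm_bound]) (use i1 fb in \<open>auto intro!: G.integral_le_const\<close>)
    then show "AE x in P. norm (\<integral>z. f (x + \<sigma> *\<^sub>R z) \<partial>std_mv_normal) \<le> 1" by auto
  qed measurable
  have in_: "integrable (std_mv_normal :: (real^'n) measure) norm" by (rule integrable_norm_std_mv_normal)
  have "\<bar>(\<integral>x. f x \<partial>P) - (\<integral>y. f y * smoothed_density \<sigma> P y \<partial>lborel)\<bar> =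
      \<bar>\<integral>x. f x - (\<integral>z. f (x + \<sigma> *\<^sub>R z) \<partial>std_mv_normal) \<partial>P\<bar>"
    by (subst gauss_smoothing(1)[OF P \<sigma> _ fb, symmetric], measurable) (simp add: i2 i3)
  also have "\<dots> \<le> (\<integral>x. \<sigma> * (\<integral>z. norm z \<partial>(std_mv_normal :: (real^'n) measure)) \<partial>P)"
  proof (rule order_trans[OF integral_abs_bound], rule integral_mono)
    fix x
    have "\<bar>f x - (\<integral>z. f (x + \<sigma> *\<^sub>R z) \<partial>std_mv_normal)\<bar> = \<bar>\<integral>z. f x - f (x + \<sigma> *\<^sub>R z) \<partial>std_mv_normal\<bar>"
      using G.prob_space by (simp add: i1)
    also have "\<dots> \<le> (\<integral>z. \<bar>f x - f (x + \<sigma> *\<^sub>R z)\<bar> \<partial>std_mv_normal)"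
      by (rule integral_abs_bound)
    also have "\<dots> \<le> (\<integral>z. \<sigma> * norm z \<partial>(std_mv_normal :: (real^'n) measure))"
    proof (rule integral_mono)
      fix z :: "real^'n"
      show "\<bar>f x - f (x + \<sigma> *\<^sub>R z)\<bar> \<le> \<sigma> * norm z"
        using fl[of x "x + \<sigma> *\<^sub>R z"] \<sigma> by simp
    qed (use i1 in_ in auto)
    finally show "\<bar>f x - (\<integral>z. f (x + \<sigma> *\<^sub>R z) \<partial>std_mv_normal)\<bar> \<le> \<sigma> * (\<integral>z. norm z \<partial>(std_mv_normal :: (real^'n) measure))"
      by simp
  qed (use i2 i3 in auto)
  also have "\<dots> = \<sigma> * (\<integral>z. norm z \<partial>(std_mv_normal :: (real^'n) measure))"
    by (simp add: P.prob_space)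
  finally show ?thesis .
qed

lemma BL_dist_le:
  fixes P Q :: "(real ^ 'n) measure"
  assumes "\<And>f. f \<in> BL1 \<Longrightarrow> \<bar>(\<integral>x. f x \<partial>P) - (\<integral>x. f x \<partial>Q)\<bar> \<le> c"
  shows "BL_dist P Q \<le> c"
  unfolding BL_dist_def
proof (rule cSUP_least)
  show "(BL1 :: (real^'n \<Rightarrow> real) set) \<noteq> {}"
    by (auto simp: BL1_def intro!: exI[of _ "\<lambda>_. 0"])
qed (rule assms)

text \<open>
  A quantitative form of the continuity theorem. Replacing both laws by their smoothed versions
  costs at most \<open>\<eta> / 2\<close>. The \<open>L\<^sup>1\<close> distance of the smoothed densities is estimated as in Scheffe's lemma:
  on a ball that carries almost all mass of the smoothed \<open>Q\<close> they are uniformly close, and as both integrate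
  to one, nothing else has to be controlled. The constants depend on \<open>Q\<close> and \<open>\<eta>\<close> only, so the estimate can be
  used for a random \<open>P\<close> pointwise.
\<close>

lemma BL_dist_char_fn:
  fixes Q :: "(real ^ 'n) measure"
  assumes Q: "prob_space Q" "sets Q = sets borel" and \<eta>: "\<eta> > 0"
  obtains \<sigma> C where "\<sigma> > 0" "C \<ge> 0"
    "\<And>P. prob_space P \<Longrightarrow> sets P = sets borel \<Longrightarrow>
      BL_dist P Q \<le> \<eta> + C * (\<integral>w. norm (char_fn P ((1/\<sigma>) *\<^sub>R w) - char_fn Q ((1/\<sigma>) *\<^sub>R w)) \<partial>std_mv_normal)"
proof -
  define E where "E = (\<integral>z. norm z \<partial>(std_mv_normal :: (real^'n) measure))"
  have E: "E \<ge> 0" unfolding E_def by (auto intro!: Bochner_Integration.integral_nonneg)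
  define \<sigma> where "\<sigma> = \<eta> / (4 * (E + 1))"
  have \<sigma>: "\<sigma> > 0" using \<eta> E by (auto simp: \<sigma>_def)
  have \<sigma>E: "2 * (\<sigma> * E) \<le> \<eta> / 2" using \<eta> E by (simp add: \<sigma>_def divide_simps)
  let ?q = "smoothed_density \<sigma> Q"
  note iq = integrable_smoothed_density[OF Q \<sigma>]
  have qm [measurable]: "?q \<in> borel_measurable borel" using iq by auto
  have "(\<lambda>k. \<integral>y. indicator (cball 0 (real k)) y * ?q y \<partial>lborel) \<longlonglongrightarrow> (\<integral>y. ?q y \<partial>lborel)"
  proof (rule integral_dominated_convergence[where w="?q"])
    have "(\<lambda>k. indicator (cball 0 (real k)) y * ?q y) \<longlonglongrightarrow> ?q y" for y
    proof (rule tendsto_eventually)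
      have "\<forall>\<^sub>F k in sequentially. norm y \<le> real k"
        by (simp add: eventually_sequentially) (meson real_arch_simple order_trans of_nat_le_iff)
      then show "\<forall>\<^sub>F k in sequentially. indicator (cball 0 (real k)) y * ?q y = ?q y"
        by eventually_elim auto
    qed
    then show "AE y in lborel. (\<lambda>k. indicator (cball 0 (real k)) y * ?q y) \<longlonglongrightarrow> ?q y" by auto
  qed (use iq smoothed_density_nonneg[OF \<sigma>] in \<open>auto simp: indicator_def\<close>)
  then have "\<forall>\<^sub>F k in sequentially. (\<integral>y. indicator (cball 0 (real k)) y * ?q y \<partial>lborel) > 1 - \<eta> / 4"
    unfolding integral_smoothed_density[OF Q \<sigma>] using \<eta> by (intro order_tendstoD) auto
  then obtain k where k: "(\<integral>y. indicator (cball 0 (real k)) y * ?q y \<partial>lborel) > 1 - \<eta> / 4"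
    by (auto simp: eventually_sequentially)
  define B where "B = (cball 0 (real k) :: (real^'n) set)"
  have Bm [measurable]: "B \<in> sets borel" by (simp add: B_def)
  have Bf: "emeasure lborel B < \<infinity>" unfolding B_def by (rule emeasure_bounded_finite) simp
  define C where "C = 2 * (measure lborel B * (1 / (\<sigma> * sqrt (2 * pi))) ^ CARD('n))"
  have C: "C \<ge> 0" using \<sigma> by (simp add: C_def)
  show thesis
  proof (rule that[OF \<sigma> C])
    fix P :: "(real^'n) measure" assume P: "prob_space P" "sets P = sets borel"
    define V where "V = (\<integral>w. norm (char_fn P ((1/\<sigma>) *\<^sub>R w) - char_fn Q ((1/\<sigma>) *\<^sub>R w)) \<partial>std_mv_normal)"
    let ?p = "smoothed_density \<sigma> P"
    let ?D = "(1 / (\<sigma> * sqrt (2 * pi))) ^ CARD('n) * V"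
    note ip = integrable_smoothed_density[OF P \<sigma>]
    have pm [measurable]: "?p \<in> borel_measurable borel" using ip by auto
    have V0: "0 \<le> ?D" using \<sigma> by (auto simp: V_def intro!: mult_nonneg_nonneg Bochner_Integration.integral_nonneg)
    have pq: "\<bar>?p y - ?q y\<bar> \<le> ?D" for y
      unfolding V_def by (rule smoothed_density_diff_le[OF P Q \<sigma>])
    have iBq: "integrable lborel (\<lambda>y. indicator B y * ?q y)"
      using iq by (rule Bochner_Integration.integrable_bound) (auto simp: indicator_def)
    have iB: "integrable lborel (\<lambda>y. indicator B y * ?D)"
      using Bf by (intro integrable_mult_left) (auto simp: B_def)
    (* both densities integrate to 1, so the L1 distance is twice the integral of the positive part of q - p *)
    have "(\<integral>y. \<bar>?p y - ?q y\<bar> \<partial>lborel) = (\<integral>y. ?p y - ?q y + 2 * max 0 (?q y - ?p y) \<partial>lborel)"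
      by (rule Bochner_Integration.integral_cong) (auto simp: max_def)
    also have "\<dots> = 2 * (\<integral>y. max 0 (?q y - ?p y) \<partial>lborel)"
      using ip iq by (simp add: integral_smoothed_density[OF P \<sigma>] integral_smoothed_density[OF Q \<sigma>])
    also have "(\<integral>y. max 0 (?q y - ?p y) \<partial>lborel) \<le> (\<integral>y. indicator B y * ?D + (?q y - indicator B y * ?q y) \<partial>lborel)"
    proof (rule integral_mono)
      fix y
      show "max 0 (?q y - ?p y) \<le> indicator B y * ?D + (?q y - indicator B y * ?q y)"
        using pq[of y] V0 smoothed_density_nonneg[OF \<sigma>, of P y] smoothed_density_nonneg[OF \<sigma>, of Q y]
        by (cases "y \<in> B") auto
    qed (use ip iq iBq iB in auto)
    also have "\<dots> = measure lborel B * ?D + (1 - (\<integral>y. indicator B y * ?q y \<partial>lborel))"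
      using iq iBq iB Bf by (simp add: integral_smoothed_density[OF Q \<sigma>])
    also have "\<dots> \<le> measure lborel B * ?D + \<eta> / 4"
      using k by (simp add: B_def)
    finally have L1: "(\<integral>y. \<bar>?p y - ?q y\<bar> \<partial>lborel) \<le> C * V + \<eta> / 2"
      by (simp add: C_def algebra_simps)
    have "\<bar>(\<integral>x. f x \<partial>P) - (\<integral>x. f x \<partial>Q)\<bar> \<le> \<eta> + C * V" if f: "f \<in> BL1" for f
    proof -
      note [measurable] = BL1_measurable[OF f]
      have fb: "\<bar>f x\<bar> \<le> 1" for x using f by (auto simp: BL1_def)
      note i = gauss_smoothing(2)[OF P \<sigma> _ fb, simplified] gauss_smoothing(2)[OF Q \<sigma> _ fb, simplified]
      have "\<bar>(\<integral>y. f y * ?p y \<partial>lborel) - (\<integral>y. f y * ?q y \<partial>lborel)\<bar> = \<bar>\<integral>y. f y * (?p y - ?q y) \<partial>lborel\<bar>"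
        using i by (simp add: right_diff_distrib)
      also have "\<dots> \<le> (\<integral>y. \<bar>?p y - ?q y\<bar> \<partial>lborel)"
      proof (rule order_trans[OF integral_abs_bound], rule integral_mono)
        fix y show "\<bar>f y * (?p y - ?q y)\<bar> \<le> \<bar>?p y - ?q y\<bar>"
          using fb[of y] by (auto simp: abs_mult intro: mult_left_le_one_le)
      qed (use i ip iq in \<open>auto simp: right_diff_distrib\<close>)
      finally have "\<bar>(\<integral>y. f y * ?p y \<partial>lborel) - (\<integral>y. f y * ?q y \<partial>lborel)\<bar> \<le> C * V + \<eta> / 2"
        using L1 by linarith
      moreover have "\<bar>(\<integral>x. f x \<partial>P) - (\<integral>y. f y * ?p y \<partial>lborel)\<bar> \<le> \<sigma> * E"
        unfolding E_def by (rule BL1_smoothing_error[OF P \<sigma> f])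
      moreover have "\<bar>(\<integral>x. f x \<partial>Q) - (\<integral>y. f y * ?q y \<partial>lborel)\<bar> \<le> \<sigma> * E"
        unfolding E_def by (rule BL1_smoothing_error[OF Q \<sigma> f])
      ultimately show ?thesis using \<sigma>E by linarith
    qed
    then show "BL_dist P Q \<le> \<eta> + C * (\<integral>w. norm (char_fn P ((1/\<sigma>) *\<^sub>R w) - char_fn Q ((1/\<sigma>) *\<^sub>R w)) \<partial>std_mv_normal)"
      unfolding V_def by (rule BL_dist_le)
  qed
qed

section \<open>Multivariate normal laws\<close>

definition psd :: "real ^ 'n ^ 'n \<Rightarrow> bool" where
  "psd S \<longleftrightarrow> transpose S = S \<and> (\<forall>x. 0 \<le> x \<bullet> (S *v x))"

lemma psd_sym: "psd S \<Longrightarrow> S $ i $ j = S $ j $ i"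
  unfolding psd_def by (metis transpose_def vec_lambda_beta)

lemma psd_diag: "psd S \<Longrightarrow> 0 \<le> S $ i $ i"
proof -
  assume "psd S"
  then have "0 \<le> axis i 1 \<bullet> (S *v axis i 1)" by (auto simp: psd_def)
  then show ?thesis by (simp add: inner_axis' matrix_vector_mult_basis column_def)
qed

lemma inner_matrix_expand: "x \<bullet> (S *v y) = (\<Sum>i\<in>UNIV. \<Sum>j\<in>UNIV. x $ i * S $ i $ j * y $ j)"
  by (simp add: inner_vec_def matrix_vector_mult_def sum_distrib_left mult.assoc)

lemma psd_cauchy_schwarz:
  assumes S: "psd S"
  shows "(x \<bullet> (S *v y))\<^sup>2 \<le> (x \<bullet> (S *v x)) * (y \<bullet> (S *v y))"
proof -
  have sym: "y \<bullet> (S *v x) = x \<bullet> (S *v y)"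
    using S by (metis dot_lmul_matrix inner_commute psd_def vector_transpose_matrix)
  have q: "0 \<le> (x \<bullet> (S *v x)) + 2 * r * (x \<bullet> (S *v y)) + r\<^sup>2 * (y \<bullet> (S *v y))" for r
  proof -
    have "0 \<le> (x + r *\<^sub>R y) \<bullet> (S *v (x + r *\<^sub>R y))" using S by (auto simp: psd_def)
    also have "\<dots> = (x \<bullet> (S *v x)) + 2 * r * (x \<bullet> (S *v y)) + r\<^sup>2 * (y \<bullet> (S *v y))"
      by (simp add: matrix_vector_right_distrib matrix_vector_mult_scaleR inner_add_left inner_add_right sym power2_eq_square algebra_simps)
    finally show ?thesis .
  qed
  show ?thesis
  proof (cases "y \<bullet> (S *v y) = 0")
    case True
    have "x \<bullet> (S *v y) = 0"
    proof (rule ccontr)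
      assume n: "x \<bullet> (S *v y) \<noteq> 0"
      have "0 \<le> (x \<bullet> (S *v x)) + 2 * (- ((x \<bullet> (S *v x)) + 1) / (2 * (x \<bullet> (S *v y)))) * (x \<bullet> (S *v y))"
        using q[of "- ((x \<bullet> (S *v x)) + 1) / (2 * (x \<bullet> (S *v y)))"] True by simp
      then show False using n by (simp add: field_simps)
    qed
    then show ?thesis using True by simp
  next
    case False
    then have p: "0 < y \<bullet> (S *v y)" using S by (auto simp: psd_def less_le)
    define r where "r = - (x \<bullet> (S *v y)) / (y \<bullet> (S *v y))"
    have "0 \<le> (y \<bullet> (S *v y)) * ((x \<bullet> (S *v x)) + 2 * r * (x \<bullet> (S *v y)) + r\<^sup>2 * (y \<bullet> (S *v y)))"
      using q[of r] p by (intro mult_nonneg_nonneg) auto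
    also have "\<dots> = (x \<bullet> (S *v x)) * (y \<bullet> (S *v y)) - (x \<bullet> (S *v y))\<^sup>2"
      using False unfolding r_def by (simp add: power2_eq_square divide_simps)
    finally show ?thesis by simp
  qed
qed

lemma psd_entry_eq_axis: "axis i 1 \<bullet> (S *v axis j 1) = S $ i $ j" for S :: "real ^ 'n ^ 'n"
  by (simp add: inner_axis' matrix_vector_mult_basis column_def)

text \<open>
  Cholesky factorization by induction over the support. Eliminating the index \<open>k\<close> subtracts the rank
  one matrix \<open>c c\<^sup>T\<close>, with \<open>c\<close> the \<open>k\<close>-th column divided by the root of the pivot. If the pivot is zero, then by
  Cauchy-Schwarz the whole row is, and there is nothing to eliminate.
\<close>

lemma psd_cholesky_support:
  fixes S :: "real ^ 'n ^ 'n"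
  assumes "finite I" "psd S" "\<And>i j. i \<notin> I \<Longrightarrow> S $ i $ j = 0"
  shows "\<exists>A. A ** transpose A = S \<and> (\<forall>i j. j \<notin> I \<longrightarrow> A $ i $ j = 0)"
  using assms
proof (induction I arbitrary: S rule: finite_induct)
  case empty
  then have "S = 0" by (simp add: vec_eq_iff)
  then show ?case by (intro exI[of _ 0]) (simp add: vec_eq_iff matrix_matrix_mult_def)
next
  case (insert k I)
  let ?d = "S $ k $ k"
  have d0: "0 \<le> ?d" by (rule psd_diag) fact
  show ?case
  proof (cases "?d = 0")
    case True
    have "S $ k $ j = 0" for j
      using psd_cauchy_schwarz[OF insert.prems(1), of "axis k 1" "axis j 1"] True
      by (simp add: psd_entry_eq_axis)
    then have "\<And>i j. i \<notin> I \<Longrightarrow> S $ i $ j = 0"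
      using insert.prems(2) by (metis insert_iff)
    from insert.IH[OF insert.prems(1) this] show ?thesis by auto
  next
    case False
    with d0 have d: "0 < ?d" by simp
    define c where "c = (\<chi> i. S $ i $ k / sqrt ?d)"
    define S' where "S' = (\<chi> i j. S $ i $ j - c $ i * c $ j)"
    have cc: "c $ i * c $ j = S $ i $ k * S $ j $ k / ?d" for i j
      using d by (simp add: c_def)
    have qf: "x \<bullet> (S' *v x) = x \<bullet> (S *v x) - (c \<bullet> x)\<^sup>2" for x
    proof -
      have "(c \<bullet> x)\<^sup>2 = (\<Sum>i\<in>UNIV. \<Sum>j\<in>UNIV. x $ i * (c $ i * c $ j) * x $ j)"
        unfolding power2_eq_square inner_vec_def sum_product by (simp add: mult_ac)
      then show ?thesis
        by (simp add: inner_matrix_expand S'_def sum_subtractf[symmetric] left_diff_distrib right_diff_distrib)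
    qed
    have cx: "c \<bullet> x = (axis k 1 \<bullet> (S *v x)) / sqrt ?d" for x
      using psd_sym[OF insert.prems(1)]
      by (simp add: inner_axis', simp add: c_def inner_vec_def matrix_vector_mult_def sum_divide_distrib)
    have "psd S'"
      unfolding psd_def
    proof (intro conjI allI)
      show "transpose S' = S'"
        using psd_sym[OF insert.prems(1)] by (auto simp: S'_def transpose_def vec_eq_iff mult.commute)
      fix x
      have "(axis k 1 \<bullet> (S *v x))\<^sup>2 \<le> ?d * (x \<bullet> (S *v x))"
        using psd_cauchy_schwarz[OF insert.prems(1), of "axis k 1" x] by (simp add: psd_entry_eq_axis)
      then show "0 \<le> x \<bullet> (S' *v x)"
        using d unfolding qf cx by (simp add: power_divide field_simps)
    qed
    moreover have "S' $ i $ j = 0" if "i \<notin> I" for i j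
    proof (cases "i = k")
      case True
      then show ?thesis using d psd_sym[OF insert.prems(1), of j k] by (simp add: S'_def cc)
    next
      case False
      then show ?thesis using that insert.prems(2)[of i] by (simp add: S'_def cc)
    qed
    ultimately obtain A' where A': "A' ** transpose A' = S'" "\<And>i j. j \<notin> I \<Longrightarrow> A' $ i $ j = 0"
      using insert.IH by blast
    define A where "A = (\<chi> i j. if j = k then c $ i else A' $ i $ j)"
    have A'k: "A' $ i $ k = 0" for i using A'(2) insert.hyps(2) by simp
    have "(A ** transpose A) $ i $ j = S $ i $ j" for i j
    proof -
      have "(A ** transpose A) $ i $ j = (\<Sum>l\<in>UNIV. A' $ i $ l * A' $ j $ l + (if l = k then c $ i * c $ j else 0))"
        by (auto simp: matrix_matrix_mult_def transpose_def A_def A'k intro!: sum.cong)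
      also have "\<dots> = (A' ** transpose A') $ i $ j + c $ i * c $ j"
        by (simp add: sum.distrib matrix_matrix_mult_def transpose_def)
      finally show ?thesis by (simp add: A'(1) S'_def)
    qed
    then have "A ** transpose A = S" by (simp add: vec_eq_iff)
    moreover have "\<forall>i j. j \<notin> insert k I \<longrightarrow> A $ i $ j = 0" by (auto simp: A_def A'(2))
    ultimately show ?thesis by blast
  qed
qed

lemma psd_has_root:
  fixes S :: "real ^ 'n ^ 'n"
  assumes "psd S"
  shows "\<exists>A :: real ^ 'n ^ 'n. A ** transpose A = S"
  using psd_cholesky_support[OF finite assms, of UNIV] by auto

lemma measurable_matrix_vector_mult [measurable]:
  "(*v) (A :: real ^ 'n ^ 'm) \<in> borel_measurable borel"
  by (intro borel_measurable_continuous_onI linear_continuous_on matrix_vector_mul_bounded_linear)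

lemma
  fixes S :: "real ^ 'n ^ 'n"
  shows prob_space_mv_normal: "prob_space (mv_normal m S)"
    and sets_mv_normal: "sets (mv_normal m S) = sets borel"
proof -
  interpret prob_space "std_mv_normal :: (real^'n) measure" by (rule prob_space_std_mv_normal)
  show "prob_space (mv_normal m S)"
    unfolding mv_normal_def by (rule prob_space_distr) simp
  show "sets (mv_normal m S) = sets borel"
    by (simp add: mv_normal_def)
qed

text \<open>
  The exponent depends on the root \<open>A\<close> only through \<open>A A\<^sup>T = S\<close>, hence not on the one that the choice
  operator picks.
\<close>

lemma char_fn_mv_normal:
  fixes S :: "real ^ 'n ^ 'n"
  assumes S: "psd S"
  shows "char_fn (mv_normal 0 S) u = exp (- (u \<bullet> (S *v u)) / 2)"
proof -
  define A where "A = (SOME A :: real ^ 'n ^ 'n. A ** transpose A = S)"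
  have A: "A ** transpose A = S"
    unfolding A_def by (rule someI_ex) (rule psd_has_root[OF S])
  have "char_fn (mv_normal 0 S) u = (\<integral>z. cis (u \<bullet> (A *v z)) \<partial>std_mv_normal)"
    unfolding char_fn_def mv_normal_def A_def by (subst integral_distr) auto
  also have "\<dots> = (\<integral>z. cis ((transpose A *v u) \<bullet> z) \<partial>std_mv_normal)"
    by (simp add: dot_lmul_matrix)
  also have "\<dots> = exp (- (norm (transpose A *v u))\<^sup>2 / 2)"
    by (rule char_std_mv_normal)
  also have "(norm (transpose A *v u))\<^sup>2 = u \<bullet> (S *v u)"
  proof -
    have "A *v (transpose A *v u) = S *v u"
      by (simp only: matrix_vector_mul_assoc A)
    then show ?thesis by (simp add: power2_norm_eq_inner dot_lmul_matrix)
  qed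
  finally show ?thesis .
qed

section \<open>Gradients and Hessians\<close>

lemma GDERIV_unique:
  assumes "GDERIV f x :> D" "GDERIV f x :> D'"
  shows "D = D'"
proof -
  have "(\<lambda>h. h \<bullet> D) = (\<lambda>h. h \<bullet> D')"
    using assms unfolding gderiv_def by (rule has_derivative_unique)
  then show ?thesis by (metis vector_eq_ldot)
qed

lemma gradient_GDERIV:
  fixes f :: "real ^ 'n \<Rightarrow> real"
  assumes "f differentiable (at x)"
  shows "GDERIV f x :> gradient f x"
proof -
  from assms obtain f' where f': "(f has_derivative f') (at x)" by (auto simp: differentiable_def)
  then have lin: "linear f'" by (rule has_derivative_linear)
  have "f' h = h \<bullet> adjoint f' 1" for h
    using adjoint_works[OF lin, of h 1] by simp
  then have "f' = (\<lambda>h. h \<bullet> adjoint f' 1)" by auto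
  with f' have "GDERIV f x :> adjoint f' 1" by (simp add: gderiv_def)
  then have "\<exists>!D. GDERIV f x :> D"
    by (metis GDERIV_unique)
  then show ?thesis unfolding gradient_def by (rule theI')
qed

lemma GDERIV_gradient_eq: "GDERIV f x :> D \<Longrightarrow> gradient f x = D"
  unfolding gradient_def by (rule the_equality) (auto intro: GDERIV_unique)

lemma has_derivative_hessian:
  fixes f :: "real ^ 'n \<Rightarrow> real"
  assumes "gradient f differentiable (at x)"
  shows "(gradient f has_derivative (\<lambda>h. hessian f x *v h)) (at x)"
  unfolding hessian_def by (rule jacobian_works[THEN iffD1, OF assms])

lemma GDERIV_along_line:
  assumes "GDERIV f (x + s *\<^sub>R h) :> D"
  shows "((\<lambda>s. f (x + s *\<^sub>R h)) has_real_derivative (h \<bullet> D)) (at s)"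
proof -
  have 1: "(f has_derivative (\<lambda>k. k \<bullet> D)) (at (x + s *\<^sub>R h))" using assms by (simp add: gderiv_def)
  have "((\<lambda>s. f (x + s *\<^sub>R h)) has_derivative (\<lambda>r. (r *\<^sub>R h) \<bullet> D)) (at s)"
    by (rule has_derivative_compose[of "\<lambda>s. x + s *\<^sub>R h" _ s UNIV f]) (auto intro!: derivative_eq_intros 1)
  then show ?thesis by (simp add: has_field_derivative_def mult.commute[of _ "h \<bullet> D"])
qed

text \<open>
  Differentiability around a point together with a derivative of the gradient at the point itself is
  what a second-order Taylor expansion with small-o remainder requires.
\<close>

locale second_order_at =
  fixes f :: "real ^ 'n \<Rightarrow> real" and x :: "real ^ 'n" and r0 :: real
  assumes r0: "r0 > 0"
    and diff: "\<And>y. norm (y - x) < r0 \<Longrightarrow> f differentiable (at y)"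
    and diff2: "gradient f differentiable (at x)"
begin

lemma gradient_remainder:
  assumes \<eta>: "\<eta> > 0"
  shows "\<exists>d>0. d \<le> r0 \<and> (\<forall>h. norm h < d \<longrightarrow>
    norm (gradient f (x + h) - gradient f x - hessian f x *v h) \<le> \<eta> * norm h)"
proof -
  from has_derivative_hessian[OF diff2] \<eta>
  obtain d where d: "d > 0" "\<And>y. norm (y - x) < d \<Longrightarrow>
      norm (gradient f y - gradient f x - hessian f x *v (y - x)) \<le> \<eta> * norm (y - x)"
    unfolding has_derivative_at_alt by blast
  show ?thesis
  proof (intro exI[of _ "min d r0"] conjI allI impI)
    fix h :: "real^'n" assume "norm h < min d r0"
    then show "norm (gradient f (x + h) - gradient f x - hessian f x *v h) \<le> \<eta> * norm h"
      using d(2)[of "x + h"] by simp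
  qed (use d r0 in auto)
qed

text \<open>
  The mean value theorem along the segment, applied to \<open>f\<close> minus its quadratic Taylor polynomial: the
  derivative of the difference is the remainder of the gradient.
\<close>

lemma second_order_expansion:
  assumes \<eta>: "\<eta> > 0"
  shows "\<exists>d>0. d \<le> r0 \<and> (\<forall>h. norm h < d \<longrightarrow>
    \<bar>f (x + h) - f x - gradient f x \<bullet> h - (h \<bullet> (hessian f x *v h)) / 2\<bar> \<le> \<eta> * (norm h)\<^sup>2)"
proof -
  from gradient_remainder[OF \<eta>] obtain d where d0: "d > 0 \<and> d \<le> r0 \<and>
    (\<forall>h. norm h < d \<longrightarrow> norm (gradient f (x + h) - gradient f x - hessian f x *v h) \<le> \<eta> * norm h)" ..
  note d = d0[THEN conjunct1] d0[THEN conjunct2, THEN conjunct1]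
    d0[THEN conjunct2, THEN conjunct2, rule_format]
  show ?thesis
  proof (intro exI[of _ d] conjI allI impI d(1,2))
    fix h :: "real^'n" assume h: "norm h < d"
    let ?q = "h \<bullet> (hessian f x *v h)"
    define \<phi> where "\<phi> s = f (x + s *\<^sub>R h) - s * (gradient f x \<bullet> h) - s\<^sup>2 * ?q / 2" for s
    have der: "(\<phi> has_real_derivative (h \<bullet> (gradient f (x + s *\<^sub>R h) - gradient f x - hessian f x *v (s *\<^sub>R h)))) (at s)"
      if "0 \<le> s" "s \<le> 1" for s
    proof -
      have "norm (s *\<^sub>R h) < r0"
        using h d that mult_right_mono[of s 1 "norm h"] by simp
      then have "GDERIV f (x + s *\<^sub>R h) :> gradient f (x + s *\<^sub>R h)"
        by (intro gradient_GDERIV diff) simp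
      from GDERIV_along_line[OF this] show ?thesis
        unfolding \<phi>_def
        by (auto intro!: derivative_eq_intros simp: inner_diff_right matrix_vector_mult_scaleR inner_commute)
    qed
    have "\<exists>s. 0 < s \<and> s < 1 \<and> \<phi> 1 - \<phi> 0 = (1 - 0) * (h \<bullet> (gradient f (x + s *\<^sub>R h) - gradient f x - hessian f x *v (s *\<^sub>R h)))"
      by (rule MVT2) (use der in auto)
    then obtain s where s: "0 < s" "s < 1"
      and eq: "\<phi> 1 - \<phi> 0 = h \<bullet> (gradient f (x + s *\<^sub>R h) - gradient f x - hessian f x *v (s *\<^sub>R h))" by auto
    have "\<bar>\<phi> 1 - \<phi> 0\<bar> \<le> norm h * norm (gradient f (x + s *\<^sub>R h) - gradient f x - hessian f x *v (s *\<^sub>R h))"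
      unfolding eq by (rule Cauchy_Schwarz_ineq2)
    also have "\<dots> \<le> norm h * (\<eta> * norm (s *\<^sub>R h))"
      using s h mult_right_mono[of s 1 "norm h"] by (intro mult_left_mono d) auto
    also have "\<dots> \<le> norm h * (\<eta> * norm h)"
      using s \<eta> by (intro mult_left_mono) (auto simp: mult_left_le_one_le)
    finally show "\<bar>f (x + h) - f x - gradient f x \<bullet> h - (h \<bullet> (hessian f x *v h)) / 2\<bar> \<le> \<eta> * (norm h)\<^sup>2"
      by (simp add: \<phi>_def power2_eq_square algebra_simps)
  qed
qed

text \<open>
  The mixed second difference of \<open>f\<close> with steps \<open>r h\<close> and \<open>r k\<close> is symmetric in \<open>h\<close> and \<open>k\<close>, and divided by
  \<open>r\<^sup>2\<close> it tends to the Hessian form.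
\<close>

lemma hessian_bilinear_sym: "h \<bullet> (hessian f x *v k) = k \<bullet> (hessian f x *v h)"
proof -
  let ?A = "hessian f x"
  have key: "\<exists>d>0. \<forall>r. 0 < r \<and> r < d \<longrightarrow>
      \<bar>(f (x + r *\<^sub>R (h + k)) - f (x + r *\<^sub>R h) - f (x + r *\<^sub>R k) + f x) / r\<^sup>2 - k \<bullet> (?A *v h)\<bar> \<le> \<eta>"
    if \<eta>: "\<eta> > 0" for \<eta> and h k :: "real ^ 'n"
  proof -
    let ?m = "norm h + norm k + 1"
    have m: "?m > 0" by (simp add: add_nonneg_pos)
    have "\<eta> / (2 * ?m\<^sup>2) > 0" using \<eta> m by simp
    from gradient_remainder[OF this] obtain d where d0: "d > 0 \<and> d \<le> r0 \<and>
      (\<forall>w. norm w < d \<longrightarrow> norm (gradient f (x + w) - gradient f x - ?A *v w) \<le> \<eta> / (2 * ?m\<^sup>2) * norm w)" ..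
    note d = d0[THEN conjunct1] d0[THEN conjunct2, THEN conjunct1]
      d0[THEN conjunct2, THEN conjunct2, rule_format]
    show ?thesis
    proof (intro exI[of _ "d / ?m"] conjI allI impI)
      show "0 < d / ?m" using d m by simp
      fix r assume r: "0 < r \<and> r < d / ?m"
      then have rm: "r * ?m < d" using m by (simp add: pos_less_divide_eq)
      have small: "norm (r *\<^sub>R h + s *\<^sub>R k) \<le> r * ?m" "norm (s *\<^sub>R k) \<le> r * ?m" if "0 \<le> s" "s \<le> r" for s
      proof -
        have "norm (s *\<^sub>R k) \<le> r * norm k" using that by (simp add: mult_right_mono)
        moreover have "norm (r *\<^sub>R h + s *\<^sub>R k) \<le> r * norm h + norm (s *\<^sub>R k)"
          using norm_triangle_ineq[of "r *\<^sub>R h" "s *\<^sub>R k"] r by simp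
        moreover have "0 \<le> r * norm h" "0 \<le> r * norm k" "0 < r" using r by auto
        moreover have "r * ?m = r * norm h + r * norm k + r" by (simp add: algebra_simps)
        ultimately show "norm (r *\<^sub>R h + s *\<^sub>R k) \<le> r * ?m" "norm (s *\<^sub>R k) \<le> r * ?m" by linarith+
      qed
      define \<phi> where "\<phi> s = f ((x + r *\<^sub>R h) + s *\<^sub>R k) - f (x + s *\<^sub>R k)" for s
      let ?g = "\<lambda>s. k \<bullet> gradient f ((x + r *\<^sub>R h) + s *\<^sub>R k) - k \<bullet> gradient f (x + s *\<^sub>R k)"
      have der: "(\<phi> has_real_derivative ?g s) (at s)" if "0 \<le> s" "s \<le> r" for s
      proof -
        have "norm (r *\<^sub>R h + s *\<^sub>R k) < r0" "norm (s *\<^sub>R k) < r0" using small[OF that] rm d by linarith+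
        then have "GDERIV f ((x + r *\<^sub>R h) + s *\<^sub>R k) :> gradient f ((x + r *\<^sub>R h) + s *\<^sub>R k)"
          "GDERIV f (x + s *\<^sub>R k) :> gradient f (x + s *\<^sub>R k)"
          by (auto intro!: gradient_GDERIV diff)
        from this[THEN GDERIV_along_line] show ?thesis
          unfolding \<phi>_def by (auto intro!: derivative_eq_intros)
      qed
      have "\<exists>s. 0 < s \<and> s < r \<and> \<phi> r - \<phi> 0 = (r - 0) * ?g s"
        by (rule MVT2) (use der r in auto)
      then obtain s where s: "0 < s" "s < r" and eq: "\<phi> r - \<phi> 0 = r * ?g s" by auto
      have quot: "L / r\<^sup>2 - a = c / r" if "L = r\<^sup>2 * a + r * c" for L a c :: real
        using r that by (simp add: power2_eq_square field_simps)
      define u where "u = gradient f (x + (r *\<^sub>R h + s *\<^sub>R k)) - gradient f x - ?A *v (r *\<^sub>R h + s *\<^sub>R k)"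
      define w where "w = gradient f (x + s *\<^sub>R k) - gradient f x - ?A *v (s *\<^sub>R k)"
      have gs: "?g s = r * (k \<bullet> (?A *v h)) + k \<bullet> (u - w)"
        by (simp add: u_def w_def inner_diff_right matrix_vector_right_distrib matrix_vector_mult_scaleR inner_add_right add.assoc)
      have "\<phi> r - \<phi> 0 = r * (r * (k \<bullet> (?A *v h)) + k \<bullet> (u - w))"
        unfolding eq gs ..
      then have "\<phi> r - \<phi> 0 = r\<^sup>2 * (k \<bullet> (?A *v h)) + r * (k \<bullet> (u - w))"
        by (simp only: power2_eq_square distrib_left mult.assoc)
      moreover have "\<phi> r - \<phi> 0 = f (x + r *\<^sub>R (h + k)) - f (x + r *\<^sub>R h) - f (x + r *\<^sub>R k) + f x"
        by (simp add: \<phi>_def scaleR_add_right add.assoc)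
      ultimately have E: "(f (x + r *\<^sub>R (h + k)) - f (x + r *\<^sub>R h) - f (x + r *\<^sub>R k) + f x) / r\<^sup>2 - k \<bullet> (?A *v h)
          = k \<bullet> (u - w) / r"
        using r by (intro quot) auto
      have "norm u \<le> \<eta> / (2 * ?m\<^sup>2) * norm (r *\<^sub>R h + s *\<^sub>R k)"
        unfolding u_def using small(1)[of s] s rm by (intro d) linarith
      also have "\<dots> \<le> \<eta> / (2 * ?m\<^sup>2) * (r * ?m)"
        using small(1)[of s] s \<eta> by (intro mult_left_mono) auto
      finally have nu: "norm u \<le> \<eta> / (2 * ?m\<^sup>2) * (r * ?m)" .
      have "norm w \<le> \<eta> / (2 * ?m\<^sup>2) * norm (s *\<^sub>R k)"
        unfolding w_def using small(2)[of s] s rm by (intro d) linarith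
      also have "\<dots> \<le> \<eta> / (2 * ?m\<^sup>2) * (r * ?m)"
        using small(2)[of s] s \<eta> by (intro mult_left_mono) auto
      finally have nw: "norm w \<le> \<eta> / (2 * ?m\<^sup>2) * (r * ?m)" .
      have nuw: "norm (u - w) \<le> 2 * (\<eta> / (2 * ?m\<^sup>2) * (r * ?m))"
        using nu nw norm_triangle_ineq4[of u w] by linarith
      have "\<bar>k \<bullet> (u - w)\<bar> \<le> norm k * norm (u - w)" by (rule Cauchy_Schwarz_ineq2)
      also have "\<dots> \<le> ?m * (2 * (\<eta> / (2 * ?m\<^sup>2) * (r * ?m)))"
        using m by (intro mult_mono nuw) auto
      also have "\<dots> = \<eta> * r"
        using m by (simp add: power2_eq_square divide_simps)
      finally have "\<bar>k \<bullet> (u - w) / r\<bar> \<le> \<eta>"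
        using r by (simp add: field_simps abs_divide)
      then show "\<bar>(f (x + r *\<^sub>R (h + k)) - f (x + r *\<^sub>R h) - f (x + r *\<^sub>R k) + f x) / r\<^sup>2 - k \<bullet> (?A *v h)\<bar> \<le> \<eta>"
        unfolding E .
    qed
  qed
  have "\<bar>h \<bullet> (?A *v k) - k \<bullet> (?A *v h)\<bar> \<le> 2 * \<eta>" if \<eta>: "\<eta> > 0" for \<eta>
  proof -
    obtain d1 where d1: "d1 > 0" "\<And>r. 0 < r \<Longrightarrow> r < d1 \<Longrightarrow>
      \<bar>(f (x + r *\<^sub>R (h + k)) - f (x + r *\<^sub>R h) - f (x + r *\<^sub>R k) + f x) / r\<^sup>2 - k \<bullet> (?A *v h)\<bar> \<le> \<eta>"
      using key[OF \<eta>, of h k] by auto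
    obtain d2 where d2: "d2 > 0" "\<And>r. 0 < r \<Longrightarrow> r < d2 \<Longrightarrow>
      \<bar>(f (x + r *\<^sub>R (k + h)) - f (x + r *\<^sub>R k) - f (x + r *\<^sub>R h) + f x) / r\<^sup>2 - h \<bullet> (?A *v k)\<bar> \<le> \<eta>"
      using key[OF \<eta>, of k h] by auto
    define r where "r = min d1 d2 / 2"
    have r: "0 < r" "r < d1" "r < d2" using d1(1) d2(1) by (auto simp: r_def)
    have "f (x + r *\<^sub>R (k + h)) - f (x + r *\<^sub>R k) - f (x + r *\<^sub>R h) + f x =
        f (x + r *\<^sub>R (h + k)) - f (x + r *\<^sub>R h) - f (x + r *\<^sub>R k) + f x" by (simp add: add.commute)
    from d2(2)[OF r(1,3), unfolded this] d1(2)[OF r(1,2)] show ?thesis by linarith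
  qed
  moreover define D where "D = \<bar>h \<bullet> (?A *v k) - k \<bullet> (?A *v h)\<bar>"
  ultimately have le: "D \<le> 2 * \<eta>" if "\<eta> > 0" for \<eta> using that by blast
  have "D = 0"
  proof (rule ccontr)
    assume "D \<noteq> 0"
    then have "D > 0" by (simp add: D_def)
    with le[of "D / 4"] show False by simp
  qed
  then show ?thesis by (simp add: D_def)
qed

lemma transpose_hessian: "transpose (hessian f x) = hessian f x"
proof -
  have "hessian f x $ i $ j = hessian f x $ j $ i" for i j
    using hessian_bilinear_sym[of "axis i 1" "axis j 1"]
    by (simp add: inner_axis' matrix_vector_mult_basis column_def)
  then show ?thesis by (simp add: vec_eq_iff transpose_def)
qed

end

section \<open>Minimizers of perturbed log-penalized convex functions\<close>

abbreviation all_pos :: "real ^ 'n \<Rightarrow> bool" where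
  "all_pos \<beta> \<equiv> \<forall>i. 0 < \<beta> $ i"

definition log_utility :: "real ^ 'n \<Rightarrow> real ^ 'n \<Rightarrow> real" where
  "log_utility b \<beta> = (\<Sum>i\<in>UNIV. b $ i * ln (\<beta> $ i))"

text \<open>
  The objective is infinite on the boundary, so a minimizer is strictly positive once some value is
  finite; \<open>\<beta>0\<close> witnesses the latter.
\<close>

lemma argmin_orthant_iff:
  fixes \<beta>0 \<beta> :: "real ^ 'n"
  assumes "all_pos \<beta>0"
  shows "\<beta> \<in> argmin_orthant J \<longleftrightarrow> all_pos \<beta> \<and> (\<forall>\<beta>'. all_pos \<beta>' \<longrightarrow> J \<beta> \<le> J \<beta>')"
proof
  assume "\<beta> \<in> argmin_orthant J"
  then have a: "\<forall>i. 0 \<le> \<beta> $ i" "\<And>y. \<forall>i. 0 \<le> y $ i \<Longrightarrow> \<not> ext_obj J y < ext_obj J \<beta>"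
    by (auto simp: argmin_orthant_def is_arg_min_def)
  have p: "all_pos \<beta>"
  proof (rule ccontr)
    assume "\<not> all_pos \<beta>"
    then have "ext_obj J \<beta>0 < ext_obj J \<beta>" using assms unfolding ext_obj_def by (simp only: if_True if_False) simp
    moreover have "\<forall>i. 0 \<le> \<beta>0 $ i" using assms by (simp add: less_imp_le)
    ultimately show False using a(2) by blast
  qed
  moreover have "J \<beta> \<le> J \<beta>'" if "all_pos \<beta>'" for \<beta>'
    using a(2)[of \<beta>'] p that by (simp add: ext_obj_def less_imp_le)
  ultimately show "all_pos \<beta> \<and> (\<forall>\<beta>'. all_pos \<beta>' \<longrightarrow> J \<beta> \<le> J \<beta>')" by blast
next
  assume "all_pos \<beta> \<and> (\<forall>\<beta>'. all_pos \<beta>' \<longrightarrow> J \<beta> \<le> J \<beta>')"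
  then show "\<beta> \<in> argmin_orthant J"
    by (auto simp: argmin_orthant_def is_arg_min_def ext_obj_def less_imp_le not_less)
qed

lemma all_pos_ball:
  fixes \<beta>s :: "real ^ 'n"
  assumes "all_pos \<beta>s"
  shows "\<exists>d>0. \<forall>\<beta>. norm (\<beta> - \<beta>s) < d \<longrightarrow> all_pos \<beta>"
proof (intro exI[of _ "Min (range (\<lambda>i. \<beta>s $ i))"] conjI allI impI)
  show "0 < Min (range (\<lambda>i. \<beta>s $ i))" using assms by (subst Min_gr_iff) auto
  fix \<beta> i assume n: "norm (\<beta> - \<beta>s) < Min (range (\<lambda>i. \<beta>s $ i))"
  have "Min (range (\<lambda>i. \<beta>s $ i)) \<le> \<beta>s $ i" by (rule Min_le) auto
  with n component_le_norm_cart[of "\<beta> - \<beta>s" i] have "\<bar>(\<beta> - \<beta>s) $ i\<bar> < \<beta>s $ i" by linarith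
  then show "0 < \<beta> $ i" by auto
qed

text \<open>
  The structure of the limit objective at its minimizer.
\<close>

locale penalized_convex =
  fixes fbar :: "real ^ 'n \<Rightarrow> real" and b \<beta>s :: "real ^ 'n" and r0 :: real and H
  assumes cvx: "convex_on UNIV fbar"
    and b: "all_pos b"
    and pos: "all_pos \<beta>s"
    and H_eq: "\<And>\<beta>. all_pos \<beta> \<Longrightarrow> H \<beta> = fbar \<beta> - log_utility b \<beta>"
    and minimal: "\<And>\<beta>. all_pos \<beta> \<Longrightarrow> H \<beta>s \<le> H \<beta>"
    and second: "second_order_at H \<beta>s r0"
begin

sublocale second_order_at H \<beta>s r0 by (rule second)

lemma gradient_zero: "gradient H \<beta>s = 0"
proof -
  obtain d where d: "d > 0" "\<And>\<beta>. norm (\<beta> - \<beta>s) < d \<Longrightarrow> all_pos \<beta>" using all_pos_ball[OF pos] by blast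
  have "H differentiable (at \<beta>s)" using diff[of \<beta>s] r0 by simp
  then have "GDERIV H \<beta>s :> gradient H \<beta>s" by (rule gradient_GDERIV)
  then have D: "(H has_derivative (\<lambda>h. h \<bullet> gradient H \<beta>s)) (at \<beta>s)" by (simp add: gderiv_def)
  have "(\<lambda>h. h \<bullet> gradient H \<beta>s) = (\<lambda>v. 0)"
    by (rule differential_zero_maxmin[OF _ _ D, of "ball \<beta>s d"])
      (use d minimal in \<open>auto simp: dist_norm norm_minus_commute\<close>)
  then show ?thesis by (metis inner_eq_zero_iff)
qed

text \<open>
  The logarithms alone give strong convexity. The symmetric second difference of \<open>fbar\<close> is nonnegative,
  and the one of each \<open>ln\<close> is bounded by \<open>ln (1 - x\<^sup>2) \<le> - x\<^sup>2\<close>.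
\<close>

lemma hessian_posdef: "\<exists>l>0. \<forall>h. l * (norm h)\<^sup>2 \<le> h \<bullet> (hessian H \<beta>s *v h)"
proof -
  define l where "l = Min (range (\<lambda>i. b $ i / (\<beta>s $ i)\<^sup>2))"
  have l: "l > 0" unfolding l_def using b pos
    by (subst Min_gr_iff) (auto intro!: divide_pos_pos zero_less_power)
  have li: "l \<le> b $ i / (\<beta>s $ i)\<^sup>2" for i unfolding l_def by (rule Min_le) auto
  obtain dp where dp: "dp > 0" "\<And>\<beta>. norm (\<beta> - \<beta>s) < dp \<Longrightarrow> all_pos \<beta>" using all_pos_ball[OF pos] by blast
  have "l * (norm h)\<^sup>2 \<le> h \<bullet> (hessian H \<beta>s *v h) + 2 * \<eta> * (norm h)\<^sup>2" if \<eta>: "\<eta> > 0" for \<eta> h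
  proof (cases "h = 0")
    case False
    from second_order_expansion[OF \<eta>] obtain d where d: "d > 0" "\<And>h. norm h < d \<Longrightarrow>
      \<bar>H (\<beta>s + h) - H \<beta>s - gradient H \<beta>s \<bullet> h - (h \<bullet> (hessian H \<beta>s *v h)) / 2\<bar> \<le> \<eta> * (norm h)\<^sup>2" by blast
    define r where "r = min d dp / (2 * norm h)"
    have r: "r > 0" "r * norm h < d" "r * norm h < dp" using d(1) dp(1) False by (auto simp: r_def)
    define k where "k = r *\<^sub>R h"
    have nk: "norm k < d" "norm (-k) < d" "norm k < dp" using r by (auto simp: k_def)
    have p: "all_pos (\<beta>s + k)" "all_pos (\<beta>s - k)" using dp(2)[of "\<beta>s + k"] dp(2)[of "\<beta>s - k"] nk(3) by auto
    have "fbar ((1/2) *\<^sub>R (\<beta>s + k) + (1/2) *\<^sub>R (\<beta>s - k)) \<le> (1/2) * fbar (\<beta>s + k) + (1/2) * fbar (\<beta>s - k)"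
      using convex_onD[OF cvx, of "1/2" "\<beta>s + k" "\<beta>s - k"] by simp
    also have "(1/2) *\<^sub>R (\<beta>s + k) + (1/2) *\<^sub>R (\<beta>s - k) = \<beta>s"
      by (simp add: vec_eq_iff field_simps)
    finally have c: "0 \<le> fbar (\<beta>s + k) + fbar (\<beta>s - k) - 2 * fbar \<beta>s" by simp
    (* from ln (1 - x^2) \<le> - x^2 with x = k_i / \<beta>s_i *)
    have lnb: "b $ i * (k $ i)\<^sup>2 / (\<beta>s $ i)\<^sup>2 \<le> b $ i * (2 * ln (\<beta>s $ i) - ln (\<beta>s $ i + k $ i) - ln (\<beta>s $ i - k $ i))" for i
    proof -
      have ps: "0 < \<beta>s $ i" "0 < \<beta>s $ i + k $ i" "0 < \<beta>s $ i - k $ i" using pos p[THEN spec[of _ i]] by auto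
      have e: "(\<beta>s $ i + k $ i) * (\<beta>s $ i - k $ i) / (\<beta>s $ i)\<^sup>2 = 1 - (k $ i)\<^sup>2 / (\<beta>s $ i)\<^sup>2"
        using ps(1) by (simp add: field_simps power2_eq_square)
      have q: "0 < (\<beta>s $ i + k $ i) * (\<beta>s $ i - k $ i) / (\<beta>s $ i)\<^sup>2" using ps by simp
      have "ln ((\<beta>s $ i + k $ i) * (\<beta>s $ i - k $ i) / (\<beta>s $ i)\<^sup>2) = ln (\<beta>s $ i + k $ i) + ln (\<beta>s $ i - k $ i) - 2 * ln (\<beta>s $ i)"
        using ps by (simp add: ln_div ln_mult ln_realpow)
      moreover have "ln ((\<beta>s $ i + k $ i) * (\<beta>s $ i - k $ i) / (\<beta>s $ i)\<^sup>2) \<le> - ((k $ i)\<^sup>2 / (\<beta>s $ i)\<^sup>2)"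
        using ln_le_minus_one[OF q] unfolding e by simp
      ultimately have "(k $ i)\<^sup>2 / (\<beta>s $ i)\<^sup>2 \<le> 2 * ln (\<beta>s $ i) - ln (\<beta>s $ i + k $ i) - ln (\<beta>s $ i - k $ i)" by simp
      then have "b $ i * ((k $ i)\<^sup>2 / (\<beta>s $ i)\<^sup>2) \<le> b $ i * (2 * ln (\<beta>s $ i) - ln (\<beta>s $ i + k $ i) - ln (\<beta>s $ i - k $ i))"
        using b by (intro mult_left_mono) (auto simp: less_imp_le)
      then show ?thesis by simp
    qed
    have "l * (norm k)\<^sup>2 = (\<Sum>i\<in>UNIV. l * (k $ i)\<^sup>2)"
      by (simp add: norm_vec_def L2_set_def sum_nonneg sum_distrib_left)
    also have "\<dots> \<le> (\<Sum>i\<in>UNIV. b $ i / (\<beta>s $ i)\<^sup>2 * (k $ i)\<^sup>2)"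
      by (intro sum_mono mult_right_mono li) auto
    also have "\<dots> \<le> (\<Sum>i\<in>UNIV. b $ i * (2 * ln (\<beta>s $ i) - ln (\<beta>s $ i + k $ i) - ln (\<beta>s $ i - k $ i)))"
      using lnb by (intro sum_mono) simp
    also have "\<dots> = 2 * log_utility b \<beta>s - log_utility b (\<beta>s + k) - log_utility b (\<beta>s - k)"
      by (simp add: log_utility_def sum_subtractf right_diff_distrib sum_distrib_left mult_ac)
    also have "\<dots> \<le> H (\<beta>s + k) + H (\<beta>s - k) - 2 * H \<beta>s"
      using c unfolding H_eq[OF pos] H_eq[OF p(1)] H_eq[OF p(2)] by simp
    also have "\<dots> \<le> k \<bullet> (hessian H \<beta>s *v k) + 2 * \<eta> * (norm k)\<^sup>2"
    proof -
      have "hessian H \<beta>s *v (- k) = - (hessian H \<beta>s *v k)"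
        by (rule linear_neg[OF matrix_vector_mul_linear])
      with d(2)[OF nk(1)] d(2)[OF nk(2)] show ?thesis by (simp add: gradient_zero abs_le_iff)
    qed
    finally have "r\<^sup>2 * (l * (norm h)\<^sup>2) \<le> r\<^sup>2 * (h \<bullet> (hessian H \<beta>s *v h) + 2 * \<eta> * (norm h)\<^sup>2)"
      by (simp add: k_def matrix_vector_mult_scaleR power2_eq_square algebra_simps)
    then show ?thesis using r(1) by simp
  qed simp
  note le = this
  have "l * (norm h)\<^sup>2 \<le> h \<bullet> (hessian H \<beta>s *v h)" for h
  proof (rule field_le_epsilon)
    fix e :: real assume e: "e > 0"
    define \<eta> where "\<eta> = e / (2 * ((norm h)\<^sup>2 + 1))"
    have "\<eta> > 0" using e by (simp add: \<eta>_def add_nonneg_pos)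
    moreover have "2 * \<eta> * (norm h)\<^sup>2 \<le> e" using e unfolding \<eta>_def by (simp add: divide_simps add_nonneg_pos)
    ultimately show "l * (norm h)\<^sup>2 \<le> h \<bullet> (hessian H \<beta>s *v h) + e" using le[of \<eta> h] by linarith
  qed
  with l show ?thesis by blast
qed

lemma log_utility_concave:
  assumes "all_pos x" "all_pos y" "0 \<le> t" "t \<le> 1"
  shows "(1 - t) * log_utility b x + t * log_utility b y \<le> log_utility b ((1 - t) *\<^sub>R x + t *\<^sub>R y)"
proof -
  have "(1 - t) * log_utility b x + t * log_utility b y = (\<Sum>i\<in>UNIV. b $ i * ((1 - t) * ln (x $ i) + t * ln (y $ i)))"
    by (simp add: log_utility_def sum_distrib_left sum.distrib[symmetric] algebra_simps)
  also have "\<dots> \<le> (\<Sum>i\<in>UNIV. b $ i * ln ((1 - t) * x $ i + t * y $ i))"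
  proof (intro sum_mono mult_left_mono)
    fix i
    have "concave_on {0<..} (ln :: real \<Rightarrow> real)" by (rule ln_concave)
    then show "(1 - t) * ln (x $ i) + t * ln (y $ i) \<le> ln ((1 - t) * x $ i + t * y $ i)"
      using assms by (auto simp: concave_on_iff)
    show "0 \<le> b $ i" using b by (simp add: less_imp_le)
  qed
  finally show ?thesis by (simp add: log_utility_def)
qed

lemma H_convex:
  assumes "all_pos x" "all_pos y" "0 \<le> t" "t \<le> 1"
  shows "H ((1 - t) *\<^sub>R x + t *\<^sub>R y) \<le> (1 - t) * H x + t * H y"
proof -
  have p: "all_pos ((1 - t) *\<^sub>R x + t *\<^sub>R y)"
  proof
    fix i
    have "0 \<le> (1 - t) * x $ i" "0 \<le> t * y $ i"
      using assms by (auto simp: less_imp_le intro!: mult_nonneg_nonneg)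
    moreover have "0 < (1 - t) * x $ i \<or> 0 < t * y $ i"
      using assms by (cases "t = 0") (auto intro!: mult_pos_pos)
    ultimately show "0 < ((1 - t) *\<^sub>R x + t *\<^sub>R y) $ i" by auto
  qed
  have "fbar ((1 - t) *\<^sub>R x + t *\<^sub>R y) \<le> (1 - t) * fbar x + t * fbar y"
    using cvx assms by (auto simp: convex_on_def)
  moreover note log_utility_concave[OF assms] H_eq[OF p] H_eq[OF assms(1)] H_eq[OF assms(2)]
  ultimately show ?thesis
    by (simp only: right_diff_distrib)
qed

text \<open>
  Growth is quadratic near the minimizer because the Hessian is positive definite; convexity along
  rays continues it linearly outside the ball.
\<close>

lemma growth:
  obtains c \<delta> where "c > 0" "\<delta> > 0" "\<delta> < r0"
    "\<And>\<beta>. norm (\<beta> - \<beta>s) \<le> \<delta> \<Longrightarrow> all_pos \<beta>"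
    "\<And>h. norm h \<le> \<delta> \<Longrightarrow> H \<beta>s + c * (norm h)\<^sup>2 \<le> H (\<beta>s + h)"
    "\<And>\<beta>. all_pos \<beta> \<Longrightarrow> \<delta> \<le> norm (\<beta> - \<beta>s) \<Longrightarrow> H \<beta>s + c * \<delta> * norm (\<beta> - \<beta>s) \<le> H \<beta>"
proof -
  from hessian_posdef obtain l where l: "l > 0" "\<And>h. l * (norm h)\<^sup>2 \<le> h \<bullet> (hessian H \<beta>s *v h)" by blast
  obtain dp where dp: "dp > 0" "\<And>\<beta>. norm (\<beta> - \<beta>s) < dp \<Longrightarrow> all_pos \<beta>" using all_pos_ball[OF pos] by blast
  from l(1) have "l / 4 > 0" by simp
  from second_order_expansion[OF this] obtain d where d: "d > 0" "d \<le> r0" "\<And>h. norm h < d \<Longrightarrow>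
      \<bar>H (\<beta>s + h) - H \<beta>s - gradient H \<beta>s \<bullet> h - (h \<bullet> (hessian H \<beta>s *v h)) / 2\<bar> \<le> l / 4 * (norm h)\<^sup>2" by blast
  define \<delta> where "\<delta> = min d dp / 2"
  have \<delta>: "\<delta> > 0" "\<delta> < d" "\<delta> < dp" using d(1) dp(1) by (auto simp: \<delta>_def)
  have g1: "H \<beta>s + l / 4 * (norm h)\<^sup>2 \<le> H (\<beta>s + h)" if "norm h \<le> \<delta>" for h
  proof -
    have "\<bar>H (\<beta>s + h) - H \<beta>s - (h \<bullet> (hessian H \<beta>s *v h)) / 2\<bar> \<le> l / 4 * (norm h)\<^sup>2"
      using d(3)[of h] \<delta> that by (simp add: gradient_zero)
    with l(2)[of h] show ?thesis by linarith
  qed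
  have pb: "all_pos \<beta>" if "norm (\<beta> - \<beta>s) \<le> \<delta>" for \<beta>
    by (rule dp(2)) (use that \<delta>(3) in linarith)
  show thesis
  proof (rule that[of "l / 4" \<delta>])
    fix \<beta> assume \<beta>: "all_pos \<beta>" "\<delta> \<le> norm (\<beta> - \<beta>s)"
    define t where "t = \<delta> / norm (\<beta> - \<beta>s)"
    have nz: "norm (\<beta> - \<beta>s) > 0" using \<beta> \<delta> by linarith
    have t: "0 < t" "t \<le> 1" using \<beta> \<delta> nz by (auto simp: t_def)
    have nt: "norm (t *\<^sub>R (\<beta> - \<beta>s)) = \<delta>" using nz \<delta> by (simp add: t_def)
    have "(1 - t) *\<^sub>R \<beta>s + t *\<^sub>R \<beta> = \<beta>s + t *\<^sub>R (\<beta> - \<beta>s)" by (simp add: algebra_simps)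
    then have "H \<beta>s + l / 4 * \<delta>\<^sup>2 \<le> (1 - t) * H \<beta>s + t * H \<beta>"
      using g1[of "t *\<^sub>R (\<beta> - \<beta>s)"] H_convex[OF pos \<beta>(1), of t] t nt by simp
    then have "l / 4 * \<delta>\<^sup>2 \<le> t * (H \<beta> - H \<beta>s)" by (simp add: algebra_simps)
    note tle = this
    show "H \<beta>s + l / 4 * \<delta> * norm (\<beta> - \<beta>s) \<le> H \<beta>"
    proof -
      from tle
      have "\<delta> * (l / 4 * \<delta> * norm (\<beta> - \<beta>s)) \<le> \<delta> * (H \<beta> - H \<beta>s)"
        using nz by (simp add: t_def field_simps power2_eq_square)
      then have "l / 4 * \<delta> * norm (\<beta> - \<beta>s) \<le> H \<beta> - H \<beta>s"
        using \<delta>(1) by (simp only: mult_le_cancel_left_pos)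
      then show ?thesis by linarith
    qed
  qed (use l \<delta> d g1 pb in auto)
qed

end

text \<open>
  The deterministic part of the rate argument for \<open>J = H + e \<xi>\<close>. The linear bound on \<open>\<xi>\<close> keeps minimizers
  inside the ball, where compactness provides one although \<open>J\<close> need not be convex. Inside the ball,
  the growth \<open>c |h|\<^sup>2\<close> competes with a perturbation of order \<open>e |h| sqrt (|h| / e)\<close>; as the latter has exponent
  \<open>3/2\<close> in \<open>|h|\<close>, the former wins as soon as \<open>|h|\<close> is a large multiple of \<open>e\<close>.
\<close>

lemma argmin_localization:
  fixes H J \<xi> :: "real ^ 'n \<Rightarrow> real"
  assumes c: "c > 0" and \<delta>: "\<delta> > 0" and e: "e > 0"
    and pb: "\<And>\<beta>. norm (\<beta> - \<beta>s) \<le> \<delta> \<Longrightarrow> all_pos \<beta>"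
    and g1: "\<And>h. norm h \<le> \<delta> \<Longrightarrow> H \<beta>s + c * (norm h)\<^sup>2 \<le> H (\<beta>s + h)"
    and g2: "\<And>\<beta>. all_pos \<beta> \<Longrightarrow> \<delta> \<le> norm (\<beta> - \<beta>s) \<Longrightarrow> H \<beta>s + c * \<delta> * norm (\<beta> - \<beta>s) \<le> H \<beta>"
    and J: "\<And>\<beta>. all_pos \<beta> \<Longrightarrow> J \<beta> = H \<beta> + e * \<xi> \<beta>"
    and cont: "continuous_on (cball \<beta>s \<delta>) J"
    and B: "\<And>\<beta>. \<bar>\<xi> \<beta>\<bar> \<le> B * norm \<beta>" "e * B * (1 + 2 * norm \<beta>s / \<delta>) < c * \<delta>"
    and A: "\<And>h. e \<le> norm h \<Longrightarrow> \<bar>\<xi> (\<beta>s + h) - \<xi> \<beta>s\<bar> \<le> A * norm h * sqrt (norm h / e)"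
  shows "argmin_orthant J \<noteq> {}"
    and "\<beta> \<in> argmin_orthant J \<Longrightarrow> norm (\<beta> - \<beta>s) \<le> e * max 1 ((A / c)\<^sup>2)"
proof -
  have B0: "0 \<le> B"
  proof -
    (* any unit vector shows that B is nonnegative *)
    have "0 \<le> B * norm (axis undefined 1 :: real^'n)" using B(1)[of "axis undefined 1"] by linarith
    then show ?thesis by (simp)
  qed
  have ps: "all_pos \<beta>s" using pb[of \<beta>s] \<delta> by simp
  note iff = argmin_orthant_iff[OF ps]
  have far: "J \<beta>s < J \<beta>" if "all_pos \<beta>" "\<delta> \<le> norm (\<beta> - \<beta>s)" for \<beta>
  proof -
    have "norm \<beta> \<le> norm (\<beta> - \<beta>s) + norm \<beta>s" using norm_triangle_ineq[of "\<beta> - \<beta>s" \<beta>s] by simp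
    then have "\<bar>\<xi> \<beta> - \<xi> \<beta>s\<bar> \<le> B * (norm (\<beta> - \<beta>s) + norm \<beta>s) + B * norm \<beta>s"
      using B(1)[of \<beta>] B(1)[of \<beta>s] mult_left_mono[OF _ B0, of "norm \<beta>" "norm (\<beta> - \<beta>s) + norm \<beta>s"] by linarith
    also have "\<dots> = B * norm (\<beta> - \<beta>s) + B * (2 * norm \<beta>s)" by (simp add: algebra_simps)
    also have "\<dots> \<le> B * norm (\<beta> - \<beta>s) + B * (2 * norm \<beta>s * (norm (\<beta> - \<beta>s) / \<delta>))"
    proof -
      have "2 * norm \<beta>s * 1 \<le> 2 * norm \<beta>s * (norm (\<beta> - \<beta>s) / \<delta>)"
        using \<delta> that by (intro mult_left_mono) auto
      then show ?thesis using B0 by (intro add_left_mono mult_left_mono) auto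
    qed
    also have "\<dots> = B * (1 + 2 * norm \<beta>s / \<delta>) * norm (\<beta> - \<beta>s)" by (simp add: algebra_simps)
    finally have "e * \<bar>\<xi> \<beta> - \<xi> \<beta>s\<bar> \<le> e * (B * (1 + 2 * norm \<beta>s / \<delta>) * norm (\<beta> - \<beta>s))"
      using e by (intro mult_left_mono) auto
    also have "\<dots> < c * \<delta> * norm (\<beta> - \<beta>s)"
    proof -
      have "norm (\<beta> - \<beta>s) > 0" using \<delta> that by linarith
      from mult_strict_right_mono[OF B(2) this] show ?thesis by (simp only: mult.assoc)
    qed
    finally have "\<bar>e * \<xi> \<beta> - e * \<xi> \<beta>s\<bar> < c * \<delta> * norm (\<beta> - \<beta>s)"
      using e by (simp add: abs_mult flip: right_diff_distrib)
    with g2[OF that] show ?thesis unfolding J[OF that(1)] J[OF ps] by linarith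
  qed
  have "\<exists>\<beta>\<in>cball \<beta>s \<delta>. \<forall>y\<in>cball \<beta>s \<delta>. J \<beta> \<le> J y"
    by (rule continuous_attains_inf) (use \<delta> cont in auto)
  then obtain m where m0: "m \<in> cball \<beta>s \<delta>" "\<And>y. y \<in> cball \<beta>s \<delta> \<Longrightarrow> J m \<le> J y" by blast
  have m: "norm (m - \<beta>s) \<le> \<delta>" "\<And>y. norm (y - \<beta>s) \<le> \<delta> \<Longrightarrow> J m \<le> J y"
    using m0 by (auto simp: dist_norm norm_minus_commute)
  have "J m \<le> J y" if "all_pos y" for y
    using far[OF that] m(2)[of y] m(2)[of \<beta>s] \<delta> by (cases "norm (y - \<beta>s) \<le> \<delta>") auto
  then have "m \<in> argmin_orthant J" using pb[OF m(1)] by (auto simp: iff)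
  then show "argmin_orthant J \<noteq> {}" by auto
  assume "\<beta> \<in> argmin_orthant J"
  then have p: "all_pos \<beta>" and le: "J \<beta> \<le> J \<beta>s" using ps by (auto simp: iff)
  define h where "h = \<beta> - \<beta>s"
  have near: "norm h \<le> \<delta>" using far[OF p] le by (force simp: h_def)
  show "norm (\<beta> - \<beta>s) \<le> e * max 1 ((A / c)\<^sup>2)"
  proof (cases "norm h < e")
    case True
    have "e * 1 \<le> e * max 1 ((A / c)\<^sup>2)" using e by (intro mult_left_mono) auto
    with True show ?thesis by (simp add: h_def)
  next
    case False
    then have h: "e \<le> norm h" "norm h > 0" using e by linarith+
    have bh: "\<beta>s + h = \<beta>" by (simp add: h_def)
    have "c * (norm h)\<^sup>2 \<le> e * \<bar>\<xi> \<beta> - \<xi> \<beta>s\<bar>"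
    proof -
      have "e * \<bar>\<xi> \<beta> - \<xi> \<beta>s\<bar> = \<bar>e * \<xi> \<beta> - e * \<xi> \<beta>s\<bar>"
        using e by (simp add: abs_mult flip: right_diff_distrib)
      with g1[OF near] le show ?thesis unfolding bh J[OF p] J[OF ps] by linarith
    qed
    also have "\<dots> \<le> e * (A * norm h * sqrt (norm h / e))"
      using A[OF h(1)] e unfolding bh by (intro mult_left_mono) auto
    finally have ch: "c * norm h \<le> e * A * sqrt (norm h / e)"
      using h by (simp add: power2_eq_square field_simps)
    have "norm h = e * (sqrt (norm h / e))\<^sup>2" using e h by simp
    with ch have "c * (e * (sqrt (norm h / e))\<^sup>2) \<le> e * A * sqrt (norm h / e)" by metis
    then have "e * (c * (sqrt (norm h / e))\<^sup>2) \<le> e * (A * sqrt (norm h / e))" by (simp only: mult_ac)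
    note es = this
    have "c * s \<le> A" if "e * (c * s\<^sup>2) \<le> e * (A * s)" "s > 0" for s
      using that e by (simp add: power2_eq_square)
    from this[OF es] have "c * sqrt (norm h / e) \<le> A"
      using e h by simp
    then have "sqrt (norm h / e) \<le> A / c" using c by (simp add: field_simps)
    then have "(sqrt (norm h / e))\<^sup>2 \<le> (A / c)\<^sup>2" using e h by (intro power_mono) auto
    then have "norm h / e \<le> (A / c)\<^sup>2" using e h by simp
    then have "norm h \<le> e * (A / c)\<^sup>2" using e by (simp add: field_simps)
    also have "\<dots> \<le> e * max 1 ((A / c)\<^sup>2)" using e by (intro mult_left_mono) auto
    finally show ?thesis by (simp add: h_def)
  qed
qed

text \<open>
  In the variable \<open>k\<close> with \<open>\<beta> = \<beta>s + e k\<close>, the objective is \<open>e\<^sup>2\<close> times the quadratic function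
  \<open>k \<bullet> Q k / 2 + z \<bullet> k\<close> up to \<open>2 e\<^sup>2 \<eta>\<close>. Strong convexity of the quadratic places its near-minimizer \<open>k\<close> close to its
  minimizer \<open>k0\<close>.
\<close>

lemma argmin_linearization:
  fixes H J \<xi> :: "real ^ 'n \<Rightarrow> real" and Q :: "real ^ 'n ^ 'n"
  assumes e: "e > 0" and l: "l > 0"
    and pb: "\<And>\<beta>. norm (\<beta> - \<beta>s) \<le> \<delta> \<Longrightarrow> all_pos \<beta>" and eR: "e * R \<le> \<delta>"
    and J: "\<And>\<beta>. all_pos \<beta> \<Longrightarrow> J \<beta> = H \<beta> + e * \<xi> \<beta>"
    and Q: "transpose Q = Q" "\<And>h. l * (norm h)\<^sup>2 \<le> h \<bullet> (Q *v h)"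
    and quad: "\<And>k. norm k \<le> R \<Longrightarrow> \<bar>H (\<beta>s + e *\<^sub>R k) - H \<beta>s - e\<^sup>2 * (k \<bullet> (Q *v k)) / 2\<bar> \<le> e\<^sup>2 * \<eta>"
    and lin: "\<And>k. norm k \<le> R \<Longrightarrow> \<bar>\<xi> (\<beta>s + e *\<^sub>R k) - \<xi> \<beta>s - e * (z \<bullet> k)\<bar> \<le> e * \<eta>"
    and min: "\<beta>s + e *\<^sub>R k \<in> argmin_orthant J" and k: "norm k \<le> R"
    and k0: "Q *v k0 = - z" "norm k0 \<le> R"
  shows "(norm (k - k0))\<^sup>2 \<le> 8 * \<eta> / l"
proof -
  have p: "all_pos (\<beta>s + e *\<^sub>R k')" if "norm k' \<le> R" for k'
  proof (rule pb)
    have "e * norm k' \<le> e * R" using that e by (intro mult_left_mono) auto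
    with eR have "e * norm k' \<le> \<delta>" by linarith
    then show "norm (\<beta>s + e *\<^sub>R k' - \<beta>s) \<le> \<delta>" using e by simp
  qed
  define q where "q k = (k \<bullet> (Q *v k)) / 2 + z \<bullet> k" for k
  have apx: "\<bar>J (\<beta>s + e *\<^sub>R k') - J \<beta>s - e\<^sup>2 * q k'\<bar> \<le> 2 * (e\<^sup>2 * \<eta>)" if "norm k' \<le> R" for k'
  proof -
    have R: "norm (0 :: real^'n) \<le> R" using order_trans[OF norm_ge_zero that] by simp
    have ps: "all_pos \<beta>s" using p[OF R] by simp
    have "e * \<bar>\<xi> (\<beta>s + e *\<^sub>R k') - \<xi> \<beta>s - e * (z \<bullet> k')\<bar> \<le> e * (e * \<eta>)"
      using e lin[OF that] by (intro mult_left_mono) auto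
    then have "\<bar>e * (\<xi> (\<beta>s + e *\<^sub>R k') - \<xi> \<beta>s - e * (z \<bullet> k'))\<bar> \<le> e\<^sup>2 * \<eta>"
      using e by (simp add: abs_mult power2_eq_square mult.assoc)
    moreover have "J (\<beta>s + e *\<^sub>R k') - J \<beta>s - e\<^sup>2 * q k' =
      (H (\<beta>s + e *\<^sub>R k') - H \<beta>s - e\<^sup>2 * (k' \<bullet> (Q *v k')) / 2) + e * (\<xi> (\<beta>s + e *\<^sub>R k') - \<xi> \<beta>s - e * (z \<bullet> k'))"
      unfolding J[OF p[OF that]] J[OF ps] by (simp add: q_def power2_eq_square algebra_simps)
    ultimately show ?thesis using quad[OF that] by linarith
  qed
  have "J (\<beta>s + e *\<^sub>R k) \<le> J (\<beta>s + e *\<^sub>R k0)"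
    using min p[OF k0(2)] argmin_orthant_iff[OF p[OF k0(2)]] by blast
  with apx[OF k] apx[OF k0(2)] have "e\<^sup>2 * q k - e\<^sup>2 * q k0 \<le> 4 * (e\<^sup>2 * \<eta>)" by linarith
  then have "e\<^sup>2 * (q k - q k0) \<le> e\<^sup>2 * (4 * \<eta>)" by (simp add: algebra_simps)
  then have "q k - q k0 \<le> 4 * \<eta>" using e by simp
  moreover have "q k - q k0 = ((k - k0) \<bullet> (Q *v (k - k0))) / 2"
  proof -
    have s: "k0 \<bullet> (Q *v k) = k \<bullet> (Q *v k0)"
      using Q(1) by (metis dot_lmul_matrix inner_commute vector_transpose_matrix)
    have z: "z = - (Q *v k0)" using k0 by simp
    show ?thesis
      unfolding q_def z using s
      by (simp add: matrix_vector_mult_diff_distrib inner_diff_left inner_diff_right inner_commute[of "Q *v k0"])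
  qed
  ultimately have "l * (norm (k - k0))\<^sup>2 \<le> 8 * \<eta>" using Q(2)[of "k - k0"] by linarith
  then show ?thesis using l by (simp add: field_simps)
qed

section \<open>Moments and characteristic functions of normalized sums\<close>

lemma power_le_fact_exp:
  assumes "(0::real) \<le> x"
  shows "x ^ k \<le> fact k * exp x"
proof -
  have "(\<Sum>n\<in>{k}. x ^ n /\<^sub>R fact n) \<le> (\<Sum>n. x ^ n /\<^sub>R fact n)"
    by (rule sum_le_suminf) (use assms summable_exp_generic[of x] in auto)
  then have "x ^ k / fact k \<le> exp x" by (simp add: exp_def divide_inverse_commute)
  then show ?thesis by (simp add: field_simps)
qed

lemma even_power_le_fact_cosh:
  fixes x :: real
  assumes "even k"
  shows "x ^ k \<le> fact k * (exp x + exp (- x))"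
proof -
  have "x ^ k = \<bar>x\<bar> ^ k" using assms by (simp add: power_even_abs)
  also have "\<dots> \<le> fact k * exp \<bar>x\<bar>" by (rule power_le_fact_exp) simp
  also have "\<dots> \<le> fact k * (exp x + exp (- x))"
    by (intro mult_left_mono) (auto simp: abs_if)
  finally show ?thesis .
qed

context prob_space
begin

lemma exp_sum_centred_bounded_le:
  assumes fin: "finite J" and ind: "indep_vars (\<lambda>_. borel) Y J"
    and bd: "\<And>j \<omega>. j \<in> J \<Longrightarrow> \<omega> \<in> space M \<Longrightarrow> \<bar>Y j \<omega>\<bar> \<le> c"
    and zero: "\<And>j. j \<in> J \<Longrightarrow> expectation (Y j) = 0" and c: "c > 0" and l: "l > 0"
  shows "(\<integral>\<^sup>+\<omega>. ennreal (exp (l * (\<Sum>j\<in>J. Y j \<omega>))) \<partial>M) \<le> ennreal (exp (real (card J) * (l\<^sup>2 * c\<^sup>2 / 2)))"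
proof -
  have rv: "random_variable borel (Y j)" if "j \<in> J" for j
    using ind that by (auto simp: indep_vars_def)
  have ind2: "indep_vars (\<lambda>_. borel) (\<lambda>j \<omega>. ennreal (exp (l * Y j \<omega>))) J"
    using indep_vars_compose2[OF ind, where Y="\<lambda>_ y. ennreal (exp (l * y))" and N="\<lambda>_. borel"] by simp
  have one: "(\<integral>\<^sup>+\<omega>. ennreal (exp (l * Y j \<omega>)) \<partial>M) \<le> ennreal (exp (l\<^sup>2 * c\<^sup>2 / 2))" if j: "j \<in> J" for j
  proof -
    have ib: "interval_bounded_random_variable M (Y j) (- c) c"
    proof unfold_locales
      show "random_variable borel (Y j)" by (rule rv[OF j])
      have "Y j \<omega> \<in> {- c..c}" if "\<omega> \<in> space M" for \<omega> using bd[OF j that] by simp linarith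
      then show "AE \<omega> in M. Y j \<omega> \<in> {- c..c}" by (intro AE_I2)
    qed
    have "(\<integral>\<^sup>+\<omega>. ennreal (exp (l * Y j \<omega>)) \<partial>M) \<le> ennreal (exp (l\<^sup>2 * (c - - c)\<^sup>2 / 8))"
      by (rule interval_bounded_random_variable.Hoeffdings_lemma_nn_integral_0[OF ib l zero[OF j]])
    also have "l\<^sup>2 * (c - - c)\<^sup>2 / 8 = l\<^sup>2 * c\<^sup>2 / 2" by (simp add: power2_eq_square)
    finally show ?thesis .
  qed
  have "(\<integral>\<^sup>+\<omega>. ennreal (exp (l * (\<Sum>j\<in>J. Y j \<omega>))) \<partial>M) = (\<integral>\<^sup>+\<omega>. (\<Prod>j\<in>J. ennreal (exp (l * Y j \<omega>))) \<partial>M)"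
    by (simp add: sum_distrib_left exp_sum[OF fin] prod_ennreal)
  also have "\<dots> = (\<Prod>j\<in>J. \<integral>\<^sup>+\<omega>. ennreal (exp (l * Y j \<omega>)) \<partial>M)"
    by (rule indep_vars_nn_integral[OF fin ind2]) simp
  also have "\<dots> \<le> (\<Prod>j\<in>J. ennreal (exp (l\<^sup>2 * c\<^sup>2 / 2)))"
    by (rule prod_mono_ennreal) (rule one)
  also have "\<dots> = ennreal (exp (real (card J) * (l\<^sup>2 * c\<^sup>2 / 2)))"
    by (simp add: ennreal_power flip: exp_of_nat_mult)
  finally show ?thesis .
qed

text \<open>
  With \<open>l = 1 / (c sqrt n)\<close>, Hoeffding's lemma bounds the expectations of \<open>exp (l S)\<close> and \<open>exp (- l S)\<close> by a
  constant, and \<open>exp x + exp (- x)\<close> dominates \<open>x ^ k / fact k\<close> for even \<open>k\<close>. The bound is the same for all numbers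
  of summands, and its homogeneity in \<open>c\<close> makes it usable for increments.
\<close>

lemma normalized_sum_moment_le:
  assumes fin: "finite J" and J: "card J > 0" and ind: "indep_vars (\<lambda>_. borel) Y J"
    and bd: "\<And>j \<omega>. j \<in> J \<Longrightarrow> \<omega> \<in> space M \<Longrightarrow> \<bar>Y j \<omega>\<bar> \<le> c"
    and zero: "\<And>j. j \<in> J \<Longrightarrow> expectation (Y j) = 0" and k: "even k" "k > 0"
  shows "(\<integral>\<^sup>+\<omega>. ennreal (((\<Sum>j\<in>J. Y j \<omega>) / sqrt (card J)) ^ k) \<partial>M) \<le> ennreal (4 * fact k * c ^ k)"
proof -
  have rv: "random_variable borel (Y j)" if "j \<in> J" for j
    using ind that by (auto simp: indep_vars_def)
  obtain j where j: "j \<in> J" using J by (auto simp: card_gt_0_iff)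
  obtain \<omega> where "\<omega> \<in> space M" using not_empty by auto
  then have c0: "0 \<le> c" using bd[OF j] by (meson abs_ge_zero order_trans)
  show ?thesis
  proof (cases "c = 0")
    case True
    then have "(\<Sum>j\<in>J. Y j \<omega>) = 0" if "\<omega> \<in> space M" for \<omega> using bd that by (intro sum.neutral) auto
    then have "(\<integral>\<^sup>+\<omega>. ennreal (((\<Sum>j\<in>J. Y j \<omega>) / sqrt (card J)) ^ k) \<partial>M) = (\<integral>\<^sup>+\<omega>. 0 \<partial>M)"
      using k by (intro nn_integral_cong) simp
    then show ?thesis by simp
  next
    case False
    with c0 have c: "c > 0" by simp
    define l where "l = 1 / (c * sqrt (card J))"
    have l: "l > 0" using c J by (simp add: l_def)
    have e: "real (card J) * (l\<^sup>2 * c\<^sup>2 / 2) = 1 / 2"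
      using c J by (simp add: l_def power_divide power_mult_distrib)
    let ?S = "\<lambda>\<omega>. \<Sum>j\<in>J. Y j \<omega>"
    have Sm [measurable]: "?S \<in> borel_measurable M" by (rule borel_measurable_sum) (erule rv)
    have 1: "(\<integral>\<^sup>+\<omega>. ennreal (exp (l * ?S \<omega>)) \<partial>M) \<le> ennreal (exp (1/2))"
      using exp_sum_centred_bounded_le[OF fin ind bd zero c l] unfolding e by simp
    have indn: "indep_vars (\<lambda>_. borel) (\<lambda>j \<omega>. - Y j \<omega>) J"
      using indep_vars_compose2[OF ind, where Y="\<lambda>_ y. - y" and N="\<lambda>_. borel"] by simp
    have 2: "(\<integral>\<^sup>+\<omega>. ennreal (exp (- (l * ?S \<omega>))) \<partial>M) \<le> ennreal (exp (1/2))"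
      using exp_sum_centred_bounded_le[OF fin indn _ _ c l] bd zero unfolding e by (simp add: sum_negf)
    have "(\<integral>\<^sup>+\<omega>. ennreal ((?S \<omega> / sqrt (card J)) ^ k) \<partial>M) \<le>
        (\<integral>\<^sup>+\<omega>. ennreal (c ^ k * fact k) * (ennreal (exp (l * ?S \<omega>)) + ennreal (exp (- (l * ?S \<omega>)))) \<partial>M)"
    proof (rule nn_integral_mono)
      fix \<omega>
      have "(?S \<omega> / sqrt (card J)) ^ k = c ^ k * (l * ?S \<omega>) ^ k"
        using c by (simp add: l_def flip: power_mult_distrib)
      also have "\<dots> \<le> c ^ k * (fact k * (exp (l * ?S \<omega>) + exp (- (l * ?S \<omega>))))"
        using c by (intro mult_left_mono even_power_le_fact_cosh k) auto
      finally have "ennreal ((?S \<omega> / sqrt (card J)) ^ k) \<le> ennreal (c ^ k * fact k * (exp (l * ?S \<omega>) + exp (- (l * ?S \<omega>))))"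
        by (intro ennreal_leI) (simp add: mult_ac)
      also have "\<dots> = ennreal (c ^ k * fact k) * (ennreal (exp (l * ?S \<omega>)) + ennreal (exp (- (l * ?S \<omega>))))"
        using c by (simp add: ennreal_mult ennreal_plus)
      finally show "ennreal ((?S \<omega> / sqrt (card J)) ^ k) \<le> ennreal (c ^ k * fact k) * (ennreal (exp (l * ?S \<omega>)) + ennreal (exp (- (l * ?S \<omega>))))" .
    qed
    also have "\<dots> = ennreal (c ^ k * fact k) * ((\<integral>\<^sup>+\<omega>. ennreal (exp (l * ?S \<omega>)) \<partial>M) + (\<integral>\<^sup>+\<omega>. ennreal (exp (- (l * ?S \<omega>))) \<partial>M))"
      by (simp add: nn_integral_cmult nn_integral_add)
    also have "\<dots> \<le> ennreal (c ^ k * fact k) * (ennreal (exp (1/2)) + ennreal (exp (1/2)))"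
      by (intro mult_left_mono add_mono 1 2) auto
    also have "\<dots> = ennreal (c ^ k * fact k * (exp (1/2) + exp (1/2)))"
      using c by (subst ennreal_mult) (auto simp del: ennreal_mult' simp: ennreal_plus[symmetric] simp del: ennreal_plus)
    also have "\<dots> \<le> ennreal (4 * fact k * c ^ k)"
    proof (rule ennreal_leI)
      have "exp (1/2 :: real) \<le> 2" using exp_half_le2 by simp
      then have "c ^ k * fact k * (exp (1/2) + exp (1/2)) \<le> c ^ k * fact k * 4"
        using c by (intro mult_left_mono) auto
      then show "c ^ k * fact k * (exp (1/2) + exp (1/2)) \<le> 4 * fact k * c ^ k" by (simp add: mult_ac)
    qed
    finally show ?thesis .
  qed
qed

lemma expectation_sum_centred_square:
  assumes fin: "finite J" and ind: "indep_vars (\<lambda>_. borel) Y J"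
    and bd: "\<And>j \<omega>. j \<in> J \<Longrightarrow> \<omega> \<in> space M \<Longrightarrow> \<bar>Y j \<omega>\<bar> \<le> (c :: real)"
    and zero: "\<And>j. j \<in> J \<Longrightarrow> expectation (Y j) = 0"
  shows "expectation (\<lambda>\<omega>. (\<Sum>j\<in>J. Y j \<omega>)\<^sup>2) = (\<Sum>j\<in>J. expectation (\<lambda>\<omega>. (Y j \<omega>)\<^sup>2))"
  using assms
proof (induction J rule: finite_induct)
  case (insert i J)
  have rv: "random_variable borel (Y j)" if "j \<in> insert i J" for j
    using insert.prems(1) that by (auto simp: indep_vars_def)
  let ?S = "\<lambda>\<omega>. \<Sum>j\<in>J. Y j \<omega>"
  have Sm: "random_variable borel ?S" by (rule borel_measurable_sum) (use rv in auto)
  note [measurable] = Sm rv[of i, simplified]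
  have Sb: "\<bar>?S \<omega>\<bar> \<le> real (card J) * c" if "\<omega> \<in> space M" for \<omega>
    by (rule order_trans[OF sum_abs]) (use insert.prems(2) that in \<open>auto intro!: sum_bounded_above\<close>)
  have Yb: "\<bar>Y i \<omega>\<bar> \<le> c" if "\<omega> \<in> space M" for \<omega> using insert.prems(2) that by auto
  have iv: "indep_var borel (Y i) borel ?S"
    using insert.hyps insert.prems(1) by (intro indep_vars_sum) auto
  have iS: "integrable M ?S"
    using Sb by (intro integrable_const_bound[of _ "real (card J) * c"] AE_I2) auto
  have iY: "integrable M (Y i)"
    using Yb by (intro integrable_const_bound[of _ c] AE_I2) auto
  have sq: "x\<^sup>2 \<le> d\<^sup>2" if "\<bar>x\<bar> \<le> d" for x d :: real using that by (metis abs_ge_zero power2_abs power_mono)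
  have iS2: "integrable M (\<lambda>\<omega>. (?S \<omega>)\<^sup>2)"
    by (intro integrable_const_bound[of _ "(real (card J) * c)\<^sup>2"] AE_I2) (use Sb sq in auto)
  have iY2: "integrable M (\<lambda>\<omega>. (Y i \<omega>)\<^sup>2)"
    by (intro integrable_const_bound[of _ "c\<^sup>2"] AE_I2) (use Yb sq in auto)
  have iYS: "integrable M (\<lambda>\<omega>. Y i \<omega> * ?S \<omega>)" by (rule indep_var_integrable[OF iv iY iS])
  have YS: "expectation (\<lambda>\<omega>. Y i \<omega> * ?S \<omega>) = 0"
    using indep_var_lebesgue_integral[OF iv iY iS] insert.prems(3)[of i] by simp
  have "expectation (\<lambda>\<omega>. (\<Sum>j\<in>insert i J. Y j \<omega>)\<^sup>2) = expectation (\<lambda>\<omega>. (Y i \<omega>)\<^sup>2 + 2 * (Y i \<omega> * ?S \<omega>) + (?S \<omega>)\<^sup>2)"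
    using insert.hyps by (simp add: power2_eq_square algebra_simps)
  also have "\<dots> = expectation (\<lambda>\<omega>. (Y i \<omega>)\<^sup>2) + expectation (\<lambda>\<omega>. (?S \<omega>)\<^sup>2)"
    using iS2 iY2 iYS YS by simp
  also have "expectation (\<lambda>\<omega>. (?S \<omega>)\<^sup>2) = (\<Sum>j\<in>J. expectation (\<lambda>\<omega>. (Y j \<omega>)\<^sup>2))"
    by (rule insert.IH) (use insert.prems in \<open>auto intro: indep_vars_subset\<close>)
  finally show ?case using insert.hyps by simp
qed simp

text \<open>
  Each factor of the characteristic function is replaced by \<open>1 - v / (2 t)\<close>, and the errors add up
  because all factors lie in the unit disc. The error is explicit, and the variance \<open>v\<close> is kept apart from the
  target \<open>\<sigma>2\<close>, because the law of the summands will vary with \<open>t\<close> and with the data.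
\<close>

lemma char_normalized_iid_sum:
  fixes Y :: "'i \<Rightarrow> 'a \<Rightarrow> real"
  assumes fin: "finite J" and J: "card J = t" "t > 0" and ind: "indep_vars (\<lambda>_. borel) Y J"
    and bd: "\<And>j \<omega>. j \<in> J \<Longrightarrow> \<omega> \<in> space M \<Longrightarrow> \<bar>Y j \<omega>\<bar> \<le> c"
    and zero: "\<And>j. j \<in> J \<Longrightarrow> expectation (Y j) = 0"
    and var: "\<And>j. j \<in> J \<Longrightarrow> expectation (\<lambda>\<omega>. (Y j \<omega>)\<^sup>2) = v"
    and \<sigma>2: "\<sigma>2 \<ge> 0"
  shows "norm (expectation (\<lambda>\<omega>. cis ((\<Sum>j\<in>J. Y j \<omega>) / sqrt t)) - complex_of_real (exp (- \<sigma>2 / 2))) \<le>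
    c ^ 3 / (6 * sqrt t) + \<bar>v - \<sigma>2\<bar> / 2 + \<sigma>2\<^sup>2 / (8 * t)"
proof -
  have rv: "random_variable borel (Y j)" if "j \<in> J" for j
    using ind that by (auto simp: indep_vars_def)
  have st: "sqrt t > 0" using J by simp
  obtain j where j: "j \<in> J" using J by (auto simp: card_gt_0_iff)
  obtain \<omega>0 where "\<omega>0 \<in> space M" using not_empty by auto
  then have c0: "0 \<le> c" using bd[OF j] by (meson abs_ge_zero order_trans)
  have sq: "(Y j \<omega>)\<^sup>2 \<le> c\<^sup>2" if "j \<in> J" "\<omega> \<in> space M" for j \<omega>
    using bd[OF that] c0 by (metis abs_ge_zero power2_abs power_mono)
  have iY: "integrable M (Y j)" if "j \<in> J" for j
    using bd[OF that] rv[OF that] by (intro integrable_const_bound[of _ c] AE_I2) auto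
  have iY2: "integrable M (\<lambda>\<omega>. (Y j \<omega>)\<^sup>2)" if "j \<in> J" for j
    using sq[OF that] rv[OF that] by (intro integrable_const_bound[of _ "c\<^sup>2"] AE_I2) auto
  define u where "u = 1 / sqrt t"
  have u2: "u\<^sup>2 = 1 / t" using J by (simp add: u_def power_divide)
  have u0: "u > 0" using st by (simp add: u_def)
  let ?ch = "\<lambda>j. char (distr M borel (Y j)) u"
  have ch: "norm (?ch j - complex_of_real (1 - v / (2 * real t))) \<le> c ^ 3 / (6 * t * sqrt t)" if j: "j \<in> J" for j
  proof -
    have "norm (?ch j - complex_of_real (1 - u\<^sup>2 * v / 2)) \<le> (u\<^sup>2 / 6) * expectation (\<lambda>x. min (6 * (Y j x)\<^sup>2) (\<bar>u\<bar> * \<bar>Y j x\<bar> ^ 3))"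
      by (rule char_approx3'[OF rv[OF j] iY[OF j] iY2[OF j] zero[OF j] _ refl]) (simp add: zero[OF j] var[OF j])
    also have "\<dots> \<le> (u\<^sup>2 / 6) * (u * c ^ 3)"
    proof (intro mult_left_mono)
      have "integrable M (\<lambda>x. min (6 * (Y j x)\<^sup>2) (\<bar>u\<bar> * \<bar>Y j x\<bar> ^ 3))"
      proof (rule Bochner_Integration.integrable_bound[of _ "\<lambda>x. 6 * (Y j x)\<^sup>2"])
        show "integrable M (\<lambda>x. 6 * (Y j x)\<^sup>2)" using iY2[OF j] by simp
        note [measurable] = rv[OF j]
        show "(\<lambda>x. min (6 * (Y j x)\<^sup>2) (\<bar>u\<bar> * \<bar>Y j x\<bar> ^ 3)) \<in> borel_measurable M" by measurable
      qed (simp add: min_def)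
      then show "expectation (\<lambda>x. min (6 * (Y j x)\<^sup>2) (\<bar>u\<bar> * \<bar>Y j x\<bar> ^ 3)) \<le> u * c ^ 3"
      proof (rule integral_le_const)
        show "AE x in M. min (6 * (Y j x)\<^sup>2) (\<bar>u\<bar> * \<bar>Y j x\<bar> ^ 3) \<le> u * c ^ 3"
        proof (rule AE_I2, rule min.coboundedI2)
          fix x assume "x \<in> space M"
          then have "\<bar>Y j x\<bar> ^ 3 \<le> c ^ 3" using bd[OF j] by (intro power_mono) auto
          then show "\<bar>u\<bar> * \<bar>Y j x\<bar> ^ 3 \<le> u * c ^ 3" using u0 by simp
        qed
      qed
    qed simp
    also have "\<dots> = c ^ 3 / (6 * t * sqrt t)" by (simp add: u2) (simp add: u_def)
    also have "u\<^sup>2 * v / 2 = v / (2 * real t)" by (simp add: u2)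
    finally show ?thesis .
  qed
  have nch: "norm (?ch j) \<le> 1" if "j \<in> J" for j
    by (rule real_distribution.cmod_char_le_1) (use rv[OF that] in \<open>auto intro!: real_distribution_distr\<close>)
  have "expectation (\<lambda>\<omega>. cis ((\<Sum>j\<in>J. Y j \<omega>) / sqrt t)) = char (distr M borel (\<lambda>\<omega>. \<Sum>j\<in>J. Y j \<omega>)) u"
    unfolding char_def u_def
    by (subst integral_distr) (use rv in \<open>auto intro!: borel_measurable_sum simp: cis_conv_exp\<close>)
  also have "\<dots> = (\<Prod>j\<in>J. ?ch j)" by (rule char_distr_sum[OF ind])
  finally have E: "expectation (\<lambda>\<omega>. cis ((\<Sum>j\<in>J. Y j \<omega>) / sqrt t)) = (\<Prod>j\<in>J. ?ch j)" .
  have gp: "complex_of_real (exp (- \<sigma>2 / 2)) = (\<Prod>j\<in>J. complex_of_real (exp (- \<sigma>2 / (2 * t))))"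
    using J by (simp flip: exp_of_nat_mult of_real_power)
  have "norm ((\<Prod>j\<in>J. ?ch j) - complex_of_real (exp (- \<sigma>2 / 2))) \<le> (\<Sum>j\<in>J. norm (?ch j - exp (- \<sigma>2 / (2 * t))))"
    unfolding gp by (rule norm_prod_diff) (use nch \<sigma>2 in auto)
  also have "\<dots> \<le> (\<Sum>j\<in>J. c ^ 3 / (6 * t * sqrt t) + (\<bar>v - \<sigma>2\<bar> / (2 * t) + (\<sigma>2 / (2 * t))\<^sup>2 / 2))"
  proof (rule sum_mono)
    fix j assume j: "j \<in> J"
    have e1: "0 \<le> exp (- x) - (1 - x)" "exp (- x) - (1 - x) \<le> x\<^sup>2 / 2" if "0 \<le> x" for x :: real
    proof -
      show "0 \<le> exp (- x) - (1 - x)" using exp_ge_add_one_self[of "- x"] by simp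
      have "(1 + x + x\<^sup>2/2) * (1 - x + x\<^sup>2/2) \<ge> 1"
        using that by (simp add: power2_eq_square algebra_simps)
      moreover have "1 + x + x\<^sup>2/2 \<le> exp x" using exp_lower_Taylor_quadratic[OF that] by simp
      moreover have p: "0 < 1 - x + x\<^sup>2/2"
        using sum_power2_ge_zero[of "x - 1" 0] by (simp add: power2_eq_square algebra_simps)
      ultimately have "1 \<le> exp x * (1 - x + x\<^sup>2/2)"
        by (meson mult_right_mono less_imp_le order_trans)
      then have "exp (- x) \<le> 1 - x + x\<^sup>2/2" by (simp add: exp_minus field_simps)
      then show "exp (- x) - (1 - x) \<le> x\<^sup>2 / 2" by simp
    qed
    have "\<bar>(1 - v / (2 * t)) - exp (- \<sigma>2 / (2 * t))\<bar> \<le> \<bar>v - \<sigma>2\<bar> / (2 * t) + (\<sigma>2 / (2 * t))\<^sup>2 / 2"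
    proof -
      have "(1 - v / (2 * t)) - exp (- \<sigma>2 / (2 * t)) = (\<sigma>2 - v) / (2 * t) - (exp (- (\<sigma>2 / (2 * t))) - (1 - \<sigma>2 / (2 * t)))"
        by (simp add: diff_divide_distrib)
      then have "\<bar>(1 - v / (2 * t)) - exp (- \<sigma>2 / (2 * t))\<bar> \<le>
          \<bar>(\<sigma>2 - v) / (2 * t)\<bar> + \<bar>exp (- (\<sigma>2 / (2 * t))) - (1 - \<sigma>2 / (2 * t))\<bar>"
        by (simp only: abs_triangle_ineq4)
      also have "\<bar>(\<sigma>2 - v) / (2 * t)\<bar> = \<bar>v - \<sigma>2\<bar> / (2 * t)"
        by (simp add: abs_divide abs_minus_commute)
      also have "\<bar>exp (- (\<sigma>2 / (2 * t))) - (1 - \<sigma>2 / (2 * t))\<bar> \<le> (\<sigma>2 / (2 * t))\<^sup>2 / 2"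
        using e1[of "\<sigma>2 / (2 * t)"] \<sigma>2 by simp
      finally show ?thesis by simp
    qed
    then have "norm (complex_of_real (1 - v / (2 * t)) - exp (- \<sigma>2 / (2 * t))) \<le> \<bar>v - \<sigma>2\<bar> / (2 * t) + (\<sigma>2 / (2 * t))\<^sup>2 / 2"
      by (metis norm_of_real of_real_diff)
    then show "norm (?ch j - exp (- \<sigma>2 / (2 * t))) \<le> c ^ 3 / (6 * t * sqrt t) + (\<bar>v - \<sigma>2\<bar> / (2 * t) + (\<sigma>2 / (2 * t))\<^sup>2 / 2)"
      using ch[OF j] norm_triangle_ineq[of "?ch j - complex_of_real (1 - v / (2 * t))" "complex_of_real (1 - v / (2 * t)) - exp (- \<sigma>2 / (2 * t))"]
      by simp
  qed
  also have "\<dots> = c ^ 3 / (6 * sqrt t) + \<bar>v - \<sigma>2\<bar> / 2 + \<sigma>2\<^sup>2 / (8 * t)"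
    using J by (simp add: field_simps power2_eq_square)
  finally show ?thesis unfolding E by simp
qed

end

section \<open>Dyadic chaining\<close>

definition dyadic_grid :: "nat \<Rightarrow> (real ^ 'n) set" where
  "dyadic_grid k = (\<lambda>z. \<chi> i. real_of_int (z i) / 2 ^ k) ` (\<Pi>\<^sub>E i\<in>UNIV. {- (2 ^ k)..2 ^ k})"

definition dyadic_floor :: "nat \<Rightarrow> real ^ 'n \<Rightarrow> real ^ 'n" where
  "dyadic_floor k h = (\<chi> i. real_of_int \<lfloor>2 ^ k * h $ i\<rfloor> / 2 ^ k)"

definition dyadic_shift :: "nat \<Rightarrow> 'n set \<Rightarrow> real ^ 'n" where
  "dyadic_shift k E = (\<chi> i. indicator E i / 2 ^ k)"

lemma finite_dyadic_grid [simp]: "finite (dyadic_grid k)"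
  unfolding dyadic_grid_def by (intro finite_imageI finite_PiE) auto

lemma card_dyadic_grid_le: "real (card (dyadic_grid k :: (real^'n) set)) \<le> (4 * 2 ^ k) ^ CARD('n)"
proof -
  have "card (dyadic_grid k :: (real^'n) set) \<le> card (\<Pi>\<^sub>E i\<in>(UNIV::'n set). {- (2 ^ k)..(2 ^ k :: int)})"
    unfolding dyadic_grid_def by (rule card_image_le) (auto intro!: finite_PiE)
  also have "\<dots> = (2 * 2 ^ k + 1) ^ CARD('n)"
  proof -
    have "card {- (2 ^ k)..(2 ^ k :: int)} = 2 * 2 ^ k + 1"
      by (simp add: nat_add_distrib nat_mult_distrib nat_power_eq)
    then show ?thesis by (subst card_PiE) (simp_all only: prod_constant finite)
  qed
  finally have "real (card (dyadic_grid k :: (real^'n) set)) \<le> real ((2 * 2 ^ k + 1) ^ CARD('n))"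
    by (rule of_nat_mono)
  also have "\<dots> = (2 * 2 ^ k + 1) ^ CARD('n)" by (simp add: add.commute)
  also have "\<dots> \<le> (4 * 2 ^ k) ^ CARD('n)"
  proof (rule power_mono)
    have "1 \<le> (2 :: real) ^ k" by simp
    then show "2 * 2 ^ k + 1 \<le> 4 * (2 :: real) ^ k" by linarith
  qed simp
  finally show ?thesis .
qed

lemma dyadic_floor_in_grid:
  assumes "norm h \<le> 1"
  shows "dyadic_floor k h \<in> dyadic_grid k"
  unfolding dyadic_grid_def
proof
  have "\<lfloor>2 ^ k * h $ i\<rfloor> \<in> {- (2 ^ k)..2 ^ k}" for i
  proof -
    have "\<bar>h $ i\<bar> \<le> 1" using component_le_norm_cart[of h i] assms by linarith
    then have "2 ^ k * h $ i \<le> 2 ^ k * 1" "2 ^ k * (- 1) \<le> 2 ^ k * h $ i"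
      by (intro mult_left_mono; auto)+
    then have "2 ^ k * h $ i \<le> of_int (2 ^ k)" "of_int (- (2 ^ k)) \<le> 2 ^ k * h $ i" by auto
    then show ?thesis by (auto simp only: atLeastAtMost_iff le_floor_iff intro: floor_le_iff[THEN iffD2])
  qed
  then show "(\<lambda>i. \<lfloor>2 ^ k * h $ i\<rfloor>) \<in> (\<Pi>\<^sub>E i\<in>UNIV. {- (2 ^ k)..2 ^ k})" by auto
qed (simp add: dyadic_floor_def)

text \<open>
  A refinement moves each coordinate by \<open>0\<close> or one new unit. A grid point thus has a bounded number of
  successors, and the number of links between two levels is comparable to the size of the grid.
\<close>

lemma dyadic_floor_Suc: "\<exists>E. dyadic_floor (Suc k) h = dyadic_floor k h + dyadic_shift (Suc k) E"
proof (intro exI)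
  let ?E = "{i. \<lfloor>2 ^ Suc k * h $ i\<rfloor> = 2 * \<lfloor>2 ^ k * h $ i\<rfloor> + 1}"
  have "\<lfloor>2 ^ Suc k * h $ i\<rfloor> = 2 * \<lfloor>2 ^ k * h $ i\<rfloor> \<or> \<lfloor>2 ^ Suc k * h $ i\<rfloor> = 2 * \<lfloor>2 ^ k * h $ i\<rfloor> + 1" for i
  proof -
    have "2 ^ Suc k * h $ i = 2 * (2 ^ k * h $ i)" by simp
    then show ?thesis by linarith
  qed
  note step = this
  have "real_of_int \<lfloor>2 ^ Suc k * h $ i\<rfloor> = 2 * real_of_int \<lfloor>2 ^ k * h $ i\<rfloor> + indicator ?E i" for i
    using step[of i] by (elim disjE) (simp_all add: indicator_def del: power_Suc)
  then have "real_of_int \<lfloor>2 ^ Suc k * h $ i\<rfloor> / 2 ^ Suc k = real_of_int \<lfloor>2 ^ k * h $ i\<rfloor> / 2 ^ k + indicator ?E i / 2 ^ Suc k" for i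
    by (simp only: add_divide_distrib) simp
  then show "dyadic_floor (Suc k) h = dyadic_floor k h + dyadic_shift (Suc k) ?E"
    unfolding vec_eq_iff dyadic_floor_def dyadic_shift_def by simp
qed

lemma dyadic_floor_tendsto: "(\<lambda>k. dyadic_floor (m + k) h) \<longlonglongrightarrow> h"
proof (rule vec_tendstoI)
  fix i
  have "(\<lambda>k. dyadic_floor k h $ i) \<longlonglongrightarrow> h $ i"
  proof (rule real_tendsto_sandwich)
    show "\<forall>\<^sub>F k in sequentially. h $ i - (1/2) ^ k \<le> dyadic_floor k h $ i"
    proof (intro always_eventually allI)
      fix k
      have "2 ^ k * h $ i - 1 \<le> real_of_int \<lfloor>2 ^ k * h $ i\<rfloor>" by linarith
      then have "(2 ^ k * h $ i - 1) / 2 ^ k \<le> dyadic_floor k h $ i"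
        unfolding dyadic_floor_def by (simp add: divide_right_mono)
      then show "h $ i - (1/2) ^ k \<le> dyadic_floor k h $ i"
        by (simp add: diff_divide_distrib power_divide)
    qed
    show "\<forall>\<^sub>F k in sequentially. dyadic_floor k h $ i \<le> h $ i"
      by (intro always_eventually allI) (simp add: dyadic_floor_def divide_le_eq mult.commute)
    have "(\<lambda>k. h $ i - (1/2) ^ k) \<longlonglongrightarrow> h $ i - 0"
      by (intro tendsto_intros LIMSEQ_realpow_zero) auto
    then show "(\<lambda>k. h $ i - (1/2) ^ k) \<longlonglongrightarrow> h $ i" by simp
  qed auto
  from LIMSEQ_ignore_initial_segment[OF this, of m]
  show "(\<lambda>k. dyadic_floor (m + k) h $ i) \<longlonglongrightarrow> h $ i" by (simp add: add.commute)
qed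

lemma norm_dyadic_shift_le: "norm (dyadic_shift k E :: real^'n) \<le> real CARD('n) / 2 ^ k"
proof -
  have "norm (dyadic_shift k E :: real^'n) \<le> (\<Sum>i\<in>UNIV. \<bar>(dyadic_shift k E :: real^'n) $ i\<bar>)" by (rule norm_le_l1_cart)
  also have "\<dots> \<le> (\<Sum>i\<in>(UNIV::'n set). 1 / 2 ^ k)"
    by (intro sum_mono) (auto simp: dyadic_shift_def indicator_def)
  finally show ?thesis by simp
qed

text \<open>
  This bounds a maximum over many links by a level \<open>l\<close> plus a sum of \<open>q\<close>-th powers, for an \<open>l\<close> of free
  choice.
\<close>

lemma le_scaled_power:
  fixes x l :: real
  assumes "0 \<le> x" "0 < l" "0 < q"
  shows "x \<le> l + (1 / l) ^ (q - 1) * x ^ q"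
proof (cases "x \<le> l")
  case True
  then show ?thesis using assms by (auto intro!: add_increasing2)
next
  case False
  have "x = l ^ (q - 1) * x / l ^ (q - 1)" using assms by simp
  also have "\<dots> \<le> x ^ (q - 1) * x / l ^ (q - 1)"
    using False assms by (intro divide_right_mono mult_right_mono power_mono) auto
  also have "x ^ (q - 1) * x = x ^ q" using assms by (metis mult.commute power_eq_if less_numeral_extra(3))
  finally show ?thesis using assms by (simp add: power_divide)
qed

definition chain_const :: "nat \<Rightarrow> real \<Rightarrow> real" where
  "chain_const n K = (1 + 8 ^ n * real n ^ (2 * n) * K) / (1 - sqrt (1/2))"

definition sup_const :: "nat \<Rightarrow> real \<Rightarrow> real" where
  "sup_const n K = chain_const n K + 4 ^ n * (1 + K * real n ^ (2 * n))"

lemma chain_const_nonneg: "K \<ge> 0 \<Longrightarrow> chain_const n K \<ge> 0"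
  by (auto simp: chain_const_def intro!: divide_nonneg_nonneg add_nonneg_nonneg)

text \<open>
  Chaining in the style of Kolmogorov and Chentsov, with \<open>r = sqrt (1/2)\<close>. Level \<open>k\<close> has of the order of
  \<open>2 ^ (k n)\<close> links, each with moment of order \<open>q = 2 n\<close> at most \<open>2 ^ (- k q)\<close> up to constants. Taking
  \<open>l = r ^ k\<close> in \<open>le_scaled_power\<close>, the expected maximal link is of the order \<open>r ^ k\<close>, which is summable. The
  majorant \<open>Z\<close> is measurable, whereas the supremum over uncountably many \<open>h\<close> need not be a priori.
\<close>

lemma (in prob_space) dyadic_chaining:
  fixes Y :: "real ^ 'n \<Rightarrow> 'a \<Rightarrow> real"
  assumes meas: "\<And>h. Y h \<in> borel_measurable M"
    and cont: "\<And>\<omega>. \<omega> \<in> space M \<Longrightarrow> continuous_on UNIV (\<lambda>h. Y h \<omega>)"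
    and mom: "\<And>h h'. (\<integral>\<^sup>+\<omega>. ennreal ((Y h \<omega> - Y h' \<omega>) ^ (2 * CARD('n))) \<partial>M) \<le> ennreal (K * norm (h - h') ^ (2 * CARD('n)))"
    and K: "K \<ge> 0"
  shows "\<exists>Z. Z \<in> borel_measurable M \<and> (\<integral>\<^sup>+\<omega>. Z \<omega> \<partial>M) \<le> ennreal (chain_const CARD('n) K * sqrt (1/2) ^ m) \<and>
    (\<forall>\<omega>\<in>space M. \<forall>h. norm h \<le> 1 \<longrightarrow> ennreal \<bar>Y h \<omega> - Y (dyadic_floor m h) \<omega>\<bar> \<le> Z \<omega>)"
proof -
  let ?n = "CARD('n)"
  define q where "q = 2 * ?n"
  have q: "q > 0" "even q" by (auto simp: q_def)
  define r where "r = sqrt (1/2 :: real)"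
  have r: "0 < r" "r < 1" "r\<^sup>2 = 1/2" by (auto simp: r_def)
  define inc where "inc k g E \<omega> = \<bar>Y (g + dyadic_shift (Suc k) E) \<omega> - Y g \<omega>\<bar>" for k g E \<omega>
  have incm [measurable]: "inc k g E \<in> borel_measurable M" for k g E
    using meas unfolding inc_def[abs_def] by measurable
  (* dominates all links between the levels k and k + 1 *)
  define D where "D k \<omega> = ennreal (r ^ k) + (\<Sum>g\<in>dyadic_grid k. \<Sum>E\<in>UNIV. ennreal ((1 / r ^ k) ^ (q - 1)) * ennreal (inc k g E \<omega> ^ q))" for k \<omega>
  have Dm [measurable]: "D k \<in> borel_measurable M" for k unfolding D_def[abs_def] by measurable
  have incD: "ennreal (inc k g E \<omega>) \<le> D k \<omega>" if "g \<in> dyadic_grid k" for k g E \<omega>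
  proof -
    have "ennreal (inc k g E \<omega>) \<le> ennreal (r ^ k + (1 / r ^ k) ^ (q - 1) * inc k g E \<omega> ^ q)"
      using r q by (intro ennreal_leI le_scaled_power) (auto simp: inc_def)
    also have "\<dots> = ennreal (r ^ k) + ennreal ((1 / r ^ k) ^ (q - 1)) * ennreal (inc k g E \<omega> ^ q)"
      using r by (subst ennreal_plus) (auto simp: ennreal_mult inc_def)
    also have "\<dots> \<le> ennreal (r ^ k) + (\<Sum>E\<in>UNIV. ennreal ((1 / r ^ k) ^ (q - 1)) * ennreal (inc k g E \<omega> ^ q))"
      by (intro add_left_mono member_le_sum) auto
    also have "\<dots> \<le> D k \<omega>"
      unfolding D_def using that
      by (intro add_left_mono member_le_sum[where f="\<lambda>g. \<Sum>E\<in>UNIV. ennreal ((1 / r ^ k) ^ (q - 1)) * ennreal (inc k g E \<omega> ^ q)"]) auto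
    finally show ?thesis .
  qed
  let ?L = "8 ^ ?n * real ?n ^ q * K"
  have L0: "0 \<le> ?L" using K by simp
  have ED: "(\<integral>\<^sup>+\<omega>. D k \<omega> \<partial>M) \<le> ennreal ((1 + ?L) * r ^ k)" for k
  proof -
    have one: "(\<integral>\<^sup>+\<omega>. ennreal (inc k g E \<omega> ^ q) \<partial>M) \<le> ennreal (K * (real ?n / 2 ^ k) ^ q)" for g and E :: "'n set"
    proof -
      have "(\<integral>\<^sup>+\<omega>. ennreal (inc k g E \<omega> ^ q) \<partial>M) = (\<integral>\<^sup>+\<omega>. ennreal ((Y (g + dyadic_shift (Suc k) E) \<omega> - Y g \<omega>) ^ q) \<partial>M)"
        using q by (simp add: inc_def power_even_abs)
      also have "\<dots> \<le> ennreal (K * norm ((g + dyadic_shift (Suc k) E) - g) ^ q)"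
        unfolding q_def by (rule mom)
      also have "\<dots> \<le> ennreal (K * (real ?n / 2 ^ k) ^ q)"
      proof (intro ennreal_leI mult_left_mono power_mono K)
        have "norm (dyadic_shift (Suc k) E :: real^'n) \<le> real ?n / 2 ^ Suc k" by (rule norm_dyadic_shift_le)
        also have "\<dots> \<le> real ?n / 2 ^ k" by (intro divide_left_mono) auto
        finally show "norm ((g + dyadic_shift (Suc k) E) - g) \<le> real ?n / 2 ^ k" by simp
      qed auto
      finally show ?thesis .
    qed
    have "(\<integral>\<^sup>+\<omega>. D k \<omega> \<partial>M) = ennreal (r ^ k) + (\<Sum>g\<in>dyadic_grid k. \<Sum>E\<in>UNIV. ennreal ((1 / r ^ k) ^ (q - 1)) * (\<integral>\<^sup>+\<omega>. ennreal (inc k g E \<omega> ^ q) \<partial>M))"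
      unfolding D_def by (simp add: nn_integral_add nn_integral_sum nn_integral_cmult emeasure_space_1)
    also have "\<dots> \<le> ennreal (r ^ k) + (\<Sum>g\<in>(dyadic_grid k :: (real^'n) set). \<Sum>E\<in>(UNIV :: 'n set set). ennreal ((1 / r ^ k) ^ (q - 1)) * ennreal (K * (real ?n / 2 ^ k) ^ q))"
      by (intro add_left_mono sum_mono mult_left_mono one) auto
    also have "\<dots> = ennreal (r ^ k + real (card (dyadic_grid k :: (real^'n) set)) * (2 ^ ?n * ((1 / r ^ k) ^ (q - 1) * (K * (real ?n / 2 ^ k) ^ q))))"
    proof -
      have card: "card (UNIV :: 'n set set) = 2 ^ ?n" using card_Pow[of "UNIV :: 'n set"] by simp
      show ?thesis
        using r K by (simp add: card ennreal_mult ennreal_of_nat_eq_real_of_nat flip: ennreal_power)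
    qed
    also have "\<dots> \<le> ennreal (r ^ k + (4 * 2 ^ k) ^ ?n * (2 ^ ?n * ((1 / r ^ k) ^ (q - 1) * (K * (real ?n / 2 ^ k) ^ q))))"
      using r K by (intro ennreal_leI add_left_mono mult_right_mono card_dyadic_grid_le) auto
    also have "\<dots> = ennreal ((1 + ?L) * r ^ k)"
    proof -
      have two: "2 ^ k = (1 / r\<^sup>2) ^ k" by (simp add: r(3))
      have q1: "q = Suc (q - 1)" using q by simp
      have "(4 * 2 ^ k) ^ ?n * (2 ^ ?n * ((1 / r ^ k) ^ (q - 1) * (K * (real ?n / 2 ^ k) ^ q)))
          = (8 ^ ?n * real ?n ^ q * K) * ((2 ^ k) ^ ?n * (1 / r ^ k) ^ (q - 1) / (2 ^ k) ^ q)"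
        by (simp add: power_mult_distrib power_divide mult_ac flip: power_mult_distrib[of 4 2])
          (simp add: power_mult_distrib[symmetric])
      also have "(2 ^ k) ^ ?n * (1 / r ^ k) ^ (q - 1) / (2 ^ k) ^ q = r ^ k"
      proof -
        have "(2 ^ k :: real) ^ q = (2 ^ k) ^ ?n * (2 ^ k) ^ ?n" by (simp add: q_def mult_2 power_add)
        then have e1: "(2 ^ k) ^ ?n * (1 / r ^ k) ^ (q - 1) / (2 ^ k) ^ q = (1 / r ^ k) ^ (q - 1) / (2 ^ k) ^ ?n" by simp
        have "(2 ^ k :: real) ^ ?n = (1 / r ^ k) ^ q"
          unfolding two q_def by (simp add: power_divide power_mult[symmetric] mult_ac)
        then have e3: "(1 / r ^ k) ^ (q - 1) / (2 ^ k) ^ ?n = (1 / r ^ k) ^ (q - 1) / (1 / r ^ k) ^ q" by (simp only:)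
        note e1
        also note e3
        also have "(1 / r ^ k) ^ (q - 1) / (1 / r ^ k) ^ q = r ^ k"
          using r by (subst (2) q1) (simp add: field_simps)
        finally show ?thesis .
      qed
      finally show ?thesis by (simp only: distrib_right mult_1_left)
    qed
    finally show ?thesis .
  qed
  define Z where "Z \<omega> = (\<Sum>k. D (m + k) \<omega>)" for \<omega>
  have Zm: "Z \<in> borel_measurable M" unfolding Z_def[abs_def] by measurable
  have "(\<integral>\<^sup>+\<omega>. Z \<omega> \<partial>M) = (\<Sum>k. \<integral>\<^sup>+\<omega>. D (m + k) \<omega> \<partial>M)"
    unfolding Z_def by (rule nn_integral_suminf) simp
  also have "\<dots> \<le> (\<Sum>k. ennreal ((1 + ?L) * r ^ (m + k)))"
    by (intro suminf_le ED) auto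
  also have "\<dots> = ennreal (\<Sum>k. (1 + ?L) * r ^ m * r ^ k)"
    using r L0 by (subst suminf_ennreal2) (auto simp: power_add mult.assoc intro!: summable_mult summable_geometric)
  also have "(\<Sum>k. (1 + ?L) * r ^ m * r ^ k) = chain_const ?n K * r ^ m"
    using r by (simp add: suminf_mult summable_geometric suminf_geometric chain_const_def q_def r_def[symmetric])
  finally have EZ: "(\<integral>\<^sup>+\<omega>. Z \<omega> \<partial>M) \<le> ennreal (chain_const ?n K * sqrt (1/2) ^ m)" by (simp add: r_def)
  have tel: "ennreal \<bar>Y (dyadic_floor (m + j) h) \<omega> - Y (dyadic_floor m h) \<omega>\<bar> \<le> (\<Sum>k<j. D (m + k) \<omega>)" if "norm h \<le> 1" for j h \<omega>
  proof (induction j)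
    case (Suc j)
    obtain E where E: "dyadic_floor (Suc (m + j)) h = dyadic_floor (m + j) h + dyadic_shift (Suc (m + j)) E"
      using dyadic_floor_Suc by blast
    have "\<bar>Y (dyadic_floor (m + Suc j) h) \<omega> - Y (dyadic_floor m h) \<omega>\<bar> \<le>
        \<bar>Y (dyadic_floor (m + j) h) \<omega> - Y (dyadic_floor m h) \<omega>\<bar> + inc (m + j) (dyadic_floor (m + j) h) E \<omega>"
      unfolding inc_def using E by simp
    then have "ennreal \<bar>Y (dyadic_floor (m + Suc j) h) \<omega> - Y (dyadic_floor m h) \<omega>\<bar> \<le>
        ennreal \<bar>Y (dyadic_floor (m + j) h) \<omega> - Y (dyadic_floor m h) \<omega>\<bar> + ennreal (inc (m + j) (dyadic_floor (m + j) h) E \<omega>)"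
      by (subst ennreal_plus[symmetric]) (auto simp: inc_def intro!: ennreal_leI simp del: ennreal_plus)
    also have "\<dots> \<le> (\<Sum>k<j. D (m + k) \<omega>) + D (m + j) \<omega>"
      by (intro add_mono Suc incD dyadic_floor_in_grid that)
    finally show ?case by simp
  qed simp
  have "ennreal \<bar>Y h \<omega> - Y (dyadic_floor m h) \<omega>\<bar> \<le> Z \<omega>" if h: "norm h \<le> 1" and \<omega>: "\<omega> \<in> space M" for h \<omega>
  proof (rule tendsto_upperbound[OF _ _ trivial_limit_sequentially])
    have "(\<lambda>j. Y (dyadic_floor (m + j) h) \<omega>) \<longlonglongrightarrow> Y h \<omega>"
      by (rule continuous_on_tendsto_compose[OF cont[OF \<omega>] dyadic_floor_tendsto]) auto
    then show "(\<lambda>j. ennreal \<bar>Y (dyadic_floor (m + j) h) \<omega> - Y (dyadic_floor m h) \<omega>\<bar>) \<longlonglongrightarrow> ennreal \<bar>Y h \<omega> - Y (dyadic_floor m h) \<omega>\<bar>"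
      by (intro tendsto_ennrealI tendsto_intros)
    have "(\<Sum>k<j. D (m + k) \<omega>) \<le> Z \<omega>" for j
      unfolding Z_def by (rule sum_le_suminf) auto
    then show "\<forall>\<^sub>F j in sequentially. ennreal \<bar>Y (dyadic_floor (m + j) h) \<omega> - Y (dyadic_floor m h) \<omega>\<bar> \<le> Z \<omega>"
      using tel[OF h] by (intro always_eventually allI) (rule order_trans)
  qed
  with Zm EZ show ?thesis by blast
qed

text \<open>
  What chaining from level \<open>0\<close> leaves over are the values on the unit grid, which has at most \<open>4 ^ n\<close> points.
  These values are increments from the origin.
\<close>

lemma (in prob_space) dyadic_sup_bound:
  fixes Y :: "real ^ 'n \<Rightarrow> 'a \<Rightarrow> real"
  assumes meas: "\<And>h. Y h \<in> borel_measurable M"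
    and cont: "\<And>\<omega>. \<omega> \<in> space M \<Longrightarrow> continuous_on UNIV (\<lambda>h. Y h \<omega>)"
    and mom: "\<And>h h'. (\<integral>\<^sup>+\<omega>. ennreal ((Y h \<omega> - Y h' \<omega>) ^ (2 * CARD('n))) \<partial>M) \<le> ennreal (K * norm (h - h') ^ (2 * CARD('n)))"
    and K: "K \<ge> 0" and Y0: "\<And>\<omega>. \<omega> \<in> space M \<Longrightarrow> Y 0 \<omega> = 0"
  shows "\<exists>U. U \<in> borel_measurable M \<and> (\<integral>\<^sup>+\<omega>. U \<omega> \<partial>M) \<le> ennreal (sup_const CARD('n) K) \<and>
    (\<forall>\<omega>\<in>space M. \<forall>h. norm h \<le> 1 \<longrightarrow> ennreal \<bar>Y h \<omega>\<bar> \<le> U \<omega>)"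
proof -
  let ?n = "CARD('n)"
  let ?G = "dyadic_grid 0 :: (real^'n) set"
  from dyadic_chaining[OF meas cont mom K, of 0] obtain Z where Z: "Z \<in> borel_measurable M"
    "(\<integral>\<^sup>+\<omega>. Z \<omega> \<partial>M) \<le> ennreal (chain_const ?n K)"
    "\<And>\<omega> h. \<omega> \<in> space M \<Longrightarrow> norm h \<le> 1 \<Longrightarrow> ennreal \<bar>Y h \<omega> - Y (dyadic_floor 0 h) \<omega>\<bar> \<le> Z \<omega>" by auto
  note [measurable] = Z(1) meas
  define U where "U \<omega> = Z \<omega> + (\<Sum>g\<in>?G. ennreal \<bar>Y g \<omega>\<bar>)" for \<omega>
  have Um: "U \<in> borel_measurable M" unfolding U_def[abs_def] by measurable
  have ng: "norm g \<le> real ?n" if "g \<in> ?G" for g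
  proof -
    have "norm g \<le> (\<Sum>i\<in>UNIV. \<bar>g $ i\<bar>)" by (rule norm_le_l1_cart)
    also have "\<dots> \<le> (\<Sum>i\<in>(UNIV :: 'n set). 1)"
    proof (rule sum_mono)
      fix i
      from that obtain z where z: "g = (\<chi> i. real_of_int (z i))" "\<And>i. z i \<in> {-1..1}"
        by (auto simp: dyadic_grid_def PiE_iff)
      have "-1 \<le> z i" "z i \<le> 1" using z(2)[of i] by auto
      then show "\<bar>g $ i\<bar> \<le> 1" by (simp add: z(1))
    qed
    finally show ?thesis by simp
  qed
  have Eg: "(\<integral>\<^sup>+\<omega>. ennreal \<bar>Y g \<omega>\<bar> \<partial>M) \<le> ennreal (1 + K * real ?n ^ (2 * ?n))" if "g \<in> ?G" for g
  proof -
    have "(\<integral>\<^sup>+\<omega>. ennreal \<bar>Y g \<omega>\<bar> \<partial>M) \<le> (\<integral>\<^sup>+\<omega>. 1 + ennreal ((Y g \<omega> - Y 0 \<omega>) ^ (2 * ?n)) \<partial>M)"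
    proof (rule nn_integral_mono)
      fix \<omega> assume \<omega>: "\<omega> \<in> space M"
      have "\<bar>Y g \<omega>\<bar> \<le> 1 + \<bar>Y g \<omega>\<bar> ^ (2 * ?n)"
        using le_scaled_power[of "\<bar>Y g \<omega>\<bar>" 1 "2 * ?n"] by simp
      then have "ennreal \<bar>Y g \<omega>\<bar> \<le> ennreal (1 + (Y g \<omega> - Y 0 \<omega>) ^ (2 * ?n))"
        using Y0[OF \<omega>] by (intro ennreal_leI) (simp add: power_even_abs)
      also have "\<dots> = 1 + ennreal ((Y g \<omega> - Y 0 \<omega>) ^ (2 * ?n))" by (subst ennreal_plus) auto
      finally show "ennreal \<bar>Y g \<omega>\<bar> \<le> 1 + ennreal ((Y g \<omega> - Y 0 \<omega>) ^ (2 * ?n))" .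
    qed
    also have "\<dots> = 1 + (\<integral>\<^sup>+\<omega>. ennreal ((Y g \<omega> - Y 0 \<omega>) ^ (2 * ?n)) \<partial>M)"
      by (subst nn_integral_add) (auto simp: emeasure_space_1)
    also have "\<dots> \<le> 1 + ennreal (K * norm (g - 0) ^ (2 * ?n))" by (intro add_left_mono mom)
    also have "\<dots> \<le> 1 + ennreal (K * real ?n ^ (2 * ?n))"
      using ng[OF that] K by (intro add_left_mono ennreal_leI mult_left_mono power_mono) auto
    also have "\<dots> = ennreal (1 + K * real ?n ^ (2 * ?n))" using K by (subst ennreal_plus) auto
    finally show ?thesis .
  qed
  have "(\<integral>\<^sup>+\<omega>. U \<omega> \<partial>M) = (\<integral>\<^sup>+\<omega>. Z \<omega> \<partial>M) + (\<Sum>g\<in>?G. \<integral>\<^sup>+\<omega>. ennreal \<bar>Y g \<omega>\<bar> \<partial>M)"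
    unfolding U_def by (subst nn_integral_add) (auto simp: nn_integral_sum simp del: sum_ennreal)
  also have "\<dots> \<le> ennreal (chain_const ?n K) + (\<Sum>g\<in>?G. ennreal (1 + K * real ?n ^ (2 * ?n)))"
    by (intro add_mono Z sum_mono Eg)
  also have "\<dots> = ennreal (chain_const ?n K + real (card ?G) * (1 + K * real ?n ^ (2 * ?n)))"
    using K chain_const_nonneg[OF K, of ?n]
    by (subst ennreal_plus) (auto simp: ennreal_mult ennreal_of_nat_eq_real_of_nat simp del: ennreal_plus)
  also have "\<dots> \<le> ennreal (sup_const ?n K)"
    unfolding sup_const_def using K card_dyadic_grid_le[where 'n='n, of 0]
    by (intro ennreal_leI add_left_mono mult_right_mono) auto
  finally have EU: "(\<integral>\<^sup>+\<omega>. U \<omega> \<partial>M) \<le> ennreal (sup_const ?n K)" .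
  have "ennreal \<bar>Y h \<omega>\<bar> \<le> U \<omega>" if "\<omega> \<in> space M" "norm h \<le> 1" for \<omega> h
  proof -
    have "ennreal \<bar>Y h \<omega>\<bar> \<le> ennreal (\<bar>Y h \<omega> - Y (dyadic_floor 0 h) \<omega>\<bar> + \<bar>Y (dyadic_floor 0 h) \<omega>\<bar>)"
      by (intro ennreal_leI) simp
    also have "\<dots> = ennreal \<bar>Y h \<omega> - Y (dyadic_floor 0 h) \<omega>\<bar> + ennreal \<bar>Y (dyadic_floor 0 h) \<omega>\<bar>"
      by (rule ennreal_plus) auto
    also have "\<dots> \<le> U \<omega>"
      unfolding U_def using Z(3)[OF that] dyadic_floor_in_grid[OF that(2), of 0]
      by (intro add_mono member_le_sum[where f="\<lambda>g. ennreal \<bar>Y g \<omega>\<bar>"]) auto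
    finally show ?thesis .
  qed
  with Um EU show ?thesis by blast
qed

section \<open>High-probability events and uniform stochastic bounds\<close>

text \<open>
  Eventually in \<open>t\<close>, the property \<open>Q t\<close> fails with outer probability at most \<open>\<eta>\<close>. The outer form admits
  properties that quantify over uncountably many parameters.
\<close>

definition high_prob :: "'w measure \<Rightarrow> real \<Rightarrow> (nat \<Rightarrow> 'w \<Rightarrow> bool) \<Rightarrow> bool" where
  "high_prob M \<eta> Q \<longleftrightarrow> (\<forall>\<^sub>F t in sequentially.
     \<exists>A\<in>sets M. {\<omega> \<in> space M. \<not> Q t \<omega>} \<subseteq> A \<and> measure M A \<le> \<eta>)"

lemma high_prob_mono:
  assumes "high_prob M \<eta> P" "\<forall>\<^sub>F t in sequentially. \<forall>\<omega>\<in>space M. P t \<omega> \<longrightarrow> Q t \<omega>"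
  shows "high_prob M \<eta> Q"
  using assms unfolding high_prob_def
proof eventually_elim
  case (elim t)
  then obtain A where "A \<in> sets M" "{\<omega> \<in> space M. \<not> P t \<omega>} \<subseteq> A" "measure M A \<le> \<eta>" by blast
  with elim(2) show ?case by (intro bexI[of _ A]) auto
qed

lemma (in finite_measure) high_prob_conj:
  assumes "high_prob M \<eta>1 P" "high_prob M \<eta>2 Q"
  shows "high_prob M (\<eta>1 + \<eta>2) (\<lambda>t \<omega>. P t \<omega> \<and> Q t \<omega>)"
  using assms unfolding high_prob_def
proof eventually_elim
  case (elim t)
  then obtain A B where A: "A \<in> sets M" "{\<omega> \<in> space M. \<not> P t \<omega>} \<subseteq> A" "measure M A \<le> \<eta>1"
    and B: "B \<in> sets M" "{\<omega> \<in> space M. \<not> Q t \<omega>} \<subseteq> B" "measure M B \<le> \<eta>2" by blast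
  show ?case
    using A B measure_Un_le[of A M B] by (intro bexI[of _ "A \<union> B"]) auto
qed

lemma high_prob_AE:
  assumes "\<forall>\<^sub>F t in sequentially. AE \<omega> in M. Q t \<omega>"
  shows "high_prob M 0 Q"
  using assms unfolding high_prob_def
proof eventually_elim
  case (elim t)
  then obtain A where "{\<omega> \<in> space M. \<not> Q t \<omega>} \<subseteq> A" "emeasure M A = 0" "A \<in> sets M" by (rule AE_E)
  then show ?case by (intro bexI[of _ A]) (auto simp: measure_def)
qed

lemma (in finite_measure) high_prob_markov:
  assumes "\<And>t. U t \<in> borel_measurable M" "\<forall>\<^sub>F t in sequentially. (\<integral>\<^sup>+\<omega>. U t \<omega> \<partial>M) \<le> ennreal C" and B: "B > 0" and C: "C \<ge> 0"
  shows "high_prob M (C / B) (\<lambda>t \<omega>. U t \<omega> \<le> ennreal B)"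
  using assms(2) unfolding high_prob_def
proof eventually_elim
  case (elim t)
  let ?A = "{\<omega> \<in> space M. 1 \<le> ennreal (1 / B) * U t \<omega>}"
  note [measurable] = assms(1)
  have "emeasure M ?A \<le> ennreal (1 / B) * (\<integral>\<^sup>+\<omega>. U t \<omega> * indicator (space M) \<omega> \<partial>M)"
    using nn_integral_Markov_inequality[of "U t" "space M" M "ennreal (1 / B)"] by simp
  also have "(\<integral>\<^sup>+\<omega>. U t \<omega> * indicator (space M) \<omega> \<partial>M) = (\<integral>\<^sup>+\<omega>. U t \<omega> \<partial>M)"
    by (rule nn_integral_cong) simp
  also have "ennreal (1 / B) * \<dots> \<le> ennreal (1 / B) * ennreal C" by (intro mult_left_mono elim) auto
  also have "\<dots> = ennreal (C / B)" using B C by (simp flip: ennreal_mult)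
  finally have "measure M ?A \<le> C / B"
    using B C by (simp add: emeasure_eq_measure)
  moreover have "{\<omega> \<in> space M. \<not> U t \<omega> \<le> ennreal B} \<subseteq> ?A"
  proof safe
    fix \<omega> assume "\<omega> \<in> space M" "\<not> U t \<omega> \<le> ennreal B"
    then have "ennreal (1 / B) * ennreal B \<le> ennreal (1 / B) * U t \<omega>" by (intro mult_left_mono) auto
    moreover have "ennreal (1 / B) * ennreal B = 1" using B by (simp flip: ennreal_mult)
    ultimately show "1 \<le> ennreal (1 / B) * U t \<omega>" by simp
  qed
  ultimately show ?case by (intro bexI[of _ ?A]) auto
qed

lemma (in finite_measure) high_prob_tight:
  assumes "\<And>t. U t \<in> borel_measurable M" "\<forall>\<^sub>F t in sequentially. (\<integral>\<^sup>+\<omega>. U t \<omega> \<partial>M) \<le> ennreal C" and C: "C \<ge> 0" and \<eta>: "\<eta> > 0"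
  shows "\<exists>B>0. high_prob M \<eta> (\<lambda>t \<omega>. U t \<omega> \<le> ennreal B)"
proof (intro exI conjI)
  show "0 < (C + 1) / \<eta>" using C \<eta> by (simp add: add_nonneg_pos)
  have "C / ((C + 1) / \<eta>) \<le> \<eta>" using C \<eta> by (simp add: divide_simps add_nonneg_eq_0_iff)
  with high_prob_markov[OF assms(1,2) \<open>0 < (C + 1) / \<eta>\<close> C]
  show "high_prob M \<eta> (\<lambda>t \<omega>. U t \<omega> \<le> ennreal ((C + 1) / \<eta>))"
    unfolding high_prob_def by (auto elim!: eventually_mono intro: order_trans)
qed

lemma (in finite_measure) high_prob_tendsto_0:
  assumes U: "\<And>t. U t \<in> borel_measurable M" and lim: "(\<lambda>t. \<integral>\<^sup>+\<omega>. U t \<omega> \<partial>M) \<longlonglongrightarrow> 0" and \<eta>: "\<eta> > 0" and B: "B > 0"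
  shows "high_prob M \<eta> (\<lambda>t \<omega>. U t \<omega> \<le> ennreal B)"
proof -
  have "\<forall>\<^sub>F t in sequentially. (\<integral>\<^sup>+\<omega>. U t \<omega> \<partial>M) < ennreal (\<eta> * B)"
    using lim \<eta> B by (intro order_tendstoD) auto
  then have "\<forall>\<^sub>F t in sequentially. (\<integral>\<^sup>+\<omega>. U t \<omega> \<partial>M) \<le> ennreal (\<eta> * B)"
    by eventually_elim simp
  from high_prob_markov[OF U this B] show ?thesis using \<eta> B by simp
qed

lemma (in finite_measure) high_prob_finite_all:
  assumes "finite G" and "\<And>g \<eta>. g \<in> G \<Longrightarrow> \<eta> > 0 \<Longrightarrow> high_prob M \<eta> (P g)" and "\<eta> > 0"
  shows "high_prob M \<eta> (\<lambda>t \<omega>. \<forall>g\<in>G. P g t \<omega>)"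
  using assms
proof (induction G arbitrary: \<eta> rule: finite_induct)
  case empty
  then show ?case by (auto simp: high_prob_def intro!: always_eventually bexI[of _ "{}"])
next
  case (insert g G)
  have "high_prob M (\<eta>/2 + \<eta>/2) (\<lambda>t \<omega>. P g t \<omega> \<and> (\<forall>g\<in>G. P g t \<omega>))"
    using insert.prems by (intro high_prob_conj insert.IH) auto
  then show ?case by simp
qed

text \<open>
  One sequence of envelopes has to serve all \<open>\<eta>\<close>, so the envelopes are chosen nearly optimal.
\<close>

lemma (in finite_measure) vanishes_in_probI:
  assumes "\<And>\<delta> \<eta>. \<delta> > 0 \<Longrightarrow> \<eta> > 0 \<Longrightarrow> high_prob M \<eta> (\<lambda>t \<omega>. Z t \<omega> \<le> \<delta>)"
  shows "vanishes_in_prob M Z"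
  unfolding vanishes_in_prob_def
proof (intro allI impI)
  fix \<delta> :: real assume \<delta>: "\<delta> > 0"
  define cov where "cov t = {A \<in> sets M. {\<omega> \<in> space M. \<delta> < Z t \<omega>} \<subseteq> A}" for t
  define m where "m t = (INF A\<in>cov t. measure M A)" for t
  have ne: "space M \<in> cov t" for t by (auto simp: cov_def)
  have bdd: "bdd_below (measure M ` cov t)" for t by (rule bdd_belowI[of _ 0]) auto
  have "\<exists>A. A \<in> cov t \<and> measure M A < m t + 1 / Suc t" for t
  proof -
    have "Inf (measure M ` cov t) < m t + 1 / Suc t" unfolding m_def by simp
    then show ?thesis using cInf_lessD[of "measure M ` cov t"] ne[of t] by blast
  qed
  then obtain A where A: "\<And>t. A t \<in> cov t" "\<And>t. measure M (A t) < m t + 1 / Suc t" by metis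
  have "(\<lambda>t. measure M (A t)) \<longlonglongrightarrow> 0"
  proof (rule order_tendstoI)
    fix e :: real assume e: "0 < e"
    have "\<forall>\<^sub>F t in sequentially. m t \<le> e / 2"
      using assms[OF \<delta> half_gt_zero[OF e]] unfolding high_prob_def
    proof eventually_elim
      case (elim t)
      then obtain B where B: "B \<in> sets M" "{\<omega> \<in> space M. \<not> Z t \<omega> \<le> \<delta>} \<subseteq> B" "measure M B \<le> e / 2" by auto
      then have "B \<in> cov t" by (auto simp: cov_def not_le)
      then have "m t \<le> measure M B" unfolding m_def by (intro cINF_lower bdd)
      with B show ?case by simp
    qed
    moreover have "\<forall>\<^sub>F t in sequentially. 1 / Suc t < e / 2"
      using LIMSEQ_inverse_real_of_nat e by (intro order_tendstoD) (auto simp: inverse_eq_divide)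
    ultimately show "\<forall>\<^sub>F t in sequentially. measure M (A t) < e"
    proof eventually_elim
      case (elim t)
      with A(2)[of t] show ?case by linarith
    qed
  qed (auto intro!: always_eventually less_le_trans[OF _ measure_nonneg])
  with A(1) show "\<exists>A. (\<forall>t. A t \<in> sets M \<and> {\<omega> \<in> space M. \<delta> < Z t \<omega>} \<subseteq> A t) \<and> (\<lambda>t. measure M (A t)) \<longlonglongrightarrow> 0"
    by (intro exI[of _ A]) (auto simp: cov_def)
qed

text \<open>
  The hypothesis of dyadic chaining. Both sides of the moment condition have the same degree of
  homogeneity in space, so that one constant serves at all scales.
\<close>

definition lipschitz_moments :: "'w measure \<Rightarrow> real \<Rightarrow> (real ^ 'n \<Rightarrow> 'w \<Rightarrow> real) \<Rightarrow> bool" where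
  "lipschitz_moments M K Y \<longleftrightarrow> (\<forall>h. Y h \<in> borel_measurable M) \<and>
     (\<forall>\<omega>\<in>space M. continuous_on UNIV (\<lambda>h. Y h \<omega>)) \<and>
     (\<forall>h h'. (\<integral>\<^sup>+\<omega>. ennreal ((Y h \<omega> - Y h' \<omega>) ^ (2 * CARD('n))) \<partial>M) \<le> ennreal (K * norm (h - h') ^ (2 * CARD('n))))"

lemma lipschitz_moments_rescale:
  fixes Y :: "real ^ 'n \<Rightarrow> 'w \<Rightarrow> real"
  assumes Y: "lipschitz_moments M K Y" and r: "r > 0"
  shows "lipschitz_moments M K (\<lambda>h \<omega>. (Y (x + r *\<^sub>R h) \<omega> - Y x \<omega>) / r)"
  unfolding lipschitz_moments_def
proof (intro conjI allI ballI)
  let ?q = "2 * CARD('n)"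
  have m [measurable]: "Y h \<in> borel_measurable M" for h using Y by (auto simp: lipschitz_moments_def)
  show "(\<lambda>\<omega>. (Y (x + r *\<^sub>R h) \<omega> - Y x \<omega>) / r) \<in> borel_measurable M" for h by measurable
  show "continuous_on UNIV (\<lambda>h. (Y (x + r *\<^sub>R h) \<omega> - Y x \<omega>) / r)" if "\<omega> \<in> space M" for \<omega>
  proof -
    have "continuous_on UNIV (\<lambda>h. Y (x + r *\<^sub>R h) \<omega>)"
      by (rule continuous_on_compose2[of UNIV "\<lambda>h. Y h \<omega>"])
        (use Y that in \<open>auto simp: lipschitz_moments_def intro!: continuous_intros\<close>)
    then show ?thesis using r by (intro continuous_intros) auto
  qed
  fix h h' :: "real ^ 'n"
  have "(\<integral>\<^sup>+\<omega>. ennreal (((Y (x + r *\<^sub>R h) \<omega> - Y x \<omega>) / r - (Y (x + r *\<^sub>R h') \<omega> - Y x \<omega>) / r) ^ ?q) \<partial>M)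
      = (\<integral>\<^sup>+\<omega>. ennreal ((1 / r) ^ ?q) * ennreal ((Y (x + r *\<^sub>R h) \<omega> - Y (x + r *\<^sub>R h') \<omega>) ^ ?q) \<partial>M)"
    using r by (intro nn_integral_cong)
      (simp add: power_divide ennreal_mult[symmetric] flip: diff_divide_distrib)
  also have "\<dots> = ennreal ((1 / r) ^ ?q) * (\<integral>\<^sup>+\<omega>. ennreal ((Y (x + r *\<^sub>R h) \<omega> - Y (x + r *\<^sub>R h') \<omega>) ^ ?q) \<partial>M)"
    by (rule nn_integral_cmult) measurable
  also have "\<dots> \<le> ennreal ((1 / r) ^ ?q) * ennreal (K * norm ((x + r *\<^sub>R h) - (x + r *\<^sub>R h')) ^ ?q)"
  proof (intro mult_left_mono)
    show "(\<integral>\<^sup>+\<omega>. ennreal ((Y (x + r *\<^sub>R h) \<omega> - Y (x + r *\<^sub>R h') \<omega>) ^ ?q) \<partial>M)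
        \<le> ennreal (K * norm ((x + r *\<^sub>R h) - (x + r *\<^sub>R h')) ^ ?q)"
      using Y unfolding lipschitz_moments_def by blast
  qed simp
  also have "\<dots> = ennreal ((1 / r) ^ ?q * (K * norm ((x + r *\<^sub>R h) - (x + r *\<^sub>R h')) ^ ?q))"
    using r by (simp add: ennreal_mult' ennreal_mult'' )
  also have "(1 / r) ^ ?q * (K * norm ((x + r *\<^sub>R h) - (x + r *\<^sub>R h')) ^ ?q) = K * norm (h - h') ^ ?q"
  proof -
    have "norm ((x + r *\<^sub>R h) - (x + r *\<^sub>R h')) = r * norm (h - h')"
      using r by (simp flip: scaleR_right_diff_distrib)
    then show ?thesis using r by (simp add: power_mult_distrib power_divide)
  qed
  finally show "(\<integral>\<^sup>+\<omega>. ennreal (((Y (x + r *\<^sub>R h) \<omega> - Y x \<omega>) / r - (Y (x + r *\<^sub>R h') \<omega> - Y x \<omega>) / r) ^ ?q) \<partial>M)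
      \<le> ennreal (K * norm (h - h') ^ ?q)" .
qed

lemma even_power_add_le:
  fixes x y :: real
  assumes "even q"
  shows "(x + y) ^ q \<le> 2 ^ q * (x ^ q + y ^ q)"
proof -
  have "(x + y) ^ q = \<bar>x + y\<bar> ^ q" using assms by (simp add: power_even_abs)
  also have "\<dots> \<le> (2 * max \<bar>x\<bar> \<bar>y\<bar>) ^ q" by (intro power_mono) auto
  also have "\<dots> = 2 ^ q * max \<bar>x\<bar> \<bar>y\<bar> ^ q" by (rule power_mult_distrib)
  also have "max \<bar>x\<bar> \<bar>y\<bar> ^ q \<le> \<bar>x\<bar> ^ q + \<bar>y\<bar> ^ q" by (auto simp: max_def)
  also have "\<dots> = x ^ q + y ^ q" using assms by (simp add: power_even_abs)
  finally show ?thesis by simp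
qed

lemma lipschitz_moments_add:
  fixes Y1 Y2 :: "real ^ 'n \<Rightarrow> 'w \<Rightarrow> real"
  assumes Y1: "lipschitz_moments M K1 Y1" and Y2: "lipschitz_moments M K2 Y2" and K: "K1 \<ge> 0" "K2 \<ge> 0" and a: "\<bar>a\<bar> \<le> 1" "\<bar>c\<bar> \<le> 1"
  shows "lipschitz_moments M (2 ^ (2 * CARD('n)) * (K1 + K2)) (\<lambda>h \<omega>. a * Y1 h \<omega> + c * Y2 h \<omega>)"
  unfolding lipschitz_moments_def
proof (intro conjI allI ballI)
  let ?q = "2 * CARD('n)"
  have m [measurable]: "Y1 h \<in> borel_measurable M" "Y2 h \<in> borel_measurable M" for h
    using Y1 Y2 by (auto simp: lipschitz_moments_def)
  show "(\<lambda>\<omega>. a * Y1 h \<omega> + c * Y2 h \<omega>) \<in> borel_measurable M" for h by measurable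
  show "continuous_on UNIV (\<lambda>h. a * Y1 h \<omega> + c * Y2 h \<omega>)" if "\<omega> \<in> space M" for \<omega>
    using Y1 Y2 that by (auto simp: lipschitz_moments_def intro!: continuous_intros)
  fix h h' :: "real ^ 'n"
  have shrink: "(d * x) ^ ?q \<le> x ^ ?q" if "\<bar>d\<bar> \<le> 1" for d x :: real
  proof -
    have "(d * x) ^ ?q = \<bar>d * x\<bar> ^ ?q" by (simp add: power_even_abs)
    also have "\<dots> \<le> \<bar>x\<bar> ^ ?q" using that by (intro power_mono) (auto simp: abs_mult mult_left_le_one_le)
    also have "\<dots> = x ^ ?q" by (simp add: power_even_abs)
    finally show ?thesis .
  qed
  have "(\<integral>\<^sup>+\<omega>. ennreal (((a * Y1 h \<omega> + c * Y2 h \<omega>) - (a * Y1 h' \<omega> + c * Y2 h' \<omega>)) ^ ?q) \<partial>M)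
      \<le> (\<integral>\<^sup>+\<omega>. ennreal (2 ^ ?q) * (ennreal ((Y1 h \<omega> - Y1 h' \<omega>) ^ ?q) + ennreal ((Y2 h \<omega> - Y2 h' \<omega>) ^ ?q)) \<partial>M)"
  proof (rule nn_integral_mono)
    fix \<omega>
    have "((a * Y1 h \<omega> + c * Y2 h \<omega>) - (a * Y1 h' \<omega> + c * Y2 h' \<omega>)) ^ ?q =
        (a * (Y1 h \<omega> - Y1 h' \<omega>) + c * (Y2 h \<omega> - Y2 h' \<omega>)) ^ ?q" by (simp add: algebra_simps)
    also have "\<dots> \<le> 2 ^ ?q * ((a * (Y1 h \<omega> - Y1 h' \<omega>)) ^ ?q + (c * (Y2 h \<omega> - Y2 h' \<omega>)) ^ ?q)"
      by (rule even_power_add_le) simp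
    also have "\<dots> \<le> 2 ^ ?q * ((Y1 h \<omega> - Y1 h' \<omega>) ^ ?q + (Y2 h \<omega> - Y2 h' \<omega>) ^ ?q)"
      using a by (intro mult_left_mono add_mono shrink) auto
    finally have "ennreal (((a * Y1 h \<omega> + c * Y2 h \<omega>) - (a * Y1 h' \<omega> + c * Y2 h' \<omega>)) ^ ?q) \<le>
        ennreal (2 ^ ?q * ((Y1 h \<omega> - Y1 h' \<omega>) ^ ?q + (Y2 h \<omega> - Y2 h' \<omega>) ^ ?q))" by (rule ennreal_leI)
    also have "\<dots> = ennreal (2 ^ ?q) * (ennreal ((Y1 h \<omega> - Y1 h' \<omega>) ^ ?q) + ennreal ((Y2 h \<omega> - Y2 h' \<omega>) ^ ?q))"
      by (subst ennreal_mult) auto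
    finally show "ennreal (((a * Y1 h \<omega> + c * Y2 h \<omega>) - (a * Y1 h' \<omega> + c * Y2 h' \<omega>)) ^ ?q) \<le>
        ennreal (2 ^ ?q) * (ennreal ((Y1 h \<omega> - Y1 h' \<omega>) ^ ?q) + ennreal ((Y2 h \<omega> - Y2 h' \<omega>) ^ ?q))" .
  qed
  also have "\<dots> = ennreal (2 ^ ?q) * ((\<integral>\<^sup>+\<omega>. ennreal ((Y1 h \<omega> - Y1 h' \<omega>) ^ ?q) \<partial>M) + (\<integral>\<^sup>+\<omega>. ennreal ((Y2 h \<omega> - Y2 h' \<omega>) ^ ?q) \<partial>M))"
    by (simp add: nn_integral_cmult nn_integral_add)
  also have "\<dots> \<le> ennreal (2 ^ ?q) * (ennreal (K1 * norm (h - h') ^ ?q) + ennreal (K2 * norm (h - h') ^ ?q))"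
    using Y1 Y2 by (intro mult_left_mono add_mono) (auto simp: lipschitz_moments_def)
  also have "\<dots> = ennreal (2 ^ ?q * (K1 + K2) * norm (h - h') ^ ?q)"
    using K by (simp add: ennreal_mult[symmetric] ennreal_plus[symmetric] algebra_simps del: ennreal_plus)
  finally show "(\<integral>\<^sup>+\<omega>. ennreal (((a * Y1 h \<omega> + c * Y2 h \<omega>) - (a * Y1 h' \<omega> + c * Y2 h' \<omega>)) ^ ?q) \<partial>M)
      \<le> ennreal (2 ^ ?q * (K1 + K2) * norm (h - h') ^ ?q)" .
qed

context prob_space
begin

text \<open>
  The bound does not depend on the radius \<open>r\<close>: this is chaining on the unit ball, applied to the rescaled
  process.
\<close>

lemma lipschitz_moments_sup:
  fixes Y :: "real ^ 'n \<Rightarrow> 'a \<Rightarrow> real"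
  assumes Y: "lipschitz_moments M K Y" and K: "K \<ge> 0" and r: "r > 0"
  shows "\<exists>U. U \<in> borel_measurable M \<and> (\<integral>\<^sup>+\<omega>. U \<omega> \<partial>M) \<le> ennreal (sup_const CARD('n) K) \<and>
    (\<forall>\<omega>\<in>space M. \<forall>h. norm h \<le> r \<longrightarrow> ennreal (\<bar>Y (x + h) \<omega> - Y x \<omega>\<bar> / r) \<le> U \<omega>)"
proof -
  let ?Y = "\<lambda>h \<omega>. (Y (x + r *\<^sub>R h) \<omega> - Y x \<omega>) / r"
  have L: "lipschitz_moments M K ?Y" by (rule lipschitz_moments_rescale[OF Y r])
  obtain U where U: "U \<in> borel_measurable M" "(\<integral>\<^sup>+\<omega>. U \<omega> \<partial>M) \<le> ennreal (sup_const CARD('n) K)"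
    "\<And>\<omega> h. \<omega> \<in> space M \<Longrightarrow> norm h \<le> 1 \<Longrightarrow> ennreal \<bar>?Y h \<omega>\<bar> \<le> U \<omega>"
    using dyadic_sup_bound[of ?Y K] L K unfolding lipschitz_moments_def by auto
  have "ennreal (\<bar>Y (x + h) \<omega> - Y x \<omega>\<bar> / r) \<le> U \<omega>" if "\<omega> \<in> space M" "norm h \<le> r" for \<omega> h
    using U(3)[OF that(1), of "(1/r) *\<^sub>R h"] r that(2) by (simp add: abs_divide)
  with U(1,2) show ?thesis by blast
qed

text \<open>
  Positive homogeneity extends the bound on the unit sphere to the whole space.
\<close>

lemma high_prob_linear_growth:
  fixes \<xi> :: "nat \<Rightarrow> real ^ 'n \<Rightarrow> 'a \<Rightarrow> real"
  assumes ev: "\<forall>\<^sub>F t in sequentially. lipschitz_moments M K (\<xi> t)" and K: "K \<ge> 0"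
    and hom: "\<And>t s \<beta> \<omega>. s \<ge> 0 \<Longrightarrow> \<xi> t (s *\<^sub>R \<beta>) \<omega> = s * \<xi> t \<beta> \<omega>" and \<eta>: "\<eta> > 0"
  shows "\<exists>B>0. high_prob M \<eta> (\<lambda>t \<omega>. \<forall>\<beta>. \<bar>\<xi> t \<beta> \<omega>\<bar> \<le> B * norm \<beta>)"
proof -
  have "\<exists>U. U \<in> borel_measurable M \<and> (lipschitz_moments M K (\<xi> t) \<longrightarrow> (\<integral>\<^sup>+\<omega>. U \<omega> \<partial>M) \<le> ennreal (sup_const CARD('n) K) \<and>
    (\<forall>\<omega>\<in>space M. \<forall>h. norm h \<le> 1 \<longrightarrow> ennreal \<bar>\<xi> t h \<omega>\<bar> \<le> U \<omega>))" for t
  proof (cases "lipschitz_moments M K (\<xi> t)")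
    case True
    have "\<xi> t 0 \<omega> = 0" for \<omega> using hom[of 0 t 0 \<omega>] by simp
    then show ?thesis using lipschitz_moments_sup[OF True K, of 1 0] by auto
  qed (auto intro: exI[of _ "\<lambda>_. 0"])
  then obtain U where U: "\<And>t. U t \<in> borel_measurable M"
    "\<And>t. lipschitz_moments M K (\<xi> t) \<Longrightarrow> (\<integral>\<^sup>+\<omega>. U t \<omega> \<partial>M) \<le> ennreal (sup_const CARD('n) K)"
    "\<And>t \<omega> h. lipschitz_moments M K (\<xi> t) \<Longrightarrow> \<omega> \<in> space M \<Longrightarrow> norm h \<le> 1 \<Longrightarrow> ennreal \<bar>\<xi> t h \<omega>\<bar> \<le> U t \<omega>"
    by metis
  have c: "0 \<le> sup_const CARD('n) K" using K chain_const_nonneg[OF K] by (auto simp: sup_const_def)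
  from ev have ev': "\<forall>\<^sub>F t in sequentially. (\<integral>\<^sup>+\<omega>. U t \<omega> \<partial>M) \<le> ennreal (sup_const CARD('n) K)"
    by eventually_elim (rule U)
  obtain B where B: "B > 0" "high_prob M \<eta> (\<lambda>t \<omega>. U t \<omega> \<le> ennreal B)"
    using high_prob_tight[OF U(1) ev' c \<eta>] by blast
  have "high_prob M \<eta> (\<lambda>t \<omega>. \<forall>\<beta>. \<bar>\<xi> t \<beta> \<omega>\<bar> \<le> B * norm \<beta>)"
    using B(2)
  proof (rule high_prob_mono)
    show "\<forall>\<^sub>F t in sequentially. \<forall>\<omega>\<in>space M. U t \<omega> \<le> ennreal B \<longrightarrow> (\<forall>\<beta>. \<bar>\<xi> t \<beta> \<omega>\<bar> \<le> B * norm \<beta>)"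
      using ev
    proof eventually_elim
      case (elim t)
      show ?case
      proof (intro ballI impI allI)
        fix \<omega> \<beta> assume \<omega>: "\<omega> \<in> space M" and le: "U t \<omega> \<le> ennreal B"
        show "\<bar>\<xi> t \<beta> \<omega>\<bar> \<le> B * norm \<beta>"
        proof (cases "\<beta> = 0")
          case True
          then show ?thesis using hom[of 0 t 0 \<omega>] by simp
        next
          case False
          have "ennreal \<bar>\<xi> t ((1 / norm \<beta>) *\<^sub>R \<beta>) \<omega>\<bar> \<le> ennreal B"
            using U(3)[OF elim \<omega>, of "(1 / norm \<beta>) *\<^sub>R \<beta>"] le False by (simp add: order_trans)
          then have "\<bar>\<xi> t ((1 / norm \<beta>) *\<^sub>R \<beta>) \<omega>\<bar> \<le> B" using B(1) by simp
          then show ?thesis using False by (simp add: hom abs_mult abs_divide field_simps)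
        qed
      qed
    qed
  qed
  with B(1) show ?thesis by blast
qed

text \<open>
  Peeling into the shells \<open>|h| \<le> 2 ^ j e\<close>. The relative increments on each shell have bounded
  expectation; the weights \<open>sqrt (1/2) ^ j\<close> make these summable, at the price of the factor \<open>sqrt (2 ^ j)\<close>,
  which is of the order \<open>sqrt (|h| / e)\<close>.
\<close>

lemma high_prob_local_modulus:
  fixes \<xi> :: "nat \<Rightarrow> real ^ 'n \<Rightarrow> 'a \<Rightarrow> real"
  assumes ev: "\<forall>\<^sub>F t in sequentially. lipschitz_moments M K (\<xi> t)" and K: "K \<ge> 0"
    and e: "\<And>t. e t > 0" and \<eta>: "\<eta> > 0"
  shows "\<exists>A>0. high_prob M \<eta> (\<lambda>t \<omega>. \<forall>h. e t \<le> norm h \<longrightarrow> \<bar>\<xi> t (x + h) \<omega> - \<xi> t x \<omega>\<bar> \<le> A * norm h * sqrt (norm h / e t))"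
proof -
  define S where "S = sup_const CARD('n) K"
  have c: "0 \<le> S" using K chain_const_nonneg[OF K] by (auto simp: sup_const_def S_def)
  define r where "r = sqrt (1/2 :: real)"
  have r: "0 < r" "r < 1" "r\<^sup>2 = 1/2" by (auto simp: r_def)
  have "\<exists>U. U \<in> borel_measurable M \<and> (lipschitz_moments M K (\<xi> t) \<longrightarrow> (\<integral>\<^sup>+\<omega>. U \<omega> \<partial>M) \<le> ennreal S \<and>
    (\<forall>\<omega>\<in>space M. \<forall>h. norm h \<le> 2 ^ j * e t \<longrightarrow> ennreal (\<bar>\<xi> t (x + h) \<omega> - \<xi> t x \<omega>\<bar> / (2 ^ j * e t)) \<le> U \<omega>))" for t j
  proof (cases "lipschitz_moments M K (\<xi> t)")
    case True
    then show ?thesis using lipschitz_moments_sup[OF True K, of "2 ^ j * e t" x] e by (auto simp: S_def)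
  qed (auto intro: exI[of _ "\<lambda>_. 0"])
  then obtain U where U: "\<And>t j. U t j \<in> borel_measurable M"
    "\<And>t j. lipschitz_moments M K (\<xi> t) \<Longrightarrow> (\<integral>\<^sup>+\<omega>. U t j \<omega> \<partial>M) \<le> ennreal S"
    "\<And>t j \<omega> h. lipschitz_moments M K (\<xi> t) \<Longrightarrow> \<omega> \<in> space M \<Longrightarrow> norm h \<le> 2 ^ j * e t \<Longrightarrow>
       ennreal (\<bar>\<xi> t (x + h) \<omega> - \<xi> t x \<omega>\<bar> / (2 ^ j * e t)) \<le> U t j \<omega>"
    by metis
  define V where "V t \<omega> = (\<Sum>j. ennreal (r ^ j) * U t j \<omega>)" for t \<omega>
  note [measurable] = U(1)
  have Vm: "V t \<in> borel_measurable M" for t unfolding V_def[abs_def] by measurable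
  have ev': "\<forall>\<^sub>F t in sequentially. (\<integral>\<^sup>+\<omega>. V t \<omega> \<partial>M) \<le> ennreal (S / (1 - r))"
    using ev
  proof eventually_elim
    case (elim t)
    have "(\<integral>\<^sup>+\<omega>. V t \<omega> \<partial>M) = (\<Sum>j. ennreal (r ^ j) * (\<integral>\<^sup>+\<omega>. U t j \<omega> \<partial>M))"
      unfolding V_def by (subst nn_integral_suminf) (auto simp: nn_integral_cmult)
    also have "\<dots> \<le> (\<Sum>j. ennreal (r ^ j) * ennreal S)"
      by (intro suminf_le mult_left_mono U elim) auto
    also have "\<dots> = (\<Sum>j. ennreal (r ^ j * S))" using r c by (simp add: ennreal_mult)
    also have "\<dots> = ennreal (\<Sum>j. r ^ j * S)"
      using r c by (intro suminf_ennreal2) (auto intro!: summable_mult2 summable_geometric)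
    also have "(\<Sum>j. r ^ j * S) = S / (1 - r)"
      using r by (simp add: suminf_mult2[symmetric] summable_geometric suminf_geometric)
    finally show ?case .
  qed
  have c': "S / (1 - r) \<ge> 0" using c r by simp
  obtain B where B: "B > 0" "high_prob M \<eta> (\<lambda>t \<omega>. V t \<omega> \<le> ennreal B)"
    using high_prob_tight[OF Vm ev' c' \<eta>] by blast
  define A where "A = 2 * sqrt 2 * B"
  have A: "A > 0" using B by (simp add: A_def)
  have "high_prob M \<eta> (\<lambda>t \<omega>. \<forall>h. e t \<le> norm h \<longrightarrow> \<bar>\<xi> t (x + h) \<omega> - \<xi> t x \<omega>\<bar> \<le> A * norm h * sqrt (norm h / e t))"
    using B(2)
  proof (rule high_prob_mono)
    show "\<forall>\<^sub>F t in sequentially. \<forall>\<omega>\<in>space M. V t \<omega> \<le> ennreal B \<longrightarrow>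
      (\<forall>h. e t \<le> norm h \<longrightarrow> \<bar>\<xi> t (x + h) \<omega> - \<xi> t x \<omega>\<bar> \<le> A * norm h * sqrt (norm h / e t))"
      using ev
    proof eventually_elim
      case (elim t)
      show ?case
      proof (intro ballI impI allI)
        fix \<omega> and h :: "real ^ 'n" assume \<omega>: "\<omega> \<in> space M" and le: "V t \<omega> \<le> ennreal B" and h: "e t \<le> norm h"
        have ex: "\<exists>j. norm h \<le> 2 ^ j * e t"
        proof -
          obtain j where "norm h / e t < 2 ^ j" using real_arch_pow[of 2 "norm h / e t"] by auto
          then show ?thesis using e[of t] by (intro exI[of _ j]) (simp add: field_simps)
        qed
        define j where "j = (LEAST j. norm h \<le> 2 ^ j * e t)"
        have j: "norm h \<le> 2 ^ j * e t" unfolding j_def using ex by (rule LeastI_ex)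
        have j2: "2 ^ j * e t \<le> 2 * norm h"
        proof (cases j)
          case 0
          then show ?thesis using h e[of t] by simp
        next
          case (Suc i)
          then have "\<not> norm h \<le> 2 ^ i * e t" using not_less_Least[of i "\<lambda>j. norm h \<le> 2 ^ j * e t"] by (simp add: j_def)
          then show ?thesis using Suc by simp
        qed
        define d where "d = \<bar>\<xi> t (x + h) \<omega> - \<xi> t x \<omega>\<bar>"
        have "ennreal (r ^ j * (d / (2 ^ j * e t))) = ennreal (r ^ j) * ennreal (d / (2 ^ j * e t))"
          using r e[of t] by (intro ennreal_mult) (auto simp: d_def)
        also have "\<dots> \<le> ennreal (r ^ j) * U t j \<omega>"
          unfolding d_def by (intro mult_left_mono U elim \<omega> j) auto
        also have "\<dots> \<le> V t \<omega>"
          unfolding V_def using sum_le_suminf[of "\<lambda>j. ennreal (r ^ j) * U t j \<omega>" "{j}"] by simp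
        also note le
        finally have "r ^ j * (d / (2 ^ j * e t)) \<le> B" using B(1) by simp
        moreover have rj: "1 / r ^ j = sqrt (2 ^ j)"
          by (simp add: r_def real_sqrt_divide real_sqrt_power power_divide)
        ultimately have "d \<le> B * (2 ^ j * e t) * sqrt (2 ^ j)"
          unfolding rj[symmetric] using r e[of t] by (simp add: field_simps)
        also have "\<dots> \<le> B * (2 * norm h) * sqrt (2 * norm h / e t)"
        proof (rule mult_mono)
          show "B * (2 ^ j * e t) \<le> B * (2 * norm h)"
            using j2 B by (intro mult_left_mono) auto
          show "sqrt (2 ^ j) \<le> sqrt (2 * norm h / e t)"
            using j2 e[of t] by (simp add: field_simps)
        qed (use B j2 e[of t] in auto)
        also have "\<dots> = A * norm h * sqrt (norm h / e t)"
          by (simp add: A_def real_sqrt_mult real_sqrt_divide)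
        finally show "\<bar>\<xi> t (x + h) \<omega> - \<xi> t x \<omega>\<bar> \<le> A * norm h * sqrt (norm h / e t)" by (simp add: d_def)
      qed
    qed
  qed
  with A show ?thesis by blast
qed

text \<open>
  A grid is fixed so fine that the oscillation below it is small with high probability; on the
  finitely many grid points the pointwise convergence is used.
\<close>

lemma high_prob_uniformly_small:
  fixes Y :: "nat \<Rightarrow> real ^ 'n \<Rightarrow> 'a \<Rightarrow> real"
  assumes ev: "\<forall>\<^sub>F t in sequentially. lipschitz_moments M K (Y t)" and K: "K \<ge> 0"
    and meas: "\<And>t h. Y t h \<in> borel_measurable M"
    and ptw: "\<And>h. (\<lambda>t. \<integral>\<^sup>+\<omega>. ennreal ((Y t h \<omega>)\<^sup>2) \<partial>M) \<longlonglongrightarrow> 0" and \<eta>: "\<eta> > 0" and \<kappa>: "\<kappa> > 0"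
  shows "high_prob M \<eta> (\<lambda>t \<omega>. \<forall>h. norm h \<le> 1 \<longrightarrow> \<bar>Y t h \<omega>\<bar> \<le> \<kappa>)"
proof -
  let ?C = "chain_const CARD('n) K"
  have C: "?C \<ge> 0" by (rule chain_const_nonneg[OF K])
  have "(\<lambda>m. ?C * sqrt (1/2) ^ m) \<longlonglongrightarrow> ?C * 0"
    by (intro tendsto_intros LIMSEQ_realpow_zero) auto
  moreover have "?C * 0 < (\<eta> / 2) * (\<kappa> / 2)" using \<eta> \<kappa> by simp
  ultimately have "\<forall>\<^sub>F m in sequentially. ?C * sqrt (1/2) ^ m < (\<eta> / 2) * (\<kappa> / 2)"
    by (rule order_tendstoD)
  then obtain m where m: "?C * sqrt (1/2) ^ m < (\<eta> / 2) * (\<kappa> / 2)" by (auto simp: eventually_sequentially)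
  have "\<exists>U. U \<in> borel_measurable M \<and> (lipschitz_moments M K (Y t) \<longrightarrow> (\<integral>\<^sup>+\<omega>. U \<omega> \<partial>M) \<le> ennreal (?C * sqrt (1/2) ^ m) \<and>
    (\<forall>\<omega>\<in>space M. \<forall>h. norm h \<le> 1 \<longrightarrow> ennreal \<bar>Y t h \<omega> - Y t (dyadic_floor m h) \<omega>\<bar> \<le> U \<omega>))" for t
  proof (cases "lipschitz_moments M K (Y t)")
    case True
    then show ?thesis using dyadic_chaining[of "Y t" K m] K unfolding lipschitz_moments_def by auto
  qed (auto intro: exI[of _ "\<lambda>_. 0"])
  then obtain U where U: "\<And>t. U t \<in> borel_measurable M"
    "\<And>t. lipschitz_moments M K (Y t) \<Longrightarrow> (\<integral>\<^sup>+\<omega>. U t \<omega> \<partial>M) \<le> ennreal (?C * sqrt (1/2) ^ m)"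
    "\<And>t \<omega> h. lipschitz_moments M K (Y t) \<Longrightarrow> \<omega> \<in> space M \<Longrightarrow> norm h \<le> 1 \<Longrightarrow>
      ennreal \<bar>Y t h \<omega> - Y t (dyadic_floor m h) \<omega>\<bar> \<le> U t \<omega>"
    by metis
  have ev': "\<forall>\<^sub>F t in sequentially. (\<integral>\<^sup>+\<omega>. U t \<omega> \<partial>M) \<le> ennreal ((\<eta> / 2) * (\<kappa> / 2))"
    using ev by eventually_elim (rule order_trans[OF U(2) ennreal_leI[OF less_imp_le[OF m]]])
  have osc: "high_prob M (\<eta> / 2) (\<lambda>t \<omega>. U t \<omega> \<le> ennreal (\<kappa> / 2))"
    using high_prob_markov[OF U(1) ev', of "\<kappa> / 2"] \<eta> \<kappa> by simp
  have grid: "high_prob M (\<eta> / 2) (\<lambda>t \<omega>. \<forall>g\<in>dyadic_grid m. ennreal ((Y t g \<omega>)\<^sup>2) \<le> ennreal ((\<kappa> / 2)\<^sup>2))"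
  proof (rule high_prob_finite_all)
    fix g and \<eta>' :: real assume "\<eta>' > 0"
    then show "high_prob M \<eta>' (\<lambda>t \<omega>. ennreal ((Y t g \<omega>)\<^sup>2) \<le> ennreal ((\<kappa> / 2)\<^sup>2))"
      using \<kappa> meas by (intro high_prob_tendsto_0 ptw) auto
  qed (use \<eta> in auto)
  have "high_prob M (\<eta> / 2 + \<eta> / 2) (\<lambda>t \<omega>. \<forall>h. norm h \<le> 1 \<longrightarrow> \<bar>Y t h \<omega>\<bar> \<le> \<kappa>)"
    using high_prob_conj[OF osc grid]
  proof (rule high_prob_mono)
    show "\<forall>\<^sub>F t in sequentially. \<forall>\<omega>\<in>space M. U t \<omega> \<le> ennreal (\<kappa> / 2) \<and>
      (\<forall>g\<in>dyadic_grid m. ennreal ((Y t g \<omega>)\<^sup>2) \<le> ennreal ((\<kappa> / 2)\<^sup>2)) \<longrightarrow> (\<forall>h. norm h \<le> 1 \<longrightarrow> \<bar>Y t h \<omega>\<bar> \<le> \<kappa>)"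
      using ev
    proof eventually_elim
      case (elim t)
      show ?case
      proof (intro ballI impI allI, elim conjE)
        fix \<omega> and h :: "real ^ 'n" assume \<omega>: "\<omega> \<in> space M" and h: "norm h \<le> 1" and u: "U t \<omega> \<le> ennreal (\<kappa> / 2)"
          and g: "\<forall>g\<in>dyadic_grid m. ennreal ((Y t g \<omega>)\<^sup>2) \<le> ennreal ((\<kappa> / 2)\<^sup>2)"
        have "ennreal \<bar>Y t h \<omega> - Y t (dyadic_floor m h) \<omega>\<bar> \<le> ennreal (\<kappa> / 2)"
          using U(3)[OF elim \<omega> h] u by (rule order_trans)
        then have 1: "\<bar>Y t h \<omega> - Y t (dyadic_floor m h) \<omega>\<bar> \<le> \<kappa> / 2" using \<kappa> by simp
        have "ennreal ((Y t (dyadic_floor m h) \<omega>)\<^sup>2) \<le> ennreal ((\<kappa> / 2)\<^sup>2)"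
          using g dyadic_floor_in_grid[OF h] by blast
        then have "(Y t (dyadic_floor m h) \<omega>)\<^sup>2 \<le> (\<kappa> / 2)\<^sup>2" by simp
        then have "\<bar>Y t (dyadic_floor m h) \<omega>\<bar> \<le> \<kappa> / 2" using \<kappa> by (simp add: abs_le_square_iff[symmetric])
        with 1 show "\<bar>Y t h \<omega>\<bar> \<le> \<kappa>" by linarith
      qed
    qed
  qed
  then show ?thesis by simp
qed

end

section \<open>Multinomial resampling\<close>

definition boot_sum :: "nat \<Rightarrow> (nat \<Rightarrow> nat) \<Rightarrow> (nat \<Rightarrow> real) \<Rightarrow> real" where
  "boot_sum t w g = (\<Sum>\<tau>=1..t. (real (w \<tau>) - 1) * g \<tau>) / sqrt (real t)"

definition counts :: "nat \<Rightarrow> (nat \<Rightarrow> 'c) \<Rightarrow> 'c \<Rightarrow> nat" where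
  "counts t I c = card {j. j < t \<and> I j = c}"

definition emp_mean :: "nat \<Rightarrow> (nat \<Rightarrow> real) \<Rightarrow> real" where
  "emp_mean t g = (\<Sum>\<tau>=1..t. g \<tau>) / real t"

definition emp_var :: "nat \<Rightarrow> (nat \<Rightarrow> real) \<Rightarrow> real" where
  "emp_var t g = emp_mean t (\<lambda>\<tau>. (g \<tau> - emp_mean t g)\<^sup>2)"

abbreviation resample_pmf :: "nat \<Rightarrow> (nat \<Rightarrow> nat) pmf" where
  "resample_pmf t \<equiv> Pi_pmf {..<t} undefined (\<lambda>_. pmf_of_set {1..t})"

abbreviation weights_pmf :: "nat \<Rightarrow> (nat \<Rightarrow> nat) pmf" where
  "weights_pmf t \<equiv> multinomial_pmf t (pmf_of_set {1..t})"

lemma weights_pmf_eq: "weights_pmf t = map_pmf (counts t) (resample_pmf t)"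
  by (simp add: multinomial_pmf_def counts_def[abs_def])

lemma resample_in_range:
  assumes "I \<in> set_pmf (resample_pmf t)" "j < t"
  shows "I j \<in> {1..t}"
proof -
  have "t > 0" using assms(2) by simp
  then have "set_pmf (pmf_of_set {1..t}) = {1..t}" by (intro set_pmf_of_set) auto
  with assms show ?thesis by (auto simp: set_Pi_pmf PiE_dflt_def)
qed

lemma sum_counts:
  fixes g :: "nat \<Rightarrow> real"
  assumes "\<And>j. j < t \<Longrightarrow> I j \<in> {1..t}"
  shows "(\<Sum>\<tau>=1..t. real (counts t I \<tau>) * g \<tau>) = (\<Sum>j<t. g (I j))"
proof -
  have "(\<Sum>j<t. g (I j)) = (\<Sum>\<tau>\<in>{1..t}. \<Sum>j\<in>{j\<in>{..<t}. I j = \<tau>}. g (I j))"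
    by (rule sum.group[symmetric]) (use assms in auto)
  also have "\<dots> = (\<Sum>\<tau>\<in>{1..t}. real (counts t I \<tau>) * g \<tau>)"
    by (intro sum.cong) (auto simp: counts_def)
  finally show ?thesis ..
qed

lemma sum_weights_eq:
  assumes "w \<in> set_pmf (weights_pmf t)"
  shows "(\<Sum>\<tau>=1..t. real (w \<tau>)) = real t"
proof -
  from assms obtain I where I: "I \<in> set_pmf (resample_pmf t)" "w = counts t I"
    unfolding weights_pmf_eq set_map_pmf by blast
  show ?thesis using sum_counts[of t I "\<lambda>_. 1"] resample_in_range[OF I(1)] by (simp add: I(2))
qed

text \<open>
  The contribution of the \<open>j\<close>-th resampling draw. It is set to \<open>0\<close> on the null event that the drawn
  index lies outside the sample, so that it is bounded everywhere.
\<close>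

definition resampled_dev :: "nat \<Rightarrow> (nat \<Rightarrow> real) \<Rightarrow> nat \<Rightarrow> (nat \<Rightarrow> nat) \<Rightarrow> real" where
  "resampled_dev t g j I = (if I j \<in> {1..t} then g (I j) - emp_mean t g else 0)"

text \<open>
  The multinomial weights are dependent, but they count independent uniform draws. Grouping by draws
  instead of by sample points turns the weighted sum into a sum of independent centred terms.
\<close>

lemma boot_sum_counts:
  assumes "I \<in> set_pmf (resample_pmf t)" "t > 0"
  shows "boot_sum t (counts t I) g = (\<Sum>j<t. resampled_dev t g j I) / sqrt (real t)"
proof -
  have "(\<Sum>j<t. resampled_dev t g j I) = (\<Sum>j<t. g (I j) - emp_mean t g)"
    using resample_in_range[OF assms(1)] by (intro sum.cong) (auto simp: resampled_dev_def)
  also have "\<dots> = (\<Sum>j<t. g (I j)) - (\<Sum>\<tau>=1..t. g \<tau>)"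
    using assms(2) by (simp add: sum_subtractf emp_mean_def)
  also have "(\<Sum>j<t. g (I j)) = (\<Sum>\<tau>=1..t. real (counts t I \<tau>) * g \<tau>)"
    using sum_counts[of t I g] resample_in_range[OF assms(1)] by simp
  finally show ?thesis by (simp add: boot_sum_def sum_subtractf left_diff_distrib)
qed

lemma expectation_resampled:
  assumes t: "t > 0" and j: "j < t"
  shows "measure_pmf.expectation (resample_pmf t) (\<lambda>I. if I j \<in> {1..t} then f (I j) else 0) = emp_mean t f"
proof -
  have "map_pmf (\<lambda>I. I j) (resample_pmf t) = pmf_of_set {1..t}"
    using j by (simp add: Pi_pmf_component)
  moreover have "measure_pmf.expectation (map_pmf (\<lambda>I. I j) (resample_pmf t)) (\<lambda>k. if k \<in> {1..t} then f k else 0)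
      = measure_pmf.expectation (resample_pmf t) (\<lambda>I. if I j \<in> {1..t} then f (I j) else 0)"
    by (rule integral_map_pmf)
  ultimately have "measure_pmf.expectation (resample_pmf t) (\<lambda>I. if I j \<in> {1..t} then f (I j) else 0) =
      measure_pmf.expectation (pmf_of_set {1..t}) (\<lambda>k. if k \<in> {1..t} then f k else 0)"
    by (simp only:)
  also have "\<dots> = (\<Sum>k\<in>{1..t}. if k \<in> {1..t} then f k else 0) / real (card {1..t})"
    using t by (intro integral_pmf_of_set) auto
  also have "\<dots> = emp_mean t f" by (simp add: emp_mean_def)
  finally show ?thesis .
qed

lemma emp_mean_abs_le:
  assumes "\<And>\<tau>. \<tau> \<in> {1..t} \<Longrightarrow> \<bar>g \<tau>\<bar> \<le> c" "t > 0"
  shows "\<bar>emp_mean t g\<bar> \<le> c"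
proof -
  have "\<bar>\<Sum>\<tau>=1..t. g \<tau>\<bar> \<le> (\<Sum>\<tau>=1..t. c)"
    by (rule order_trans[OF sum_abs sum_mono]) (use assms in auto)
  then show ?thesis using assms(2) by (simp add: emp_mean_def abs_divide divide_le_eq mult.commute)
qed

lemma resampled_dev_facts:
  assumes t: "t > 0" and g: "\<And>\<tau>. \<tau> \<in> {1..t} \<Longrightarrow> \<bar>g \<tau>\<bar> \<le> c"
  shows "prob_space.indep_vars (resample_pmf t) (\<lambda>_. borel) (resampled_dev t g) {..<t}"
    and "\<bar>resampled_dev t g j I\<bar> \<le> 2 * c"
    and "j < t \<Longrightarrow> measure_pmf.expectation (resample_pmf t) (resampled_dev t g j) = 0"
    and "j < t \<Longrightarrow> measure_pmf.expectation (resample_pmf t) (\<lambda>I. (resampled_dev t g j I)\<^sup>2) = emp_var t g"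
proof -
  have "prob_space.indep_vars (resample_pmf t) (\<lambda>_. count_space UNIV) (\<lambda>x f. f x) {..<t}"
    by (rule indep_vars_Pi_pmf) simp
  from prob_space.indep_vars_compose2[OF prob_space_measure_pmf this, where Y="\<lambda>_ k. if k \<in> {1..t} then g k - emp_mean t g else 0" and N="\<lambda>_. borel"]
  show "prob_space.indep_vars (resample_pmf t) (\<lambda>_. borel) (resampled_dev t g) {..<t}"
    unfolding resampled_dev_def[abs_def] by simp
  have m: "\<bar>emp_mean t g\<bar> \<le> c" by (rule emp_mean_abs_le[OF _ t]) (rule g)
  show "\<bar>resampled_dev t g j I\<bar> \<le> 2 * c"
    using m g[of "I j"] by (auto simp: resampled_dev_def)
  show "measure_pmf.expectation (resample_pmf t) (resampled_dev t g j) = 0" if "j < t"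
    using expectation_resampled[OF t that, of "\<lambda>k. g k - emp_mean t g"] t
    by (simp add: resampled_dev_def[abs_def] emp_mean_def sum_subtractf)
  have "(\<lambda>I. (resampled_dev t g j I)\<^sup>2) = (\<lambda>I. if I j \<in> {1..t} then (g (I j) - emp_mean t g)\<^sup>2 else 0)"
    by (auto simp: resampled_dev_def)
  then show "measure_pmf.expectation (resample_pmf t) (\<lambda>I. (resampled_dev t g j I)\<^sup>2) = emp_var t g" if "j < t"
    using expectation_resampled[OF t that, of "\<lambda>k. (g k - emp_mean t g)\<^sup>2"] by (simp add: emp_var_def)
qed

lemma emp_var_eq: "t > 0 \<Longrightarrow> emp_var t g = emp_mean t (\<lambda>\<tau>. (g \<tau>)\<^sup>2) - (emp_mean t g)\<^sup>2"
proof -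
  assume t: "t > 0"
  define m where "m = emp_mean t g"
  have s: "(\<Sum>\<tau>=1..t. g \<tau>) = real t * m" using t by (simp add: m_def emp_mean_def)
  have "(\<Sum>\<tau>=1..t. (g \<tau> - m)\<^sup>2) = (\<Sum>\<tau>=1..t. (g \<tau>)\<^sup>2) - 2 * m * (\<Sum>\<tau>=1..t. g \<tau>) + real t * m\<^sup>2"
    by (simp add: power2_diff sum.distrib sum_subtractf sum_distrib_left mult_ac)
  also have "\<dots> = (\<Sum>\<tau>=1..t. (g \<tau>)\<^sup>2) - real t * m\<^sup>2" unfolding s by (simp add: power2_eq_square)
  finally show ?thesis unfolding emp_var_def m_def[symmetric] using t
    by (simp add: emp_mean_def diff_divide_distrib)
qed

lemma nn_integral_boot_sum:
  assumes "t > 0"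
  shows "(\<integral>\<^sup>+w. f (boot_sum t w g) \<partial>weights_pmf t) =
    (\<integral>\<^sup>+I. f ((\<Sum>j<t. resampled_dev t g j I) / sqrt (real t)) \<partial>resample_pmf t)"
  unfolding weights_pmf_eq nn_integral_map_pmf
  by (intro nn_integral_cong_AE AE_pmfI) (use boot_sum_counts assms in auto)

lemma boot_sum_moment_le:
  assumes t: "t > 0" and g: "\<And>\<tau>. \<tau> \<in> {1..t} \<Longrightarrow> \<bar>g \<tau>\<bar> \<le> c" and k: "even k" "k > 0"
  shows "(\<integral>\<^sup>+w. ennreal ((boot_sum t w g) ^ k) \<partial>weights_pmf t) \<le> ennreal (4 * fact k * (2 * c) ^ k)"
proof -
  note F = resampled_dev_facts[of t g c, OF t g]
  show ?thesis
    unfolding nn_integral_boot_sum[OF t, of "\<lambda>x. ennreal (x ^ k)"]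
    using prob_space.normalized_sum_moment_le[OF prob_space_measure_pmf _ _ F(1,2,3) k] t by simp
qed

lemma boot_sum_second_moment_le:
  assumes t: "t > 0"
  shows "(\<integral>\<^sup>+w. ennreal ((boot_sum t w g)\<^sup>2) \<partial>weights_pmf t) \<le> ennreal (emp_mean t (\<lambda>\<tau>. (g \<tau>)\<^sup>2))"
proof -
  define c where "c = Max ((\<lambda>\<tau>. \<bar>g \<tau>\<bar>) ` {1..t})"
  have g: "\<bar>g \<tau>\<bar> \<le> c" if "\<tau> \<in> {1..t}" for \<tau> unfolding c_def using that by (intro Max_ge) auto
  note F = resampled_dev_facts[of t g c, OF t g]
  have b: "\<bar>\<Sum>j<t. resampled_dev t g j I\<bar> \<le> real t * (2 * c)" for I
    by (rule order_trans[OF sum_abs]) (use F(2) sum_bounded_above[of "{..<t}" "\<lambda>j. \<bar>resampled_dev t g j I\<bar>" "2 * c"] in simp)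
  have b2: "(\<Sum>j<t. resampled_dev t g j I)\<^sup>2 \<le> (real t * (2 * c))\<^sup>2" for I
    using b[of I] by (metis abs_ge_zero power2_abs power_mono)
  have int: "integrable (resample_pmf t) (\<lambda>I. (\<Sum>j<t. resampled_dev t g j I)\<^sup>2)"
    by (rule measure_pmf.integrable_const_bound[of _ "(real t * (2 * c))\<^sup>2"]) (use b2 in auto)
  have "measure_pmf.expectation (resample_pmf t) (\<lambda>I. (\<Sum>j<t. resampled_dev t g j I)\<^sup>2) = real t * emp_var t g"
    using prob_space.expectation_sum_centred_square[OF prob_space_measure_pmf _ F(1,2,3)] F(4) by simp
  then have "(\<integral>\<^sup>+I. ennreal (((\<Sum>j<t. resampled_dev t g j I) / sqrt (real t))\<^sup>2) \<partial>resample_pmf t) = ennreal (emp_var t g)"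
    using t int by (subst nn_integral_eq_integral) (auto simp: power_divide)
  also have "\<dots> \<le> ennreal (emp_mean t (\<lambda>\<tau>. (g \<tau>)\<^sup>2))"
    using emp_var_eq[OF t] by (intro ennreal_leI) simp
  finally show ?thesis unfolding nn_integral_boot_sum[OF t, of "\<lambda>x. ennreal (x\<^sup>2)"] .
qed

lemma char_boot_sum:
  assumes t: "t > 0" and g: "\<And>\<tau>. \<tau> \<in> {1..t} \<Longrightarrow> \<bar>g \<tau>\<bar> \<le> c" and \<sigma>2: "\<sigma>2 \<ge> 0"
  shows "norm (measure_pmf.expectation (weights_pmf t) (\<lambda>w. cis (boot_sum t w g)) - complex_of_real (exp (- \<sigma>2 / 2)))
    \<le> (2 * c) ^ 3 / (6 * sqrt t) + \<bar>emp_var t g - \<sigma>2\<bar> / 2 + \<sigma>2\<^sup>2 / (8 * t)"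
proof -
  note F = resampled_dev_facts[of t g c, OF t g]
  have "measure_pmf.expectation (weights_pmf t) (\<lambda>w. cis (boot_sum t w g)) = measure_pmf.expectation (resample_pmf t) (\<lambda>I. cis ((\<Sum>j<t. resampled_dev t g j I) / sqrt (real t)))"
    unfolding weights_pmf_eq integral_map_pmf
  proof (rule integral_cong_AE)
    show "AE I in resample_pmf t. cis (boot_sum t (counts t I) g) = cis ((\<Sum>j<t. resampled_dev t g j I) / sqrt (real t))"
      by (rule AE_pmfI) (simp only: boot_sum_counts[OF _ t])
  qed simp_all
  then show ?thesis
    using prob_space.char_normalized_iid_sum[OF prob_space_measure_pmf _ _ t F(1,2,3,4) \<sigma>2] by simp
qed

section \<open>The sample and its resampling weights\<close>

lemma boot_sum_cong: "(\<And>\<tau>. \<tau> \<in> {1..t} \<Longrightarrow> f \<tau> = g \<tau>) \<Longrightarrow> boot_sum t w f = boot_sum t w g"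
  unfolding boot_sum_def by (intro arg_cong2[of _ _ _ _ "(/)"] sum.cong) auto

locale sampling = prob_space M
  for M :: "'w measure" +
  fixes N :: "'a measure" and s :: "'a \<Rightarrow> real" and X :: "nat \<Rightarrow> 'w \<Rightarrow> 'a" and W :: "nat \<Rightarrow> 'w \<Rightarrow> nat \<Rightarrow> nat"
  assumes s_measurable [measurable]: "s \<in> borel_measurable N"
    and s_nonneg: "\<And>\<theta>. \<theta> \<in> space N \<Longrightarrow> 0 \<le> s \<theta>"
    and draws_density: "\<And>\<tau>. 1 \<le> \<tau> \<Longrightarrow> distributed M N (X \<tau>) (\<lambda>\<theta>. ennreal (s \<theta>))"
    and draws_indep: "indep_vars (\<lambda>_. N) X {1..}"
    and weights_measurable: "\<And>t. 1 \<le> t \<Longrightarrow> W t \<in> measurable M (count_space UNIV)"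
    and weights_law: "\<And>t. 1 \<le> t \<Longrightarrow> distr M (count_space UNIV) (W t) = measure_pmf (weights_pmf t)"
    and weights_indep: "\<And>t. 1 \<le> t \<Longrightarrow>
          indep_set (sets (data_algebra M N t X)) (sets (vimage_algebra (space M) (W t) (count_space UNIV)))"
begin

text \<open>
  The common law of the draws.
\<close>

definition P :: "'a measure" where "P = density N (\<lambda>\<theta>. ennreal (s \<theta>))"

lemma sets_P [measurable_cong, simp]: "sets P = sets N" and space_P [simp]: "space P = space N"
  by (simp_all add: P_def)

lemma X_measurable: "1 \<le> \<tau> \<Longrightarrow> X \<tau> \<in> measurable M N"
  using draws_density by (rule distributed_measurable)

lemma distr_X: "1 \<le> \<tau> \<Longrightarrow> distr M N (X \<tau>) = P"
  unfolding P_def using draws_density by (rule distributed_distr_eq_density)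

sublocale P: prob_space P
proof -
  have "prob_space (distr M N (X 1))" by (rule prob_space_distr) (rule X_measurable, simp)
  then show "prob_space P" by (simp add: distr_X)
qed

lemma supply_expectation_eq: "g \<in> borel_measurable N \<Longrightarrow> supply_expectation N s g = (\<integral>\<theta>. g \<theta> \<partial>P)"
  unfolding supply_expectation_def P_def
  by (subst integral_real_density) (auto simp: mult.commute s_nonneg intro!: AE_I2)

lemma expectation_X:
  fixes g :: "'a \<Rightarrow> 'b::{banach, second_countable_topology}"
  shows "1 \<le> \<tau> \<Longrightarrow> g \<in> borel_measurable N \<Longrightarrow> expectation (\<lambda>\<omega>. g (X \<tau> \<omega>)) = (\<integral>\<theta>. g \<theta> \<partial>P)"
  using integral_distr[of "X \<tau>" M N g] by (simp add: X_measurable distr_X)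

lemma X_in_space: "1 \<le> \<tau> \<Longrightarrow> \<omega> \<in> space M \<Longrightarrow> X \<tau> \<omega> \<in> space N"
  using measurable_space[OF X_measurable] by blast

lemma data_vec_measurable: "data_vec t X \<in> measurable M (PiM {1..t} (\<lambda>_. N))"
  unfolding data_vec_def[abs_def] by (rule measurable_restrict) (rule X_measurable, simp)

lemma data_vec_eq: "\<tau> \<in> {1..t} \<Longrightarrow> data_vec t X \<omega> \<tau> = X \<tau> \<omega>"
  by (simp add: data_vec_def)

lemma joint_law:
  assumes t: "1 \<le> t"
  shows "distr M (PiM {1..t} (\<lambda>_. N) \<Otimes>\<^sub>M count_space UNIV) (\<lambda>\<omega>. (data_vec t X \<omega>, W t \<omega>))
    = distr M (PiM {1..t} (\<lambda>_. N)) (data_vec t X) \<Otimes>\<^sub>M measure_pmf (weights_pmf t)"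
proof -
  let ?D = "PiM {1..t} (\<lambda>_. N)"
  note dm = data_vec_measurable[of t] and wm = weights_measurable[OF t]
  let ?J = "distr M (?D \<Otimes>\<^sub>M count_space UNIV) (\<lambda>\<omega>. (data_vec t X \<omega>, W t \<omega>))"
  have pm: "(\<lambda>\<omega>. (data_vec t X \<omega>, W t \<omega>)) \<in> measurable M (?D \<Otimes>\<^sub>M count_space UNIV)"
    using dm wm by (rule measurable_Pair)
  interpret D: prob_space "distr M ?D (data_vec t X)" by (rule prob_space_distr[OF dm])
  show ?thesis
  proof (rule pair_measure_eqI[symmetric])
    show "sigma_finite_measure (distr M ?D (data_vec t X))" ..
    show "sigma_finite_measure (measure_pmf (weights_pmf t))" ..
    show "sets (distr M ?D (data_vec t X) \<Otimes>\<^sub>M measure_pmf (weights_pmf t)) = sets ?J"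
      by (simp only: sets_distr) (intro sets_pair_measure_cong, auto)
    fix A B assume A: "A \<in> sets (distr M ?D (data_vec t X))" and "B \<in> sets (measure_pmf (weights_pmf t))"
    let ?A = "data_vec t X -` A \<inter> space M" and ?B = "W t -` B \<inter> space M"
    have "?A \<in> sets (data_algebra M N t X)" "?B \<in> sets (vimage_algebra (space M) (W t) (count_space UNIV))"
      unfolding data_algebra_def using A by (auto intro!: in_vimage_algebra)
    then have "prob (?A \<inter> ?B) = prob ?A * prob ?B" by (rule indep_setD[OF weights_indep[OF t]])
    moreover have "emeasure (distr M ?D (data_vec t X)) A = ennreal (prob ?A)"
      using A dm by (simp add: emeasure_distr emeasure_eq_measure)
    moreover have "emeasure (measure_pmf (weights_pmf t)) B = ennreal (prob ?B)"
      unfolding weights_law[OF t, symmetric] using wm by (simp add: emeasure_distr emeasure_eq_measure)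
    moreover have "emeasure ?J (A \<times> B) = ennreal (prob (?A \<inter> ?B))"
    proof -
      have "emeasure ?J (A \<times> B) = emeasure M ((\<lambda>\<omega>. (data_vec t X \<omega>, W t \<omega>)) -` (A \<times> B) \<inter> space M)"
        by (rule emeasure_distr[OF pm]) (use A in auto)
      also have "(\<lambda>\<omega>. (data_vec t X \<omega>, W t \<omega>)) -` (A \<times> B) \<inter> space M = ?A \<inter> ?B" by auto
      finally show ?thesis by (simp add: emeasure_eq_measure)
    qed
    ultimately show "emeasure (distr M ?D (data_vec t X)) A * emeasure (measure_pmf (weights_pmf t)) B = emeasure ?J (A \<times> B)"
      by (simp add: ennreal_mult)
  qed
qed

text \<open>
  As weights and data are independent, conditioning on the data means integrating over the weights with
  the data held fixed.
\<close>

lemma nn_integral_data_weights: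
  assumes t: "1 \<le> t" and f: "f \<in> borel_measurable (PiM {1..t} (\<lambda>_. N) \<Otimes>\<^sub>M count_space UNIV)"
  shows "(\<integral>\<^sup>+\<omega>. f (data_vec t X \<omega>, W t \<omega>) \<partial>M) = (\<integral>\<^sup>+\<omega>. (\<integral>\<^sup>+w. f (data_vec t X \<omega>, w) \<partial>weights_pmf t) \<partial>M)"
proof -
  let ?D = "PiM {1..t} (\<lambda>_. N)"
  note dm = data_vec_measurable[of t] and wm = weights_measurable[OF t]
  have pm: "(\<lambda>\<omega>. (data_vec t X \<omega>, W t \<omega>)) \<in> measurable M (?D \<Otimes>\<^sub>M count_space UNIV)"
    using dm wm by (rule measurable_Pair)
  have f': "f \<in> borel_measurable (distr M ?D (data_vec t X) \<Otimes>\<^sub>M measure_pmf (weights_pmf t))"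
  proof -
    have "sets (distr M ?D (data_vec t X) \<Otimes>\<^sub>M measure_pmf (weights_pmf t)) = sets (?D \<Otimes>\<^sub>M count_space UNIV)"
      by (intro sets_pair_measure_cong) auto
    then show ?thesis using f by (simp cong: measurable_cong_sets)
  qed
  have "(\<integral>\<^sup>+\<omega>. f (data_vec t X \<omega>, W t \<omega>) \<partial>M) = (\<integral>\<^sup>+z. f z \<partial>distr M (?D \<Otimes>\<^sub>M count_space UNIV) (\<lambda>\<omega>. (data_vec t X \<omega>, W t \<omega>)))"
    by (rule nn_integral_distr[symmetric, OF pm]) (use f in simp)
  also have "\<dots> = (\<integral>\<^sup>+x. (\<integral>\<^sup>+w. f (x, w) \<partial>weights_pmf t) \<partial>distr M ?D (data_vec t X))"
    unfolding joint_law[OF t] by (rule measure_pmf.nn_integral_fst[symmetric]) (use f' in simp)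
  also have "\<dots> = (\<integral>\<^sup>+\<omega>. (\<integral>\<^sup>+w. f (data_vec t X \<omega>, w) \<partial>weights_pmf t) \<partial>M)"
  proof (rule nn_integral_distr[OF dm])
    show "(\<lambda>x. \<integral>\<^sup>+w. f (x, w) \<partial>weights_pmf t) \<in> borel_measurable (distr M ?D (data_vec t X))"
      by (rule measure_pmf.borel_measurable_nn_integral_fst[OF f'])
  qed
  finally show ?thesis .
qed

lemma boot_sum_measurable [measurable]:
  assumes [measurable]: "g \<in> borel_measurable N"
  shows "(\<lambda>z. boot_sum t (snd z) (\<lambda>\<tau>. g (fst z \<tau>))) \<in> borel_measurable (PiM {1..t} (\<lambda>_. N) \<Otimes>\<^sub>M count_space UNIV)"
proof -
  let ?S = "PiM {1..t} (\<lambda>_. N) \<Otimes>\<^sub>M count_space UNIV"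
  have 1: "(\<lambda>z. real (snd z \<tau>)) \<in> borel_measurable ?S" for \<tau>
    by (rule measurable_compose[OF measurable_snd]) simp
  have 2: "(\<lambda>z. g (fst z \<tau>)) \<in> borel_measurable ?S" if "\<tau> \<in> {1..t}" for \<tau>
    using that by measurable
  show ?thesis unfolding boot_sum_def
    by (intro borel_measurable_divide borel_measurable_sum borel_measurable_times borel_measurable_diff 1 2) auto
qed

lemma boot_sum_data: "boot_sum t w (\<lambda>\<tau>. g (X \<tau> \<omega>)) = boot_sum t w (\<lambda>\<tau>. g (data_vec t X \<omega> \<tau>))"
  by (rule boot_sum_cong) (simp add: data_vec_eq)

lemma nn_integral_boot_sum_joint:
  assumes t: "1 \<le> t" and g: "g \<in> borel_measurable N" and [measurable]: "f \<in> borel_measurable borel"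
  shows "(\<integral>\<^sup>+\<omega>. ennreal (f (boot_sum t (W t \<omega>) (\<lambda>\<tau>. g (X \<tau> \<omega>)))) \<partial>M) =
    (\<integral>\<^sup>+\<omega>. (\<integral>\<^sup>+w. ennreal (f (boot_sum t w (\<lambda>\<tau>. g (X \<tau> \<omega>)))) \<partial>weights_pmf t) \<partial>M)"
  unfolding boot_sum_data
  using nn_integral_data_weights[OF t, of "\<lambda>z. ennreal (f (boot_sum t (snd z) (\<lambda>\<tau>. g (fst z \<tau>))))"] boot_sum_measurable[OF g, of t]
  by simp

definition samp_dev :: "nat \<Rightarrow> 'w \<Rightarrow> ('a \<Rightarrow> real) \<Rightarrow> real" where
  "samp_dev t \<omega> g = (\<Sum>\<tau>=1..t. g (X \<tau> \<omega>) - (\<integral>\<theta>. g \<theta> \<partial>P)) / sqrt (real t)"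

definition boot_dev :: "nat \<Rightarrow> 'w \<Rightarrow> ('a \<Rightarrow> real) \<Rightarrow> real" where
  "boot_dev t \<omega> g = boot_sum t (W t \<omega>) (\<lambda>\<tau>. g (X \<tau> \<omega>))"

lemma samp_dev_measurable [measurable]:
  assumes [measurable]: "g \<in> borel_measurable N"
  shows "(\<lambda>\<omega>. samp_dev t \<omega> g) \<in> borel_measurable M"
  unfolding samp_dev_def
  by (intro borel_measurable_divide borel_measurable_sum borel_measurable_diff measurable_compose[OF X_measurable assms] borel_measurable_const) auto

lemma boot_dev_measurable:
  assumes g: "g \<in> borel_measurable N" and t: "1 \<le> t"
  shows "(\<lambda>\<omega>. boot_dev t \<omega> g) \<in> borel_measurable M"
  unfolding boot_dev_def boot_sum_data
  using measurable_compose[OF measurable_Pair[OF data_vec_measurable weights_measurable[OF t]] boot_sum_measurable[OF g, of t]] by simp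

lemma samp_dev_terms:
  fixes g :: "'a \<Rightarrow> real"
  assumes g: "g \<in> borel_measurable N" and b: "\<And>\<theta>. \<theta> \<in> space N \<Longrightarrow> \<bar>g \<theta>\<bar> \<le> c"
  shows "indep_vars (\<lambda>_. borel) (\<lambda>\<tau> \<omega>. g (X \<tau> \<omega>) - (\<integral>\<theta>. g \<theta> \<partial>P)) {1..t}"
    and "\<tau> \<in> {1..t} \<Longrightarrow> \<omega> \<in> space M \<Longrightarrow> \<bar>g (X \<tau> \<omega>) - (\<integral>\<theta>. g \<theta> \<partial>P)\<bar> \<le> 2 * c"
    and "\<tau> \<in> {1..t} \<Longrightarrow> expectation (\<lambda>\<omega>. g (X \<tau> \<omega>) - (\<integral>\<theta>. g \<theta> \<partial>P)) = 0"
    and "\<tau> \<in> {1..t} \<Longrightarrow> expectation (\<lambda>\<omega>. (g (X \<tau> \<omega>) - (\<integral>\<theta>. g \<theta> \<partial>P))\<^sup>2) \<le> (\<integral>\<theta>. (g \<theta>)\<^sup>2 \<partial>P)"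
proof -
  define m where "m = (\<integral>\<theta>. g \<theta> \<partial>P)"
  note [measurable] = g
  have ig: "integrable P g" using b by (intro P.integrable_const_bound[of _ c] AE_I2) auto
  have g2: "(g \<theta>)\<^sup>2 \<le> c\<^sup>2" if "\<theta> \<in> space N" for \<theta> using b[OF that] by (metis abs_ge_zero power2_abs power_mono)
  have ig2: "integrable P (\<lambda>\<theta>. (g \<theta>)\<^sup>2)" using g2 by (intro P.integrable_const_bound[of _ "c\<^sup>2"] AE_I2) auto
  have m: "\<bar>m\<bar> \<le> c"
  proof -
    have "\<bar>m\<bar> \<le> (\<integral>\<theta>. \<bar>g \<theta>\<bar> \<partial>P)" unfolding m_def by (rule integral_abs_bound)
    also have "\<dots> \<le> c" using ig b by (intro P.integral_le_const) (auto intro!: AE_I2)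
    finally show ?thesis .
  qed
  have "indep_vars (\<lambda>_. N) X {1..t}" by (rule indep_vars_subset[OF draws_indep]) auto
  from indep_vars_compose2[OF this, where Y="\<lambda>_ x. g x - m" and N="\<lambda>_. borel"]
  show "indep_vars (\<lambda>_. borel) (\<lambda>\<tau> \<omega>. g (X \<tau> \<omega>) - (\<integral>\<theta>. g \<theta> \<partial>P)) {1..t}"
    unfolding m_def[symmetric] by simp
  show "\<bar>g (X \<tau> \<omega>) - (\<integral>\<theta>. g \<theta> \<partial>P)\<bar> \<le> 2 * c" if "\<tau> \<in> {1..t}" "\<omega> \<in> space M"
    using b[OF X_in_space[of \<tau> \<omega>]] that m unfolding m_def[symmetric] by auto
  show "expectation (\<lambda>\<omega>. g (X \<tau> \<omega>) - (\<integral>\<theta>. g \<theta> \<partial>P)) = 0" if "\<tau> \<in> {1..t}"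
    unfolding m_def[symmetric] using expectation_X[of \<tau> "\<lambda>x. g x - m"] that ig
    by (simp add: P.prob_space[unfolded space_P] m_def)
  have "expectation (\<lambda>\<omega>. (g (X \<tau> \<omega>) - m)\<^sup>2) = (\<integral>\<theta>. (g \<theta> - m)\<^sup>2 \<partial>P)" if "\<tau> \<in> {1..t}"
    using expectation_X[of \<tau> "\<lambda>x. (g x - m)\<^sup>2"] that by simp
  moreover have "(\<integral>\<theta>. (g \<theta> - m)\<^sup>2 \<partial>P) = (\<integral>\<theta>. (g \<theta>)\<^sup>2 \<partial>P) - m\<^sup>2"
    using P.variance_eq[OF ig ig2] unfolding m_def .
  ultimately show "expectation (\<lambda>\<omega>. (g (X \<tau> \<omega>) - (\<integral>\<theta>. g \<theta> \<partial>P))\<^sup>2) \<le> (\<integral>\<theta>. (g \<theta>)\<^sup>2 \<partial>P)" if "\<tau> \<in> {1..t}"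
    unfolding m_def[symmetric] using that by simp
qed

lemma samp_dev_moment_le:
  assumes g: "g \<in> borel_measurable N" and b: "\<And>\<theta>. \<theta> \<in> space N \<Longrightarrow> \<bar>g \<theta>\<bar> \<le> c" and t: "1 \<le> t" and k: "even k" "k > 0"
  shows "(\<integral>\<^sup>+\<omega>. ennreal ((samp_dev t \<omega> g) ^ k) \<partial>M) \<le> ennreal (4 * fact k * (2 * c) ^ k)"
proof -
  note T = samp_dev_terms[OF g b, where t=t]
  have "(\<integral>\<^sup>+\<omega>. ennreal (((\<Sum>\<tau>\<in>{1..t}. g (X \<tau> \<omega>) - (\<integral>\<theta>. g \<theta> \<partial>P)) / sqrt (card {1..t})) ^ k) \<partial>M) \<le> ennreal (4 * fact k * (2 * c) ^ k)"
    by (rule normalized_sum_moment_le[OF _ _ T(1) _ _ k]) (use t T(2,3) in auto)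
  then show ?thesis by (simp add: samp_dev_def)
qed

lemma samp_dev_second_moment_le:
  assumes g: "g \<in> borel_measurable N" and b: "\<And>\<theta>. \<theta> \<in> space N \<Longrightarrow> \<bar>g \<theta>\<bar> \<le> c" and t: "1 \<le> t"
  shows "(\<integral>\<^sup>+\<omega>. ennreal ((samp_dev t \<omega> g)\<^sup>2) \<partial>M) \<le> ennreal (\<integral>\<theta>. (g \<theta>)\<^sup>2 \<partial>P)"
proof -
  note T = samp_dev_terms[OF g b, where t=t]
  let ?Y = "\<lambda>\<tau> \<omega>. g (X \<tau> \<omega>) - (\<integral>\<theta>. g \<theta> \<partial>P)"
  have Sm: "(\<lambda>\<omega>. samp_dev t \<omega> g) \<in> borel_measurable M" by (rule samp_dev_measurable[OF g])
  have "expectation (\<lambda>\<omega>. (\<Sum>\<tau>\<in>{1..t}. ?Y \<tau> \<omega>)\<^sup>2) = (\<Sum>\<tau>\<in>{1..t}. expectation (\<lambda>\<omega>. (?Y \<tau> \<omega>)\<^sup>2))"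
    by (rule expectation_sum_centred_square[OF _ T(1,2,3)]) auto
  also have "\<dots> \<le> (\<Sum>\<tau>\<in>{1..t}. (\<integral>\<theta>. (g \<theta>)\<^sup>2 \<partial>P))" by (intro sum_mono T(4))
  finally have le: "expectation (\<lambda>\<omega>. (\<Sum>\<tau>\<in>{1..t}. ?Y \<tau> \<omega>)\<^sup>2) \<le> real t * (\<integral>\<theta>. (g \<theta>)\<^sup>2 \<partial>P)" by simp
  have b1: "\<bar>samp_dev t \<omega> g\<bar> \<le> real t * (2 * c) / sqrt t" if "\<omega> \<in> space M" for \<omega>
  proof -
    have "\<bar>\<Sum>\<tau>\<in>{1..t}. ?Y \<tau> \<omega>\<bar> \<le> (\<Sum>\<tau>\<in>{1..t}. 2 * c)"
      by (rule order_trans[OF sum_abs sum_mono]) (use T(2) that in auto)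
    then show ?thesis by (simp add: samp_dev_def abs_divide divide_right_mono)
  qed
  have sq: "x\<^sup>2 \<le> d\<^sup>2" if "\<bar>x\<bar> \<le> d" for x d :: real using that by (metis abs_ge_zero power2_abs power_mono)
  have int: "integrable M (\<lambda>\<omega>. (samp_dev t \<omega> g)\<^sup>2)"
  proof (rule integrable_const_bound[of _ "(real t * (2 * c) / sqrt t)\<^sup>2"])
    show "AE \<omega> in M. norm ((samp_dev t \<omega> g)\<^sup>2) \<le> (real t * (2 * c) / sqrt t)\<^sup>2"
      by (rule AE_I2, drule b1, drule sq) simp
    show "(\<lambda>\<omega>. (samp_dev t \<omega> g)\<^sup>2) \<in> borel_measurable M" using Sm by simp
  qed
  have "(\<integral>\<^sup>+\<omega>. ennreal ((samp_dev t \<omega> g)\<^sup>2) \<partial>M) = ennreal (expectation (\<lambda>\<omega>. (samp_dev t \<omega> g)\<^sup>2))"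
    by (rule nn_integral_eq_integral[OF int]) auto
  also have "expectation (\<lambda>\<omega>. (samp_dev t \<omega> g)\<^sup>2) = expectation (\<lambda>\<omega>. (\<Sum>\<tau>\<in>{1..t}. ?Y \<tau> \<omega>)\<^sup>2) / t"
    unfolding samp_dev_def using t by (simp add: power_divide)
  also have "\<dots> \<le> (\<integral>\<theta>. (g \<theta>)\<^sup>2 \<partial>P)" using le t by (simp add: divide_le_eq mult.commute)
  finally show ?thesis by (simp add: ennreal_leI)
qed

text \<open>
  The conditional moment bound does not involve the data beyond the bound on \<open>g\<close>, so it is preserved by
  integration over the data.
\<close>

lemma boot_dev_moment_le:
  assumes g: "g \<in> borel_measurable N" and b: "\<And>\<theta>. \<theta> \<in> space N \<Longrightarrow> \<bar>g \<theta>\<bar> \<le> c" and t: "1 \<le> t" and k: "even k" "k > 0"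
  shows "(\<integral>\<^sup>+\<omega>. ennreal ((boot_dev t \<omega> g) ^ k) \<partial>M) \<le> ennreal (4 * fact k * (2 * c) ^ k)"
proof -
  have "(\<integral>\<^sup>+\<omega>. ennreal ((boot_dev t \<omega> g) ^ k) \<partial>M) = (\<integral>\<^sup>+\<omega>. (\<integral>\<^sup>+w. ennreal ((boot_sum t w (\<lambda>\<tau>. g (X \<tau> \<omega>))) ^ k) \<partial>weights_pmf t) \<partial>M)"
    unfolding boot_dev_def by (rule nn_integral_boot_sum_joint[OF t g]) simp
  also have "\<dots> \<le> (\<integral>\<^sup>+\<omega>. ennreal (4 * fact k * (2 * c) ^ k) \<partial>M)"
    using t k b X_in_space by (intro nn_integral_mono boot_sum_moment_le) auto
  finally show ?thesis by (simp add: emeasure_space_1)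
qed

lemma boot_dev_second_moment_le:
  assumes g: "g \<in> borel_measurable N" and b: "\<And>\<theta>. \<theta> \<in> space N \<Longrightarrow> \<bar>g \<theta>\<bar> \<le> c" and t: "1 \<le> t"
  shows "(\<integral>\<^sup>+\<omega>. ennreal ((boot_dev t \<omega> g)\<^sup>2) \<partial>M) \<le> ennreal (\<integral>\<theta>. (g \<theta>)\<^sup>2 \<partial>P)"
proof -
  note [measurable] = g
  have g2: "\<bar>(g \<theta>)\<^sup>2\<bar> \<le> c\<^sup>2" if "\<theta> \<in> space N" for \<theta>
    using b[OF that] by (metis abs_ge_zero abs_power2 power2_abs power_mono)
  have int: "integrable M (\<lambda>\<omega>. (g (X \<tau> \<omega>))\<^sup>2)" if "\<tau> \<in> {1..t}" for \<tau>
    using g2 X_in_space[of \<tau>] X_measurable[of \<tau>] that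
    by (intro integrable_const_bound[of _ "c\<^sup>2"] AE_I2) auto
  have "(\<integral>\<^sup>+\<omega>. ennreal ((boot_dev t \<omega> g)\<^sup>2) \<partial>M) = (\<integral>\<^sup>+\<omega>. (\<integral>\<^sup>+w. ennreal ((boot_sum t w (\<lambda>\<tau>. g (X \<tau> \<omega>)))\<^sup>2) \<partial>weights_pmf t) \<partial>M)"
    unfolding boot_dev_def by (rule nn_integral_boot_sum_joint[OF t g]) simp
  also have "\<dots> \<le> (\<integral>\<^sup>+\<omega>. ennreal (emp_mean t (\<lambda>\<tau>. (g (X \<tau> \<omega>))\<^sup>2)) \<partial>M)"
    using t by (intro nn_integral_mono boot_sum_second_moment_le) auto
  also have "\<dots> = ennreal (expectation (\<lambda>\<omega>. emp_mean t (\<lambda>\<tau>. (g (X \<tau> \<omega>))\<^sup>2)))"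
    unfolding emp_mean_def using int
    by (intro nn_integral_eq_integral integrable_divide Bochner_Integration.integrable_sum) (auto intro!: divide_nonneg_nonneg sum_nonneg)
  also have "expectation (\<lambda>\<omega>. emp_mean t (\<lambda>\<tau>. (g (X \<tau> \<omega>))\<^sup>2)) = (\<Sum>\<tau>=1..t. expectation (\<lambda>\<omega>. (g (X \<tau> \<omega>))\<^sup>2)) / t"
    unfolding emp_mean_def using int by simp
  also have "\<dots> = (\<Sum>\<tau>=1..t. (\<integral>\<theta>. (g \<theta>)\<^sup>2 \<partial>P)) / t"
    by (intro arg_cong2[of _ _ _ _ "(/)"] sum.cong expectation_X[where g="\<lambda>x. (g x)\<^sup>2"]) auto
  also have "\<dots> = (\<integral>\<theta>. (g \<theta>)\<^sup>2 \<partial>P)" using t by simp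
  finally show ?thesis .
qed

lemma AE_sum_weights: "1 \<le> t \<Longrightarrow> AE \<omega> in M. (\<Sum>\<tau>=1..t. real (W t \<omega> \<tau>)) = real t"
proof -
  assume t: "1 \<le> t"
  have "AE w in distr M (count_space UNIV) (W t). (\<Sum>\<tau>=1..t. real (w \<tau>)) = real t"
    unfolding weights_law[OF t] by (rule AE_pmfI) (rule sum_weights_eq)
  then show ?thesis by (subst (asm) AE_distr_iff[OF weights_measurable[OF t]]) auto
qed

end

section \<open>Regular conditional distributions\<close>

lemma rational_INF_eq:
  fixes c :: real
  shows "(INF q\<in>\<rat>. if c < q then ereal q else \<infinity>) = ereal c"
proof (rule antisym)
  show "ereal c \<le> (INF q\<in>\<rat>. if c < q then ereal q else \<infinity>)"
    by (rule INF_greatest) auto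
  show "(INF q\<in>\<rat>. if c < q then ereal q else \<infinity>) \<le> ereal c"
  proof (rule dense_ge)
    fix y assume "ereal c < y"
    then obtain r where r: "ereal c < ereal r" "ereal r < y" using ereal_dense2 by blast
    then obtain q where q: "q \<in> \<rat>" "c < q" "q < r" using Rats_dense_in_real[of c r] by auto
    have "(INF q\<in>\<rat>. if c < q then ereal q else \<infinity>) \<le> (if c < q then ereal q else \<infinity>)"
      by (rule INF_lower[OF q(1)])
    also have "\<dots> \<le> y" using q r less_trans[of "ereal q" "ereal r" y] by simp
    finally show "(INF q\<in>\<rat>. if c < q then ereal q else \<infinity>) \<le> y" .
  qed
qed

text \<open>
  Each sublevel set of \<open>f\<close> is the preimage of some measurable set \<open>A q\<close>. Rational levels suffice to recover
  the factor as \<open>F y = inf {q. y \<in> A q}\<close>.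
\<close>

lemma doob_dynkin_real:
  fixes f :: "'b \<Rightarrow> real"
  assumes g: "g \<in> \<Omega> \<rightarrow> space S" and f: "f \<in> borel_measurable (vimage_algebra \<Omega> g S)"
  shows "\<exists>F. F \<in> borel_measurable S \<and> (\<forall>x\<in>\<Omega>. f x = F (g x))"
proof -
  have "\<exists>A\<in>sets S. {x \<in> \<Omega>. f x < q} = g -` A \<inter> \<Omega>" for q
  proof -
    have "{x \<in> space (vimage_algebra \<Omega> g S). f x < q} \<in> sets (vimage_algebra \<Omega> g S)"
      using f by measurable
    then show ?thesis using sets_vimage_algebra2[OF g] by auto
  qed
  then obtain A where A: "\<And>q. A q \<in> sets S" "\<And>q. {x \<in> \<Omega>. f x < q} = g -` A q \<inter> \<Omega>" by metis
  define G where "G y = (INF q\<in>\<rat>. if y \<in> A q then ereal q else \<infinity>)" for y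
  have Gm: "G \<in> borel_measurable S"
    unfolding G_def[abs_def]
  proof (rule borel_measurable_INF)
    show "countable (\<rat> :: real set)" by (rule countable_rat)
    fix q :: real
    show "(\<lambda>y. if y \<in> A q then ereal q else \<infinity>) \<in> borel_measurable S"
      using A(1)[of q] by (intro measurable_If_set) auto
  qed
  show ?thesis
  proof (intro exI conjI ballI)
    show "(\<lambda>y. real_of_ereal (G y)) \<in> borel_measurable S" using Gm by simp
    fix x assume x: "x \<in> \<Omega>"
    have iff: "g x \<in> A q \<longleftrightarrow> f x < q" for q using A(2)[of q] x by auto
    have "G (g x) = ereal (f x)" unfolding G_def iff by (rule rational_INF_eq)
    then show "f x = real_of_ereal (G (g x))" by simp
  qed
qed

lemma doob_dynkin_cart:
  fixes f :: "'b \<Rightarrow> real ^ 'n"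
  assumes g: "g \<in> \<Omega> \<rightarrow> space S" and f: "f \<in> borel_measurable (vimage_algebra \<Omega> g S)"
  shows "\<exists>F\<in>borel_measurable S. \<forall>x\<in>\<Omega>. f x = F (g x)"
proof -
  have "\<exists>F. F \<in> borel_measurable S \<and> (\<forall>x\<in>\<Omega>. f x $ i = F (g x))" for i
  proof -
    have "(\<lambda>x. f x $ i) \<in> borel_measurable (vimage_algebra \<Omega> g S)"
      by (rule measurable_compose[OF f]) measurable
    from doob_dynkin_real[OF g this] show ?thesis .
  qed
  then obtain F where F: "\<And>i. F i \<in> borel_measurable S" "\<And>i x. x \<in> \<Omega> \<Longrightarrow> f x $ i = F i (g x)" by metis
  have "(\<lambda>y. \<chi> i. F i y) \<in> borel_measurable S"
  proof (rule borel_measurable_euclidean_space[THEN iffD2], rule ballI)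
    fix b :: "real ^ 'n" assume "b \<in> Basis"
    then obtain i where "b = axis i 1" by (auto simp: Basis_vec_def)
    then show "(\<lambda>y. (\<chi> i. F i y) \<bullet> b) \<in> borel_measurable S" using F(1)[of i] by (simp add: inner_axis)
  qed
  moreover have "\<forall>x\<in>\<Omega>. f x = (\<chi> i. F i (g x))" using F(2) by (simp add: vec_eq_iff)
  ultimately show ?thesis by (intro bexI[of _ "\<lambda>y. \<chi> i. F i y"]) auto
qed

text \<open>
  Two families of measures that almost surely agree on each single set of a countable generator that is
  stable under intersections almost surely agree.
\<close>

lemma countable_generator_borel:
  "\<exists>E :: 'b::second_countable_topology set set. countable E \<and> Int_stable E \<and> UNIV \<in> E \<and> E \<subseteq> sets borel \<and> sets borel = sigma_sets UNIV E"
proof -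
  obtain B :: "'b set set" where B: "countable B" "topological_basis B" using ex_countable_basis by blast
  define E where "E = Inter ` {F. finite F \<and> F \<subseteq> B}"
  have op: "open X" if "X \<in> E" for X
    using that B(2) unfolding E_def by (auto intro!: open_Inter simp: topological_basis_open)
  have "countable E" unfolding E_def using countable_Collect_finite_subset[OF B(1)] by auto
  moreover have "Int_stable E"
  proof (rule Int_stableI)
    fix a b assume "a \<in> E" "b \<in> E"
    then obtain F G where "a = \<Inter> F" "b = \<Inter> G" "finite F" "finite G" "F \<subseteq> B" "G \<subseteq> B" by (auto simp: E_def)
    then show "a \<inter> b \<in> E" unfolding E_def by (intro image_eqI[of _ _ "F \<union> G"]) auto
  qed
  moreover have "UNIV \<in> E" unfolding E_def by (intro image_eqI[of _ _ "{}"]) auto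
  moreover have Eb: "E \<subseteq> sets borel" using op by auto
  moreover have "sets borel = sigma_sets UNIV E"
  proof
    have "B \<subseteq> E" unfolding E_def by (auto intro!: image_eqI[of _ _ "{x}" for x])
    then have "sigma_sets UNIV B \<subseteq> sigma_sets UNIV E" by (rule sigma_sets_mono')
    moreover have "sets borel = sigma_sets UNIV B"
      unfolding borel_eq_countable_basis[OF B] by (rule sets_measure_of) simp
    ultimately show "sets borel \<subseteq> sigma_sets UNIV E" by simp
    show "sigma_sets UNIV E \<subseteq> sets borel" using Eb by (metis sets.sigma_sets_subset space_borel)
  qed
  ultimately show ?thesis by blast
qed

text \<open>
  Both laws are images of the same \<open>p\<close>, hence coupled. The alternative \<open>2 \<le> d w\<close> is harmless because functions in
  \<open>BL1\<close> never differ by more than \<open>2\<close>; it permits the truncation \<open>d = min 2 (norm (\<Phi> - R))\<close>.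
\<close>

lemma BL_dist_coupling_le:
  fixes L :: "(real ^ 'n) measure"
  assumes L: "prob_space L" "sets L = sets borel" and \<Phi>R: "\<And>w. w \<in> set_pmf p \<Longrightarrow> norm (\<Phi> w - R w) \<le> d w \<or> 2 \<le> d w"
    and d: "integrable (measure_pmf p) d" "\<And>w. 0 \<le> d w"
  shows "BL_dist (distr (measure_pmf p) borel \<Phi>) L \<le> (\<integral>w. d w \<partial>p) + BL_dist (distr (measure_pmf p) borel R) L"
proof (rule BL_dist_le)
  fix f :: "real ^ 'n \<Rightarrow> real" assume f: "f \<in> BL1"
  note fm = BL1_measurable[OF f]
  have fb: "\<bar>f x\<bar> \<le> 1" and fl: "\<bar>f x - f y\<bar> \<le> norm (x - y)" for x y using f by (auto simp: BL1_def)
  interpret L: prob_space L by fact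
  have ab: "\<bar>\<integral>x. g x \<partial>Q\<bar> \<le> 1" if "prob_space Q" "sets Q = sets borel" "g \<in> BL1" for Q and g :: "real ^ 'n \<Rightarrow> real"
  proof -
    interpret Q: prob_space Q by fact
    have "\<bar>\<integral>x. g x \<partial>Q\<bar> \<le> (\<integral>x. \<bar>g x\<bar> \<partial>Q)" by (rule integral_abs_bound)
    also have "\<dots> \<le> 1"
    proof (rule Q.integral_le_const)
      have "integrable Q g"
        using that(3) BL1_measurable[OF that(3)] that(2)
        by (intro Q.integrable_const_bound[of _ 1] AE_I2) (auto simp: BL1_def cong: measurable_cong_sets)
      then show "integrable Q (\<lambda>x. \<bar>g x\<bar>)" by simp
      show "AE x in Q. \<bar>g x\<bar> \<le> 1" using that(3) by (auto simp: BL1_def)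
    qed
    finally show ?thesis .
  qed
  have pR: "prob_space (distr (measure_pmf p) borel R)"
    by (rule measure_pmf.prob_space_distr) simp
  have "\<bar>(\<integral>x. f x \<partial>distr (measure_pmf p) borel R) - (\<integral>x. f x \<partial>L)\<bar> \<le> BL_dist (distr (measure_pmf p) borel R) L"
    unfolding BL_dist_def
  proof (rule cSUP_upper[OF f])
    show "bdd_above ((\<lambda>f. \<bar>(\<integral>x. f x \<partial>distr (measure_pmf p) borel R) - (\<integral>x. f x \<partial>L)\<bar>) ` BL1)"
    proof (rule bdd_aboveI[of _ 2], clarify)
      fix g :: "real ^ 'n \<Rightarrow> real" assume "g \<in> BL1"
      then show "\<bar>(\<integral>x. g x \<partial>distr (measure_pmf p) borel R) - (\<integral>x. g x \<partial>L)\<bar> \<le> 2"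
        using ab[OF pR _ \<open>g \<in> BL1\<close>] ab[OF L \<open>g \<in> BL1\<close>] by simp
    qed
  qed
  moreover have "\<bar>(\<integral>x. f x \<partial>distr (measure_pmf p) borel \<Phi>) - (\<integral>x. f x \<partial>distr (measure_pmf p) borel R)\<bar> \<le> (\<integral>w. d w \<partial>p)"
  proof -
    have i: "integrable (measure_pmf p) (\<lambda>w. f (h w))" for h
      using fb by (intro measure_pmf.integrable_const_bound[of _ 1]) auto
    have "\<bar>(\<integral>x. f x \<partial>distr (measure_pmf p) borel \<Phi>) - (\<integral>x. f x \<partial>distr (measure_pmf p) borel R)\<bar> = \<bar>\<integral>w. f (\<Phi> w) - f (R w) \<partial>p\<bar>"
      using fm i by (simp add: integral_distr)
    also have "\<dots> \<le> (\<integral>w. \<bar>f (\<Phi> w) - f (R w)\<bar> \<partial>p)" by (rule integral_abs_bound)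
    also have "\<dots> \<le> (\<integral>w. d w \<partial>p)"
    proof (rule integral_mono_AE)
      show "AE w in measure_pmf p. \<bar>f (\<Phi> w) - f (R w)\<bar> \<le> d w"
      proof (rule AE_pmfI)
        fix w assume "w \<in> set_pmf p"
        then show "\<bar>f (\<Phi> w) - f (R w)\<bar> \<le> d w"
          using \<Phi>R[of w] fl[of "\<Phi> w" "R w"] fb[of "\<Phi> w"] fb[of "R w"] by linarith
      qed
    qed (use i d in auto)
    finally show ?thesis .
  qed
  ultimately show "\<bar>(\<integral>x. f x \<partial>distr (measure_pmf p) borel \<Phi>) - (\<integral>x. f x \<partial>L)\<bar> \<le> (\<integral>w. d w \<partial>p) + BL_dist (distr (measure_pmf p) borel R) L"
    by linarith
qed

context sampling
begin

lemma data_vec_in_space: "data_vec t X \<in> space M \<rightarrow> space (PiM {1..t} (\<lambda>_. N))"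
  using measurable_space[OF data_vec_measurable] by auto

lemma subalgebra_data: "subalgebra M (data_algebra M N t X)"
  unfolding subalgebra_def
proof
  show "space (data_algebra M N t X) = space M" by (simp add: data_algebra_def)
  show "sets (data_algebra M N t X) \<subseteq> sets M"
    unfolding data_algebra_def sets_vimage_algebra2[OF data_vec_in_space]
    using measurable_sets[OF data_vec_measurable] by auto
qed

text \<open>
  Freezing the data and integrating out the independent weights yields a version of the conditional
  distribution. Versions agree almost surely on each Borel set, hence simultaneously on a countable generator.
\<close>

lemma cond_distr_eq_kernel:
  fixes Z :: "'w \<Rightarrow> real ^ 'n"
  assumes t: "1 \<le> t" and K: "is_cond_distr M (data_algebra M N t X) Z K"
    and \<Phi>: "\<Phi> \<in> borel_measurable (PiM {1..t} (\<lambda>_. N) \<Otimes>\<^sub>M count_space UNIV)"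
    and Z: "\<And>\<omega>. \<omega> \<in> space M \<Longrightarrow> Z \<omega> = \<Phi> (data_vec t X \<omega>, W t \<omega>)"
  shows "AE \<omega> in M. K \<omega> = distr (measure_pmf (weights_pmf t)) borel (\<lambda>w. \<Phi> (data_vec t X \<omega>, w))"
proof -
  let ?D = "PiM {1..t} (\<lambda>_. N)" and ?G = "data_algebra M N t X"
  let ?\<mu> = "measure_pmf (weights_pmf t)"
  let ?Q = "\<lambda>\<omega>. distr ?\<mu> borel (\<lambda>w. \<Phi> (data_vec t X \<omega>, w))"
  interpret S: finite_measure_subalgebra M ?G
    by unfold_locales (rule subalgebra_data)
  note dm = data_vec_measurable[of t] and wm = weights_measurable[OF t]
  have pm [measurable]: "(\<lambda>\<omega>. (data_vec t X \<omega>, W t \<omega>)) \<in> measurable M (?D \<Otimes>\<^sub>M count_space UNIV)"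
    using dm wm by (rule measurable_Pair)
  have dG: "data_vec t X \<in> measurable ?G ?D"
    unfolding data_algebra_def by (rule measurable_vimage_algebra1[OF data_vec_in_space])
  have Kp: "prob_space (K \<omega>)" "sets (K \<omega>) = sets borel" if "\<omega> \<in> space M" for \<omega>
  proof -
    have "K \<omega> \<in> space (prob_algebra borel)"
      using K that measurable_space[of K ?G "prob_algebra borel" \<omega>] by (simp add: is_cond_distr_def data_algebra_def)
    then show "prob_space (K \<omega>)" "sets (K \<omega>) = sets borel" by (auto simp: space_prob_algebra)
  qed
  have ae: "AE \<omega> in M. measure (K \<omega>) A = measure (?Q \<omega>) A" if A: "A \<in> sets borel" for A
  proof -
    define q where "q x = measure ?\<mu> {w. \<Phi> (x, w) \<in> A}" for x
    have qe: "ennreal (q x) = (\<integral>\<^sup>+w. indicator A (\<Phi> (x, w)) \<partial>?\<mu>)" for x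
    proof -
      have "(\<integral>\<^sup>+w. indicator A (\<Phi> (x, w)) \<partial>?\<mu>) = (\<integral>\<^sup>+w. indicator {w. \<Phi> (x, w) \<in> A} w \<partial>?\<mu>)"
        by (intro nn_integral_cong) (auto simp: indicator_def)
      then show ?thesis by (simp add: q_def measure_pmf.emeasure_eq_measure)
    qed
    have im: "(\<lambda>z. indicator A (\<Phi> z) :: ennreal) \<in> borel_measurable (?D \<Otimes>\<^sub>M count_space UNIV)"
      using \<Phi> A by measurable
    then have im': "(\<lambda>z. indicator A (\<Phi> z) :: ennreal) \<in> borel_measurable (?D \<Otimes>\<^sub>M ?\<mu>)"
    proof -
      have "sets (?D \<Otimes>\<^sub>M ?\<mu>) = sets (?D \<Otimes>\<^sub>M count_space UNIV)"
        by (intro sets_pair_measure_cong) auto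
      with im show ?thesis by (simp cong: measurable_cong_sets)
    qed
    have "(\<lambda>x. ennreal (q x)) \<in> borel_measurable ?D"
      unfolding qe using measure_pmf.borel_measurable_nn_integral_fst[OF im'] by simp
    then have "(\<lambda>x. enn2real (ennreal (q x))) \<in> borel_measurable ?D" by measurable
    moreover have "(\<lambda>x. enn2real (ennreal (q x))) = q" by (auto simp: q_def)
    ultimately have qm: "q \<in> borel_measurable ?D" by (simp only:)
    have qG: "(\<lambda>\<omega>. q (data_vec t X \<omega>)) \<in> borel_measurable ?G" by (rule measurable_compose[OF dG qm])
    have qM: "(\<lambda>\<omega>. q (data_vec t X \<omega>)) \<in> borel_measurable M" by (rule measurable_compose[OF dm qm])
    have q01: "0 \<le> q x" "q x \<le> 1" for x by (auto simp: q_def)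
    have Zm: "Z \<in> borel_measurable M"
      using measurable_compose[OF pm \<Phi>] by (rule measurable_cong[THEN iffD1, rotated]) (simp add: Z)
    have i1: "integrable M (\<lambda>\<omega>. indicator A (Z \<omega>) :: real)"
      using Zm A by (intro integrable_const_bound[of _ 1]) auto
    have i2: "integrable M (\<lambda>\<omega>. q (data_vec t X \<omega>))"
      using q01 qM by (intro integrable_const_bound[of _ 1]) auto
    have "AE \<omega> in M. real_cond_exp M ?G (\<lambda>\<omega>. indicator A (Z \<omega>)) \<omega> = q (data_vec t X \<omega>)"
    proof (rule S.real_cond_exp_charact[OF _ i1 i2 qG])
      fix B assume "B \<in> sets ?G"
      then obtain C where C: "C \<in> sets ?D" "B = data_vec t X -` C \<inter> space M"
        unfolding data_algebra_def sets_vimage_algebra2[OF data_vec_in_space] by auto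
      have Bm: "B \<in> sets M" unfolding C(2) using C(1) dm by (rule measurable_sets[rotated])
      have "(\<integral>\<^sup>+\<omega>. ennreal (indicator B \<omega> * indicator A (Z \<omega>)) \<partial>M) = (\<integral>\<^sup>+\<omega>. indicator C (data_vec t X \<omega>) * indicator A (\<Phi> (data_vec t X \<omega>, W t \<omega>)) \<partial>M)"
        by (intro nn_integral_cong) (auto simp: Z C(2) indicator_def)
      also have "\<dots> = (\<integral>\<^sup>+\<omega>. (\<integral>\<^sup>+w. indicator C (data_vec t X \<omega>) * indicator A (\<Phi> (data_vec t X \<omega>, w)) \<partial>?\<mu>) \<partial>M)"
      proof -
        have "(\<lambda>z. indicator C (fst z) * indicator A (\<Phi> z) :: ennreal) \<in> borel_measurable (?D \<Otimes>\<^sub>M count_space UNIV)"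
          using C(1) im by measurable
        from nn_integral_data_weights[OF t this] show ?thesis by simp
      qed
      also have "\<dots> = (\<integral>\<^sup>+\<omega>. ennreal (indicator B \<omega> * q (data_vec t X \<omega>)) \<partial>M)"
      proof (rule nn_integral_cong)
        fix \<omega> assume \<omega>: "\<omega> \<in> space M"
        have "(\<integral>\<^sup>+w. indicator C (data_vec t X \<omega>) * indicator A (\<Phi> (data_vec t X \<omega>, w)) \<partial>?\<mu>)
            = indicator C (data_vec t X \<omega>) * ennreal (q (data_vec t X \<omega>))"
          unfolding qe by (rule nn_integral_cmult) simp
        also have "\<dots> = ennreal (indicator B \<omega> * q (data_vec t X \<omega>))"
          using \<omega> by (simp add: C(2) split: split_indicator)
        finally show "(\<integral>\<^sup>+w. indicator C (data_vec t X \<omega>) * indicator A (\<Phi> (data_vec t X \<omega>, w)) \<partial>?\<mu>) = ennreal (indicator B \<omega> * q (data_vec t X \<omega>))" .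
      qed
      finally have eq: "(\<integral>\<^sup>+\<omega>. ennreal (indicator B \<omega> * indicator A (Z \<omega>)) \<partial>M) = (\<integral>\<^sup>+\<omega>. ennreal (indicator B \<omega> * q (data_vec t X \<omega>)) \<partial>M)" .
      have "(\<integral>\<omega>. indicator B \<omega> * indicator A (Z \<omega>) \<partial>M) = enn2real (\<integral>\<^sup>+\<omega>. ennreal (indicator B \<omega> * indicator A (Z \<omega>)) \<partial>M)"
        using Bm Zm A by (intro integral_eq_nn_integral) auto
      also have "\<dots> = (\<integral>\<omega>. indicator B \<omega> * q (data_vec t X \<omega>) \<partial>M)"
        unfolding eq using Bm qM q01 by (intro integral_eq_nn_integral[symmetric]) auto
      finally show "(\<integral>\<omega>\<in>B. indicator A (Z \<omega>) \<partial>M) = (\<integral>\<omega>\<in>B. q (data_vec t X \<omega>) \<partial>M)"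
        by (simp add: set_lebesgue_integral_def)
    qed
    moreover have "AE \<omega> in M. measure (K \<omega>) A = real_cond_exp M ?G (\<lambda>\<omega>. indicator A (Z \<omega>)) \<omega>"
      using K A by (simp add: is_cond_distr_def)
    moreover have "measure (?Q \<omega>) A = q (data_vec t X \<omega>)" for \<omega>
      using A by (simp add: measure_distr q_def vimage_def)
    ultimately show ?thesis by (auto elim: eventually_elim2)
  qed
  obtain E :: "(real ^ 'n) set set" where E: "countable E" "Int_stable E" "UNIV \<in> E" "E \<subseteq> sets borel" "sets borel = sigma_sets UNIV E"
    using countable_generator_borel by blast
  have "AE \<omega> in M. \<forall>A\<in>E. measure (K \<omega>) A = measure (?Q \<omega>) A"
    using E(1,4) ae by (subst AE_ball_countable) auto
  then show ?thesis
  proof (rule AE_mp, intro AE_I2 impI)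
    fix \<omega> assume \<omega>: "\<omega> \<in> space M" and eq: "\<forall>A\<in>E. measure (K \<omega>) A = measure (?Q \<omega>) A"
    interpret K: prob_space "K \<omega>" by (rule Kp(1)[OF \<omega>])
    interpret Q: prob_space "?Q \<omega>" by (rule measure_pmf.prob_space_distr) simp
    show "K \<omega> = ?Q \<omega>"
    proof (rule measure_eqI_generator_eq[OF E(2), of UNIV _ _ "\<lambda>_. UNIV"])
      show "emeasure (K \<omega>) A = emeasure (?Q \<omega>) A" if "A \<in> E" for A
        unfolding K.emeasure_eq_measure Q.emeasure_eq_measure using eq that by simp
      show "sets (K \<omega>) = sigma_sets UNIV E" using Kp(2)[OF \<omega>] E(5) by simp
      show "sets (?Q \<omega>) = sigma_sets UNIV E" using E(5) by simp
    qed (use E in auto)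
  qed
qed

text \<open>
  The effect of replacing \<open>Z\<close> by an approximation \<open>R\<close> on conditional laws. The error \<open>U\<close> is the conditional
  expectation of the truncated distance of \<open>Z\<close> and \<open>R\<close>, so its mean is the unconditional one: an approximation
  in probability is automatically one for the conditional laws.
\<close>

lemma cond_distr_BL_dist_le:
  fixes Z :: "'w \<Rightarrow> real ^ 'n" and L :: "(real ^ 'n) measure"
  assumes t: "1 \<le> t" and K: "is_cond_distr M (data_algebra M N t X) Z K"
    and Zm: "Z \<in> borel_measurable (data_weight_algebra M N t X (W t))"
    and R: "R \<in> borel_measurable (PiM {1..t} (\<lambda>_. N) \<Otimes>\<^sub>M count_space UNIV)"
    and L: "prob_space L" "sets L = sets borel"
  shows "\<exists>U. U \<in> borel_measurable M \<and>
    (\<integral>\<^sup>+\<omega>. U \<omega> \<partial>M) = (\<integral>\<^sup>+\<omega>. ennreal (min 2 (norm (Z \<omega> - R (data_vec t X \<omega>, W t \<omega>)))) \<partial>M) \<and>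
    (AE \<omega> in M. ennreal (BL_dist (K \<omega>) L) \<le>
       U \<omega> + ennreal (BL_dist (distr (measure_pmf (weights_pmf t)) borel (\<lambda>w. R (data_vec t X \<omega>, w))) L))"
proof -
  let ?D = "PiM {1..t} (\<lambda>_. N)"
  let ?\<mu> = "measure_pmf (weights_pmf t)"
  note dm = data_vec_measurable[of t] and wm = weights_measurable[OF t]
  have pm: "(\<lambda>\<omega>. (data_vec t X \<omega>, W t \<omega>)) \<in> measurable M (?D \<Otimes>\<^sub>M count_space UNIV)"
    using dm wm by (rule measurable_Pair)
  have "\<exists>\<Phi>\<in>borel_measurable (?D \<Otimes>\<^sub>M count_space UNIV). \<forall>\<omega>\<in>space M. Z \<omega> = \<Phi> (data_vec t X \<omega>, W t \<omega>)"
    by (rule doob_dynkin_cart[where g="\<lambda>\<omega>. (data_vec t X \<omega>, W t \<omega>)"])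
      (use Zm measurable_space[OF pm] in \<open>auto simp: data_weight_algebra_def simp del: space_pair_measure\<close>)
  then obtain \<Phi> where \<Phi>: "\<Phi> \<in> borel_measurable (?D \<Otimes>\<^sub>M count_space UNIV)"
    "\<And>\<omega>. \<omega> \<in> space M \<Longrightarrow> Z \<omega> = \<Phi> (data_vec t X \<omega>, W t \<omega>)" by blast
  let ?d = "\<lambda>z. min 2 (norm (\<Phi> z - R z))"
  have dmz: "(\<lambda>z. ennreal (?d z)) \<in> borel_measurable (?D \<Otimes>\<^sub>M count_space UNIV)"
    using \<Phi>(1) R by measurable
  have dmz': "(\<lambda>z. ennreal (?d z)) \<in> borel_measurable (?D \<Otimes>\<^sub>M ?\<mu>)"
  proof -
    have "sets (?D \<Otimes>\<^sub>M ?\<mu>) = sets (?D \<Otimes>\<^sub>M count_space UNIV)"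
      by (intro sets_pair_measure_cong) auto
    with dmz show ?thesis by (simp cong: measurable_cong_sets)
  qed
  define U where "U \<omega> = (\<integral>\<^sup>+w. ennreal (?d (data_vec t X \<omega>, w)) \<partial>?\<mu>)" for \<omega>
  have Um: "U \<in> borel_measurable M"
    unfolding U_def[abs_def]
    using measurable_compose[OF dm measure_pmf.borel_measurable_nn_integral_fst[OF dmz']] by simp
  have "(\<integral>\<^sup>+\<omega>. U \<omega> \<partial>M) = (\<integral>\<^sup>+\<omega>. ennreal (?d (data_vec t X \<omega>, W t \<omega>)) \<partial>M)"
    unfolding U_def by (rule nn_integral_data_weights[OF t dmz, symmetric])
  also have "\<dots> = (\<integral>\<^sup>+\<omega>. ennreal (min 2 (norm (Z \<omega> - R (data_vec t X \<omega>, W t \<omega>)))) \<partial>M)"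
    by (intro nn_integral_cong) (simp add: \<Phi>(2))
  finally have EU: "(\<integral>\<^sup>+\<omega>. U \<omega> \<partial>M) = (\<integral>\<^sup>+\<omega>. ennreal (min 2 (norm (Z \<omega> - R (data_vec t X \<omega>, W t \<omega>)))) \<partial>M)" .
  have ker: "AE \<omega> in M. K \<omega> = distr ?\<mu> borel (\<lambda>w. \<Phi> (data_vec t X \<omega>, w))"
    by (rule cond_distr_eq_kernel[OF t K \<Phi>(1)]) (rule \<Phi>(2))
  have "AE \<omega> in M. ennreal (BL_dist (K \<omega>) L) \<le> U \<omega> + ennreal (BL_dist (distr ?\<mu> borel (\<lambda>w. R (data_vec t X \<omega>, w))) L)"
    using ker
  proof (rule AE_mp, intro AE_I2 impI)
    fix \<omega> assume eq: "K \<omega> = distr ?\<mu> borel (\<lambda>w. \<Phi> (data_vec t X \<omega>, w))"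
    let ?dw = "\<lambda>w. ?d (data_vec t X \<omega>, w)"
    have id: "integrable ?\<mu> ?dw" by (rule measure_pmf.integrable_const_bound[of _ 2]) auto
    have Ue: "U \<omega> = ennreal (\<integral>w. ?dw w \<partial>?\<mu>)"
      unfolding U_def by (rule nn_integral_eq_integral[OF id]) auto
    have "BL_dist (K \<omega>) L \<le> (\<integral>w. ?dw w \<partial>?\<mu>) + BL_dist (distr ?\<mu> borel (\<lambda>w. R (data_vec t X \<omega>, w))) L"
      unfolding eq by (rule BL_dist_coupling_le[OF L _ id]) auto
    then have "ennreal (BL_dist (K \<omega>) L) \<le> ennreal ((\<integral>w. ?dw w \<partial>?\<mu>) + BL_dist (distr ?\<mu> borel (\<lambda>w. R (data_vec t X \<omega>, w))) L)"
      by (rule ennreal_leI)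
    also have "\<dots> \<le> U \<omega> + ennreal (BL_dist (distr ?\<mu> borel (\<lambda>w. R (data_vec t X \<omega>, w))) L)"
    proof (cases "0 \<le> BL_dist (distr ?\<mu> borel (\<lambda>w. R (data_vec t X \<omega>, w))) L")
      case True
      then show ?thesis unfolding Ue by (subst ennreal_plus) (auto intro!: Bochner_Integration.integral_nonneg)
    next
      case False
      then show ?thesis unfolding Ue by (intro add_increasing2 ennreal_leI) auto
    qed
    finally show "ennreal (BL_dist (K \<omega>) L) \<le> U \<omega> + ennreal (BL_dist (distr ?\<mu> borel (\<lambda>w. R (data_vec t X \<omega>, w))) L)" .
  qed
  with Um EU show ?thesis by blast
qed

end

section \<open>A conditional central limit theorem\<close>

context sampling
begin

lemma emp_mean_dev:
  assumes "1 \<le> t"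
  shows "emp_mean t (\<lambda>\<tau>. g (X \<tau> \<omega>)) - (\<integral>\<theta>. g \<theta> \<partial>P) = samp_dev t \<omega> g / sqrt t"
proof -
  have "samp_dev t \<omega> g / sqrt t = ((\<Sum>\<tau>=1..t. g (X \<tau> \<omega>)) - real t * (\<integral>\<theta>. g \<theta> \<partial>P)) / real t"
    by (simp add: samp_dev_def sum_subtractf)
  then show ?thesis using assms by (simp add: emp_mean_def diff_divide_distrib)
qed

lemma nn_integral_emp_mean_dev_le:
  fixes g :: "'a \<Rightarrow> real"
  assumes g: "g \<in> borel_measurable N" and b: "\<And>\<theta>. \<theta> \<in> space N \<Longrightarrow> \<bar>g \<theta>\<bar> \<le> c" and t: "1 \<le> t"
  shows "(\<integral>\<^sup>+\<omega>. ennreal \<bar>emp_mean t (\<lambda>\<tau>. g (X \<tau> \<omega>)) - (\<integral>\<theta>. g \<theta> \<partial>P)\<bar> \<partial>M) \<le> ennreal ((1 + c\<^sup>2) / sqrt t)"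
proof -
  note [measurable] = g
  have sm [measurable]: "(\<lambda>\<omega>. samp_dev t \<omega> g) \<in> borel_measurable M" by (rule samp_dev_measurable[OF g])
  have g2: "(g \<theta>)\<^sup>2 \<le> c\<^sup>2" if "\<theta> \<in> space N" for \<theta>
    using b[OF that] by (metis abs_ge_zero power2_abs power_mono)
  have Eg2: "(\<integral>\<theta>. (g \<theta>)\<^sup>2 \<partial>P) \<le> c\<^sup>2"
    using g2 by (intro P.integral_le_const P.integrable_const_bound[of _ "c\<^sup>2"]) (auto intro!: AE_I2)
  have "(\<integral>\<^sup>+\<omega>. ennreal \<bar>emp_mean t (\<lambda>\<tau>. g (X \<tau> \<omega>)) - (\<integral>\<theta>. g \<theta> \<partial>P)\<bar> \<partial>M)
      \<le> (\<integral>\<^sup>+\<omega>. ennreal (1 / sqrt t) * (1 + ennreal ((samp_dev t \<omega> g)\<^sup>2)) \<partial>M)"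
  proof (rule nn_integral_mono)
    fix \<omega>
    have "\<bar>x\<bar> \<le> 1 + x\<^sup>2" for x :: real
    proof -
      have "0 \<le> (\<bar>x\<bar> - 1)\<^sup>2" by simp
      then have "2 * \<bar>x\<bar> \<le> 1 + x\<^sup>2" by (simp add: power2_diff)
      then show ?thesis by simp
    qed
    then have "\<bar>samp_dev t \<omega> g\<bar> / sqrt t \<le> (1 + (samp_dev t \<omega> g)\<^sup>2) / sqrt t" by (intro divide_right_mono) auto
    then have "ennreal \<bar>emp_mean t (\<lambda>\<tau>. g (X \<tau> \<omega>)) - (\<integral>\<theta>. g \<theta> \<partial>P)\<bar> \<le> ennreal (1 / sqrt t * (1 + (samp_dev t \<omega> g)\<^sup>2))"
      by (intro ennreal_leI) (simp add: emp_mean_dev[OF t] abs_divide)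
    also have "\<dots> = ennreal (1 / sqrt t) * (1 + ennreal ((samp_dev t \<omega> g)\<^sup>2))"
      by (subst ennreal_mult) auto
    finally show "ennreal \<bar>emp_mean t (\<lambda>\<tau>. g (X \<tau> \<omega>)) - (\<integral>\<theta>. g \<theta> \<partial>P)\<bar> \<le> ennreal (1 / sqrt t) * (1 + ennreal ((samp_dev t \<omega> g)\<^sup>2))" .
  qed
  also have "\<dots> = ennreal (1 / sqrt t) * (1 + (\<integral>\<^sup>+\<omega>. ennreal ((samp_dev t \<omega> g)\<^sup>2) \<partial>M))"
    by (subst nn_integral_cmult, simp, subst nn_integral_add) (auto simp: emeasure_space_1)
  also have "\<dots> \<le> ennreal (1 / sqrt t) * (1 + ennreal (c\<^sup>2))"
    by (intro mult_left_mono add_left_mono order_trans[OF samp_dev_second_moment_le[OF g b t]] ennreal_leI Eg2) auto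
  also have "\<dots> = ennreal ((1 + c\<^sup>2) / sqrt t)"
    by (simp flip: ennreal_mult ennreal_1 ennreal_plus)
  finally show ?thesis .
qed

text \<open>
  The law of large numbers for the empirical variance, in mean and with a rate.
\<close>

lemma nn_integral_emp_var_dev_le:
  fixes g :: "'a \<Rightarrow> real"
  assumes g: "g \<in> borel_measurable N" and b: "\<And>\<theta>. \<theta> \<in> space N \<Longrightarrow> \<bar>g \<theta>\<bar> \<le> c" and t: "1 \<le> t"
  shows "(\<integral>\<^sup>+\<omega>. ennreal \<bar>emp_var t (\<lambda>\<tau>. g (X \<tau> \<omega>)) - P.variance g\<bar> \<partial>M) \<le> ennreal ((1 + (c\<^sup>2)\<^sup>2 + 2 * c * (1 + c\<^sup>2)) / sqrt t)"
proof -
  note [measurable] = g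
  obtain \<theta>0 where "\<theta>0 \<in> space N" using P.not_empty by auto
  then have c0: "0 \<le> c" using b by (meson abs_ge_zero order_trans)
  have g2: "\<bar>(g \<theta>)\<^sup>2\<bar> \<le> c\<^sup>2" if "\<theta> \<in> space N" for \<theta>
    using b[OF that] by (metis abs_ge_zero abs_power2 power2_abs power_mono)
  have ig: "integrable P g" using b by (intro P.integrable_const_bound[of _ c] AE_I2) auto
  have ig2: "integrable P (\<lambda>\<theta>. (g \<theta>)\<^sup>2)" using g2 by (intro P.integrable_const_bound[of _ "c\<^sup>2"] AE_I2) auto
  let ?m = "\<integral>\<theta>. g \<theta> \<partial>P" and ?m2 = "\<integral>\<theta>. (g \<theta>)\<^sup>2 \<partial>P"
  let ?e = "\<lambda>\<omega>. emp_mean t (\<lambda>\<tau>. g (X \<tau> \<omega>))" and ?e2 = "\<lambda>\<omega>. emp_mean t (\<lambda>\<tau>. (g (X \<tau> \<omega>))\<^sup>2)"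
  have m: "\<bar>?m\<bar> \<le> c"
    by (rule order_trans[OF integral_abs_bound]) (use ig b in \<open>auto intro!: P.integral_le_const AE_I2\<close>)
  have em: "(\<lambda>\<omega>. emp_mean t (\<lambda>\<tau>. h (X \<tau> \<omega>))) \<in> borel_measurable M" if "h \<in> borel_measurable N" for h :: "'a \<Rightarrow> real"
    unfolding emp_mean_def using that measurable_compose[OF X_measurable that]
    by (intro borel_measurable_divide borel_measurable_sum) auto
  have [measurable]: "?e \<in> borel_measurable M" "?e2 \<in> borel_measurable M"
    using em[OF g] em[of "\<lambda>x. (g x)\<^sup>2"] by simp_all
  have "(\<integral>\<^sup>+\<omega>. ennreal \<bar>emp_var t (\<lambda>\<tau>. g (X \<tau> \<omega>)) - P.variance g\<bar> \<partial>M) \<le>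
      (\<integral>\<^sup>+\<omega>. ennreal \<bar>?e2 \<omega> - ?m2\<bar> + ennreal (2 * c) * ennreal \<bar>?e \<omega> - ?m\<bar> \<partial>M)"
  proof (rule nn_integral_mono)
    fix \<omega> assume \<omega>: "\<omega> \<in> space M"
    have e: "\<bar>?e \<omega>\<bar> \<le> c"
      by (rule emp_mean_abs_le) (use t b X_in_space \<omega> in auto)
    have "\<bar>(?e \<omega>)\<^sup>2 - ?m\<^sup>2\<bar> = \<bar>?e \<omega> + ?m\<bar> * \<bar>?e \<omega> - ?m\<bar>"
      by (simp add: power2_eq_square algebra_simps flip: abs_mult)
    also have "\<dots> \<le> (2 * c) * \<bar>?e \<omega> - ?m\<bar>" using e m by (intro mult_right_mono) auto
    finally have sq: "\<bar>(?e \<omega>)\<^sup>2 - ?m\<^sup>2\<bar> \<le> (2 * c) * \<bar>?e \<omega> - ?m\<bar>" .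
    have "emp_var t (\<lambda>\<tau>. g (X \<tau> \<omega>)) - P.variance g = (?e2 \<omega> - ?m2) - ((?e \<omega>)\<^sup>2 - ?m\<^sup>2)"
      using t by (simp add: emp_var_eq P.variance_eq[OF ig ig2])
    then have "\<bar>emp_var t (\<lambda>\<tau>. g (X \<tau> \<omega>)) - P.variance g\<bar> \<le> \<bar>?e2 \<omega> - ?m2\<bar> + (2 * c) * \<bar>?e \<omega> - ?m\<bar>"
      using sq by linarith
    then have "ennreal \<bar>emp_var t (\<lambda>\<tau>. g (X \<tau> \<omega>)) - P.variance g\<bar> \<le> ennreal (\<bar>?e2 \<omega> - ?m2\<bar> + (2 * c) * \<bar>?e \<omega> - ?m\<bar>)"
      by (rule ennreal_leI)
    also have "\<dots> = ennreal \<bar>?e2 \<omega> - ?m2\<bar> + ennreal (2 * c) * ennreal \<bar>?e \<omega> - ?m\<bar>"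
      using c0 by (subst ennreal_plus) (auto simp: ennreal_mult)
    finally show "ennreal \<bar>emp_var t (\<lambda>\<tau>. g (X \<tau> \<omega>)) - P.variance g\<bar> \<le> ennreal \<bar>?e2 \<omega> - ?m2\<bar> + ennreal (2 * c) * ennreal \<bar>?e \<omega> - ?m\<bar>" .
  qed
  also have "\<dots> = (\<integral>\<^sup>+\<omega>. ennreal \<bar>?e2 \<omega> - ?m2\<bar> \<partial>M) + ennreal (2 * c) * (\<integral>\<^sup>+\<omega>. ennreal \<bar>?e \<omega> - ?m\<bar> \<partial>M)"
    by (subst nn_integral_add) (auto simp: nn_integral_cmult)
  also have "\<dots> \<le> ennreal ((1 + (c\<^sup>2)\<^sup>2) / sqrt t) + ennreal (2 * c) * ennreal ((1 + c\<^sup>2) / sqrt t)"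
    using nn_integral_emp_mean_dev_le[OF g b t] nn_integral_emp_mean_dev_le[of "\<lambda>x. (g x)\<^sup>2" "c\<^sup>2", OF _ g2 t]
    by (intro add_mono mult_left_mono) auto
  also have "\<dots> = ennreal ((1 + (c\<^sup>2)\<^sup>2 + 2 * c * (1 + c\<^sup>2)) / sqrt t)"
  proof -
    have "ennreal ((1 + (c\<^sup>2)\<^sup>2) / sqrt t) + ennreal (2 * c) * ennreal ((1 + c\<^sup>2) / sqrt t)
        = ennreal ((1 + (c\<^sup>2)\<^sup>2) / sqrt t + 2 * c * ((1 + c\<^sup>2) / sqrt t))"
      using c0 by (simp flip: ennreal_mult ennreal_plus)
    also have "(1 + (c\<^sup>2)\<^sup>2) / sqrt t + 2 * c * ((1 + c\<^sup>2) / sqrt t) = (1 + (c\<^sup>2)\<^sup>2 + 2 * c * (1 + c\<^sup>2)) / sqrt t"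
    proof -
      have "p / s + 2 * c * (q / s) = (p + 2 * c * q) / s" for p q s :: real
        by (simp add: add_divide_distrib)
      then show ?thesis .
    qed
    finally show ?thesis .
  qed
  finally show ?thesis .
qed

text \<open>
  The argument is the pair of data and weights, so that freezing the data is substitution in the first
  component.
\<close>

definition boot_vec :: "nat \<Rightarrow> ('a \<Rightarrow> real ^ 'n) \<Rightarrow> (nat \<Rightarrow> 'a) \<times> (nat \<Rightarrow> nat) \<Rightarrow> real ^ 'n" where
  "boot_vec t E z = (\<chi> i. boot_sum t (snd z) (\<lambda>\<tau>. E (fst z \<tau>) $ i))"

lemma inner_boot_vec: "u \<bullet> boot_vec t E (x, w) = boot_sum t w (\<lambda>\<tau>. u \<bullet> E (x \<tau>))"
proof -
  have "u \<bullet> boot_vec t E (x, w) = (\<Sum>i\<in>UNIV. \<Sum>\<tau>=1..t. u $ i * ((real (w \<tau>) - 1) * E (x \<tau>) $ i)) / sqrt t"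
    by (simp add: boot_vec_def boot_sum_def inner_vec_def sum_distrib_left sum_divide_distrib)
  also have "(\<Sum>i\<in>UNIV. \<Sum>\<tau>=1..t. u $ i * ((real (w \<tau>) - 1) * E (x \<tau>) $ i)) = (\<Sum>\<tau>=1..t. (real (w \<tau>) - 1) * (u \<bullet> E (x \<tau>)))"
    by (subst sum.swap) (simp add: inner_vec_def sum_distrib_left mult_ac)
  finally show ?thesis by (simp add: boot_sum_def)
qed

lemma boot_vec_measurable:
  fixes E :: "'a \<Rightarrow> real ^ 'n"
  assumes [measurable]: "E \<in> borel_measurable N"
  shows "boot_vec t E \<in> borel_measurable (PiM {1..t} (\<lambda>_. N) \<Otimes>\<^sub>M count_space UNIV)"
proof (rule borel_measurable_euclidean_space[THEN iffD2], rule ballI)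
  fix b :: "real ^ 'n" assume "b \<in> Basis"
  then obtain i where "b = axis i 1" by (auto simp: Basis_vec_def)
  moreover have "(\<lambda>\<theta>. E \<theta> $ i) \<in> borel_measurable N"
    by (rule measurable_compose[OF assms]) measurable
  ultimately show "(\<lambda>z. boot_vec t E z \<bullet> b) \<in> borel_measurable (PiM {1..t} (\<lambda>_. N) \<Otimes>\<^sub>M count_space UNIV)"
    using boot_sum_measurable[of "\<lambda>\<theta>. E \<theta> $ i" t] by (simp add: inner_axis boot_vec_def)
qed

text \<open>
  By \<open>BL_dist_char_fn\<close> it suffices that the difference of the characteristic functions, averaged over
  Gaussian frequencies, is small with high probability. For each frequency it is bounded by a quantity whose mean
  vanishes, because the empirical variance converges; Fubini's theorem and dominated convergence carry this over
  to the average.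
\<close>

lemma conditional_bootstrap_clt:
  fixes E :: "'a \<Rightarrow> real ^ 'n" and L :: "(real ^ 'n) measure"
  assumes E: "E \<in> borel_measurable N" and Eb: "\<And>\<theta>. \<theta> \<in> space N \<Longrightarrow> norm (E \<theta>) \<le> c"
    and L: "prob_space L" "sets L = sets borel"
    and chL: "\<And>u. char_fn L u = exp (- P.variance (\<lambda>\<theta>. u \<bullet> E \<theta>) / 2)"
    and \<delta>: "\<delta> > 0" and \<eta>: "\<eta> > 0"
  shows "high_prob M \<eta> (\<lambda>t \<omega>. BL_dist (distr (measure_pmf (weights_pmf t)) borel (\<lambda>w. boot_vec t E (data_vec t X \<omega>, w))) L \<le> \<delta>)"
proof -
  note [measurable] = E
  let ?G = "std_mv_normal :: (real^'n) measure"
  let ?Q = "\<lambda>t \<omega>. distr (measure_pmf (weights_pmf t)) borel (\<lambda>w. boot_vec t E (data_vec t X \<omega>, w))"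
  interpret G: prob_space ?G by (rule prob_space_std_mv_normal)
  interpret MG: pair_prob_space M ?G ..
  obtain \<sigma> C where \<sigma>: "\<sigma> > 0" and C: "C \<ge> 0" and BL: "\<And>Q. prob_space Q \<Longrightarrow> sets Q = sets borel \<Longrightarrow>
      BL_dist Q L \<le> \<delta> / 2 + C * (\<integral>z. norm (char_fn Q ((1/\<sigma>) *\<^sub>R z) - char_fn L ((1/\<sigma>) *\<^sub>R z)) \<partial>?G)"
    using BL_dist_char_fn[OF L half_gt_zero[OF \<delta>]] by blast
  obtain \<theta>0 where \<theta>0: "\<theta>0 \<in> space N" using P.not_empty by auto
  then have c0: "0 \<le> c" using Eb by (meson norm_ge_zero order_trans)
  define v where "v u = P.variance (\<lambda>\<theta>. u \<bullet> E \<theta>)" for u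
  have v0: "0 \<le> v u" for u unfolding v_def by (rule P.variance_positive)
  have gb: "\<bar>u \<bullet> E \<theta>\<bar> \<le> norm u * c" if "\<theta> \<in> space N" for u \<theta>
    by (rule order_trans[OF Cauchy_Schwarz_ineq2]) (use Eb[OF that] in \<open>auto intro!: mult_left_mono\<close>)
  define k where "k u = norm u * c" for u :: "real^'n"
  (* bounds the error of the characteristic function at the frequency u *)
  define b where "b t \<omega> u = (2 * k u) ^ 3 / (6 * sqrt t) + \<bar>emp_var t (\<lambda>\<tau>. u \<bullet> E (X \<tau> \<omega>)) - v u\<bar> / 2 + (v u)\<^sup>2 / (8 * t)" for t \<omega> u
  have ch: "norm (char_fn (?Q t \<omega>) u - char_fn L u) \<le> b t \<omega> u" if t: "1 \<le> t" and \<omega>: "\<omega> \<in> space M" for t \<omega> u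
  proof -
    have "char_fn (?Q t \<omega>) u = measure_pmf.expectation (weights_pmf t) (\<lambda>w. cis (boot_sum t w (\<lambda>\<tau>. u \<bullet> E (X \<tau> \<omega>))))"
      unfolding char_fn_def by (subst integral_distr) (auto simp: inner_boot_vec boot_sum_data[of t _ "\<lambda>x. u \<bullet> E x"])
    then show ?thesis
      using char_boot_sum[of t "\<lambda>\<tau>. u \<bullet> E (X \<tau> \<omega>)" "k u" "v u"] t gb X_in_space[OF _ \<omega>] v0[of u]
      by (simp add: b_def k_def chL v_def)
  qed
  have vm [measurable]: "v \<in> borel_measurable borel"
  proof -
    have "v u = (\<integral>\<theta>. (u \<bullet> E \<theta> - (\<integral>\<theta>. u \<bullet> E \<theta> \<partial>P))\<^sup>2 \<partial>P)" for u by (simp add: v_def)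
    moreover have "(\<lambda>u. \<integral>\<theta>. (u \<bullet> E \<theta> - (\<integral>\<theta>. u \<bullet> E \<theta> \<partial>P))\<^sup>2 \<partial>P) \<in> borel_measurable borel"
      by measurable
    ultimately show ?thesis by (simp cong: measurable_cong)
  qed
  have bm: "(\<lambda>(\<omega>, z). min 2 (b t \<omega> ((1/\<sigma>) *\<^sub>R z))) \<in> borel_measurable (M \<Otimes>\<^sub>M ?G)" for t
  proof -
    have EX: "(\<lambda>\<omega>. E (X \<tau> \<omega>)) \<in> borel_measurable M" if "\<tau> \<in> {1..t}" for \<tau>
      using that by (intro measurable_compose[OF X_measurable E]) auto
    have e1: "(\<lambda>y. ((1/\<sigma>) *\<^sub>R snd y) \<bullet> E (X \<tau> (fst y))) \<in> borel_measurable (M \<Otimes>\<^sub>M ?G)" if "\<tau> \<in> {1..t}" for \<tau>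
      using measurable_compose[OF measurable_fst EX[OF that]] by measurable
    have e2: "(\<lambda>y. emp_mean t (\<lambda>\<tau>. ((1/\<sigma>) *\<^sub>R snd y) \<bullet> E (X \<tau> (fst y)))) \<in> borel_measurable (M \<Otimes>\<^sub>M ?G)"
      unfolding emp_mean_def by (intro borel_measurable_divide borel_measurable_sum e1) auto
    have e3: "(\<lambda>y. emp_var t (\<lambda>\<tau>. ((1/\<sigma>) *\<^sub>R snd y) \<bullet> E (X \<tau> (fst y)))) \<in> borel_measurable (M \<Otimes>\<^sub>M ?G)"
      unfolding emp_var_def emp_mean_def[of t "\<lambda>\<tau>. (_ \<tau>)\<^sup>2"]
      by (intro borel_measurable_divide borel_measurable_sum borel_measurable_power borel_measurable_diff e1 e2) auto
    show ?thesis unfolding b_def k_def split_beta using e3 by measurable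
  qed
  define V where "V t \<omega> = (\<integral>\<^sup>+z. ennreal (min 2 (b t \<omega> ((1/\<sigma>) *\<^sub>R z))) \<partial>?G)" for t \<omega>
  have Vm: "V t \<in> borel_measurable M" for t
    unfolding V_def[abs_def] using bm[of t] by (intro G.borel_measurable_nn_integral) (simp add: split_beta)
  have ptw: "(\<lambda>t. \<integral>\<^sup>+\<omega>. ennreal (min 2 (b t \<omega> u)) \<partial>M) \<longlonglongrightarrow> 0" for u
  proof (rule tendsto_sandwich[OF _ _ tendsto_const])
    let ?k = "k u"
    define a where "a t = (2 * ?k) ^ 3 / (6 * sqrt t) + (1 + (?k\<^sup>2)\<^sup>2 + 2 * ?k * (1 + ?k\<^sup>2)) / sqrt t + (v u)\<^sup>2 / (8 * t)" for t :: nat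
    have k0: "0 \<le> ?k" using c0 by (simp add: k_def)
    show "\<forall>\<^sub>F t in sequentially. (\<integral>\<^sup>+\<omega>. ennreal (min 2 (b t \<omega> u)) \<partial>M) \<le> ennreal (a t)"
      using eventually_ge_at_top[of 1]
    proof eventually_elim
      case (elim t)
      let ?dev = "\<lambda>\<omega>. \<bar>emp_var t (\<lambda>\<tau>. u \<bullet> E (X \<tau> \<omega>)) - v u\<bar>"
      have uE: "(\<lambda>\<theta>. u \<bullet> E \<theta>) \<in> borel_measurable N" by measurable
      have uX: "(\<lambda>\<omega>. u \<bullet> E (X \<tau> \<omega>)) \<in> borel_measurable M" if "\<tau> \<in> {1..t}" for \<tau>
        using that by (intro measurable_compose[OF X_measurable uE]) auto
      have devm: "(\<lambda>\<omega>. ennreal (?dev \<omega>)) \<in> borel_measurable M"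
        unfolding emp_var_def emp_mean_def
        by (intro measurable_compose[OF _ measurable_ennreal] borel_measurable_abs borel_measurable_diff borel_measurable_divide borel_measurable_sum borel_measurable_power uX) auto
      let ?c1 = "(2 * ?k) ^ 3 / (6 * sqrt t)" and ?c2 = "(v u)\<^sup>2 / (8 * t)"
      have "(\<integral>\<^sup>+\<omega>. ennreal (min 2 (b t \<omega> u)) \<partial>M) \<le> (\<integral>\<^sup>+\<omega>. ennreal (?c1 + ?c2) + ennreal (?dev \<omega>) \<partial>M)"
      proof (rule nn_integral_mono)
        fix \<omega>
        have "min 2 (b t \<omega> u) \<le> (?c1 + ?c2) + ?dev \<omega>"
          unfolding b_def by (rule min.coboundedI2) simp
        then have "ennreal (min 2 (b t \<omega> u)) \<le> ennreal ((?c1 + ?c2) + ?dev \<omega>)" by (rule ennreal_leI)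
        also have "\<dots> = ennreal (?c1 + ?c2) + ennreal (?dev \<omega>)" using k0 by (intro ennreal_plus) auto
        finally show "ennreal (min 2 (b t \<omega> u)) \<le> ennreal (?c1 + ?c2) + ennreal (?dev \<omega>)" .
      qed
      also have "\<dots> = ennreal (?c1 + ?c2) + (\<integral>\<^sup>+\<omega>. ennreal (?dev \<omega>) \<partial>M)"
        by (subst nn_integral_add[OF _ devm]) (auto simp: emeasure_space_1)
      also have "\<dots> \<le> ennreal (?c1 + ?c2) + ennreal ((1 + (?k\<^sup>2)\<^sup>2 + 2 * ?k * (1 + ?k\<^sup>2)) / sqrt t)"
        unfolding v_def k_def by (intro add_left_mono nn_integral_emp_var_dev_le[OF uE gb elim])
      also have "\<dots> = ennreal (a t)"
        using k0 by (subst ennreal_plus[symmetric]) (auto simp: a_def add_ac)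
      finally show ?case .
    qed
    have "a \<longlonglongrightarrow> 0" unfolding a_def
      by real_asymp
    then show "(\<lambda>t. ennreal (a t)) \<longlonglongrightarrow> 0" using tendsto_ennrealI[of a 0 sequentially] by simp
  qed simp
  have "(\<lambda>t. \<integral>\<^sup>+\<omega>. V t \<omega> \<partial>M) \<longlonglongrightarrow> 0"
  proof -
    have bm2: "(\<lambda>(\<omega>, z). ennreal (min 2 (b t \<omega> ((1/\<sigma>) *\<^sub>R z)))) \<in> borel_measurable (M \<Otimes>\<^sub>M ?G)" for t
      using measurable_compose[OF bm[of t] measurable_ennreal] by (simp add: split_beta)
    have "(\<integral>\<^sup>+\<omega>. V t \<omega> \<partial>M) = (\<integral>\<^sup>+z. (\<integral>\<^sup>+\<omega>. ennreal (min 2 (b t \<omega> ((1/\<sigma>) *\<^sub>R z))) \<partial>M) \<partial>?G)" for t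
      unfolding V_def using MG.Fubini[OF bm2[of t]] by (simp add: split_beta)
    moreover have "(\<lambda>t. \<integral>\<^sup>+z. (\<integral>\<^sup>+\<omega>. ennreal (min 2 (b t \<omega> ((1/\<sigma>) *\<^sub>R z))) \<partial>M) \<partial>?G) \<longlonglongrightarrow> (\<integral>\<^sup>+z. 0 \<partial>?G)"
    proof (rule nn_integral_dominated_convergence[where w="\<lambda>_. 2"])
      show "(\<lambda>z. \<integral>\<^sup>+\<omega>. ennreal (min 2 (b t \<omega> ((1/\<sigma>) *\<^sub>R z))) \<partial>M) \<in> borel_measurable ?G" for t
      proof -
        have "(\<lambda>(z, \<omega>). ennreal (min 2 (b t \<omega> ((1/\<sigma>) *\<^sub>R z)))) \<in> borel_measurable (?G \<Otimes>\<^sub>M M)"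
          using measurable_pair_swap[OF bm2[of t]] by simp
        then show ?thesis by (intro borel_measurable_nn_integral) simp
      qed
      show "AE z in ?G. (\<integral>\<^sup>+\<omega>. ennreal (min 2 (b t \<omega> ((1/\<sigma>) *\<^sub>R z))) \<partial>M) \<le> 2" for t
      proof (rule AE_I2)
        fix z
        have "(\<integral>\<^sup>+\<omega>. ennreal (min 2 (b t \<omega> ((1/\<sigma>) *\<^sub>R z))) \<partial>M) \<le> (\<integral>\<^sup>+\<omega>. ennreal 2 \<partial>M)"
          by (intro nn_integral_mono ennreal_leI) simp
        then show "(\<integral>\<^sup>+\<omega>. ennreal (min 2 (b t \<omega> ((1/\<sigma>) *\<^sub>R z))) \<partial>M) \<le> 2" by (simp add: emeasure_space_1)
      qed
      show "(\<integral>\<^sup>+z. 2 \<partial>?G) < \<infinity>" using G.emeasure_space_1 by (simp add: ennreal_mult_less_top)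
      show "AE z in ?G. (\<lambda>t. \<integral>\<^sup>+\<omega>. ennreal (min 2 (b t \<omega> ((1/\<sigma>) *\<^sub>R z))) \<partial>M) \<longlonglongrightarrow> 0"
        using ptw by auto
    qed auto
    ultimately show ?thesis by simp
  qed
  from high_prob_tendsto_0[OF Vm this \<eta>, of "\<delta> / (2 * (C + 1))"] \<delta> C
  have "high_prob M \<eta> (\<lambda>t \<omega>. V t \<omega> \<le> ennreal (\<delta> / (2 * (C + 1))))" by simp
  then show ?thesis
  proof (rule high_prob_mono)
    show "\<forall>\<^sub>F t in sequentially. \<forall>\<omega>\<in>space M. V t \<omega> \<le> ennreal (\<delta> / (2 * (C + 1))) \<longrightarrow> BL_dist (?Q t \<omega>) L \<le> \<delta>"
      using eventually_ge_at_top[of 1]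
    proof (eventually_elim, intro ballI impI)
      fix t :: nat and \<omega> assume t: "1 \<le> t" and \<omega>: "\<omega> \<in> space M" and le: "V t \<omega> \<le> ennreal (\<delta> / (2 * (C + 1)))"
      have pQ: "prob_space (?Q t \<omega>)" by (rule measure_pmf.prob_space_distr) simp
      note pQs = pQ sets_distr[of "measure_pmf (weights_pmf t)" borel "\<lambda>w. boot_vec t E (data_vec t X \<omega>, w)"]
      let ?d = "\<lambda>z. norm (char_fn (?Q t \<omega>) ((1/\<sigma>) *\<^sub>R z) - char_fn L ((1/\<sigma>) *\<^sub>R z))"
      have dm: "?d \<in> borel_measurable ?G"
        using char_fn_measurable[OF pQs] char_fn_measurable[OF L] by measurable
      have d2: "?d z \<le> 2" for z
        using norm_triangle_ineq4[of "char_fn (?Q t \<omega>) ((1/\<sigma>) *\<^sub>R z)" "char_fn L ((1/\<sigma>) *\<^sub>R z)"]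
          norm_char_fn_le_1[OF pQ, of "(1/\<sigma>) *\<^sub>R z"] norm_char_fn_le_1[OF L(1), of "(1/\<sigma>) *\<^sub>R z"] by linarith
      have id: "integrable ?G ?d" using dm d2 by (intro G.integrable_const_bound[of _ 2]) auto
      have "ennreal (\<integral>z. ?d z \<partial>?G) = (\<integral>\<^sup>+z. ennreal (?d z) \<partial>?G)"
        by (rule nn_integral_eq_integral[OF id, symmetric]) simp
      also have "\<dots> \<le> V t \<omega>"
        unfolding V_def by (intro nn_integral_mono ennreal_leI min.boundedI d2 ch[OF t \<omega>])
      also note le
      finally have I: "(\<integral>z. ?d z \<partial>?G) \<le> \<delta> / (2 * (C + 1))" using \<delta> C by simp
      have "BL_dist (?Q t \<omega>) L \<le> \<delta> / 2 + C * (\<integral>z. ?d z \<partial>?G)" by (rule BL[OF pQs])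
      also have "C * (\<integral>z. ?d z \<partial>?G) \<le> C * (\<delta> / (2 * (C + 1)))" using I C by (rule mult_left_mono)
      also have "\<dots> \<le> \<delta> / 2" using \<delta> C by (simp add: divide_simps)
      finally show "BL_dist (?Q t \<omega>) L \<le> \<delta>" by simp
    qed
  qed
qed

end

section \<open>The maximal bid and its kinks\<close>

definition max_value :: "('n::finite \<Rightarrow> 'a \<Rightarrow> real) \<Rightarrow> 'a \<Rightarrow> real ^ 'n \<Rightarrow> real" where
  "max_value v \<theta> \<beta> = (MAX i. \<beta> $ i * v i \<theta>)"

lemma max_value_ge: "\<beta> $ i * v i \<theta> \<le> max_value v \<theta> \<beta>"
  unfolding max_value_def by (rule Max_ge) auto

lemma max_value_attained: "\<exists>i. max_value v \<theta> \<beta> = \<beta> $ i * v i \<theta>"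
proof -
  have "max_value v \<theta> \<beta> \<in> range (\<lambda>i. \<beta> $ i * v i \<theta>)"
    unfolding max_value_def by (rule Max_in) auto
  then show ?thesis by auto
qed

lemma max_value_leI: "(\<And>i. \<beta> $ i * v i \<theta> \<le> y) \<Longrightarrow> max_value v \<theta> \<beta> \<le> y"
  using max_value_attained[of v \<theta> \<beta>] by auto

lemma max_value_scale:
  assumes "0 \<le> r"
  shows "max_value v \<theta> (r *\<^sub>R \<beta>) = r * max_value v \<theta> \<beta>"
proof (rule antisym)
  show "max_value v \<theta> (r *\<^sub>R \<beta>) \<le> r * max_value v \<theta> \<beta>"
    by (rule max_value_leI) (use assms max_value_ge in \<open>auto simp: mult.assoc intro!: mult_left_mono\<close>)
  obtain i where "max_value v \<theta> \<beta> = \<beta> $ i * v i \<theta>" using max_value_attained[of v \<theta> \<beta>] by blast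
  then show "r * max_value v \<theta> \<beta> \<le> max_value v \<theta> (r *\<^sub>R \<beta>)"
    using max_value_ge[of "r *\<^sub>R \<beta>" i v \<theta>] by (simp add: mult.assoc)
qed

lemma max_value_convex:
  fixes v :: "'n::finite \<Rightarrow> 'a \<Rightarrow> real"
  shows "convex_on UNIV (max_value v \<theta>)"
proof (rule convex_onI)
  fix t :: real and x y :: "real ^ 'n" assume t: "0 < t" "t < 1"
  show "max_value v \<theta> ((1 - t) *\<^sub>R x + t *\<^sub>R y) \<le> (1 - t) * max_value v \<theta> x + t * max_value v \<theta> y"
  proof (rule max_value_leI)
    fix i
    have "((1 - t) *\<^sub>R x + t *\<^sub>R y) $ i * v i \<theta> = (1 - t) * (x $ i * v i \<theta>) + t * (y $ i * v i \<theta>)"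
      by (simp add: algebra_simps)
    also have "\<dots> \<le> (1 - t) * max_value v \<theta> x + t * max_value v \<theta> y"
      using t by (intro add_mono mult_left_mono max_value_ge) auto
    finally show "((1 - t) *\<^sub>R x + t *\<^sub>R y) $ i * v i \<theta> \<le> (1 - t) * max_value v \<theta> x + t * max_value v \<theta> y" .
  qed
qed simp

lemma max_value_lipschitz:
  assumes "\<And>i. \<bar>v i \<theta>\<bar> \<le> C"
  shows "\<bar>max_value v \<theta> \<beta> - max_value v \<theta> \<beta>'\<bar> \<le> C * norm (\<beta> - \<beta>')"
proof -
  have le: "max_value v \<theta> x \<le> max_value v \<theta> y + C * norm (x - y)" for x y
  proof (rule max_value_leI)
    fix i
    have "\<bar>(x - y) $ i * v i \<theta>\<bar> \<le> norm (x - y) * C"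
      unfolding abs_mult by (intro mult_mono component_le_norm_cart assms) auto
    then have "x $ i * v i \<theta> \<le> y $ i * v i \<theta> + C * norm (x - y)"
      by (simp add: algebra_simps abs_le_iff)
    also have "y $ i * v i \<theta> \<le> max_value v \<theta> y" by (rule max_value_ge)
    finally show "x $ i * v i \<theta> \<le> max_value v \<theta> y + C * norm (x - y)" by simp
  qed
  from le[of \<beta> \<beta>'] le[of \<beta>' \<beta>] show ?thesis by (simp add: norm_minus_commute abs_le_iff)
qed

lemma max_value_measurable:
  assumes [measurable]: "\<And>i. v i \<in> borel_measurable N"
  shows "(\<lambda>\<theta>. max_value v \<theta> \<beta>) \<in> borel_measurable N"
proof -
  have "(\<lambda>\<theta>. SUP i. \<beta> $ i * v i \<theta>) \<in> borel_measurable N"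
    by (rule borel_measurable_cSUP) auto
  moreover have "(SUP i. \<beta> $ i * v i \<theta>) = max_value v \<theta> \<beta>" for \<theta>
    unfolding max_value_def by (rule cSup_eq_Max) auto
  ultimately show ?thesis by simp
qed

text \<open>
  Where a single bidder is maximal this is the gradient of \<open>max_value v \<theta>\<close>. If the maximal bid is zero, the
  maximal bidders have valuation zero, and so does the vector.
\<close>

definition max_value_grad :: "('n::finite \<Rightarrow> 'a \<Rightarrow> real) \<Rightarrow> real ^ 'n \<Rightarrow> 'a \<Rightarrow> real ^ 'n" where
  "max_value_grad v \<beta> \<theta> = (\<chi> i. if \<beta> $ i * v i \<theta> = max_value v \<theta> \<beta> then v i \<theta> else 0)"

text \<open>
  Ties at the value zero are harmless, hence the condition \<open>0 < v i \<theta>\<close>.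
\<close>

definition tie_at :: "('n::finite \<Rightarrow> 'a \<Rightarrow> real) \<Rightarrow> real ^ 'n \<Rightarrow> 'a \<Rightarrow> 'n \<Rightarrow> bool" where
  "tie_at v \<beta> \<theta> i \<longleftrightarrow> \<beta> $ i * v i \<theta> = max_value v \<theta> \<beta> \<and> 0 < v i \<theta> \<and> (\<exists>j. j \<noteq> i \<and> \<beta> $ j * v j \<theta> = max_value v \<theta> \<beta>)"

lemma max_value_GDERIV:
  fixes \<beta> :: "real ^ 'n"
  assumes pos: "all_pos \<beta>" and nn: "\<And>i. 0 \<le> v i \<theta>" and nt: "\<And>i. \<not> tie_at v \<beta> \<theta> i"
  shows "GDERIV (max_value v \<theta>) \<beta> :> max_value_grad v \<beta> \<theta>"
proof -
  obtain i where i: "max_value v \<theta> \<beta> = \<beta> $ i * v i \<theta>" using max_value_attained[of v \<theta> \<beta>] by blast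
  show ?thesis
  proof (cases "v i \<theta> = 0")
    case True
    have "v j \<theta> = 0" for j
    proof -
      have "\<beta> $ j * v j \<theta> \<le> 0" using max_value_ge[of \<beta> j v \<theta>] i True by simp
      then show ?thesis using pos nn[of j] by (metis less_le_not_le mult_le_0_iff order.antisym)
    qed
    then have "max_value v \<theta> = (\<lambda>_. 0)" "max_value_grad v \<beta> \<theta> = 0"
      by (auto simp: max_value_def[abs_def] max_value_grad_def vec_eq_iff)
    then show ?thesis by (simp add: GDERIV_const)
  next
    case False
    then have vi: "0 < v i \<theta>" using nn[of i] by simp
    have strict: "\<beta> $ j * v j \<theta> < \<beta> $ i * v i \<theta>" if "j \<noteq> i" for j
      using nt[of i] vi that max_value_ge[of \<beta> j v \<theta>] i unfolding tie_at_def by force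
    have g: "max_value_grad v \<beta> \<theta> = axis i (v i \<theta>)"
      using strict i by (force simp: max_value_grad_def vec_eq_iff axis_def)
    have "\<forall>\<^sub>F y in nhds \<beta>. \<forall>j. j \<noteq> i \<longrightarrow> y $ j * v j \<theta> < y $ i * v i \<theta>"
    proof (intro eventually_all_finite)
      fix j
      show "\<forall>\<^sub>F y in nhds \<beta>. j \<noteq> i \<longrightarrow> y $ j * v j \<theta> < y $ i * v i \<theta>"
      proof (cases "j = i")
        case False
        have "((\<lambda>y. y $ i * v i \<theta> - y $ j * v j \<theta>) \<longlongrightarrow> \<beta> $ i * v i \<theta> - \<beta> $ j * v j \<theta>) (nhds \<beta>)"
          by (intro tendsto_intros filterlim_ident)
        moreover have "0 < \<beta> $ i * v i \<theta> - \<beta> $ j * v j \<theta>" using strict[OF False] by simp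
        ultimately have "\<forall>\<^sub>F y in nhds \<beta>. 0 < y $ i * v i \<theta> - y $ j * v j \<theta>" by (rule order_tendstoD)
        then show ?thesis by eventually_elim simp
      qed simp
    qed
    then have ev: "\<forall>\<^sub>F y in nhds \<beta>. y $ i * v i \<theta> = max_value v \<theta> y"
    proof eventually_elim
      case (elim y)
      show ?case
      proof (rule antisym[OF max_value_ge max_value_leI])
        fix j show "y $ j * v j \<theta> \<le> y $ i * v i \<theta>" using elim by (cases "j = i") (auto simp: less_imp_le)
      qed
    qed
    have "((\<lambda>y. y $ i * v i \<theta>) has_derivative (\<lambda>h. h $ i * v i \<theta>)) (at \<beta>)"
      by (auto intro!: derivative_eq_intros bounded_linear.has_derivative[OF bounded_linear_vec_nth])
    then have "(max_value v \<theta> has_derivative (\<lambda>h. h $ i * v i \<theta>)) (at \<beta>)"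
    proof (rule has_derivative_transform_eventually)
      show "\<forall>\<^sub>F y in at \<beta>. y $ i * v i \<theta> = max_value v \<theta> y"
        using ev by (simp add: eventually_nhds_conv_at)
    qed (use i in auto)
    moreover have "(\<lambda>h. h $ i * v i \<theta>) = (\<lambda>h. h \<bullet> max_value_grad v \<beta> \<theta>)"
      by (simp add: g inner_axis)
    ultimately show ?thesis by (simp add: gderiv_def)
  qed
qed

text \<open>
  Raising \<open>\<beta> $ i\<close> raises the maximum at rate \<open>v i \<theta>\<close>, while lowering it has no effect since the rival bidder
  keeps the maximum. The two one-sided slopes differ.
\<close>

lemma max_value_kink:
  fixes \<beta> :: "real ^ 'n"
  assumes tie: "tie_at v \<beta> \<theta> i"
  shows "max_value v \<theta> \<beta> + r * v i \<theta> \<le> max_value v \<theta> (\<beta> + r *\<^sub>R axis i 1)"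
    and "max_value v \<theta> \<beta> \<le> max_value v \<theta> (\<beta> + r *\<^sub>R axis i 1)"
proof -
  from tie obtain j where i: "\<beta> $ i * v i \<theta> = max_value v \<theta> \<beta>" and j: "j \<noteq> i" "\<beta> $ j * v j \<theta> = max_value v \<theta> \<beta>"
    by (auto simp: tie_at_def)
  show "max_value v \<theta> \<beta> + r * v i \<theta> \<le> max_value v \<theta> (\<beta> + r *\<^sub>R axis i 1)"
    using max_value_ge[of "\<beta> + r *\<^sub>R axis i 1" i v \<theta>] i by (simp add: algebra_simps)
  show "max_value v \<theta> \<beta> \<le> max_value v \<theta> (\<beta> + r *\<^sub>R axis i 1)"
    using max_value_ge[of "\<beta> + r *\<^sub>R axis i 1" j v \<theta>] j by (simp add: axis_def)
qed

lemma max_value_not_GDERIV: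
  fixes \<beta> :: "real ^ 'n"
  assumes tie: "tie_at v \<beta> \<theta> i"
  shows "\<not> GDERIV (max_value v \<theta>) \<beta> :> d"
proof
  assume "GDERIV (max_value v \<theta>) \<beta> :> d"
  then have "GDERIV (max_value v \<theta>) (\<beta> + 0 *\<^sub>R axis i 1) :> d" by simp
  from GDERIV_along_line[OF this] have der: "((\<lambda>r. max_value v \<theta> (\<beta> + r *\<^sub>R axis i 1)) has_real_derivative (axis i 1 \<bullet> d)) (at 0)" .
  have vi: "0 < v i \<theta>" using tie by (auto simp: tie_at_def)
  show False
  proof (cases "0 < axis i 1 \<bullet> d")
    case True
    from DERIV_pos_inc_left[OF der True] obtain e where e: "e > 0"
      "\<And>h. h > 0 \<Longrightarrow> h < e \<Longrightarrow> max_value v \<theta> (\<beta> + (0 - h) *\<^sub>R axis i 1) < max_value v \<theta> (\<beta> + 0 *\<^sub>R axis i 1)" by blast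
    from e(2)[of "e/2"] e(1) max_value_kink(2)[OF tie, of "0 - e/2"] show False by simp
  next
    case False
    have der2: "((\<lambda>r. max_value v \<theta> (\<beta> + r *\<^sub>R axis i 1) - r * v i \<theta>) has_real_derivative (axis i 1 \<bullet> d - v i \<theta>)) (at 0)"
      by (auto intro!: derivative_eq_intros der)
    have "axis i 1 \<bullet> d - v i \<theta> < 0" using False vi by simp
    from DERIV_neg_dec_right[OF der2 this] obtain e where e: "e > 0"
      "\<And>h. h > 0 \<Longrightarrow> h < e \<Longrightarrow> max_value v \<theta> (\<beta> + (0 + h) *\<^sub>R axis i 1) - (0 + h) * v i \<theta> < max_value v \<theta> (\<beta> + 0 *\<^sub>R axis i 1) - 0 * v i \<theta>" by blast
    from e(2)[of "e/2"] e(1) max_value_kink(1)[OF tie, of "e/2"] show False by simp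
  qed
qed

lemma log_utility_GDERIV:
  fixes \<beta> :: "real ^ 'n"
  assumes "all_pos \<beta>"
  shows "GDERIV (log_utility b) \<beta> :> (\<chi> i. b $ i / \<beta> $ i)"
proof -
  have "((\<lambda>x. b $ i * ln (x $ i)) has_derivative (\<lambda>h. b $ i * (h $ i * inverse (\<beta> $ i)))) (at \<beta>)" for i
  proof -
    have "((\<lambda>x. x $ i) has_derivative (\<lambda>h. h $ i)) (at \<beta>)"
      by (rule bounded_linear_imp_has_derivative[OF bounded_linear_vec_nth])
    from has_derivative_ln[OF _ this] assms show ?thesis
      by (intro has_derivative_mult_right) (auto simp: mult.commute)
  qed
  then have "(log_utility b has_derivative (\<lambda>h. \<Sum>i\<in>UNIV. b $ i * (h $ i * inverse (\<beta> $ i)))) (at \<beta>)"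
    unfolding log_utility_def[abs_def] by (intro has_derivative_sum) auto
  moreover have "(\<lambda>h. \<Sum>i\<in>UNIV. b $ i * (h $ i * inverse (\<beta> $ i))) = (\<lambda>h. h \<bullet> (\<chi> i. b $ i / \<beta> $ i))"
    by (auto simp: inner_vec_def field_simps)
  ultimately show ?thesis by (simp add: gderiv_def)
qed

lemma F_LFM_eq: "F_LFM b v \<theta> \<beta> = max_value v \<theta> \<beta> - log_utility b \<beta>"
  by (simp add: F_LFM_def max_value_def log_utility_def)

text \<open>
  The constant \<open>gradient\<close> is a definite description, so at a kink its value is one unspecified vector, the same
  for all kinks. This makes the gradient a measurable function of \<open>\<theta>\<close>.
\<close>

lemma gradient_F_LFM:
  fixes \<beta> :: "real ^ 'n"
  assumes pos: "all_pos \<beta>" and nn: "\<And>i. 0 \<le> v i \<theta>"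
  shows "gradient (F_LFM b v \<theta>) \<beta> = (if \<exists>i. tie_at v \<beta> \<theta> i then (THE d. False) else max_value_grad v \<beta> \<theta> - (\<chi> i. b $ i / \<beta> $ i))"
proof (cases "\<exists>i. tie_at v \<beta> \<theta> i")
  case True
  have "\<not> GDERIV (F_LFM b v \<theta>) \<beta> :> d" for d
  proof
    assume "GDERIV (F_LFM b v \<theta>) \<beta> :> d"
    from GDERIV_add[OF this log_utility_GDERIV[OF pos, of b]]
    have "GDERIV (\<lambda>x. F_LFM b v \<theta> x + log_utility b x) \<beta> :> (d + (\<chi> i. b $ i / \<beta> $ i))" .
    then have "GDERIV (max_value v \<theta>) \<beta> :> (d + (\<chi> i. b $ i / \<beta> $ i))" by (simp add: F_LFM_eq)
    moreover from True obtain i where "tie_at v \<beta> \<theta> i" by blast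
    ultimately show False using max_value_not_GDERIV[of v \<beta> \<theta> i] by blast
  qed
  then show ?thesis using True by (simp add: gradient_def)
next
  case False
  have "GDERIV (\<lambda>x. max_value v \<theta> x - log_utility b x) \<beta> :> (max_value_grad v \<beta> \<theta> - (\<chi> i. b $ i / \<beta> $ i))"
    by (intro GDERIV_diff max_value_GDERIV log_utility_GDERIV) (use pos nn False in auto)
  then have "GDERIV (F_LFM b v \<theta>) \<beta> :> (max_value_grad v \<beta> \<theta> - (\<chi> i. b $ i / \<beta> $ i))"
    by (simp add: F_LFM_eq[abs_def])
  then show ?thesis using False by (simp add: GDERIV_gradient_eq)
qed

section \<open>The limit market\<close>

locale market = sampling M N s X W
  for M :: "'w measure" and N :: "'a measure" and s :: "'a \<Rightarrow> real" and X :: "nat \<Rightarrow> 'w \<Rightarrow> 'a" and W :: "nat \<Rightarrow> 'w \<Rightarrow> nat \<Rightarrow> nat" +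
  fixes b \<beta>s :: "real ^ 'n" and v :: "'n::finite \<Rightarrow> 'a \<Rightarrow> real" and C :: real
  assumes budgets: "all_pos b"
    and v_measurable [measurable]: "\<And>i. v i \<in> borel_measurable N"
    and v_nonneg: "\<And>i \<theta>. \<theta> \<in> space N \<Longrightarrow> 0 \<le> v i \<theta>"
    and v_le: "\<And>i \<theta>. \<theta> \<in> space N \<Longrightarrow> v i \<theta> \<le> C"
    and \<beta>s_argmin: "\<beta>s \<in> argmin_orthant (H_pop N s b v)"
    and H_C2: "C2_near (H_pop N s b v) \<beta>s"
begin

abbreviation "H \<equiv> H_pop N s b v"
abbreviation "f \<beta> \<theta> \<equiv> max_value v \<theta> \<beta>"
abbreviation "D \<equiv> max_value_grad v \<beta>s"

definition fbar :: "real ^ 'n \<Rightarrow> real" where "fbar \<beta> = (\<integral>\<theta>. f \<beta> \<theta> \<partial>P)"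

lemma C_nonneg: "0 \<le> C"
proof -
  obtain \<theta> where "\<theta> \<in> space N" using P.not_empty by auto
  then show ?thesis using v_nonneg v_le by (meson order_trans)
qed

lemma v_abs_le: "\<theta> \<in> space N \<Longrightarrow> \<bar>v i \<theta>\<bar> \<le> C"
  using v_nonneg[of \<theta> i] v_le[of \<theta> i] by simp

lemma f_measurable [measurable]: "f \<beta> \<in> borel_measurable N"
  by (rule max_value_measurable) simp

lemma f_lipschitz: "\<theta> \<in> space N \<Longrightarrow> \<bar>f \<beta> \<theta> - f \<beta>' \<theta>\<bar> \<le> C * norm (\<beta> - \<beta>')"
  by (rule max_value_lipschitz) (rule v_abs_le)

lemma f_bounded: "\<theta> \<in> space N \<Longrightarrow> \<bar>f \<beta> \<theta>\<bar> \<le> C * norm \<beta>"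
  using f_lipschitz[of \<theta> \<beta> 0] max_value_scale[of 0 v \<theta> 0] by simp

lemma f_integrable: "integrable P (f \<beta>)"
  using f_bounded by (intro P.integrable_const_bound[of _ "C * norm \<beta>"] AE_I2) auto

lemma D_measurable [measurable]: "D \<in> borel_measurable N"
proof (rule borel_measurable_euclidean_space[THEN iffD2], rule ballI)
  fix e :: "real ^ 'n" assume "e \<in> Basis"
  then obtain i where i: "e = axis i 1" by (auto simp: Basis_vec_def)
  have "(\<lambda>\<theta>. if \<beta>s $ i * v i \<theta> = f \<beta>s \<theta> then v i \<theta> else 0) \<in> borel_measurable N" by measurable
  then show "(\<lambda>\<theta>. D \<theta> \<bullet> e) \<in> borel_measurable N" by (simp add: i inner_axis max_value_grad_def)
qed

lemma D_bounded: "\<theta> \<in> space N \<Longrightarrow> norm (D \<theta>) \<le> real CARD('n) * C"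
proof -
  assume \<theta>: "\<theta> \<in> space N"
  have "norm (D \<theta>) \<le> (\<Sum>i\<in>UNIV. \<bar>D \<theta> $ i\<bar>)" by (rule norm_le_l1_cart)
  also have "\<dots> \<le> (\<Sum>i\<in>(UNIV::'n set). C)"
    using v_abs_le[OF \<theta>] C_nonneg by (intro sum_mono) (auto simp: max_value_grad_def)
  finally show ?thesis by simp
qed

lemma D_inner_bounded: "\<theta> \<in> space N \<Longrightarrow> \<bar>D \<theta> \<bullet> h\<bar> \<le> real CARD('n) * C * norm h"
  by (rule order_trans[OF Cauchy_Schwarz_ineq2]) (auto intro!: mult_right_mono D_bounded)

lemma D_inner_integrable: "integrable P (\<lambda>\<theta>. D \<theta> \<bullet> h)"
  using D_inner_bounded by (intro P.integrable_const_bound[of _ "real CARD('n) * C * norm h"] AE_I2) auto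

lemma H_eq: "H \<beta> = fbar \<beta> - log_utility b \<beta>"
proof -
  have "H \<beta> = (\<integral>\<theta>. f \<beta> \<theta> - log_utility b \<beta> \<partial>P)"
    unfolding H_pop_def F_LFM_eq by (rule supply_expectation_eq) measurable
  also have "\<dots> = fbar \<beta> - log_utility b \<beta>"
    using f_integrable[of \<beta>] P.prob_space by (simp add: fbar_def)
  finally show ?thesis .
qed

lemma fbar_convex: "convex_on UNIV fbar"
proof (rule convex_onI)
  fix t :: real and x y :: "real ^ 'n" assume t: "0 < t" "t < 1"
  have "fbar ((1 - t) *\<^sub>R x + t *\<^sub>R y) \<le> (\<integral>\<theta>. (1 - t) * f x \<theta> + t * f y \<theta> \<partial>P)"
    unfolding fbar_def using f_integrable t
    by (intro integral_mono) (auto intro!: convex_onD[OF max_value_convex])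
  also have "\<dots> = (1 - t) * fbar x + t * fbar y"
    using f_integrable by (simp add: fbar_def)
  finally show "fbar ((1 - t) *\<^sub>R x + t *\<^sub>R y) \<le> (1 - t) * fbar x + t * fbar y" .
qed simp

lemma ones_pos: "all_pos (\<chi> i::'n. 1)"
  by simp

lemma \<beta>s_pos: "all_pos \<beta>s" and \<beta>s_minimal: "all_pos \<beta> \<Longrightarrow> H \<beta>s \<le> H \<beta>"
  using \<beta>s_argmin argmin_orthant_iff[OF ones_pos, of \<beta>s H] by auto

lemma ex_second_order: "\<exists>r0. second_order_at H \<beta>s r0"
proof -
  obtain U where U: "open U" "\<beta>s \<in> U" "\<And>y. y \<in> U \<Longrightarrow> H differentiable (at y)" "\<And>y. y \<in> U \<Longrightarrow> gradient H differentiable (at y)"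
    using H_C2 unfolding C2_near_def by blast
  then obtain r where "r > 0" "ball \<beta>s r \<subseteq> U" by (metis open_contains_ball)
  then have "second_order_at H \<beta>s r"
    using U by unfold_locales (auto simp: dist_norm norm_minus_commute subset_iff)
  then show ?thesis ..
qed

definition "r0 = (SOME r0. second_order_at H \<beta>s r0)"

lemma second_order_r0: "second_order_at H \<beta>s r0"
  unfolding r0_def using ex_second_order by (rule someI_ex)

sublocale PC: penalized_convex fbar b \<beta>s r0 H
  by (rule penalized_convex.intro) (use fbar_convex budgets \<beta>s_pos H_eq \<beta>s_minimal second_order_r0 in auto)

text \<open>
  The second differences of \<open>H\<close> are of order \<open>r\<^sup>2\<close>, and adding the concave \<open>log_utility\<close> only decreases them.
\<close>

lemma fbar_second_difference:
  "\<exists>c d. d > 0 \<and> (\<forall>r. 0 < r \<and> r < d \<longrightarrow> fbar (\<beta>s + r *\<^sub>R axis i 1) + fbar (\<beta>s - r *\<^sub>R axis i 1) - 2 * fbar \<beta>s \<le> c * r\<^sup>2)"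
proof -
  from PC.second_order_expansion[of 1] obtain d where d: "d > 0" "\<And>h. norm h < d \<Longrightarrow>
      \<bar>H (\<beta>s + h) - H \<beta>s - gradient H \<beta>s \<bullet> h - (h \<bullet> (hessian H \<beta>s *v h)) / 2\<bar> \<le> 1 * (norm h)\<^sup>2" by auto
  from all_pos_ball[OF \<beta>s_pos] obtain dp where dp: "dp > 0" "\<And>\<beta>. norm (\<beta> - \<beta>s) < dp \<Longrightarrow> all_pos \<beta>" by blast
  let ?e = "axis i 1 :: real ^ 'n"
  let ?q = "?e \<bullet> (hessian H \<beta>s *v ?e)"
  have "fbar (\<beta>s + r *\<^sub>R ?e) + fbar (\<beta>s - r *\<^sub>R ?e) - 2 * fbar \<beta>s \<le> (?q + 2) * r\<^sup>2" if r: "0 < r" "r < min d dp" for r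
  proof -
    let ?h = "r *\<^sub>R ?e"
    have n: "norm ?h = r" "norm (- ?h) = r" using r by auto
    have p: "all_pos (\<beta>s + ?h)" "all_pos (\<beta>s - ?h)" by (rule dp(2); use r n in simp)+
    have m: "hessian H \<beta>s *v (- ?h) = - (hessian H \<beta>s *v ?h)" by (rule linear_neg[OF matrix_vector_mul_linear])
    have q: "?h \<bullet> (hessian H \<beta>s *v ?h) = r\<^sup>2 * ?q" by (simp add: matrix_vector_mult_scaleR power2_eq_square)
    have 1: "\<bar>H (\<beta>s + ?h) - H \<beta>s - r\<^sup>2 * ?q / 2\<bar> \<le> r\<^sup>2"
      using d(2)[of ?h] r n unfolding q PC.gradient_zero by simp
    have 2: "\<bar>H (\<beta>s - ?h) - H \<beta>s - r\<^sup>2 * ?q / 2\<bar> \<le> r\<^sup>2"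
      using d(2)[of "- ?h"] r n unfolding m PC.gradient_zero inner_minus_left inner_minus_right q by simp
    have mid: "(1 - 1/2) *\<^sub>R (\<beta>s + ?h) + (1/2) *\<^sub>R (\<beta>s - ?h) = \<beta>s"
      by (simp add: vec_eq_iff field_simps)
    have 3: "log_utility b (\<beta>s + ?h) + log_utility b (\<beta>s - ?h) \<le> 2 * log_utility b \<beta>s"
      using PC.log_utility_concave[OF p, of "1/2"] unfolding mid by simp
    have "fbar (\<beta>s + ?h) + fbar (\<beta>s - ?h) - 2 * fbar \<beta>s \<le> H (\<beta>s + ?h) + H (\<beta>s - ?h) - 2 * H \<beta>s"
      using 3 unfolding H_eq by simp
    also have "\<dots> \<le> (?q + 2) * r\<^sup>2" using 1 2 by (simp add: algebra_simps abs_le_iff)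
    finally show ?thesis .
  qed
  then show ?thesis using d(1) dp(1) by (intro exI[of _ "?q + 2"] exI[of _ "min d dp"]) auto
qed

lemma tie_measurable [measurable]: "Measurable.pred N (\<lambda>\<theta>. tie_at v \<beta>s \<theta> i)"
  unfolding tie_at_def by measurable

text \<open>
  Twice differentiability of \<open>H\<close> excludes kinks. On a tie the second difference of the maximal bid with step \<open>r\<close> is
  at least \<open>r v_i\<close>, and everywhere it is nonnegative. Hence the mean of \<open>v_i\<close> over the ties is at most
  \<open>c r\<close> for all small \<open>r\<close>, whereas \<open>v_i\<close> is positive on them.
\<close>

lemma AE_no_tie: "AE \<theta> in P. \<forall>i. \<not> tie_at v \<beta>s \<theta> i"
proof -
  have "AE \<theta> in P. \<not> tie_at v \<beta>s \<theta> i" for i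
  proof -
    let ?g = "\<lambda>\<theta>. if tie_at v \<beta>s \<theta> i then v i \<theta> else 0"
    let ?e = "axis i 1 :: real ^ 'n"
    have gm: "?g \<in> borel_measurable N" by measurable
    have g0: "0 \<le> ?g \<theta>" if "\<theta> \<in> space N" for \<theta> using v_nonneg[OF that] by simp
    have gi: "integrable P ?g"
      using gm v_abs_le C_nonneg by (intro P.integrable_const_bound[of _ C] AE_I2) auto
    obtain c d where d: "d > 0" "\<And>r. 0 < r \<Longrightarrow> r < d \<Longrightarrow> fbar (\<beta>s + r *\<^sub>R ?e) + fbar (\<beta>s - r *\<^sub>R ?e) - 2 * fbar \<beta>s \<le> c * r\<^sup>2"
      using fbar_second_difference[of i] by blast
    have le: "(\<integral>\<theta>. ?g \<theta> \<partial>P) \<le> c * r" if r: "0 < r" "r < d" for r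
    proof -
      have "r * (\<integral>\<theta>. ?g \<theta> \<partial>P) = (\<integral>\<theta>. r * ?g \<theta> \<partial>P)" by simp
      also have "\<dots> \<le> (\<integral>\<theta>. f (\<beta>s + r *\<^sub>R ?e) \<theta> + f (\<beta>s - r *\<^sub>R ?e) \<theta> - 2 * f \<beta>s \<theta> \<partial>P)"
      proof (rule integral_mono)
        fix \<theta>
        have mid: "(1 - 1/2) *\<^sub>R (\<beta>s + r *\<^sub>R ?e) + (1/2) *\<^sub>R (\<beta>s - r *\<^sub>R ?e) = \<beta>s"
          by (simp add: vec_eq_iff field_simps)
        have "0 \<le> f (\<beta>s + r *\<^sub>R ?e) \<theta> + f (\<beta>s - r *\<^sub>R ?e) \<theta> - 2 * f \<beta>s \<theta>"
          using convex_onD[OF max_value_convex, of "1/2" "\<beta>s + r *\<^sub>R ?e" "\<beta>s - r *\<^sub>R ?e" v \<theta>] unfolding mid by simp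
        moreover have "r * v i \<theta> \<le> f (\<beta>s + r *\<^sub>R ?e) \<theta> + f (\<beta>s - r *\<^sub>R ?e) \<theta> - 2 * f \<beta>s \<theta>" if "tie_at v \<beta>s \<theta> i"
          using max_value_kink(1)[OF that, of r] max_value_kink(2)[OF that, of "- r"] by simp
        ultimately show "r * ?g \<theta> \<le> f (\<beta>s + r *\<^sub>R ?e) \<theta> + f (\<beta>s - r *\<^sub>R ?e) \<theta> - 2 * f \<beta>s \<theta>" by simp
      qed (use gi f_integrable in auto)
      also have "\<dots> = fbar (\<beta>s + r *\<^sub>R ?e) + fbar (\<beta>s - r *\<^sub>R ?e) - 2 * fbar \<beta>s"
        using f_integrable by (simp add: fbar_def)
      also have "\<dots> \<le> c * r\<^sup>2" by (rule d(2)[OF r])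
      finally have "r * (\<integral>\<theta>. ?g \<theta> \<partial>P) \<le> r * (c * r)" by (simp add: power2_eq_square mult_ac)
      then show ?thesis using r(1) by simp
    qed
    have "(\<integral>\<theta>. ?g \<theta> \<partial>P) \<le> 0"
    proof (rule field_le_epsilon)
      fix e :: real assume e: "e > 0"
      define r where "r = min (d / 2) (e / (\<bar>c\<bar> + 1))"
      have r: "0 < r" "r < d" using d(1) e by (auto simp: r_def add_nonneg_pos)
      have "c * r \<le> (\<bar>c\<bar> + 1) * (e / (\<bar>c\<bar> + 1))"
        using r(1) by (intro mult_mono) (auto simp: r_def)
      also have "\<dots> = e" by (simp add: add_nonneg_eq_0_iff)
      finally show "(\<integral>\<theta>. ?g \<theta> \<partial>P) \<le> 0 + e" using le[OF r] by linarith
    qed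
    moreover have "0 \<le> (\<integral>\<theta>. ?g \<theta> \<partial>P)" using g0 by (intro integral_nonneg_AE AE_I2) simp
    ultimately have "(\<integral>\<theta>. ?g \<theta> \<partial>P) = 0" by simp
    moreover have "AE \<theta> in P. 0 \<le> ?g \<theta>" using g0 by (intro AE_I2) simp
    ultimately have "AE \<theta> in P. ?g \<theta> = 0"
      using integral_nonneg_eq_0_iff_AE[OF gi] by blast
    then show ?thesis
      by (rule eventually_mono) (auto simp: tie_at_def split: if_splits)
  qed
  then show ?thesis by (simp add: AE_all_countable)
qed

definition lin_rem :: "real ^ 'n \<Rightarrow> 'a \<Rightarrow> real" where
  "lin_rem h \<theta> = f (\<beta>s + h) \<theta> - f \<beta>s \<theta> - D \<theta> \<bullet> h"

text \<open>
  A Lipschitz constant of the remainder \<open>lin_rem h \<theta>\<close> in \<open>h\<close>.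
\<close>

definition "K1 = C + real CARD('n) * C"

lemma lin_rem_measurable [measurable]: "lin_rem h \<in> borel_measurable N"
  unfolding lin_rem_def[abs_def] by measurable

lemma lin_rem_lipschitz: "\<theta> \<in> space N \<Longrightarrow> \<bar>lin_rem h \<theta> - lin_rem h' \<theta>\<bar> \<le> K1 * norm (h - h')"
proof -
  assume \<theta>: "\<theta> \<in> space N"
  have "lin_rem h \<theta> - lin_rem h' \<theta> = (f (\<beta>s + h) \<theta> - f (\<beta>s + h') \<theta>) - D \<theta> \<bullet> (h - h')"
    by (simp add: lin_rem_def inner_diff_right)
  then show ?thesis
    using f_lipschitz[OF \<theta>, of "\<beta>s + h" "\<beta>s + h'"] D_inner_bounded[OF \<theta>, of "h - h'"]
    by (simp add: K1_def distrib_right)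
qed

lemma lin_rem_0 [simp]: "lin_rem 0 \<theta> = 0"
  by (simp add: lin_rem_def)

lemma lin_rem_bounded: "\<theta> \<in> space N \<Longrightarrow> \<bar>lin_rem h \<theta>\<bar> \<le> K1 * norm h"
  using lin_rem_lipschitz[of \<theta> h 0] by simp

lemma lin_rem_small_o:
  assumes e: "e \<longlonglongrightarrow> 0" "\<And>t. 0 < e t" and \<theta>: "\<theta> \<in> space N" and nt: "\<And>i. \<not> tie_at v \<beta>s \<theta> i"
  shows "(\<lambda>t. lin_rem (e t *\<^sub>R h) \<theta> / e t) \<longlonglongrightarrow> 0"
proof -
  have "GDERIV (max_value v \<theta>) \<beta>s :> D \<theta>"
    by (rule max_value_GDERIV) (use \<beta>s_pos v_nonneg[OF \<theta>] nt in auto)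
  then have "GDERIV (max_value v \<theta>) (\<beta>s + 0 *\<^sub>R h) :> D \<theta>" by simp
  from GDERIV_along_line[OF this]
  have "((\<lambda>r. (f (\<beta>s + r *\<^sub>R h) \<theta> - f (\<beta>s + 0 *\<^sub>R h) \<theta>) / (r - 0)) \<longlongrightarrow> h \<bullet> D \<theta>) (at 0)"
    unfolding has_field_derivative_iff by simp
  moreover have "filterlim e (at 0) sequentially"
    using e by (simp add: filterlim_at less_imp_neq[symmetric])
  ultimately have "((\<lambda>t. (f (\<beta>s + e t *\<^sub>R h) \<theta> - f (\<beta>s + 0 *\<^sub>R h) \<theta>) / (e t - 0)) \<longlonglongrightarrow> h \<bullet> D \<theta>)"
    by (rule filterlim_compose)
  then have "(\<lambda>t. (f (\<beta>s + e t *\<^sub>R h) \<theta> - f \<beta>s \<theta>) / e t - h \<bullet> D \<theta>) \<longlonglongrightarrow> h \<bullet> D \<theta> - h \<bullet> D \<theta>"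
    by (intro tendsto_intros) simp
  moreover have "(f (\<beta>s + e t *\<^sub>R h) \<theta> - f \<beta>s \<theta>) / e t - h \<bullet> D \<theta> = lin_rem (e t *\<^sub>R h) \<theta> / e t" for t
    using e(2)[of t] by (simp add: lin_rem_def field_simps inner_commute)
  ultimately show ?thesis by simp
qed

lemma lin_rem_square_tendsto_0:
  assumes e: "e \<longlonglongrightarrow> 0" "\<And>t. 0 < e t"
  shows "(\<lambda>t. \<integral>\<theta>. (lin_rem (e t *\<^sub>R h) \<theta> / e t)\<^sup>2 \<partial>P) \<longlonglongrightarrow> 0"
proof -
  have "(\<lambda>t. \<integral>\<theta>. (lin_rem (e t *\<^sub>R h) \<theta> / e t)\<^sup>2 \<partial>P) \<longlonglongrightarrow> (\<integral>\<theta>. 0 \<partial>P)"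
  proof (rule integral_dominated_convergence[where w="\<lambda>_. (K1 * norm h)\<^sup>2"])
    show "AE \<theta> in P. (\<lambda>t. (lin_rem (e t *\<^sub>R h) \<theta> / e t)\<^sup>2) \<longlonglongrightarrow> 0"
      using AE_no_tie AE_space
    proof eventually_elim
      case (elim \<theta>)
      then have "(\<lambda>t. lin_rem (e t *\<^sub>R h) \<theta> / e t) \<longlonglongrightarrow> 0" by (intro lin_rem_small_o e) auto
      from tendsto_power[OF this, of 2] show ?case by simp
    qed
    show "AE \<theta> in P. norm ((lin_rem (e t *\<^sub>R h) \<theta> / e t)\<^sup>2) \<le> (K1 * norm h)\<^sup>2" for t
    proof (rule AE_I2)
      fix \<theta> assume "\<theta> \<in> space P"
      then have "\<bar>lin_rem (e t *\<^sub>R h) \<theta>\<bar> \<le> K1 * (e t * norm h)"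
        using lin_rem_bounded[of \<theta> "e t *\<^sub>R h"] e(2)[of t] by simp
      then have "\<bar>lin_rem (e t *\<^sub>R h) \<theta> / e t\<bar> \<le> K1 * norm h"
        using e(2)[of t] by (simp add: field_simps)
      then show "norm ((lin_rem (e t *\<^sub>R h) \<theta> / e t)\<^sup>2) \<le> (K1 * norm h)\<^sup>2"
        by (metis abs_ge_zero norm_power power2_abs power_mono real_norm_def)
    qed
  qed auto
  then show ?thesis by simp
qed

text \<open>
  The first-order condition at \<open>\<beta>s\<close>, after differentiation under the integral. It says that the gradient of
  \<open>F_LFM\<close> at \<open>\<beta>s\<close> has mean zero.
\<close>

lemma expectation_D: "(\<integral>\<theta>. D \<theta> $ i \<partial>P) = b $ i / \<beta>s $ i"
proof -
  let ?e = "axis i 1 :: real ^ 'n"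
  define e where "e t = 1 / real (Suc t)" for t
  have e: "e \<longlonglongrightarrow> 0" "\<And>t. 0 < e t"
    using LIMSEQ_inverse_real_of_nat by (auto simp: e_def[abs_def] inverse_eq_divide)
  have eR: "(\<lambda>t. \<integral>\<theta>. lin_rem (e t *\<^sub>R ?e) \<theta> / e t \<partial>P) \<longlonglongrightarrow> (\<integral>\<theta>. 0 \<partial>P)"
  proof (rule integral_dominated_convergence[where w="\<lambda>_. K1"])
    show "AE \<theta> in P. (\<lambda>t. lin_rem (e t *\<^sub>R ?e) \<theta> / e t) \<longlonglongrightarrow> 0"
      using AE_no_tie AE_space by eventually_elim (intro lin_rem_small_o e, auto)
    show "AE \<theta> in P. norm (lin_rem (e t *\<^sub>R ?e) \<theta> / e t) \<le> K1" for t
    proof (rule AE_I2)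
      fix \<theta> assume "\<theta> \<in> space P"
      then have "\<bar>lin_rem (e t *\<^sub>R ?e) \<theta>\<bar> \<le> K1 * e t"
        using lin_rem_bounded[of \<theta> "e t *\<^sub>R ?e"] e(2)[of t] by simp
      then show "norm (lin_rem (e t *\<^sub>R ?e) \<theta> / e t) \<le> K1" using e(2)[of t] by (simp add: field_simps)
    qed
  qed auto
  have "H differentiable (at \<beta>s)" using PC.diff[of \<beta>s] PC.r0 by simp
  then have "GDERIV H \<beta>s :> 0" using gradient_GDERIV PC.gradient_zero by metis
  from GDERIV_add[OF this log_utility_GDERIV[OF \<beta>s_pos, of b]]
  have "GDERIV (\<lambda>x. H x + log_utility b x) \<beta>s :> (\<chi> i. b $ i / \<beta>s $ i)" by simp
  moreover have "(\<lambda>x. H x + log_utility b x) = fbar" by (auto simp: H_eq)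
  ultimately have "GDERIV fbar (\<beta>s + 0 *\<^sub>R ?e) :> (\<chi> i. b $ i / \<beta>s $ i)" by simp
  from GDERIV_along_line[OF this]
  have "((\<lambda>r. (fbar (\<beta>s + r *\<^sub>R ?e) - fbar (\<beta>s + 0 *\<^sub>R ?e)) / (r - 0)) \<longlongrightarrow> ?e \<bullet> (\<chi> i. b $ i / \<beta>s $ i)) (at 0)"
    unfolding has_field_derivative_iff by simp
  moreover have "filterlim e (at 0) sequentially"
    using e by (simp add: filterlim_at less_imp_neq[symmetric])
  ultimately have "(\<lambda>t. (fbar (\<beta>s + e t *\<^sub>R ?e) - fbar (\<beta>s + 0 *\<^sub>R ?e)) / (e t - 0)) \<longlonglongrightarrow> ?e \<bullet> (\<chi> i. b $ i / \<beta>s $ i)"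
    by (rule filterlim_compose)
  then have l1: "(\<lambda>t. (fbar (\<beta>s + e t *\<^sub>R ?e) - fbar \<beta>s) / e t) \<longlonglongrightarrow> b $ i / \<beta>s $ i"
    by (simp add: inner_axis')
  have eq: "(fbar (\<beta>s + e t *\<^sub>R ?e) - fbar \<beta>s) / e t = (\<integral>\<theta>. D \<theta> $ i \<partial>P) + (\<integral>\<theta>. lin_rem (e t *\<^sub>R ?e) \<theta> / e t \<partial>P)" for t
  proof -
    have iR: "integrable P (\<lambda>\<theta>. lin_rem (e t *\<^sub>R ?e) \<theta> / e t)"
      unfolding lin_rem_def using f_integrable D_inner_integrable by (intro integrable_divide Bochner_Integration.integrable_diff) auto
    have "(fbar (\<beta>s + e t *\<^sub>R ?e) - fbar \<beta>s) / e t = (\<integral>\<theta>. (f (\<beta>s + e t *\<^sub>R ?e) \<theta> - f \<beta>s \<theta>) / e t \<partial>P)"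
      using f_integrable by (simp add: fbar_def)
    also have "\<dots> = (\<integral>\<theta>. D \<theta> $ i + lin_rem (e t *\<^sub>R ?e) \<theta> / e t \<partial>P)"
      using e(2)[of t] by (intro Bochner_Integration.integral_cong) (auto simp: lin_rem_def inner_axis field_simps)
    also have "\<dots> = (\<integral>\<theta>. D \<theta> $ i \<partial>P) + (\<integral>\<theta>. lin_rem (e t *\<^sub>R ?e) \<theta> / e t \<partial>P)"
      using D_inner_integrable[of ?e] iR by (intro Bochner_Integration.integral_add) (auto simp: inner_axis)
    finally show ?thesis .
  qed
  have "(\<lambda>t. (\<integral>\<theta>. D \<theta> $ i \<partial>P) + (\<integral>\<theta>. lin_rem (e t *\<^sub>R ?e) \<theta> / e t \<partial>P)) \<longlonglongrightarrow> (\<integral>\<theta>. D \<theta> $ i \<partial>P) + 0"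
    using eR by (intro tendsto_intros) simp
  then show ?thesis using l1 LIMSEQ_unique unfolding eq by fastforce
qed

end

section \<open>The limit covariance and the joint deviation process\<close>

context market
begin

abbreviation "A \<equiv> hessian H \<beta>s"
abbreviation "Ainv \<equiv> matrix_inv A"

lemma invertible_A: "invertible A"
proof -
  obtain l where l: "l > 0" "\<And>h. l * (norm h)\<^sup>2 \<le> h \<bullet> (A *v h)" using PC.hessian_posdef by blast
  have "x = 0" if "A *v x = 0" for x
  proof -
    have "l * (norm x)\<^sup>2 \<le> 0" using l(2)[of x] that by simp
    with l(1) show "x = 0" by (simp add: mult_le_0_iff)
  qed
  then have "\<exists>B. B ** A = mat 1" by (simp add: matrix_left_invertible_ker)
  then show ?thesis using invertible_left_inverse by blast
qed

lemma A_Ainv: "A ** Ainv = mat 1"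
  using someI_ex[OF invertible_A[unfolded invertible_def]] unfolding matrix_inv_def by auto

lemma transpose_A: "transpose A = A" by (rule PC.transpose_hessian)

lemma transpose_Ainv: "transpose Ainv = Ainv"
proof -
  have "transpose Ainv ** A = mat 1"
    using arg_cong[OF A_Ainv, of transpose] by (simp add: matrix_transpose_mul transpose_A transpose_mat)
  then have "transpose Ainv ** A ** Ainv = Ainv" by (simp add: matrix_mul_lid)
  then show ?thesis by (simp add: matrix_mul_assoc[symmetric] A_Ainv matrix_mul_rid)
qed

lemma A_mult_Ainv: "A *v (Ainv *v x) = x"
  by (simp add: matrix_vector_mul_assoc A_Ainv)

text \<open>
  The linear effect of one draw on the minimizer. The constant part of the gradient of \<open>F_LFM\<close> is omitted, as it
  has no effect on centred sums.
\<close>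

definition influence :: "'a \<Rightarrow> real ^ 'n" where
  "influence \<theta> = - (Ainv *v D \<theta>)"

lemma influence_measurable: "influence \<in> borel_measurable N"
  unfolding influence_def[abs_def] by (intro borel_measurable_uminus measurable_compose[OF D_measurable measurable_matrix_vector_mult])

lemma influence_bounded: "\<exists>c. \<forall>\<theta>\<in>space N. norm (influence \<theta>) \<le> c"
proof (intro exI ballI)
  fix \<theta> assume "\<theta> \<in> space N"
  then have "norm (influence \<theta>) \<le> onorm ((*v) Ainv) * norm (D \<theta>)"
    unfolding influence_def by (simp add: onorm matrix_vector_mul_bounded_linear)
  also have "\<dots> \<le> onorm ((*v) Ainv) * (real CARD('n) * C)"
    using \<open>\<theta> \<in> space N\<close> by (intro mult_left_mono D_bounded onorm_pos_le matrix_vector_mul_bounded_linear)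
  finally show "norm (influence \<theta>) \<le> onorm ((*v) Ainv) * (real CARD('n) * C)" .
qed

lemma D_component_measurable [measurable]: "(\<lambda>\<theta>. D \<theta> $ i) \<in> borel_measurable N"
  by (rule measurable_compose[OF D_measurable]) measurable

definition score_cov :: "real ^ 'n ^ 'n" where
  "score_cov = (\<chi> i j. \<integral>\<theta>. (D \<theta> $ i - b $ i / \<beta>s $ i) * (D \<theta> $ j - b $ j / \<beta>s $ j) \<partial>P)"

lemma score_cov_LFM:
  "(\<chi> i j. supply_expectation N s (\<lambda>\<theta>. gradient (F_LFM b v \<theta>) \<beta>s $ i * gradient (F_LFM b v \<theta>) \<beta>s $ j)) = score_cov"
proof -
  define a where "a = (\<chi> i. b $ i / \<beta>s $ i)"
  define c0 where "c0 = (THE d :: real ^ 'n. False)"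
  let ?g = "\<lambda>\<theta>. if \<exists>i. tie_at v \<beta>s \<theta> i then c0 else D \<theta> - a"
  have gr: "gradient (F_LFM b v \<theta>) \<beta>s = ?g \<theta>" if "\<theta> \<in> space N" for \<theta>
    unfolding a_def c0_def by (rule gradient_F_LFM[OF \<beta>s_pos]) (rule v_nonneg[OF that])
  have pm [measurable]: "Measurable.pred N (\<lambda>\<theta>. \<exists>i. tie_at v \<beta>s \<theta> i)"
    by (intro pred_intros_countable tie_measurable)
  have gm: "(\<lambda>\<theta>. ?g \<theta> $ i) \<in> borel_measurable N" for i
  proof -
    have "(\<lambda>\<theta>. if \<exists>i. tie_at v \<beta>s \<theta> i then c0 $ i else D \<theta> $ i - a $ i) \<in> borel_measurable N"
      by measurable
    moreover have "(\<lambda>\<theta>. ?g \<theta> $ i) = (\<lambda>\<theta>. if \<exists>i. tie_at v \<beta>s \<theta> i then c0 $ i else D \<theta> $ i - a $ i)" by auto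
    ultimately show ?thesis by simp
  qed
  have "supply_expectation N s (\<lambda>\<theta>. gradient (F_LFM b v \<theta>) \<beta>s $ i * gradient (F_LFM b v \<theta>) \<beta>s $ j) = score_cov $ i $ j" for i j
  proof -
    have "supply_expectation N s (\<lambda>\<theta>. gradient (F_LFM b v \<theta>) \<beta>s $ i * gradient (F_LFM b v \<theta>) \<beta>s $ j) = supply_expectation N s (\<lambda>\<theta>. ?g \<theta> $ i * ?g \<theta> $ j)"
      unfolding supply_expectation_def by (rule Bochner_Integration.integral_cong[OF refl]) (simp add: gr)
    also have "\<dots> = (\<integral>\<theta>. ?g \<theta> $ i * ?g \<theta> $ j \<partial>P)"
      by (rule supply_expectation_eq) (intro borel_measurable_times gm)
    also have "\<dots> = (\<integral>\<theta>. (D \<theta> $ i - b $ i / \<beta>s $ i) * (D \<theta> $ j - b $ j / \<beta>s $ j) \<partial>P)"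
    proof (rule integral_cong_AE)
      show "(\<lambda>\<theta>. ?g \<theta> $ i * ?g \<theta> $ j) \<in> borel_measurable P"
        using gm[of i] gm[of j] by simp
      show "AE \<theta> in P. ?g \<theta> $ i * ?g \<theta> $ j = (D \<theta> $ i - b $ i / \<beta>s $ i) * (D \<theta> $ j - b $ j / \<beta>s $ j)"
        using AE_no_tie by (rule eventually_mono) (simp add: a_def)
    qed measurable
    finally show ?thesis by (simp add: score_cov_def)
  qed
  then show ?thesis by (simp add: vec_eq_iff)
qed

lemma inner_score_cov: "w \<bullet> (score_cov *v w) = P.variance (\<lambda>\<theta>. w \<bullet> D \<theta>)"
proof -
  let ?d = "\<lambda>\<theta> i. D \<theta> $ i - b $ i / \<beta>s $ i"
  have iD: "integrable P (\<lambda>\<theta>. D \<theta> $ i)" for i using D_inner_integrable[of "axis i 1"] by (simp add: inner_axis)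
  have ad: "\<bar>?d \<theta> i\<bar> \<le> C + \<bar>b $ i / \<beta>s $ i\<bar>" if "\<theta> \<in> space N" for \<theta> i
    using v_abs_le[OF that, of i] C_nonneg abs_triangle_ineq4[of "D \<theta> $ i" "b $ i / \<beta>s $ i"]
    by (simp add: max_value_grad_def split: if_splits)
  have idd: "integrable P (\<lambda>\<theta>. ?d \<theta> i * ?d \<theta> j)" for i j
  proof (rule P.integrable_const_bound[of _ "(C + \<bar>b $ i / \<beta>s $ i\<bar>) * (C + \<bar>b $ j / \<beta>s $ j\<bar>)"])
    show "AE \<theta> in P. norm (?d \<theta> i * ?d \<theta> j) \<le> (C + \<bar>b $ i / \<beta>s $ i\<bar>) * (C + \<bar>b $ j / \<beta>s $ j\<bar>)"
      unfolding real_norm_def abs_mult using C_nonneg by (intro AE_I2 mult_mono ad) auto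
    have "(\<lambda>\<theta>. ?d \<theta> i * ?d \<theta> j) \<in> borel_measurable N" by measurable
    then show "(\<lambda>\<theta>. ?d \<theta> i * ?d \<theta> j) \<in> borel_measurable P" by simp
  qed
  have "(\<integral>\<theta>. w \<bullet> D \<theta> \<partial>P) = (\<Sum>i\<in>UNIV. w $ i * (b $ i / \<beta>s $ i))"
    unfolding inner_vec_def using iD by (simp add: expectation_D)
  then have "P.variance (\<lambda>\<theta>. w \<bullet> D \<theta>) = (\<integral>\<theta>. (\<Sum>i\<in>UNIV. w $ i * ?d \<theta> i)\<^sup>2 \<partial>P)"
    by (simp add: inner_vec_def right_diff_distrib sum_subtractf)
  also have "\<dots> = (\<integral>\<theta>. (\<Sum>i\<in>UNIV. \<Sum>j\<in>UNIV. w $ i * w $ j * (?d \<theta> i * ?d \<theta> j)) \<partial>P)"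
    unfolding power2_eq_square sum_product by (simp add: mult_ac)
  also have "\<dots> = (\<Sum>i\<in>UNIV. \<Sum>j\<in>UNIV. w $ i * w $ j * (\<integral>\<theta>. ?d \<theta> i * ?d \<theta> j \<partial>P))"
    using idd by simp
  also have "\<dots> = w \<bullet> (score_cov *v w)"
    by (simp add: inner_matrix_expand score_cov_def mult_ac)
  finally show ?thesis ..
qed

text \<open>
  The sandwich matrix is the covariance of \<open>influence\<close>. In this form it comes out of the conditional central
  limit theorem.
\<close>

lemma limit_covariance:
  "u \<bullet> ((Ainv ** score_cov ** Ainv) *v u) = P.variance (\<lambda>\<theta>. u \<bullet> influence \<theta>)"
proof -
  have m: "x \<bullet> (Ainv *v y) = (Ainv *v x) \<bullet> y" for x y
    by (metis dot_lmul_matrix transpose_Ainv transpose_matrix_vector)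
  have "u \<bullet> ((Ainv ** score_cov ** Ainv) *v u) = u \<bullet> (Ainv *v (score_cov *v (Ainv *v u)))"
    by (simp add: matrix_vector_mul_assoc[symmetric])
  also have "\<dots> = (Ainv *v u) \<bullet> (score_cov *v (Ainv *v u))" by (rule m)
  also have "\<dots> = P.variance (\<lambda>\<theta>. (Ainv *v u) \<bullet> D \<theta>)" by (rule inner_score_cov)
  also have "\<dots> = P.variance (\<lambda>\<theta>. u \<bullet> influence \<theta>)"
  proof -
    have "u \<bullet> influence \<theta> = - ((Ainv *v u) \<bullet> D \<theta>)" for \<theta> by (simp add: influence_def m)
    then show ?thesis by (simp add: power2_commute)
  qed
  finally show ?thesis .
qed

lemma psd_limit: "psd (Ainv ** score_cov ** Ainv)"
proof -
  have "transpose score_cov = score_cov" by (simp add: score_cov_def transpose_def vec_eq_iff mult.commute)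
  then have "transpose (Ainv ** score_cov ** Ainv) = Ainv ** score_cov ** Ainv"
    by (simp add: matrix_transpose_mul transpose_Ainv matrix_mul_assoc)
  then show ?thesis unfolding psd_def limit_covariance using P.variance_positive by auto
qed

lemma J_LFM_eq: "J_LFM N s b v \<beta>s = mv_normal 0 (Ainv ** score_cov ** Ainv)"
  unfolding J_LFM_def Let_def score_cov_LFM ..

lemma char_fn_J_LFM: "char_fn (J_LFM N s b v \<beta>s) u = exp (- P.variance (\<lambda>\<theta>. u \<bullet> influence \<theta>) / 2)"
  unfolding J_LFM_eq char_fn_mv_normal[OF psd_limit] limit_covariance ..

end

context sampling
begin

text \<open>
  For \<open>t = 0\<close> the sum is empty.
\<close>

lemma boot_dev_measurable_all:
  assumes g: "g \<in> borel_measurable N"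
  shows "(\<lambda>\<omega>. boot_dev t \<omega> g) \<in> borel_measurable M"
proof (cases "t = 0")
  case True
  then show ?thesis by (simp add: boot_dev_def boot_sum_def)
next
  case False
  then show ?thesis using g by (intro boot_dev_measurable) auto
qed

lemma samp_dev_add:
  assumes "integrable P g" "integrable P h"
  shows "samp_dev t \<omega> (\<lambda>\<theta>. g \<theta> + h \<theta>) = samp_dev t \<omega> g + samp_dev t \<omega> h"
  using assms by (simp add: samp_dev_def add_divide_distrib sum.distrib[symmetric] algebra_simps flip: add_divide_distrib)

lemma samp_dev_cmult: "samp_dev t \<omega> (\<lambda>\<theta>. c * g \<theta>) = c * samp_dev t \<omega> g"
  by (simp add: samp_dev_def sum_distrib_left right_diff_distrib)

lemma boot_dev_add: "boot_dev t \<omega> (\<lambda>\<theta>. g \<theta> + h \<theta>) = boot_dev t \<omega> g + boot_dev t \<omega> h"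
  by (simp add: boot_dev_def boot_sum_def sum.distrib[symmetric] algebra_simps flip: add_divide_distrib)

lemma boot_dev_cmult: "boot_dev t \<omega> (\<lambda>\<theta>. c * g \<theta>) = c * boot_dev t \<omega> g"
  by (simp add: boot_dev_def boot_sum_def sum_distrib_left mult_ac)

text \<open>
  Choosing \<open>k = 0\<close> or \<open>k = 1\<close> treats the observed and the bootstrap objective at once.
\<close>

definition dev :: "real \<Rightarrow> real \<Rightarrow> nat \<Rightarrow> 'w \<Rightarrow> ('a \<Rightarrow> real) \<Rightarrow> real" where
  "dev a k t \<omega> g = a * samp_dev t \<omega> g + k * boot_dev t \<omega> g"

lemma dev_measurable:
  assumes "g \<in> borel_measurable N"
  shows "(\<lambda>\<omega>. dev a k t \<omega> g) \<in> borel_measurable M"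
  unfolding dev_def using samp_dev_measurable[OF assms] boot_dev_measurable_all[OF assms] by measurable

lemma dev_add:
  assumes "integrable P g" "integrable P h"
  shows "dev a k t \<omega> (\<lambda>\<theta>. g \<theta> + h \<theta>) = dev a k t \<omega> g + dev a k t \<omega> h"
  by (simp add: dev_def samp_dev_add[OF assms] boot_dev_add algebra_simps)

lemma dev_cmult: "dev a k t \<omega> (\<lambda>\<theta>. c * g \<theta>) = c * dev a k t \<omega> g"
  by (simp add: dev_def samp_dev_cmult boot_dev_cmult algebra_simps)

lemma dev_diff:
  assumes "integrable P g" "integrable P h"
  shows "dev a k t \<omega> (\<lambda>\<theta>. g \<theta> - h \<theta>) = dev a k t \<omega> g - dev a k t \<omega> h"
  using dev_add[of g "\<lambda>\<theta>. (-1) * h \<theta>" a k t \<omega>] dev_cmult[of a k t \<omega> "-1" h] assms by simp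

lemma dev_sum:
  assumes "finite I" "\<And>i. i \<in> I \<Longrightarrow> integrable P (g i)"
  shows "dev a k t \<omega> (\<lambda>\<theta>. \<Sum>i\<in>I. g i \<theta>) = (\<Sum>i\<in>I. dev a k t \<omega> (g i))"
  using assms
proof (induction I rule: finite_induct)
  case empty
  then show ?case using dev_cmult[of a k t \<omega> 0 "\<lambda>_. 0"] by simp
next
  case (insert i I)
  have "dev a k t \<omega> (\<lambda>\<theta>. g i \<theta> + (\<Sum>i\<in>I. g i \<theta>)) = dev a k t \<omega> (g i) + dev a k t \<omega> (\<lambda>\<theta>. \<Sum>i\<in>I. g i \<theta>)"
    using insert.prems by (intro dev_add Bochner_Integration.integrable_sum) auto
  then show ?case using insert by simp
qed

lemma dev_second_moment_le:
  assumes g: "g \<in> borel_measurable N" and b: "\<And>\<theta>. \<theta> \<in> space N \<Longrightarrow> \<bar>g \<theta>\<bar> \<le> c" and t: "1 \<le> t" and ak: "\<bar>a\<bar> \<le> 1" "\<bar>k\<bar> \<le> 1"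
  shows "(\<integral>\<^sup>+\<omega>. ennreal ((dev a k t \<omega> g)\<^sup>2) \<partial>M) \<le> ennreal (4 * (\<integral>\<theta>. (g \<theta>)\<^sup>2 \<partial>P))"
proof -
  note [measurable] = samp_dev_measurable[OF g] boot_dev_measurable_all[OF g]
  have sq: "(a * x)\<^sup>2 \<le> x\<^sup>2" if "\<bar>a\<bar> \<le> 1" for a x :: real
  proof -
    have "a\<^sup>2 \<le> 1" using that by (simp add: abs_square_le_1)
    then show ?thesis by (simp add: power_mult_distrib mult_left_le_one_le)
  qed
  have "(\<integral>\<^sup>+\<omega>. ennreal ((dev a k t \<omega> g)\<^sup>2) \<partial>M) \<le> (\<integral>\<^sup>+\<omega>. 2 * ennreal ((samp_dev t \<omega> g)\<^sup>2) + 2 * ennreal ((boot_dev t \<omega> g)\<^sup>2) \<partial>M)"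
  proof (rule nn_integral_mono)
    fix \<omega>
    have "(dev a k t \<omega> g)\<^sup>2 \<le> 2 * (a * samp_dev t \<omega> g)\<^sup>2 + 2 * (k * boot_dev t \<omega> g)\<^sup>2"
    proof -
      have "0 \<le> (a * samp_dev t \<omega> g - k * boot_dev t \<omega> g)\<^sup>2" by simp
      then show ?thesis by (simp add: dev_def power2_sum power2_diff)
    qed
    also have "\<dots> \<le> 2 * (samp_dev t \<omega> g)\<^sup>2 + 2 * (boot_dev t \<omega> g)\<^sup>2"
      using sq[OF ak(1)] sq[OF ak(2)] by (intro add_mono mult_left_mono) auto
    finally have "ennreal ((dev a k t \<omega> g)\<^sup>2) \<le> ennreal (2 * (samp_dev t \<omega> g)\<^sup>2 + 2 * (boot_dev t \<omega> g)\<^sup>2)" by (rule ennreal_leI)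
    then show "ennreal ((dev a k t \<omega> g)\<^sup>2) \<le> 2 * ennreal ((samp_dev t \<omega> g)\<^sup>2) + 2 * ennreal ((boot_dev t \<omega> g)\<^sup>2)"
      by (simp add: ennreal_mult)
  qed
  also have "\<dots> = 2 * (\<integral>\<^sup>+\<omega>. ennreal ((samp_dev t \<omega> g)\<^sup>2) \<partial>M) + 2 * (\<integral>\<^sup>+\<omega>. ennreal ((boot_dev t \<omega> g)\<^sup>2) \<partial>M)"
    by (simp add: nn_integral_add nn_integral_cmult)
  also have "\<dots> \<le> 2 * ennreal (\<integral>\<theta>. (g \<theta>)\<^sup>2 \<partial>P) + 2 * ennreal (\<integral>\<theta>. (g \<theta>)\<^sup>2 \<partial>P)"
    using g b t by (intro add_mono mult_left_mono samp_dev_second_moment_le boot_dev_second_moment_le) auto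
  also have "\<dots> = ennreal (4 * (\<integral>\<theta>. (g \<theta>)\<^sup>2 \<partial>P))"
    by (simp add: ennreal_mult flip: distrib_right)
  finally show ?thesis .
qed

text \<open>
  The deviation is linear in \<open>g\<close>, so its increments are deviations of functions bounded by \<open>L * norm (h - h')\<close>,
  to which the moment bounds apply.
\<close>

lemma dev_lipschitz_moments:
  fixes g :: "real ^ 'n \<Rightarrow> 'a \<Rightarrow> real"
  assumes g: "\<And>h. g h \<in> borel_measurable N" and L: "\<And>h h' \<theta>. \<theta> \<in> space N \<Longrightarrow> \<bar>g h \<theta> - g h' \<theta>\<bar> \<le> L * norm (h - h')"
    and B: "\<And>h. \<exists>B. \<forall>\<theta>\<in>space N. \<bar>g h \<theta>\<bar> \<le> B" and t: "1 \<le> t" and ak: "\<bar>a\<bar> \<le> 1" "\<bar>k\<bar> \<le> 1"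
  defines "K \<equiv> 4 * fact (2 * CARD('n)) * (2 * L) ^ (2 * CARD('n))"
  shows "lipschitz_moments M (2 ^ (2 * CARD('n)) * (K + K)) (\<lambda>h \<omega>. dev a k t \<omega> (g h))"
proof -
  let ?q = "2 * CARD('n)"
  have K0: "0 \<le> K" unfolding K_def by (intro mult_nonneg_nonneg) auto
  have ig: "integrable P (g h)" for h
  proof -
    obtain B where "\<forall>\<theta>\<in>space N. \<bar>g h \<theta>\<bar> \<le> B" using B by blast
    then show ?thesis using g by (intro P.integrable_const_bound[of _ B] AE_I2) auto
  qed
  have dm: "(\<lambda>\<theta>. g h \<theta> - g h' \<theta>) \<in> borel_measurable N" for h h' using g by measurable
  have sdiff: "samp_dev t \<omega> (g h) - samp_dev t \<omega> (g h') = samp_dev t \<omega> (\<lambda>\<theta>. g h \<theta> - g h' \<theta>)" for \<omega> h h'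
    using dev_diff[OF ig ig, of 1 0 t \<omega> h h'] by (simp add: dev_def)
  have bdiff: "boot_dev t \<omega> (g h) - boot_dev t \<omega> (g h') = boot_dev t \<omega> (\<lambda>\<theta>. g h \<theta> - g h' \<theta>)" for \<omega> h h'
    using dev_diff[OF ig ig, of 0 1 t \<omega> h h'] by (simp add: dev_def)
  have Keq: "4 * fact ?q * (2 * (L * norm (h - h'))) ^ ?q = K * norm (h - h') ^ ?q" for h h' :: "real^'n"
    by (simp add: K_def power_mult_distrib mult_ac)
  have contI: "continuous_on UNIV F" if "\<And>h h'. \<bar>F h - F h'\<bar> \<le> c * norm (h - h')" "0 \<le> c" for F :: "real ^ 'n \<Rightarrow> real" and c
    by (rule lipschitz_on_continuous_on[of c]) (use that in \<open>auto simp: lipschitz_on_def dist_norm\<close>)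
  have L0: "0 \<le> L"
  proof -
    obtain \<theta> where "\<theta> \<in> space N" using P.not_empty by auto
    from L[OF this, of "axis undefined 1" 0] show ?thesis by simp
  qed
  have "lipschitz_moments M K (\<lambda>h \<omega>. samp_dev t \<omega> (g h))"
    unfolding lipschitz_moments_def
  proof (intro conjI allI ballI)
    show "(\<lambda>\<omega>. samp_dev t \<omega> (g h)) \<in> borel_measurable M" for h by (rule samp_dev_measurable[OF g])
    show "continuous_on UNIV (\<lambda>h. samp_dev t \<omega> (g h))" if \<omega>: "\<omega> \<in> space M" for \<omega>
    proof (rule contI)
      fix h h' :: "real ^ 'n"
      have "\<bar>\<Sum>\<tau>=1..t. (g h (X \<tau> \<omega>) - g h' (X \<tau> \<omega>)) - (\<integral>\<theta>. g h \<theta> - g h' \<theta> \<partial>P)\<bar> \<le> (\<Sum>\<tau>=1..t. 2 * (L * norm (h - h')))"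
        by (rule order_trans[OF sum_abs sum_mono]) (use samp_dev_terms(2)[OF dm L] \<omega> in auto)
      then show "\<bar>samp_dev t \<omega> (g h) - samp_dev t \<omega> (g h')\<bar> \<le> (real t * (2 * L) / sqrt t) * norm (h - h')"
        unfolding sdiff unfolding samp_dev_def abs_divide by (simp add: divide_right_mono mult_ac)
    qed (use L0 in auto)
    show "(\<integral>\<^sup>+\<omega>. ennreal ((samp_dev t \<omega> (g h) - samp_dev t \<omega> (g h')) ^ ?q) \<partial>M) \<le> ennreal (K * norm (h - h') ^ ?q)" for h h'
      unfolding sdiff Keq[symmetric] by (rule samp_dev_moment_le[OF dm L t]) auto
  qed
  moreover have "lipschitz_moments M K (\<lambda>h \<omega>. boot_dev t \<omega> (g h))"
    unfolding lipschitz_moments_def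
  proof (intro conjI allI ballI)
    show "(\<lambda>\<omega>. boot_dev t \<omega> (g h)) \<in> borel_measurable M" for h by (rule boot_dev_measurable[OF g t])
    show "continuous_on UNIV (\<lambda>h. boot_dev t \<omega> (g h))" if \<omega>: "\<omega> \<in> space M" for \<omega>
    proof (rule contI)
      fix h h' :: "real ^ 'n"
      have "\<bar>\<Sum>\<tau>=1..t. (real (W t \<omega> \<tau>) - 1) * (g h (X \<tau> \<omega>) - g h' (X \<tau> \<omega>))\<bar> \<le> (\<Sum>\<tau>=1..t. \<bar>real (W t \<omega> \<tau>) - 1\<bar> * (L * norm (h - h')))"
        by (rule order_trans[OF sum_abs sum_mono]) (use L X_in_space \<omega> in \<open>auto simp: abs_mult intro!: mult_left_mono\<close>)
      also have "\<dots> = ((\<Sum>\<tau>=1..t. \<bar>real (W t \<omega> \<tau>) - 1\<bar>) * L) * norm (h - h')" by (simp add: sum_distrib_left sum_distrib_right mult_ac)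
      finally show "\<bar>boot_dev t \<omega> (g h) - boot_dev t \<omega> (g h')\<bar> \<le> ((\<Sum>\<tau>=1..t. \<bar>real (W t \<omega> \<tau>) - 1\<bar>) * L / sqrt t) * norm (h - h')"
        unfolding bdiff unfolding boot_dev_def boot_sum_def abs_divide by (simp add: divide_right_mono)
    qed (use L0 in \<open>auto intro!: mult_nonneg_nonneg divide_nonneg_nonneg sum_nonneg\<close>)
    show "(\<integral>\<^sup>+\<omega>. ennreal ((boot_dev t \<omega> (g h) - boot_dev t \<omega> (g h')) ^ ?q) \<partial>M) \<le> ennreal (K * norm (h - h') ^ ?q)" for h h'
      unfolding bdiff Keq[symmetric] by (rule boot_dev_moment_le[OF dm L t]) auto
  qed
  ultimately show ?thesis
    unfolding dev_def by (rule lipschitz_moments_add) (use K0 ak in auto)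
qed

end

section \<open>Linear expansion of the minimizers\<close>

locale bootstrap_market = market M N s X W b \<beta>s v C
  for M :: "'w measure" and N :: "'a measure" and s :: "'a \<Rightarrow> real" and X :: "nat \<Rightarrow> 'w \<Rightarrow> 'a" and W :: "nat \<Rightarrow> 'w \<Rightarrow> nat \<Rightarrow> nat"
    and b \<beta>s :: "real ^ 'n" and v :: "'n::finite \<Rightarrow> 'a \<Rightarrow> real" and C :: real +
  fixes \<epsilon> :: "nat \<Rightarrow> real"
  assumes \<epsilon>_pos: "\<And>t. 0 < \<epsilon> t" and \<epsilon>_small: "\<epsilon> \<longlonglongrightarrow> 0"
    and \<epsilon>_large: "filterlim (\<lambda>t. \<epsilon> t * sqrt (real t)) at_top sequentially"
begin

text \<open>
  The perturbation of \<open>H\<close> on the scale \<open>\<epsilon> t\<close>. The sampling error of order \<open>1 / sqrt t\<close> receives the coefficient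
  \<open>1 / (\<epsilon> t * sqrt t)\<close>, which is eventually at most one.
\<close>

definition Xi :: "real \<Rightarrow> nat \<Rightarrow> 'w \<Rightarrow> ('a \<Rightarrow> real) \<Rightarrow> real" where
  "Xi k t \<omega> g = dev (1 / (\<epsilon> t * sqrt (real t))) k t \<omega> g"

text \<open>
  The slope of \<open>Xi k t \<omega> (f \<beta>)\<close> at \<open>\<beta> = \<beta>s\<close>.
\<close>

definition zeta :: "real \<Rightarrow> nat \<Rightarrow> 'w \<Rightarrow> real ^ 'n" where
  "zeta k t \<omega> = (\<chi> i. Xi k t \<omega> (\<lambda>\<theta>. D \<theta> $ i))"

lemma eventually_coeff: "\<forall>\<^sub>F t in sequentially. 1 \<le> t \<and> \<bar>1 / (\<epsilon> t * sqrt (real t))\<bar> \<le> 1"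
proof -
  have "\<forall>\<^sub>F t in sequentially. 1 \<le> \<epsilon> t * sqrt (real t)"
    using \<epsilon>_large by (simp add: filterlim_at_top)
  then show ?thesis using eventually_ge_at_top[of 1] by eventually_elim simp
qed

lemma integrable_D_component: "integrable P (\<lambda>\<theta>. D \<theta> $ i)"
  using D_inner_integrable[of "axis i 1"] by (simp add: inner_axis)

lemma Xi_expansion: "Xi k t \<omega> (f (\<beta>s + h)) - Xi k t \<omega> (f \<beta>s) - zeta k t \<omega> \<bullet> h = Xi k t \<omega> (lin_rem h)"
proof -
  have "Xi k t \<omega> (\<lambda>\<theta>. \<Sum>i\<in>UNIV. h $ i * D \<theta> $ i) = (\<Sum>i\<in>UNIV. Xi k t \<omega> (\<lambda>\<theta>. h $ i * D \<theta> $ i))"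
    unfolding Xi_def by (rule dev_sum) (use integrable_D_component in auto)
  also have "\<dots> = zeta k t \<omega> \<bullet> h"
    unfolding Xi_def dev_cmult by (simp add: zeta_def Xi_def inner_vec_def mult.commute)
  finally have z: "Xi k t \<omega> (\<lambda>\<theta>. D \<theta> \<bullet> h) = zeta k t \<omega> \<bullet> h"
    by (simp add: inner_vec_def mult.commute)
  have "lin_rem h = (\<lambda>\<theta>. (f (\<beta>s + h) \<theta> - f \<beta>s \<theta>) - D \<theta> \<bullet> h)" by (auto simp: lin_rem_def)
  then have "Xi k t \<omega> (lin_rem h) = Xi k t \<omega> (\<lambda>\<theta>. f (\<beta>s + h) \<theta> - f \<beta>s \<theta>) - Xi k t \<omega> (\<lambda>\<theta>. D \<theta> \<bullet> h)"
    unfolding Xi_def using dev_diff[of "\<lambda>\<theta>. f (\<beta>s + h) \<theta> - f \<beta>s \<theta>" "\<lambda>\<theta>. D \<theta> \<bullet> h"] f_integrable D_inner_integrable by simp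
  also have "Xi k t \<omega> (\<lambda>\<theta>. f (\<beta>s + h) \<theta> - f \<beta>s \<theta>) = Xi k t \<omega> (f (\<beta>s + h)) - Xi k t \<omega> (f \<beta>s)"
    unfolding Xi_def by (rule dev_diff) (rule f_integrable)+
  finally show ?thesis using z by simp
qed

text \<open>
  \<open>Kf\<close> and \<open>Kr\<close> are the constants of \<open>dev_lipschitz_moments\<close> for the maximal bid and for its remainder.
\<close>

definition Kf :: real where "Kf = 2 ^ (2 * CARD('n)) * (4 * fact (2 * CARD('n)) * (2 * C) ^ (2 * CARD('n)) + 4 * fact (2 * CARD('n)) * (2 * C) ^ (2 * CARD('n)))"
definition Kr :: real where "Kr = 2 ^ (2 * CARD('n)) * (4 * fact (2 * CARD('n)) * (2 * K1) ^ (2 * CARD('n)) + 4 * fact (2 * CARD('n)) * (2 * K1) ^ (2 * CARD('n)))"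

lemma Kf_nonneg: "0 \<le> Kf" and Kr_nonneg: "0 \<le> Kr"
  unfolding Kf_def Kr_def by (auto intro!: mult_nonneg_nonneg add_nonneg_nonneg)

lemma f_ex_bound: "\<exists>B. \<forall>\<theta>\<in>space N. \<bar>f \<beta> \<theta>\<bar> \<le> B"
  using f_bounded by blast

lemma lin_rem_ex_bound: "\<exists>B. \<forall>\<theta>\<in>space N. \<bar>lin_rem h \<theta>\<bar> \<le> B"
  using lin_rem_bounded by blast

lemma Xi_f_lipschitz:
  assumes "\<bar>k\<bar> \<le> 1"
  shows "\<forall>\<^sub>F t in sequentially. lipschitz_moments M Kf (\<lambda>\<beta> \<omega>. Xi k t \<omega> (f \<beta>))"
  using eventually_coeff
proof eventually_elim
  case (elim t)
  show ?case unfolding Xi_def Kf_def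
    by (rule dev_lipschitz_moments[of "\<lambda>\<beta>. f \<beta>" C]) (use elim assms f_lipschitz f_ex_bound in auto)
qed

lemma Xi_lin_rem_lipschitz:
  assumes "\<bar>k\<bar> \<le> 1"
  shows "\<forall>\<^sub>F t in sequentially. lipschitz_moments M Kr (\<lambda>h \<omega>. Xi k t \<omega> (lin_rem h))"
  using eventually_coeff
proof eventually_elim
  case (elim t)
  show ?case unfolding Xi_def Kr_def
    by (rule dev_lipschitz_moments[of lin_rem K1]) (use elim assms lin_rem_lipschitz lin_rem_ex_bound in auto)
qed

text \<open>
  The rescaled remainders have Lipschitz moments with a fixed constant, and for each direction their variance
  tends to zero because the maximal bid is almost surely differentiable at \<open>\<beta>s\<close>. Chaining makes this uniform.
\<close>

lemma Xi_lin_rem_small: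
  assumes k: "\<bar>k\<bar> \<le> 1" and R: "R > 0" and \<kappa>: "\<kappa> > 0" and \<eta>: "\<eta> > 0"
  shows "high_prob M \<eta> (\<lambda>t \<omega>. \<forall>h. norm h \<le> R \<longrightarrow> \<bar>Xi k t \<omega> (lin_rem (\<epsilon> t *\<^sub>R h))\<bar> \<le> \<epsilon> t * \<kappa>)"
proof -
  define r where "r t = \<epsilon> t * R" for t
  have r: "r \<longlonglongrightarrow> 0" "\<And>t. 0 < r t"
    using \<epsilon>_small \<epsilon>_pos R tendsto_mult_right[of \<epsilon> 0 sequentially R] by (auto simp: r_def[abs_def] mult.commute)
  define Y where "Y t h \<omega> = Xi k t \<omega> (lin_rem (r t *\<^sub>R h)) / r t" for t h \<omega>
  have Xi0: "Xi k t \<omega> (lin_rem 0) = 0" for t \<omega>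
  proof -
    have "lin_rem 0 = (\<lambda>_. 0)" by auto
    then show ?thesis using dev_cmult[of _ k t \<omega> 0 "\<lambda>_. 0"] by (simp add: Xi_def)
  qed
  have LY: "\<forall>\<^sub>F t in sequentially. lipschitz_moments M Kr (Y t)"
    using Xi_lin_rem_lipschitz[OF k]
  proof eventually_elim
    case (elim t)
    from lipschitz_moments_rescale[OF elim r(2)[of t], of 0] show ?case
      by (simp add: Y_def[abs_def] Xi0)
  qed
  have Ym: "Y t h \<in> borel_measurable M" for t h
    unfolding Y_def[abs_def] Xi_def using dev_measurable[OF lin_rem_measurable] by measurable
  have Yeq: "Y t h \<omega> = Xi k t \<omega> (\<lambda>\<theta>. (1 / r t) * lin_rem (r t *\<^sub>R h) \<theta>)" for t h \<omega>
    unfolding Y_def Xi_def dev_cmult by simp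
  have ptw: "(\<lambda>t. \<integral>\<^sup>+\<omega>. ennreal ((Y t h \<omega>)\<^sup>2) \<partial>M) \<longlonglongrightarrow> 0" for h
  proof (rule tendsto_sandwich[OF _ _ tendsto_const])
    show "\<forall>\<^sub>F t in sequentially. (\<integral>\<^sup>+\<omega>. ennreal ((Y t h \<omega>)\<^sup>2) \<partial>M) \<le> ennreal (4 * (\<integral>\<theta>. (lin_rem (r t *\<^sub>R h) \<theta> / r t)\<^sup>2 \<partial>P))"
      using eventually_coeff
    proof eventually_elim
      case (elim t)
      have b: "\<bar>(1 / r t) * lin_rem (r t *\<^sub>R h) \<theta>\<bar> \<le> (1 / r t) * (K1 * norm (r t *\<^sub>R h))" if "\<theta> \<in> space N" for \<theta>
      proof -
        have "\<bar>(1 / r t) * lin_rem (r t *\<^sub>R h) \<theta>\<bar> = (1 / r t) * \<bar>lin_rem (r t *\<^sub>R h) \<theta>\<bar>"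
          using r(2)[of t] by (simp add: abs_mult)
        also have "\<dots> \<le> (1 / r t) * (K1 * norm (r t *\<^sub>R h))"
          using r(2)[of t] by (intro mult_left_mono lin_rem_bounded that) simp
        finally show ?thesis .
      qed
      have "(\<integral>\<^sup>+\<omega>. ennreal ((Y t h \<omega>)\<^sup>2) \<partial>M) \<le> ennreal (4 * (\<integral>\<theta>. ((1 / r t) * lin_rem (r t *\<^sub>R h) \<theta>)\<^sup>2 \<partial>P))"
        unfolding Yeq Xi_def by (rule dev_second_moment_le[OF _ b]) (use elim k in auto)
      then show ?case by simp
    qed
    have "(\<lambda>t. 4 * (\<integral>\<theta>. (lin_rem (r t *\<^sub>R h) \<theta> / r t)\<^sup>2 \<partial>P)) \<longlonglongrightarrow> 4 * 0"
      by (intro tendsto_intros lin_rem_square_tendsto_0 r)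
    from tendsto_ennrealI[OF this] show "(\<lambda>t. ennreal (4 * (\<integral>\<theta>. (lin_rem (r t *\<^sub>R h) \<theta> / r t)\<^sup>2 \<partial>P))) \<longlonglongrightarrow> 0" by simp
  qed simp
  have "high_prob M \<eta> (\<lambda>t \<omega>. \<forall>h. norm h \<le> 1 \<longrightarrow> \<bar>Y t h \<omega>\<bar> \<le> \<kappa> / R)"
    by (rule high_prob_uniformly_small[OF LY Kr_nonneg Ym ptw \<eta>]) (use \<kappa> R in auto)
  then show ?thesis
  proof (rule high_prob_mono)
    show "\<forall>\<^sub>F t in sequentially. \<forall>\<omega>\<in>space M. (\<forall>h. norm h \<le> 1 \<longrightarrow> \<bar>Y t h \<omega>\<bar> \<le> \<kappa> / R) \<longrightarrow>
      (\<forall>h. norm h \<le> R \<longrightarrow> \<bar>Xi k t \<omega> (lin_rem (\<epsilon> t *\<^sub>R h))\<bar> \<le> \<epsilon> t * \<kappa>)"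
    proof (intro always_eventually allI ballI impI)
      fix t \<omega> and h :: "real ^ 'n"
      assume Y: "\<forall>h. norm h \<le> 1 \<longrightarrow> \<bar>Y t h \<omega>\<bar> \<le> \<kappa> / R" and h: "norm h \<le> R"
      have "\<bar>Y t ((1 / R) *\<^sub>R h) \<omega>\<bar> \<le> \<kappa> / R" using Y h R by simp
      then have "\<bar>Xi k t \<omega> (lin_rem (\<epsilon> t *\<^sub>R h))\<bar> / r t \<le> \<kappa> / R"
        using R r(2)[of t] by (simp add: Y_def abs_divide) (simp add: r_def)
      then show "\<bar>Xi k t \<omega> (lin_rem (\<epsilon> t *\<^sub>R h))\<bar> \<le> \<epsilon> t * \<kappa>"
        using R \<epsilon>_pos[of t] by (simp add: r_def field_simps)
    qed
  qed
qed

text \<open>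
  With high probability the perturbation grows at most linearly, has the local modulus of the peeling
  argument and is uniformly linear on the scale \<open>\<epsilon> t\<close>. On this event \<open>argmin_localization\<close> and
  \<open>argmin_linearization\<close> apply. They do not rest on convexity of \<open>J\<close>, which the bootstrap objective may lack.
\<close>

lemma argmin_expansion:
  fixes J :: "nat \<Rightarrow> 'w \<Rightarrow> real ^ 'n \<Rightarrow> real" and \<beta>h :: "nat \<Rightarrow> 'w \<Rightarrow> real ^ 'n"
  assumes k: "\<bar>k\<bar> \<le> 1"
    and J: "\<And>t. 1 \<le> t \<Longrightarrow> AE \<omega> in M. \<forall>\<beta>. J t \<omega> \<beta> = H \<beta> + \<epsilon> t * Xi k t \<omega> (f \<beta>)"
    and sel: "\<And>t \<omega>. 1 \<le> t \<Longrightarrow> \<omega> \<in> space M \<Longrightarrow> argmin_orthant (J t \<omega>) \<noteq> {} \<Longrightarrow> \<beta>h t \<omega> \<in> argmin_orthant (J t \<omega>)"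
    and \<delta>: "\<delta> > 0" and \<eta>: "\<eta> > 0"
  shows "high_prob M \<eta> (\<lambda>t \<omega>. norm ((1 / \<epsilon> t) *\<^sub>R (\<beta>h t \<omega> - \<beta>s) + Ainv *v zeta k t \<omega>) \<le> \<delta>)"
proof -
  obtain c \<delta>0 where c: "c > 0" and \<delta>0: "\<delta>0 > 0" "\<delta>0 < r0"
    and pb: "\<And>\<beta>. norm (\<beta> - \<beta>s) \<le> \<delta>0 \<Longrightarrow> all_pos \<beta>"
    and g1: "\<And>h. norm h \<le> \<delta>0 \<Longrightarrow> H \<beta>s + c * (norm h)\<^sup>2 \<le> H (\<beta>s + h)"
    and g2: "\<And>\<beta>. all_pos \<beta> \<Longrightarrow> \<delta>0 \<le> norm (\<beta> - \<beta>s) \<Longrightarrow> H \<beta>s + c * \<delta>0 * norm (\<beta> - \<beta>s) \<le> H \<beta>"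
    by (rule PC.growth) blast
  obtain l where l: "l > 0" "\<And>h. l * (norm h)\<^sup>2 \<le> h \<bullet> (A *v h)" using PC.hessian_posdef by blast
  note Lf = Xi_f_lipschitz[OF k]
  have \<eta>3: "\<eta> / 3 > 0" using \<eta> by simp
  have hom: "Xi k t \<omega> (f (r *\<^sub>R \<beta>)) = r * Xi k t \<omega> (f \<beta>)" if "0 \<le> r" for t r \<beta> \<omega>
    using dev_cmult[of _ k t \<omega> r "f \<beta>"] max_value_scale[OF that, of v _ \<beta>] by (simp add: Xi_def)
  have "\<exists>B>0. high_prob M (\<eta> / 3) (\<lambda>t \<omega>. \<forall>\<beta>. \<bar>Xi k t \<omega> (f \<beta>)\<bar> \<le> B * norm \<beta>)"
    by (rule high_prob_linear_growth[OF Lf Kf_nonneg hom \<eta>3])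
  then obtain B where B': "B > 0 \<and> high_prob M (\<eta> / 3) (\<lambda>t \<omega>. \<forall>\<beta>. \<bar>Xi k t \<omega> (f \<beta>)\<bar> \<le> B * norm \<beta>)" ..
  note B = B'[THEN conjunct1] B'[THEN conjunct2]
  have "\<exists>A>0. high_prob M (\<eta> / 3) (\<lambda>t \<omega>. \<forall>h. \<epsilon> t \<le> norm h \<longrightarrow>
      \<bar>Xi k t \<omega> (f (\<beta>s + h)) - Xi k t \<omega> (f \<beta>s)\<bar> \<le> A * norm h * sqrt (norm h / \<epsilon> t))"
    by (rule high_prob_local_modulus[OF Lf Kf_nonneg \<epsilon>_pos \<eta>3])
  then obtain A0 where A0': "A0 > 0 \<and> high_prob M (\<eta> / 3) (\<lambda>t \<omega>. \<forall>h. \<epsilon> t \<le> norm h \<longrightarrow>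
      \<bar>Xi k t \<omega> (f (\<beta>s + h)) - Xi k t \<omega> (f \<beta>s)\<bar> \<le> A0 * norm h * sqrt (norm h / \<epsilon> t))" ..
  note A0 = A0'[THEN conjunct1] A0'[THEN conjunct2]
  (* R bounds the rescaled minimizer as well as the minimizer k0 of the quadratic model *)
  define R where "R = max (max 1 ((A0 / c)\<^sup>2)) ((A0 + 1) / l)"
  have R: "1 \<le> R" "max 1 ((A0 / c)\<^sup>2) \<le> R" "(A0 + 1) / l \<le> R" by (auto simp: R_def)
  (* argmin_linearization leaves the squared error 8 \<kappa> / l *)
  define \<kappa> where "\<kappa> = min 1 (l * \<delta>\<^sup>2 / 8)"
  have \<kappa>: "0 < \<kappa>" "\<kappa> \<le> 1" "8 * \<kappa> / l \<le> \<delta>\<^sup>2" using l(1) \<delta> by (auto simp: \<kappa>_def pos_divide_le_eq min_def mult.commute)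
  have small: "high_prob M (\<eta> / 3) (\<lambda>t \<omega>. \<forall>h. norm h \<le> R \<longrightarrow> \<bar>Xi k t \<omega> (lin_rem (\<epsilon> t *\<^sub>R h))\<bar> \<le> \<epsilon> t * \<kappa>)"
    using R by (intro Xi_lin_rem_small[OF k _ \<kappa>(1) \<eta>3]) simp
  have Jp: "high_prob M 0 (\<lambda>t \<omega>. \<forall>\<beta>. J t \<omega> \<beta> = H \<beta> + \<epsilon> t * Xi k t \<omega> (f \<beta>))"
    by (rule high_prob_AE, rule eventually_mono[OF eventually_ge_at_top[of 1]], rule J)
  have "\<kappa> / R\<^sup>2 > 0" using \<kappa> R by simp
  from PC.second_order_expansion[OF this] obtain d where d: "d > 0"
    "\<And>h. norm h < d \<Longrightarrow> \<bar>H (\<beta>s + h) - H \<beta>s - gradient H \<beta>s \<bullet> h - (h \<bullet> (A *v h)) / 2\<bar> \<le> \<kappa> / R\<^sup>2 * (norm h)\<^sup>2" by blast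
  have ev: "\<forall>\<^sub>F t in sequentially. \<epsilon> t * B * (1 + 2 * norm \<beta>s / \<delta>0) < c * \<delta>0 \<and> \<epsilon> t * R < d \<and> \<epsilon> t * R \<le> \<delta>0 \<and> 1 \<le> t \<and> lipschitz_moments M Kf (\<lambda>\<beta> \<omega>. Xi k t \<omega> (f \<beta>))"
  proof -
    have "(\<lambda>t. \<epsilon> t * B * (1 + 2 * norm \<beta>s / \<delta>0)) \<longlonglongrightarrow> 0 * B * (1 + 2 * norm \<beta>s / \<delta>0)"
      by (intro tendsto_mult tendsto_const \<epsilon>_small)
    then have e1: "\<forall>\<^sub>F t in sequentially. \<epsilon> t * B * (1 + 2 * norm \<beta>s / \<delta>0) < c * \<delta>0"
      using c \<delta>0 by (intro order_tendstoD) auto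
    have "(\<lambda>t. \<epsilon> t * R) \<longlonglongrightarrow> 0 * R" by (intro tendsto_mult tendsto_const \<epsilon>_small)
    then have e2: "\<forall>\<^sub>F t in sequentially. \<epsilon> t * R < min d \<delta>0"
      using d \<delta>0 by (intro order_tendstoD) auto
    from e1 e2 eventually_ge_at_top[of 1] Lf show ?thesis by eventually_elim auto
  qed
  have "high_prob M (\<eta> / 3 + (\<eta> / 3 + (\<eta> / 3 + 0))) (\<lambda>t \<omega>. norm ((1 / \<epsilon> t) *\<^sub>R (\<beta>h t \<omega> - \<beta>s) + Ainv *v zeta k t \<omega>) \<le> \<delta>)"
    using high_prob_conj[OF B(2) high_prob_conj[OF A0(2) high_prob_conj[OF small Jp]]]
  proof (rule high_prob_mono)
    show "\<forall>\<^sub>F t in sequentially. \<forall>\<omega>\<in>space M.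
       (\<forall>\<beta>. \<bar>Xi k t \<omega> (f \<beta>)\<bar> \<le> B * norm \<beta>) \<and>
       (\<forall>h. \<epsilon> t \<le> norm h \<longrightarrow> \<bar>Xi k t \<omega> (f (\<beta>s + h)) - Xi k t \<omega> (f \<beta>s)\<bar> \<le> A0 * norm h * sqrt (norm h / \<epsilon> t)) \<and>
       (\<forall>h. norm h \<le> R \<longrightarrow> \<bar>Xi k t \<omega> (lin_rem (\<epsilon> t *\<^sub>R h))\<bar> \<le> \<epsilon> t * \<kappa>) \<and>
       (\<forall>\<beta>. J t \<omega> \<beta> = H \<beta> + \<epsilon> t * Xi k t \<omega> (f \<beta>)) \<longrightarrow>
       norm ((1 / \<epsilon> t) *\<^sub>R (\<beta>h t \<omega> - \<beta>s) + Ainv *v zeta k t \<omega>) \<le> \<delta>"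
      using ev
    proof (eventually_elim, intro ballI impI, elim conjE)
      fix t \<omega>
      assume eB: "\<epsilon> t * B * (1 + 2 * norm \<beta>s / \<delta>0) < c * \<delta>0" and eR: "\<epsilon> t * R < d" "\<epsilon> t * R \<le> \<delta>0" and t: "1 \<le> t"
        and Lt: "lipschitz_moments M Kf (\<lambda>\<beta> \<omega>. Xi k t \<omega> (f \<beta>))" and \<omega>: "\<omega> \<in> space M"
        and E1: "\<forall>\<beta>. \<bar>Xi k t \<omega> (f \<beta>)\<bar> \<le> B * norm \<beta>"
        and E2: "\<forall>h. \<epsilon> t \<le> norm h \<longrightarrow> \<bar>Xi k t \<omega> (f (\<beta>s + h)) - Xi k t \<omega> (f \<beta>s)\<bar> \<le> A0 * norm h * sqrt (norm h / \<epsilon> t)"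
        and E3: "\<forall>h. norm h \<le> R \<longrightarrow> \<bar>Xi k t \<omega> (lin_rem (\<epsilon> t *\<^sub>R h))\<bar> \<le> \<epsilon> t * \<kappa>"
        and EJ: "\<forall>\<beta>. J t \<omega> \<beta> = H \<beta> + \<epsilon> t * Xi k t \<omega> (f \<beta>)"
      let ?\<xi> = "\<lambda>\<beta>. Xi k t \<omega> (f \<beta>)"
      have e: "\<epsilon> t > 0" by (rule \<epsilon>_pos)
      have contJ: "continuous_on (cball \<beta>s \<delta>0) (J t \<omega>)"
      proof -
        have "continuous_on (cball \<beta>s \<delta>0) ?\<xi>"
          using Lt \<omega> unfolding lipschitz_moments_def by (auto intro: continuous_on_subset)
        moreover have "continuous_on (cball \<beta>s \<delta>0) H"
        proof (intro continuous_at_imp_continuous_on ballI differentiable_imp_continuous_within)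
          fix y assume "y \<in> cball \<beta>s \<delta>0"
          then show "H differentiable (at y)" using PC.diff[of y] \<delta>0(2) by (simp add: dist_norm norm_minus_commute)
        qed
        ultimately have "continuous_on (cball \<beta>s \<delta>0) (\<lambda>\<beta>. H \<beta> + \<epsilon> t * ?\<xi> \<beta>)" by (intro continuous_intros)
        then show ?thesis using EJ by (simp cong: continuous_on_cong)
      qed
      have J': "\<And>\<beta>. all_pos \<beta> \<Longrightarrow> J t \<omega> \<beta> = H \<beta> + \<epsilon> t * ?\<xi> \<beta>" using EJ by blast
      have "argmin_orthant (J t \<omega>) \<noteq> {}"
        by (rule argmin_localization(1)[where H=H and \<xi>="?\<xi>" and e="\<epsilon> t" and B=B and A=A0 and \<beta>s=\<beta>s and c=c and \<delta>=\<delta>0])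
          (assumption | rule c \<delta>0(1) e pb g1 g2 J' contJ E1[rule_format] eB E2[rule_format])+
      then have am: "\<beta>h t \<omega> \<in> argmin_orthant (J t \<omega>)" by (rule sel[OF t \<omega>])
      have near: "norm (\<beta>h t \<omega> - \<beta>s) \<le> \<epsilon> t * max 1 ((A0 / c)\<^sup>2)"
        by (rule argmin_localization(2)[where H=H and J="J t \<omega>" and \<xi>="?\<xi>" and e="\<epsilon> t" and B=B and A=A0 and \<beta>s=\<beta>s and c=c and \<delta>=\<delta>0])
          (assumption | rule am c \<delta>0(1) e pb g1 g2 J' contJ E1[rule_format] eB E2[rule_format])+
      define kh where "kh = (1 / \<epsilon> t) *\<^sub>R (\<beta>h t \<omega> - \<beta>s)"
      have bh: "\<beta>s + \<epsilon> t *\<^sub>R kh = \<beta>h t \<omega>" using e by (simp add: kh_def)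
      have "norm (\<beta>h t \<omega> - \<beta>s) \<le> \<epsilon> t * max 1 ((A0 / c)\<^sup>2)" by (rule near)
      also have "\<dots> \<le> \<epsilon> t * R" using R e by (intro mult_left_mono) auto
      finally have "norm (\<beta>h t \<omega> - \<beta>s) / \<epsilon> t \<le> R" using e by (simp add: pos_divide_le_eq mult.commute)
      moreover have "norm kh = norm (\<beta>h t \<omega> - \<beta>s) / \<epsilon> t" unfolding kh_def norm_scaleR using e by simp
      ultimately have nk: "norm kh \<le> R" by simp
      have lin: "\<bar>?\<xi> (\<beta>s + \<epsilon> t *\<^sub>R h) - ?\<xi> \<beta>s - \<epsilon> t * (zeta k t \<omega> \<bullet> h)\<bar> \<le> \<epsilon> t * \<kappa>" if "norm h \<le> R" for h
        using E3 that Xi_expansion[of k t \<omega> "\<epsilon> t *\<^sub>R h"] by simp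
      (* the slope is bounded by testing the modulus in its own direction at the smallest scale \<epsilon> t *)
      have nz: "norm (zeta k t \<omega>) \<le> A0 + 1"
      proof (cases "zeta k t \<omega> = 0")
        case True
        then show ?thesis using A0 by simp
      next
        case False
        define u where "u = (1 / norm (zeta k t \<omega>)) *\<^sub>R zeta k t \<omega>"
        have u: "norm u = 1" using False by (simp add: u_def)
        have zu: "zeta k t \<omega> \<bullet> u = norm (zeta k t \<omega>)"
          using False by (simp add: u_def power2_norm_eq_inner[symmetric] power2_eq_square)
        have 1: "\<bar>?\<xi> (\<beta>s + \<epsilon> t *\<^sub>R u) - ?\<xi> \<beta>s\<bar> \<le> A0 * \<epsilon> t"
          using E2[rule_format, of "\<epsilon> t *\<^sub>R u"] e u by simp
        have 2: "\<bar>?\<xi> (\<beta>s + \<epsilon> t *\<^sub>R u) - ?\<xi> \<beta>s - \<epsilon> t * norm (zeta k t \<omega>)\<bar> \<le> \<epsilon> t * \<kappa>"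
          using lin[of u] u R unfolding zu by simp
        have "\<epsilon> t * norm (zeta k t \<omega>) \<le> A0 * \<epsilon> t + \<epsilon> t * \<kappa>" using 1 2 by (simp add: abs_le_iff)
        also have "\<dots> \<le> \<epsilon> t * (A0 + 1)" using e \<kappa> by (simp add: algebra_simps)
        finally show ?thesis using e by simp
      qed
      define k0 where "k0 = - (Ainv *v zeta k t \<omega>)"
      have Ak0: "A *v k0 = - zeta k t \<omega>"
        using linear_neg[OF matrix_vector_mul_linear, of A "Ainv *v zeta k t \<omega>"] by (simp add: k0_def A_mult_Ainv)
      have nk0: "norm k0 \<le> R"
      proof -
        have "l * (norm k0)\<^sup>2 \<le> norm k0 * norm (zeta k t \<omega>)"
          using l(2)[of k0] Cauchy_Schwarz_ineq2[of k0 "zeta k t \<omega>"] by (simp add: Ak0 abs_le_iff)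
        also have "\<dots> \<le> norm k0 * (A0 + 1)" using nz by (intro mult_left_mono) auto
        finally have "l * norm k0 \<le> A0 + 1"
          using A0(1) by (cases "k0 = 0") (auto simp: power2_eq_square mult.left_commute)
        then have "norm k0 \<le> (A0 + 1) / l" using l(1) by (simp add: field_simps)
        then show ?thesis using R(3) by linarith
      qed
      have quad: "\<bar>H (\<beta>s + \<epsilon> t *\<^sub>R h) - H \<beta>s - (\<epsilon> t)\<^sup>2 * (h \<bullet> (A *v h)) / 2\<bar> \<le> (\<epsilon> t)\<^sup>2 * \<kappa>" if h: "norm h \<le> R" for h
      proof -
        have "norm (\<epsilon> t *\<^sub>R h) \<le> \<epsilon> t * R" using h e by simp
        then have "norm (\<epsilon> t *\<^sub>R h) < d" using eR by linarith
        from d(2)[OF this] have "\<bar>H (\<beta>s + \<epsilon> t *\<^sub>R h) - H \<beta>s - (\<epsilon> t)\<^sup>2 * (h \<bullet> (A *v h)) / 2\<bar> \<le> \<kappa> / R\<^sup>2 * (norm (\<epsilon> t *\<^sub>R h))\<^sup>2"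
          by (simp add: PC.gradient_zero matrix_vector_mult_scaleR power2_eq_square mult.assoc)
        also have "\<dots> \<le> \<kappa> / R\<^sup>2 * (\<epsilon> t * R)\<^sup>2"
          using \<open>norm (\<epsilon> t *\<^sub>R h) \<le> \<epsilon> t * R\<close> \<kappa> by (intro mult_left_mono power_mono) auto
        also have "\<dots> = (\<epsilon> t)\<^sup>2 * \<kappa>" using R(1) by (simp add: power_mult_distrib)
        finally show ?thesis .
      qed
      have "(norm (kh - k0))\<^sup>2 \<le> 8 * \<kappa> / l"
        by (rule argmin_linearization[where H=H and J="J t \<omega>" and \<xi>="?\<xi>" and Q=A and e="\<epsilon> t" and \<delta>=\<delta>0 and z="zeta k t \<omega>" and R=R and \<beta>s=\<beta>s,
            OF e l(1) pb eR(2) J' transpose_A l(2) quad lin _ nk Ak0 nk0]) (use am bh in auto)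
      also have "\<dots> \<le> \<delta>\<^sup>2" by (rule \<kappa>(3))
      finally have "norm (kh - k0) \<le> \<delta>" using \<delta> by (simp add: power2_le_iff_abs_le)
      then show "norm ((1 / \<epsilon> t) *\<^sub>R (\<beta>h t \<omega> - \<beta>s) + Ainv *v zeta k t \<omega>) \<le> \<delta>"
        by (simp add: kh_def k0_def)
    qed
  qed
  then show ?thesis by simp
qed

lemma mean_f: "(\<integral>\<theta>. f \<beta> \<theta> \<partial>P) = fbar \<beta>"
  by (simp add: fbar_def)

lemma H_obs_eq:
  assumes t: "1 \<le> t"
  shows "H_obs b v t (\<lambda>\<tau>. X \<tau> \<omega>) \<beta> = H \<beta> + \<epsilon> t * Xi 0 t \<omega> (f \<beta>)"
proof -
  have "H_obs b v t (\<lambda>\<tau>. X \<tau> \<omega>) \<beta> = emp_mean t (\<lambda>\<tau>. f \<beta> (X \<tau> \<omega>)) - log_utility b \<beta>"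
    using t by (simp add: H_obs_def emp_mean_def F_LFM_eq sum_subtractf diff_divide_distrib)
  also have "emp_mean t (\<lambda>\<tau>. f \<beta> (X \<tau> \<omega>)) = fbar \<beta> + samp_dev t \<omega> (f \<beta>) / sqrt t"
    using emp_mean_dev[OF t, of "f \<beta>" \<omega>] by (simp add: mean_f)
  also have "samp_dev t \<omega> (f \<beta>) / sqrt t = \<epsilon> t * Xi 0 t \<omega> (f \<beta>)"
    using \<epsilon>_pos[of t] by (simp add: Xi_def dev_def)
  finally show ?thesis by (simp add: H_eq)
qed

lemma Xi_1_eq: "Xi 1 t \<omega> g = Xi 0 t \<omega> g + boot_dev t \<omega> g"
  by (simp add: Xi_def dev_def)

text \<open>
  As the weights sum to \<open>t\<close>, the logarithmic term cancels from the resampling part.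
\<close>

lemma H_boot_eq:
  assumes t: "1 \<le> t" and W: "(\<Sum>\<tau>=1..t. real (W t \<omega> \<tau>)) = real t"
  shows "H_boot b v (\<epsilon> t) t (\<lambda>\<tau>. X \<tau> \<omega>) (W t \<omega>) \<beta> = H \<beta> + \<epsilon> t * Xi 1 t \<omega> (f \<beta>)"
proof -
  let ?F = "\<lambda>\<tau>. F_LFM b v (X \<tau> \<omega>) \<beta>" and ?w = "\<lambda>\<tau>. real (W t \<omega> \<tau>) - 1"
  have z: "(\<Sum>\<tau>=1..t. ?w \<tau>) = 0" using W by (simp add: sum_subtractf)
  have "(\<Sum>\<tau>=1..t. (1 + \<epsilon> t * sqrt (real t) * ?w \<tau>) * ?F \<tau>) = (\<Sum>\<tau>=1..t. ?F \<tau>) + \<epsilon> t * sqrt t * (\<Sum>\<tau>=1..t. ?w \<tau> * ?F \<tau>)"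
    by (simp add: distrib_right sum.distrib sum_distrib_left mult.assoc)
  moreover have "(\<Sum>\<tau>=1..t. ?w \<tau> * ?F \<tau>) = (\<Sum>\<tau>=1..t. ?w \<tau> * f \<beta> (X \<tau> \<omega>)) - log_utility b \<beta> * (\<Sum>\<tau>=1..t. ?w \<tau>)"
  proof -
    have "(\<Sum>\<tau>=1..t. w \<tau> * ?F \<tau>) = (\<Sum>\<tau>=1..t. w \<tau> * f \<beta> (X \<tau> \<omega>)) - log_utility b \<beta> * (\<Sum>\<tau>=1..t. w \<tau>)" for w :: "nat \<Rightarrow> real"
      by (simp add: F_LFM_eq right_diff_distrib sum_subtractf sum_distrib_left mult.commute)
    then show ?thesis .
  qed
  moreover have "(\<Sum>\<tau>=1..t. ?w \<tau> * f \<beta> (X \<tau> \<omega>)) = sqrt t * boot_dev t \<omega> (f \<beta>)"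
    using t by (simp add: boot_dev_def boot_sum_def)
  ultimately have "(\<Sum>\<tau>=1..t. (1 + \<epsilon> t * sqrt (real t) * ?w \<tau>) * ?F \<tau>) = (\<Sum>\<tau>=1..t. ?F \<tau>) + real t * (\<epsilon> t * boot_dev t \<omega> (f \<beta>))"
    unfolding z by (simp add: mult.assoc mult.left_commute)
  then have "H_boot b v (\<epsilon> t) t (\<lambda>\<tau>. X \<tau> \<omega>) (W t \<omega>) \<beta> = H_obs b v t (\<lambda>\<tau>. X \<tau> \<omega>) \<beta> + \<epsilon> t * boot_dev t \<omega> (f \<beta>)"
    using t unfolding H_boot_def H_obs_def by (simp add: add_divide_distrib)
  then show ?thesis by (simp add: H_obs_eq[OF t] Xi_1_eq distrib_left)
qed

text \<open>
  Subtracting the expansion of the observed minimizer removes the sampling part of the slope.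
\<close>

lemma boot_vec_influence:
  "boot_vec t influence (data_vec t X \<omega>, W t \<omega>) = - (Ainv *v (zeta 1 t \<omega> - zeta 0 t \<omega>))"
proof (rule vector_eq_ldot[THEN iffD1], rule allI)
  fix u :: "real ^ 'n"
  define c where "c i = - (Ainv *v u) $ i" for i
  have "u \<bullet> boot_vec t influence (data_vec t X \<omega>, W t \<omega>) = boot_dev t \<omega> (\<lambda>\<theta>. u \<bullet> influence \<theta>)"
    unfolding inner_boot_vec boot_dev_def by (rule boot_sum_data[symmetric])
  also have "(\<lambda>\<theta>. u \<bullet> influence \<theta>) = (\<lambda>\<theta>. \<Sum>i\<in>UNIV. c i * D \<theta> $ i)"
  proof
    fix \<theta>
    have "u \<bullet> (Ainv *v D \<theta>) = (Ainv *v u) \<bullet> D \<theta>"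
      by (metis dot_lmul_matrix transpose_Ainv transpose_matrix_vector)
    then show "u \<bullet> influence \<theta> = (\<Sum>i\<in>UNIV. c i * D \<theta> $ i)"
      by (simp add: influence_def inner_vec_def sum_negf c_def)
  qed
  also have "boot_dev t \<omega> \<dots> = (\<Sum>i\<in>UNIV. c i * boot_dev t \<omega> (\<lambda>\<theta>. D \<theta> $ i))"
    using dev_sum[of UNIV "\<lambda>i \<theta>. c i * D \<theta> $ i" 0 1 t \<omega>] integrable_D_component
    by (simp add: dev_def boot_dev_cmult)
  also have "\<dots> = - ((Ainv *v u) \<bullet> (zeta 1 t \<omega> - zeta 0 t \<omega>))"
    by (simp add: inner_vec_def zeta_def Xi_1_eq sum_negf c_def)
  also have "(Ainv *v u) \<bullet> (zeta 1 t \<omega> - zeta 0 t \<omega>) = u \<bullet> (Ainv *v (zeta 1 t \<omega> - zeta 0 t \<omega>))"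
    by (metis dot_lmul_matrix transpose_Ainv transpose_matrix_vector)
  finally show "u \<bullet> boot_vec t influence (data_vec t X \<omega>, W t \<omega>) = u \<bullet> - (Ainv *v (zeta 1 t \<omega> - zeta 0 t \<omega>))" by simp
qed

end

section \<open>Consistency of the bootstrap\<close>

context bootstrap_market
begin

lemma subalgebra_data_weights: "subalgebra (data_weight_algebra M N t X (W t)) (data_algebra M N t X)"
  unfolding subalgebra_def
proof
  let ?D = "PiM {1..t} (\<lambda>_. N)" and ?p = "\<lambda>\<omega>. (data_vec t X \<omega>, W t \<omega>)"
  have p: "?p \<in> space M \<rightarrow> space (?D \<Otimes>\<^sub>M count_space UNIV)"
    using data_vec_in_space[of t] by (auto simp: space_pair_measure)
  show "space (data_algebra M N t X) = space (data_weight_algebra M N t X (W t))"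
    by (simp add: data_algebra_def data_weight_algebra_def)
  show "sets (data_algebra M N t X) \<subseteq> sets (data_weight_algebra M N t X (W t))"
  proof
    fix B assume "B \<in> sets (data_algebra M N t X)"
    then obtain A where A: "A \<in> sets ?D" "B = data_vec t X -` A \<inter> space M"
      unfolding data_algebra_def sets_vimage_algebra2[OF data_vec_in_space] by blast
    have "A \<times> UNIV \<in> sets (?D \<Otimes>\<^sub>M count_space (UNIV :: (nat \<Rightarrow> nat) set))"
      by (intro pair_measureI A) simp
    moreover have "B = ?p -` (A \<times> UNIV) \<inter> space M" using A(2) by auto
    ultimately show "B \<in> sets (data_weight_algebra M N t X (W t))"
      unfolding data_weight_algebra_def sets_vimage_algebra2[OF p] by blast
  qed
qed

text \<open>
  Truncation turns convergence in probability into convergence in mean.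
\<close>

lemma nn_integral_min_tendsto_0:
  fixes Y :: "nat \<Rightarrow> 'w \<Rightarrow> real"
  assumes Y: "\<And>\<delta> \<eta>. \<delta> > 0 \<Longrightarrow> \<eta> > 0 \<Longrightarrow> high_prob M \<eta> (\<lambda>t \<omega>. Y t \<omega> \<le> \<delta>)"
  shows "(\<lambda>t. \<integral>\<^sup>+\<omega>. ennreal (min 2 (Y t \<omega>)) \<partial>M) \<longlonglongrightarrow> 0"
proof (rule order_tendstoI)
  fix e :: ennreal assume "0 < e"
  from dense[OF this] obtain d where d: "0 < d" "d < e" by blast
  define e' where "e' = enn2real d"
  have "d < \<top>" using d(2) by (rule order.strict_trans2) simp
  then have ed: "ennreal e' = d" unfolding e'_def by simp
  then have e': "0 < e'" "ennreal e' < e" using d by (auto simp: ennreal_less_zero_iff[symmetric] simp del: ennreal_less_zero_iff)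
  have "high_prob M (e' / 4) (\<lambda>t \<omega>. Y t \<omega> \<le> e' / 4)" using e' by (intro Y) auto
  then show "\<forall>\<^sub>F t in sequentially. (\<integral>\<^sup>+\<omega>. ennreal (min 2 (Y t \<omega>)) \<partial>M) < e"
    unfolding high_prob_def
  proof eventually_elim
    case (elim t)
    then obtain B where B: "B \<in> sets M" "{\<omega> \<in> space M. \<not> Y t \<omega> \<le> e' / 4} \<subseteq> B" "measure M B \<le> e' / 4" by blast
    have "(\<integral>\<^sup>+\<omega>. ennreal (min 2 (Y t \<omega>)) \<partial>M) \<le> (\<integral>\<^sup>+\<omega>. ennreal (e' / 4) + 2 * indicator B \<omega> \<partial>M)"
    proof (rule nn_integral_mono)
      fix \<omega> assume \<omega>: "\<omega> \<in> space M"
      show "ennreal (min 2 (Y t \<omega>)) \<le> ennreal (e' / 4) + 2 * indicator B \<omega>"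
      proof (cases "\<omega> \<in> B")
        case True
        have "ennreal (min 2 (Y t \<omega>)) \<le> ennreal 2" by (intro ennreal_leI) simp
        then show ?thesis using True by (simp add: add_increasing)
      next
        case False
        then have "Y t \<omega> \<le> e' / 4" using B(2) \<omega> by blast
        then have "ennreal (min 2 (Y t \<omega>)) \<le> ennreal (e' / 4)" by (intro ennreal_leI) simp
        then show ?thesis by (simp add: add_increasing2)
      qed
    qed
    also have "\<dots> = ennreal (e' / 4) + 2 * ennreal (measure M B)"
      using B(1) by (simp add: nn_integral_add nn_integral_cmult emeasure_eq_measure prob_space)
    also have "\<dots> = ennreal (e' / 4 + 2 * measure M B)"
      using e' by (simp add: ennreal_mult ennreal_plus)
    also have "\<dots> \<le> ennreal e'" using B(3) e'(1) by (intro ennreal_leI) simp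
    also have "\<dots> < e" by (rule e'(2))
    finally show ?case .
  qed
qed simp

text \<open>
  The estimation error is \<open>boot_vec t influence\<close> up to an error that vanishes in probability. By
  \<open>cond_distr_BL_dist_le\<close> the conditional laws inherit this, and for \<open>boot_vec\<close> the conditional central limit theorem
  applies.
\<close>

lemma bootstrap_consistent:
  fixes \<beta>obs \<beta>boot :: "nat \<Rightarrow> 'w \<Rightarrow> real ^ 'n"
  assumes \<beta>obs_measurable: "\<And>t. 1 \<le> t \<Longrightarrow> \<beta>obs t \<in> borel_measurable (data_algebra M N t X)"
    and \<beta>obs_argmin: "\<And>t \<omega>. 1 \<le> t \<Longrightarrow> \<omega> \<in> space M \<Longrightarrow>
          argmin_orthant (H_obs b v t (\<lambda>\<tau>. X \<tau> \<omega>)) \<noteq> {} \<Longrightarrow>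
          \<beta>obs t \<omega> \<in> argmin_orthant (H_obs b v t (\<lambda>\<tau>. X \<tau> \<omega>))"
    and \<beta>boot_measurable: "\<And>t. 1 \<le> t \<Longrightarrow>
          \<beta>boot t \<in> borel_measurable (data_weight_algebra M N t X (W t))"
    and \<beta>boot_argmin: "\<And>t \<omega>. 1 \<le> t \<Longrightarrow> \<omega> \<in> space M \<Longrightarrow>
          argmin_orthant (H_boot b v (\<epsilon> t) t (\<lambda>\<tau>. X \<tau> \<omega>) (W t \<omega>)) \<noteq> {} \<Longrightarrow>
          \<beta>boot t \<omega> \<in> argmin_orthant (H_boot b v (\<epsilon> t) t (\<lambda>\<tau>. X \<tau> \<omega>) (W t \<omega>))"
  shows "consistently_estimates M (\<lambda>t. data_algebra M N t X)
           (\<lambda>t \<omega>. (1 / \<epsilon> t) *\<^sub>R (\<beta>boot t \<omega> - \<beta>obs t \<omega>)) (J_LFM N s b v \<beta>s)"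
  unfolding consistently_estimates_def
proof (intro allI impI)
  fix K :: "nat \<Rightarrow> 'w \<Rightarrow> (real ^ 'n) measure"
  let ?L = "J_LFM N s b v \<beta>s"
  let ?Z = "\<lambda>t \<omega>. (1 / \<epsilon> t) *\<^sub>R (\<beta>boot t \<omega> - \<beta>obs t \<omega>)"
  let ?R = "\<lambda>t. boot_vec t influence"
  let ?Q = "\<lambda>t \<omega>. distr (measure_pmf (weights_pmf t)) borel (\<lambda>w. ?R t (data_vec t X \<omega>, w))"
  assume K: "\<forall>t\<ge>1. is_cond_distr M (data_algebra M N t X) (?Z t) (K t)"
  have L: "prob_space ?L" "sets ?L = sets borel"
    unfolding J_LFM_eq by (rule prob_space_mv_normal, rule sets_mv_normal)
  have Zm: "?Z t \<in> borel_measurable (data_weight_algebra M N t X (W t))" if "1 \<le> t" for t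
    using \<beta>boot_measurable[OF that] measurable_from_subalg[OF subalgebra_data_weights \<beta>obs_measurable[OF that]]
    by measurable
  define Y where "Y t \<omega> = norm (?Z t \<omega> - ?R t (data_vec t X \<omega>, W t \<omega>))" for t \<omega>
  have Y: "high_prob M \<eta> (\<lambda>t \<omega>. Y t \<omega> \<le> \<delta>)" if \<delta>: "\<delta> > 0" and \<eta>: "\<eta> > 0" for \<delta> \<eta>
  proof -
    have obs: "high_prob M (\<eta> / 2) (\<lambda>t \<omega>. norm ((1 / \<epsilon> t) *\<^sub>R (\<beta>obs t \<omega> - \<beta>s) + Ainv *v zeta 0 t \<omega>) \<le> \<delta> / 2)"
    proof (rule argmin_expansion[where J="\<lambda>t \<omega>. H_obs b v t (\<lambda>\<tau>. X \<tau> \<omega>)"])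
      show "AE \<omega> in M. \<forall>\<beta>. H_obs b v t (\<lambda>\<tau>. X \<tau> \<omega>) \<beta> = H \<beta> + \<epsilon> t * Xi 0 t \<omega> (f \<beta>)" if "1 \<le> t" for t
        using H_obs_eq[OF that] by simp
    qed (use \<delta> \<eta> \<beta>obs_argmin in auto)
    have boot: "high_prob M (\<eta> / 2) (\<lambda>t \<omega>. norm ((1 / \<epsilon> t) *\<^sub>R (\<beta>boot t \<omega> - \<beta>s) + Ainv *v zeta 1 t \<omega>) \<le> \<delta> / 2)"
    proof (rule argmin_expansion[where J="\<lambda>t \<omega>. H_boot b v (\<epsilon> t) t (\<lambda>\<tau>. X \<tau> \<omega>) (W t \<omega>)"])
      show "AE \<omega> in M. \<forall>\<beta>. H_boot b v (\<epsilon> t) t (\<lambda>\<tau>. X \<tau> \<omega>) (W t \<omega>) \<beta> = H \<beta> + \<epsilon> t * Xi 1 t \<omega> (f \<beta>)" if "1 \<le> t" for t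
        using AE_sum_weights[OF that] by (rule eventually_mono) (intro allI H_boot_eq[OF that])
    qed (use \<delta> \<eta> \<beta>boot_argmin in auto)
    have "high_prob M (\<eta> / 2 + \<eta> / 2) (\<lambda>t \<omega>. Y t \<omega> \<le> \<delta>)"
      using high_prob_conj[OF obs boot]
    proof (rule high_prob_mono, intro always_eventually allI ballI impI, elim conjE)
      fix t \<omega>
      let ?o = "(1 / \<epsilon> t) *\<^sub>R (\<beta>obs t \<omega> - \<beta>s) + Ainv *v zeta 0 t \<omega>"
      let ?b = "(1 / \<epsilon> t) *\<^sub>R (\<beta>boot t \<omega> - \<beta>s) + Ainv *v zeta 1 t \<omega>"
      assume o: "norm ?o \<le> \<delta> / 2" and bb: "norm ?b \<le> \<delta> / 2"
      have "?Z t \<omega> - ?R t (data_vec t X \<omega>, W t \<omega>) = ?b - ?o"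
        unfolding boot_vec_influence by (simp add: matrix_vector_mult_diff_distrib scaleR_right_diff_distrib)
      then show "Y t \<omega> \<le> \<delta>"
        using norm_triangle_ineq4[of ?b ?o] o bb by (simp add: Y_def)
    qed
    then show ?thesis by simp
  qed
  have boot_vec_meas: "?R t \<in> borel_measurable (PiM {1..t} (\<lambda>_. N) \<Otimes>\<^sub>M count_space UNIV)" for t
    by (rule boot_vec_measurable[OF influence_measurable])
  have "\<forall>t. \<exists>U. U \<in> borel_measurable M \<and> (1 \<le> t \<longrightarrow>
      (\<integral>\<^sup>+\<omega>. U \<omega> \<partial>M) = (\<integral>\<^sup>+\<omega>. ennreal (min 2 (Y t \<omega>)) \<partial>M) \<and>
      (AE \<omega> in M. ennreal (BL_dist (K t \<omega>) ?L) \<le> U \<omega> + ennreal (BL_dist (?Q t \<omega>) ?L)))"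
  proof
    fix t
    show "\<exists>U. U \<in> borel_measurable M \<and> (1 \<le> t \<longrightarrow>
      (\<integral>\<^sup>+\<omega>. U \<omega> \<partial>M) = (\<integral>\<^sup>+\<omega>. ennreal (min 2 (Y t \<omega>)) \<partial>M) \<and>
      (AE \<omega> in M. ennreal (BL_dist (K t \<omega>) ?L) \<le> U \<omega> + ennreal (BL_dist (?Q t \<omega>) ?L)))"
    proof (cases "1 \<le> t")
    case True
    then have "is_cond_distr M (data_algebra M N t X) (?Z t) (K t)" using K by blast
    from cond_distr_BL_dist_le[OF True this Zm[OF True] boot_vec_meas L] show ?thesis unfolding Y_def by blast
    qed (auto intro: exI[of _ "\<lambda>_. 0"])
  qed
  from choice[OF this] obtain U where U_all: "\<forall>t. U t \<in> borel_measurable M \<and> (1 \<le> t \<longrightarrow>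
      (\<integral>\<^sup>+\<omega>. U t \<omega> \<partial>M) = (\<integral>\<^sup>+\<omega>. ennreal (min 2 (Y t \<omega>)) \<partial>M) \<and>
      (AE \<omega> in M. ennreal (BL_dist (K t \<omega>) ?L) \<le> U t \<omega> + ennreal (BL_dist (?Q t \<omega>) ?L)))" ..
  note U = U_all[rule_format, THEN conjunct1] U_all[rule_format, THEN conjunct2, rule_format, THEN conjunct1]
    U_all[rule_format, THEN conjunct2, rule_format, THEN conjunct2]
  have U0: "(\<lambda>t. \<integral>\<^sup>+\<omega>. U t \<omega> \<partial>M) \<longlonglongrightarrow> 0"
  proof (rule Lim_transform_eventually)
    show "(\<lambda>t. \<integral>\<^sup>+\<omega>. ennreal (min 2 (Y t \<omega>)) \<partial>M) \<longlonglongrightarrow> 0" by (rule nn_integral_min_tendsto_0[OF Y])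
    show "\<forall>\<^sub>F t in sequentially. (\<integral>\<^sup>+\<omega>. ennreal (min 2 (Y t \<omega>)) \<partial>M) = (\<integral>\<^sup>+\<omega>. U t \<omega> \<partial>M)"
      using eventually_ge_at_top[of 1] by eventually_elim (simp add: U(2))
  qed
  show "vanishes_in_prob M (\<lambda>t \<omega>. BL_dist (K t \<omega>) ?L)"
  proof (rule vanishes_in_probI)
    fix \<delta> \<eta> :: real assume \<delta>: "\<delta> > 0" and \<eta>: "\<eta> > 0"
    obtain c where c: "\<And>\<theta>. \<theta> \<in> space N \<Longrightarrow> norm (influence \<theta>) \<le> c" using influence_bounded by blast
    have h1: "high_prob M (\<eta> / 2) (\<lambda>t \<omega>. U t \<omega> \<le> ennreal (\<delta> / 2))"
      by (rule high_prob_tendsto_0[OF U(1) U0]) (use \<delta> \<eta> in auto)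
    have h2: "high_prob M (\<eta> / 2) (\<lambda>t \<omega>. BL_dist (?Q t \<omega>) ?L \<le> \<delta> / 2)"
      by (rule conditional_bootstrap_clt[OF influence_measurable c L char_fn_J_LFM]) (use \<delta> \<eta> in auto)
    have h3: "high_prob M 0 (\<lambda>t \<omega>. ennreal (BL_dist (K t \<omega>) ?L) \<le> U t \<omega> + ennreal (BL_dist (?Q t \<omega>) ?L))"
      by (rule high_prob_AE, rule eventually_mono[OF eventually_ge_at_top[of 1]], rule U(3))
    have "high_prob M (\<eta> / 2 + (\<eta> / 2 + 0)) (\<lambda>t \<omega>. BL_dist (K t \<omega>) ?L \<le> \<delta>)"
      using high_prob_conj[OF h1 high_prob_conj[OF h2 h3]]
    proof (rule high_prob_mono, intro always_eventually allI ballI impI, elim conjE)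
      fix t \<omega> assume a: "U t \<omega> \<le> ennreal (\<delta> / 2)" "BL_dist (?Q t \<omega>) ?L \<le> \<delta> / 2"
        "ennreal (BL_dist (K t \<omega>) ?L) \<le> U t \<omega> + ennreal (BL_dist (?Q t \<omega>) ?L)"
      note a(3)
      also have "U t \<omega> + ennreal (BL_dist (?Q t \<omega>) ?L) \<le> ennreal (\<delta> / 2) + ennreal (\<delta> / 2)"
        by (intro add_mono a(1) ennreal_leI a(2))
      also have "\<dots> = ennreal \<delta>" using \<delta> by (subst ennreal_plus[symmetric]) auto
      finally show "BL_dist (K t \<omega>) ?L \<le> \<delta>" using \<delta> by (simp add: ennreal_le_iff)
    qed
    then show "high_prob M \<eta> (\<lambda>t \<omega>. BL_dist (K t \<omega>) ?L \<le> \<delta>)" by simp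
  qed
qed

end

theorem theorem7:
  fixes N :: "'a measure"
    and s :: "'a \<Rightarrow> real"
    and b :: "real ^ 'n"
    and v :: "'n \<Rightarrow> 'a \<Rightarrow> real"
    and M :: "'w measure"
    and X :: "nat \<Rightarrow> 'w \<Rightarrow> 'a"
    and W :: "nat \<Rightarrow> 'w \<Rightarrow> nat \<Rightarrow> nat"
    and \<epsilon> :: "nat \<Rightarrow> real"
    and \<beta>star :: "real ^ 'n"
    and \<beta>obs \<beta>boot :: "nat \<Rightarrow> 'w \<Rightarrow> real ^ 'n"
  assumes budgets: "\<And>i. 0 < b $ i"
    and valuations_integrable: "\<And>i. integrable N (v i)"
    and valuations_nonneg: "\<And>i \<theta>. \<theta> \<in> space N \<Longrightarrow> 0 \<le> v i \<theta>"
    and valuations_bounded: "\<exists>C. \<forall>i. \<forall>\<theta>\<in>space N. v i \<theta> \<le> C"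
    and supply_measurable: "s \<in> borel_measurable N"
    and supply_nonneg: "\<And>\<theta>. \<theta> \<in> space N \<Longrightarrow> 0 \<le> s \<theta>"
    and supply_bounded: "\<exists>C. \<forall>\<theta>\<in>space N. s \<theta> \<le> C"
    and supply_unit: "(\<integral>\<theta>. s \<theta> \<partial>N) = 1"
    and prob: "prob_space M"
    and draws_density: "\<And>\<tau>. 1 \<le> \<tau> \<Longrightarrow> distributed M N (X \<tau>) (\<lambda>\<theta>. ennreal (s \<theta>))"
    and draws_indep: "prob_space.indep_vars M (\<lambda>_. N) X {1..}"
    and weights_measurable: "\<And>t. 1 \<le> t \<Longrightarrow> W t \<in> measurable M (count_space UNIV)"
    and weights_law: "\<And>t. 1 \<le> t \<Longrightarrow>
          distr M (count_space UNIV) (W t) = measure_pmf (multinomial_pmf t (pmf_of_set {1..t}))"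
    and weights_indep: "\<And>t. 1 \<le> t \<Longrightarrow>
          prob_space.indep_set M (sets (data_algebra M N t X))
            (sets (vimage_algebra (space M) (W t) (count_space UNIV)))"
    and \<beta>star: "\<beta>star \<in> argmin_orthant (H_pop N s b v)"
    and H_C2: "C2_near (H_pop N s b v) \<beta>star"
    and \<epsilon>_pos: "\<And>t. 0 < \<epsilon> t"
    and \<epsilon>_small: "\<epsilon> \<longlonglongrightarrow> 0"
    and \<epsilon>_large: "filterlim (\<lambda>t. \<epsilon> t * sqrt (real t)) at_top sequentially"
    and \<beta>obs_measurable: "\<And>t. 1 \<le> t \<Longrightarrow> \<beta>obs t \<in> borel_measurable (data_algebra M N t X)"
    and \<beta>obs_argmin: "\<And>t \<omega>. 1 \<le> t \<Longrightarrow> \<omega> \<in> space M \<Longrightarrow>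
          argmin_orthant (H_obs b v t (\<lambda>\<tau>. X \<tau> \<omega>)) \<noteq> {} \<Longrightarrow>
          \<beta>obs t \<omega> \<in> argmin_orthant (H_obs b v t (\<lambda>\<tau>. X \<tau> \<omega>))"
    and \<beta>boot_measurable: "\<And>t. 1 \<le> t \<Longrightarrow>
          \<beta>boot t \<in> borel_measurable (data_weight_algebra M N t X (W t))"
    and \<beta>boot_argmin: "\<And>t \<omega>. 1 \<le> t \<Longrightarrow> \<omega> \<in> space M \<Longrightarrow>
          argmin_orthant (H_boot b v (\<epsilon> t) t (\<lambda>\<tau>. X \<tau> \<omega>) (W t \<omega>)) \<noteq> {} \<Longrightarrow>
          \<beta>boot t \<omega> \<in> argmin_orthant (H_boot b v (\<epsilon> t) t (\<lambda>\<tau>. X \<tau> \<omega>) (W t \<omega>))"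
  shows "consistently_estimates M (\<lambda>t. data_algebra M N t X)
           (\<lambda>t \<omega>. (1 / \<epsilon> t) *\<^sub>R (\<beta>boot t \<omega> - \<beta>obs t \<omega>))
           (J_LFM N s b v \<beta>star)"
proof -
  interpret prob_space M by (rule prob)
  obtain C where C: "\<forall>i. \<forall>\<theta>\<in>space N. v i \<theta> \<le> C" using valuations_bounded by blast
  interpret bootstrap_market M N s X W b \<beta>star v C \<epsilon>
  proof (unfold_locales)
    show "all_pos b" using budgets by blast
    show "v i \<in> borel_measurable N" for i using valuations_integrable[of i] by (rule borel_measurable_integrable)
    show "v i \<theta> \<le> C" if "\<theta> \<in> space N" for i \<theta> using C that by blast
    show "distr M (count_space UNIV) (W t) = measure_pmf (weights_pmf t)" if "1 \<le> t" for t
      using weights_law[OF that] .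
  qed (fact supply_measurable supply_nonneg draws_density draws_indep weights_measurable weights_indep
      valuations_nonneg \<beta>star H_C2 \<epsilon>_pos \<epsilon>_small \<epsilon>_large)+
  show ?thesis
    by (rule bootstrap_consistent) (fact \<beta>obs_measurable \<beta>obs_argmin \<beta>boot_measurable \<beta>boot_argmin)+
qed

end
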